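(* Let $(f_\varepsilon^0)_{\varepsilon>0}$ be a family of functions on $\mathbb{R}^2\times\mathbb{R}^2$ such that, for each $\varepsilon>0$, $f_\varepsilon^0\in L^1(\mathbb{R}^2\times\mathbb{R}^2)\cap L^\infty(\mathbb{R}^2\times\mathbb{R}^2)$, $f_\varepsilon^0\ge 0$ and $f_\varepsilon^0$ is compactly supported; set $\rho_\varepsilon^0(x)=\int_{\mathbb{R}^2}f_\varepsilon^0(x,v)\,dv$. Assume that $$\sup_{\varepsilon>0}\Big(\|f_\varepsilon^0\|_{L^1}+\int_{\mathbb{R}^2}|x|^2\rho_\varepsilon^0(x)\,dx\Big)<+\infty,\qquad \sup_{\varepsilon>0}\mathcal{H}(f_\varepsilon^0)<+\infty,\qquad \sup_{\varepsilon>0}\|f_\varepsilon^0\|_{L^\infty}<+\infty.$$ Let $f_\varepsilon$ be the corresponding global weak solution of the Vlasov-Poisson system $(\mathrm{VP}_\varepsilon)$ with initial datum $f_\varepsilon^0$, with density $\rho_\varepsilon$ and electric field $E_\varepsilon$. Then there exists a sequence $\varepsilon_n\to0$ as $n\to+\infty$ such that $(\rho_{\varepsilon_n})_{n\in\mathbb{N}}$ converges to some $\rho$ in $C(\mathbb{R}_+,L^2(\mathbb{R}^2)-w)$. Moreover: (1) $\rho\in L^\infty(\mathbb{R}_+,L^2(\mathbb{R}^2))$; (2) $(E_{\varepsilon_n})_{n\in\mathbb{N}}$ converges to some $E$ in $C(\mathbb{R}_+,L^2_{\mathrm{loc}}(\mathbb{R}^2))$; (3) for all $t\in\mathbb{R}_+$,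 $E(t)=\frac{x}{|x|^2}*\rho(t)$; (4) $\rho$ is a global weak solution, in the sense of distributions, of the 2D Euler equation $$\partial_t\rho+E^\perp\cdot\nabla\rho=0,\qquad E^\perp=2\pi\nabla^\perp\Delta^{-1}\rho.$$
   Context: Notation: for $v=(v_1,v_2)\in\mathbb{R}^2$, $v^\perp=(-v_2,v_1)$; $\mathbb{R}_+=[0,+\infty)$. Energy: for $f\in L^1(\mathbb{R}^2\times\mathbb{R}^2)$ and $\rho=\int f\,dv$, $$\mathcal{H}(f)=\frac12\iint_{\mathbb{R}^2\times\mathbb{R}^2}|v|^2f(x,v)\,dx\,dv-\frac12\iint_{\mathbb{R}^2\times\mathbb{R}^2}\ln|x-y|\,\rho(x)\rho(y)\,dx\,dy.$$ System $(\mathrm{VP}_\varepsilon)$, for $(t,x,v)\in\mathbb{R}_+\times\mathbb{R}^2\times\mathbb{R}^2$: $$\partial_t f_\varepsilon+\frac{v}{\varepsilon}\cdot\nabla_x f_\varepsilon+\Big(\frac{E_\varepsilon}{\varepsilon}+\frac{v^\perp}{\varepsilon^2}\Big)\cdot\nabla_v f_\varepsilon=0,\quad E_\varepsilon(t,x)=\int_{\mathbb{R}^2}\frac{x-y}{|x-y|^2}\rho_\varepsilon(t,y)\,dy,\quad \rho_\varepsilon(t,x)=\int_{\mathbb{R}^2}f_\varepsilon(t,x,v)\,dv,\quad f_\varepsilon(0)=f_\varepsilon^0.$$ By the classical Cauchy theory, for each $\varepsilon>0$ and each nonnegative, compactly supported $f_\varepsilon^0\in L^1\cap L^\infty(\mathbb{R}^2\times\mathbb{R}^2)$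 there is a unique global weak solution $f_\varepsilon\in L^\infty(\mathbb{R}_+,L^1\cap L^\infty(\mathbb{R}^2\times\mathbb{R}^2))$ that is compactly supported (in $(x,v)$, uniformly on each bounded time interval); its density satisfies $\rho_\varepsilon\in L^\infty_{\mathrm{loc}}(\mathbb{R}_+,L^\infty(\mathbb{R}^2))$, and the energy $\mathcal{H}(f_\varepsilon(t))$ and the norms $\|f_\varepsilon(t)\|_{L^p}$ are bounded by their values at $t=0$. This $f_\varepsilon$ is "the corresponding global weak solution". $C(\mathbb{R}_+,L^2(\mathbb{R}^2)-w)$ is the space of weakly continuous maps from $\mathbb{R}_+$ to $L^2(\mathbb{R}^2)$; convergence in it means that for every $\varphi\in L^2(\mathbb{R}^2)$, $t\mapsto\int\varphi\rho_{\varepsilon_n}(t)\,dx$ converges to $t\mapsto\int\varphi\rho(t)\,dx$ locally uniformly on $\mathbb{R}_+$. Convergence in $C(\mathbb{R}_+,L^2_{\mathrm{loc}}(\mathbb{R}^2))$ means convergence in $L^2(K)$, uniformly in $t\in[0,T]$, for every compact $K\subset\mathbb{R}^2$ and $T>0$. In (4), since $E^\perp$ is divergence free, the term $E^\perp\cdot\nabla\rho$ is understood as $\mathrm{div}(E^\perp\rho)$, and the field $E$ is $\frac{x}{|x|^2}*\rho$. *)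

theory Defs
  imports "HOL-Analysis.Analysis" "HOL-Probability.Essential_Supremum"
begin

type_synonym R2 = "real ^ 2"

(* Elements of Lebesgue spaces are represented by Borel functions, identified up to null sets. *)

definition Lp_mem :: "'a measure \<Rightarrow> real \<Rightarrow> ('a \<Rightarrow> 'b::euclidean_space) \<Rightarrow> bool" where
  "Lp_mem M p g \<longleftrightarrow> g \<in> borel_measurable M \<and> integrable M (\<lambda>x. norm (g x) powr p)"

definition Lp_norm :: "'a measure \<Rightarrow> real \<Rightarrow> ('a \<Rightarrow> 'b::euclidean_space) \<Rightarrow> real" where
  "Lp_norm M p g = (LINT x|M. norm (g x) powr p) powr (1 / p)"

definition Linf_norm :: "'a measure \<Rightarrow> ('a \<Rightarrow> 'b::euclidean_space) \<Rightarrow> ereal" where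
  "Linf_norm M g = esssup M (\<lambda>x. ereal (norm (g x)))"

definition Linf_mem :: "'a measure \<Rightarrow> ('a \<Rightarrow> 'b::euclidean_space) \<Rightarrow> bool" where
  "Linf_mem M g \<longleftrightarrow> g \<in> borel_measurable M \<and> Linf_norm M g < \<infinity>"

definition ess_supported_in :: "'a::euclidean_space set \<Rightarrow> ('a \<Rightarrow> real) \<Rightarrow> bool" where
  "ess_supported_in K g \<longleftrightarrow> (AE z in lborel. z \<notin> K \<longrightarrow> g z = 0)"

(* A time-dependent function g is only looked at for times t \<ge> 0. *)

definition time_measurable :: "(real \<Rightarrow> 'a::euclidean_space \<Rightarrow> 'b::euclidean_space) \<Rightarrow> bool" where
  "time_measurable g \<longleftrightarrow> case_prod g \<in> borel_measurable (restrict_space borel ({0..} \<times> UNIV))"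

definition Linf_time_Lp :: "real \<Rightarrow> (real \<Rightarrow> 'a::euclidean_space \<Rightarrow> 'b::euclidean_space) \<Rightarrow> bool" where
  "Linf_time_Lp p g \<longleftrightarrow> time_measurable g \<and>
     (\<exists>C. AE t in lborel. 0 \<le> t \<longrightarrow> Lp_mem lborel p (g t) \<and> Lp_norm lborel p (g t) \<le> C)"

definition Linf_time_Linf :: "(real \<Rightarrow> 'a::euclidean_space \<Rightarrow> 'b::euclidean_space) \<Rightarrow> bool" where
  "Linf_time_Linf g \<longleftrightarrow> time_measurable g \<and>
     (\<exists>C::real. AE t in lborel. 0 \<le> t \<longrightarrow> Linf_norm lborel (g t) \<le> C)"

definition Linf_loc_time_Linf :: "(real \<Rightarrow> 'a::euclidean_space \<Rightarrow> 'b::euclidean_space) \<Rightarrow> bool" where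
  "Linf_loc_time_Linf g \<longleftrightarrow> time_measurable g \<and>
     (\<forall>T>0. \<exists>C::real. AE t in lborel. t \<in> {0..T} \<longrightarrow> Linf_norm lborel (g t) \<le> C)"

definition C_L2_weak :: "(real \<Rightarrow> 'a::euclidean_space \<Rightarrow> real) \<Rightarrow> bool" where
  "C_L2_weak g \<longleftrightarrow> (\<forall>t\<ge>0. Lp_mem lborel 2 (g t)) \<and>
     (\<forall>\<phi>. Lp_mem lborel 2 \<phi> \<longrightarrow> continuous_on {0..} (\<lambda>t. LINT x|lborel. \<phi> x * g t x))"

definition converges_C_L2_weak ::
    "(nat \<Rightarrow> real \<Rightarrow> 'a::euclidean_space \<Rightarrow> real) \<Rightarrow> (real \<Rightarrow> 'a \<Rightarrow> real) \<Rightarrow> bool" where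
  "converges_C_L2_weak gs g \<longleftrightarrow> (\<forall>n. C_L2_weak (gs n)) \<and> C_L2_weak g \<and>
     (\<forall>\<phi>. Lp_mem lborel 2 \<phi> \<longrightarrow> (\<forall>T>0. uniform_limit {0..T}
        (\<lambda>n t. LINT x|lborel. \<phi> x * gs n t x) (\<lambda>t. LINT x|lborel. \<phi> x * g t x) sequentially))"

definition C_L2_loc :: "(real \<Rightarrow> 'a::euclidean_space \<Rightarrow> 'b::euclidean_space) \<Rightarrow> bool" where
  "C_L2_loc g \<longleftrightarrow> (\<forall>K. compact K \<longrightarrow>
     (\<forall>t\<ge>0. Lp_mem (restrict_space lborel K) 2 (g t)) \<and>
     (\<forall>t\<ge>0. ((\<lambda>s. Lp_norm (restrict_space lborel K) 2 (\<lambda>x. g s x - g t x)) \<longlongrightarrow> 0)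
        (at t within {0..})))"

definition converges_C_L2_loc ::
    "(nat \<Rightarrow> real \<Rightarrow> 'a::euclidean_space \<Rightarrow> 'b::euclidean_space) \<Rightarrow> (real \<Rightarrow> 'a \<Rightarrow> 'b) \<Rightarrow> bool" where
  "converges_C_L2_loc gs g \<longleftrightarrow> (\<forall>n. C_L2_loc (gs n)) \<and> C_L2_loc g \<and>
     (\<forall>K. compact K \<longrightarrow> (\<forall>T>0. uniform_limit {0..T}
        (\<lambda>n t. Lp_norm (restrict_space lborel K) 2 (\<lambda>x. gs n t x - g t x)) (\<lambda>_. 0) sequentially))"

primrec Ck :: "nat \<Rightarrow> ('a::euclidean_space \<Rightarrow> real) \<Rightarrow> bool" where
  "Ck 0 \<phi> \<longleftrightarrow> continuous_on UNIV \<phi>"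
| "Ck (Suc k) \<phi> \<longleftrightarrow> (\<forall>x. \<phi> differentiable (at x)) \<and>
     (\<forall>h. Ck k (\<lambda>x. frechet_derivative \<phi> (at x) h))"

definition test_function :: "('a::euclidean_space \<Rightarrow> real) \<Rightarrow> bool" where
  "test_function \<phi> \<longleftrightarrow> (\<forall>k. Ck k \<phi>) \<and> compact (closure {x. \<phi> x \<noteq> 0})"

definition perp :: "R2 \<Rightarrow> R2" where
  "perp v = vector [- (v $ 2), v $ 1]"

definition gradient :: "(R2 \<Rightarrow> real) \<Rightarrow> R2 \<Rightarrow> R2" where
  "gradient \<phi> x = (\<chi> i. frechet_derivative \<phi> (at x) (axis i 1))"

definition kernel_convolution :: "(R2 \<Rightarrow> 'b::euclidean_space) \<Rightarrow> (R2 \<Rightarrow> real) \<Rightarrow> R2 \<Rightarrow> 'b" where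
  "kernel_convolution k g x = (LINT y|lborel. g y *\<^sub>R k (x - y))"

(* h = k * g almost everywhere, where the convolution integral converges absolutely a.e. *)
definition is_convolution :: "(R2 \<Rightarrow> 'b::euclidean_space) \<Rightarrow> (R2 \<Rightarrow> real) \<Rightarrow> (R2 \<Rightarrow> 'b) \<Rightarrow> bool" where
  "is_convolution k g h \<longleftrightarrow>
     (AE x in lborel. integrable lborel (\<lambda>y. g y *\<^sub>R k (x - y)) \<and> h x = kernel_convolution k g x)"

definition coulomb_kernel :: "R2 \<Rightarrow> R2" where
  "coulomb_kernel x = x /\<^sub>R (norm x)\<^sup>2"

(* Fundamental solution of the Laplacian on R2; convolution with it is the inverse Laplacian. *)
definition laplace_kernel :: "R2 \<Rightarrow> real" where
  "laplace_kernel x = ln (norm x) / (2 * pi)"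

definition macro_density :: "(R2 \<times> R2 \<Rightarrow> real) \<Rightarrow> R2 \<Rightarrow> real" where
  "macro_density g x = (LINT v|lborel. g (x, v))"

definition electric_field :: "(R2 \<times> R2 \<Rightarrow> real) \<Rightarrow> R2 \<Rightarrow> R2" where
  "electric_field g = kernel_convolution coulomb_kernel (macro_density g)"

definition energy :: "(R2 \<times> R2 \<Rightarrow> real) \<Rightarrow> real" where
  "energy g =
     1 / 2 * (LINT (x, v)|lborel. (norm v)\<^sup>2 * g (x, v))
   - 1 / 2 * (LINT (x, y)|lborel.
       ln (norm (x - y)) * macro_density g x * macro_density g y)"

(* Distributional form of the Vlasov-Poisson equation including the initial condition. The
   transport field (v / eps, E / eps + perp v / eps^2) is divergence free in (x, v), so no zeroth
   order term appears; the derivative of \<phi> in the direction (1, v / eps, E / eps + perp v / eps^2)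
   is the transport operator applied to \<phi>. Test functions on [0, infinity) x R2 x R2 are
   restrictions of test functions on the whole space. *)
definition vp_weak_form ::
    "real \<Rightarrow> (R2 \<times> R2 \<Rightarrow> real) \<Rightarrow> (real \<Rightarrow> R2 \<times> R2 \<Rightarrow> real) \<Rightarrow> bool" where
  "vp_weak_form \<epsilon> f0 f \<longleftrightarrow> (\<forall>\<phi> :: real \<times> R2 \<times> R2 \<Rightarrow> real. test_function \<phi> \<longrightarrow>
     set_lebesgue_integral lborel ({0..} \<times> UNIV) (\<lambda>(t, x, v).
        f t (x, v) * frechet_derivative \<phi> (at (t, x, v))
          (1, v /\<^sub>R \<epsilon>, electric_field (f t) x /\<^sub>R \<epsilon> + perp v /\<^sub>R \<epsilon>\<^sup>2))
     + (LINT z|lborel. f0 z * \<phi> (0, z)) = 0)"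

(* The global weak solution given by the Cauchy theory: besides the equation this records the
   regularity, the support property and the a priori bounds that the theory provides. Values at
   individual times refer to the weakly continuous representative of f. *)
definition vp_global_weak_solution ::
    "real \<Rightarrow> (R2 \<times> R2 \<Rightarrow> real) \<Rightarrow> (real \<Rightarrow> R2 \<times> R2 \<Rightarrow> real) \<Rightarrow> bool" where
  "vp_global_weak_solution \<epsilon> f0 f \<longleftrightarrow>
     Linf_time_Lp 1 f \<and> Linf_time_Linf f \<and> C_L2_weak f \<and>
     (\<forall>T>0. \<exists>K. compact K \<and> (\<forall>t\<in>{0..T}. ess_supported_in K (f t))) \<and>
     Linf_loc_time_Linf (\<lambda>t. macro_density (f t)) \<and>
     vp_weak_form \<epsilon> f0 f \<and>
     (\<forall>t\<ge>0. energy (f t) \<le> energy f0) \<and>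
     (\<forall>t\<ge>0. \<forall>p\<ge>1. Lp_mem lborel p (f t) \<and> Lp_norm lborel p (f t) \<le> Lp_norm lborel p f0) \<and>
     (\<forall>t\<ge>0. Linf_mem lborel (f t) \<and> Linf_norm lborel (f t) \<le> Linf_norm lborel f0)"

(* G = (- d_2 \<psi>, d_1 \<psi>) in the sense of distributions. *)
definition has_weak_perp_gradient :: "(R2 \<Rightarrow> real) \<Rightarrow> (R2 \<Rightarrow> R2) \<Rightarrow> bool" where
  "has_weak_perp_gradient \<psi> G \<longleftrightarrow>
     (\<forall>K. compact K \<longrightarrow> set_integrable lborel K \<psi> \<and> set_integrable lborel K G) \<and>
     (\<forall>\<phi>. test_function \<phi> \<longrightarrow>
        (LINT x|lborel. \<phi> x *\<^sub>R G x) = - (LINT x|lborel. \<psi> x *\<^sub>R perp (gradient \<phi> x)))"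

(* Weak form of d_t \<rho> + div (perp E \<rho>) = 0 on [0, infinity) x R2, with initial value \<rho> 0, where
   perp E = 2 pi perp-grad (inverse Laplacian of \<rho>). *)
definition euler_global_weak_solution :: "(real \<Rightarrow> R2 \<Rightarrow> real) \<Rightarrow> (real \<Rightarrow> R2 \<Rightarrow> R2) \<Rightarrow> bool" where
  "euler_global_weak_solution \<rho> E \<longleftrightarrow>
     (\<forall>T>0. \<forall>K. compact K \<longrightarrow>
        set_integrable lborel ({0..T} \<times> K) (\<lambda>(t, x). \<rho> t x) \<and>
        set_integrable lborel ({0..T} \<times> K) (\<lambda>(t, x). \<rho> t x *\<^sub>R perp (E t x))) \<and>
     (\<forall>\<phi> :: real \<times> R2 \<Rightarrow> real. test_function \<phi> \<longrightarrow>
        set_lebesgue_integral lborel ({0..} \<times> UNIV) (\<lambda>(t, x).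
           \<rho> t x * frechet_derivative \<phi> (at (t, x)) (1, perp (E t x)))
        + (LINT x|lborel. \<rho> 0 x * \<phi> (0, x)) = 0) \<and>
     (\<forall>t\<ge>0. \<exists>\<psi>. is_convolution laplace_kernel (\<rho> t) \<psi> \<and>
        has_weak_perp_gradient \<psi> (\<lambda>x. perp (E t x) /\<^sub>R (2 * pi)))"

end

theory Submission
  imports Defs "HOL-Library.Diagonal_Subsequence"
begin

text \<open>Conservation of mass and of \<open>|x|\<^sup>2 / 2 + \<epsilon> x \<cdot> perp v\<close> (the field exerts no total torque) together
  with the energy inequality bounds the moments of \<open>f\<close>, hence the density in \<open>L\<^sup>2\<close>, uniformly in \<open>\<epsilon>\<close>. The guiding center
  \<open>x + \<epsilon> perp v\<close> moves with velocity \<open>perp E\<close>, so testing the Vlasov equation with functions of the guiding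
  center gives equicontinuity of the densities in time and the Euler equation up to an error of order \<open>\<epsilon>\<close>.
  Along a diagonal subsequence the densities converge weakly in \<open>L\<^sup>2\<close>, locally uniformly in time; convolution
  with the Coulomb kernel turns weak into strong local convergence, which is enough for the product
  \<open>\<rho> perp E\<close>.\<close>

section \<open>Smooth functions and test functions\<close>

text \<open>For fixed \<epsilon> everything is bounded with compact support, but the sup bounds on
  density and field are not uniform in \<epsilon>. They are used for integrability only; the
  quantitative estimates rest on mass, second moments, the L2 norm of the density and the integral
  of |E|^2 against \<open>f\<close>. The logarithmic interaction has no sign: the energy bounds the
  kinetic part only in terms of the second moment in x, while the conserved moment contains the
  cross term \<epsilon> x . perp v, which again involves the kinetic energy. The loop closes once
  \<epsilon> (1 + 2 M) is at most 1/2, so the sequence starts at that threshold. The second moment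
  returns at the end: it gives the limit enough decay for its logarithmic convolution to converge. A
  further obstacle is measurability: weak limits are taken at each time separately, and Borel
  measurability of the limit in (t, x) has to be recovered, which is done through averages over
  dyadic squares.\<close>

abbreviation FD :: "('a::euclidean_space \<Rightarrow> real) \<Rightarrow> 'a \<Rightarrow> 'a \<Rightarrow> real" where
  "FD \<phi> x \<equiv> frechet_derivative \<phi> (at x)"

lemma Ck_SucI:
  assumes "\<And>x. (\<phi> has_derivative D x) (at x)" "\<And>h. Ck k (\<lambda>x. D x h)"
  shows "Ck (Suc k) \<phi>"
proof -
  have "FD \<phi> x = D x" for x using assms(1)[of x] frechet_derivative_at by metis
  with assms show ?thesis by (auto simp: differentiable_def)
qed

lemma Ck_SucD:
  assumes "Ck (Suc k) \<phi>"
  shows "(\<phi> has_derivative FD \<phi> x) (at x)"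
    "Ck k (\<lambda>x. FD \<phi> x h)" using assms by (auto simp: frechet_derivative_works[symmetric])

lemma Ck_mono: "Ck (Suc k) \<phi> \<Longrightarrow> Ck k \<phi>"
proof (induction k arbitrary: \<phi>)
  case 0
  then show ?case by (auto intro!: continuous_at_imp_continuous_on differentiable_imp_continuous_within)
next
  case (Suc k)
  from Suc.prems have "\<And>h. Ck (Suc k) (\<lambda>x. FD \<phi> x h)" by simp
  with Suc.IH have "\<And>h. Ck k (\<lambda>x. FD \<phi> x h)" by blast
  with Suc.prems show ?case by simp
qed

lemma Ck_const [intro]: "Ck k (\<lambda>x. c)"
  by (induction k arbitrary: c) (auto simp del: Ck.simps(2) intro!: Ck_SucI derivative_eq_intros)

lemma Ck_linear: "bounded_linear L \<Longrightarrow> Ck k L"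
proof (cases k)
  case (Suc l)
  assume "bounded_linear L"
  with Suc show ?thesis
    by (auto simp del: Ck.simps(2) intro!: Ck_SucI[where D = "\<lambda>_. L"] bounded_linear_imp_has_derivative Ck_const)
qed (auto intro: linear_continuous_on)

lemma Ck_add: "Ck k f \<Longrightarrow> Ck k g \<Longrightarrow> Ck k (\<lambda>x. f x + g x)"
proof (induction k arbitrary: f g)
  case (Suc k)
  show ?case by (rule Ck_SucI[OF has_derivative_add[OF Ck_SucD(1)[OF Suc.prems(1)] Ck_SucD(1)[OF Suc.prems(2)]]])
      (intro Suc.IH Ck_SucD(2)[OF Suc.prems(1)] Ck_SucD(2)[OF Suc.prems(2)])
qed (auto intro: continuous_intros)

lemma Ck_mult: "Ck k f \<Longrightarrow> Ck k g \<Longrightarrow> Ck k (\<lambda>x. f x * g x)"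
proof (induction k arbitrary: f g)
  case (Suc k)
  show ?case by (rule Ck_SucI[OF has_derivative_mult[OF Ck_SucD(1)[OF Suc.prems(1)] Ck_SucD(1)[OF Suc.prems(2)]]])
      (intro Ck_add Suc.IH Ck_SucD(2)[OF Suc.prems(1)] Ck_SucD(2)[OF Suc.prems(2)]
        Ck_mono[OF Suc.prems(1)] Ck_mono[OF Suc.prems(2)])
qed (auto intro: continuous_intros)

lemma Ck_cmult: "Ck k f \<Longrightarrow> Ck k (\<lambda>x. c * f x)" by (rule Ck_mult[OF Ck_const])

lemma Ck_diff: "Ck k f \<Longrightarrow> Ck k g \<Longrightarrow> Ck k (\<lambda>x. f x - g x)"
  using Ck_add[of k f "\<lambda>x. (-1) * g x"] Ck_cmult[of k g "-1"] by simp

lemma Ck_inner: "Ck k (\<lambda>x::'a::euclidean_space. x \<bullet> x)"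
proof (cases k)
  case (Suc l)
  have "Ck l (\<lambda>x::'a. x \<bullet> h + h \<bullet> x)" for h
    by (intro Ck_linear bounded_linear_add bounded_linear_inner_left bounded_linear_inner_right)
  then show ?thesis unfolding Suc
    by (intro Ck_SucI[where D = "\<lambda>x h. x \<bullet> h + h \<bullet> x"]) (auto intro!: derivative_eq_intros)
qed (auto intro: continuous_intros)

lemma Ck_inverse:
  assumes "\<And>x. f x \<noteq> 0"
  shows "Ck k f \<Longrightarrow> Ck k (\<lambda>x. inverse (f x))" using assms
proof (induction k)
  case (Suc k)
  have inv: "Ck k (\<lambda>x. inverse (f x))" using Suc.IH Suc.prems Ck_mono by blast
  show ?case
  proof (rule Ck_SucI)
    show "((\<lambda>x. inverse (f x)) has_derivative
        (\<lambda>h. (- 1) * (inverse (f x) * FD f x h * inverse (f x)))) (at x)" for x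
      using Deriv.has_derivative_inverse[OF Suc.prems(2) Ck_SucD(1)[OF Suc.prems(1)]] by simp
    show "Ck k (\<lambda>x. (- 1) * (inverse (f x) * FD f x h * inverse (f x)))" for h
      by (intro Ck_cmult Ck_mult inv Ck_SucD(2)[OF Suc.prems(1)])
  qed
qed (auto intro!: continuous_intros)

text \<open>The derivative of the composite contains the derivative of \<open>g\<close>, so the
  induction has to range over all smooth \<open>g\<close>.\<close>

lemma Ck_compose_real:
  fixes g :: "real \<Rightarrow> real"
  assumes "\<And>j. Ck j g" "Ck k f"
  shows "Ck k (\<lambda>x. g (f x))" using assms
proof (induction k arbitrary: g)
  case 0
  from 0(1)[of 0] 0(2) show ?case by (auto intro: continuous_on_compose2)
next
  case (Suc k)
  let ?g' = "\<lambda>y. FD g y 1"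
  have lin: "linear (FD g y)" for y using Ck_SucD(1)[OF Suc.prems(1)[of "Suc 0"]] has_derivative_linear by blast
  have g': "FD g y h = h * ?g' y" for y h using linear_cmul[OF lin, of y h 1] by simp
  have IH: "Ck k (\<lambda>x. ?g' (f x))"
    using Suc.IH[of ?g'] Ck_SucD(2)[OF Suc.prems(1)] Ck_mono[OF Suc.prems(2)] by blast
  show ?case
  proof (rule Ck_SucI)
    show "((\<lambda>x. g (f x)) has_derivative (\<lambda>h. FD f x h * ?g' (f x))) (at x)" for x
      using has_derivative_compose[OF Ck_SucD(1)[OF Suc.prems(2)] Ck_SucD(1)[OF Suc.prems(1)]] by (subst (asm) g')
    show "Ck k (\<lambda>x. FD f x h * ?g' (f x))" for h by (intro Ck_mult IH Ck_SucD(2)[OF Suc.prems(2)])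
  qed
qed

lemma Ck_compose_affine:
  assumes L: "bounded_linear L"
  shows "Ck k f \<Longrightarrow> Ck k (\<lambda>x. f (c + L x))"
proof (induction k arbitrary: f)
  case 0
  then show ?case
    using linear_continuous_on[OF L] by (auto intro!: continuous_on_compose2[of UNIV f] continuous_intros)
next
  case (Suc k)
  have "((\<lambda>x. c + L x) has_derivative L) (at x)" for x
    using bounded_linear_imp_has_derivative[OF L] by (auto intro!: derivative_eq_intros)
  from has_derivative_compose[OF this Ck_SucD(1)[OF Suc.prems]]
  show ?case by (rule Ck_SucI) (intro Suc.IH[OF Ck_SucD(2)[OF Suc.prems]])
qed

section \<open>Smooth transition functions built from exp(-1/x)\<close>

definition flat :: "nat \<Rightarrow> real \<Rightarrow> real" where
  "flat m x = (if x > 0 then exp (- 1 / x) / x ^ m else 0)"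

lemma flat_tendsto_0: "(flat m \<longlongrightarrow> 0) (at_right 0)"
proof -
  have "((\<lambda>x::real. inverse x ^ m / exp (inverse x)) \<longlongrightarrow> 0) (at_right 0)"
    by (rule filterlim_compose[OF tendsto_power_div_exp_0 filterlim_inverse_at_top_right])
  moreover have "eventually (\<lambda>x::real. inverse x ^ m / exp (inverse x) = flat m x) (at_right 0)"
    unfolding eventually_at_right_field by (intro exI[of _ 1]) (auto simp: flat_def exp_minus field_simps)
  ultimately show ?thesis by (rule Lim_transform_eventually)
qed

text \<open>The power of 1/x is kept as an index because differentiation then stays inside the
  family: the exponential contributes a factor x^(-2), the denominator a factor -m x^(-1).
  Smoothness of all members becomes a single induction.\<close>

lemma flat_deriv:
  "(flat m has_real_derivative flat (m + 2) x - real m * flat (m + 1) x) (at x)"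
proof -
  consider "x > 0" | "x < 0" | "x = 0" by linarith
  then show ?thesis
  proof cases
    case 1
    have "((\<lambda>x. exp (- 1 / x) / x ^ m) has_real_derivative
        flat (m + 2) x - real m * flat (m + 1) x) (at x)"
    proof (cases m)
      case 0
      then show ?thesis using 1 by (auto intro!: derivative_eq_intros simp: flat_def field_simps power2_eq_square)
    next
      case (Suc n)
      have d1: "((\<lambda>x. exp (- 1 / x)) has_real_derivative exp (- 1 / x) / (x * x)) (at x)"
        using 1 by (auto intro!: derivative_eq_intros simp: field_simps)
      have d2: "((\<lambda>x. x ^ Suc n) has_real_derivative real (Suc n) * x ^ n) (at x)"
        using DERIV_pow[of "Suc n" x UNIV] by simp
      have "x ^ Suc n \<noteq> 0" using 1 by simp
      from DERIV_divide[OF d1 d2 this] show ?thesis unfolding Suc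
        by (rule DERIV_cong) (use 1 in \<open>simp add: flat_def field_simps del: of_nat_Suc\<close>)
    qed
    then show ?thesis
      by (rule has_field_derivative_transform_within_open[where S = "{0<..}"]) (use 1 in \<open>auto simp: flat_def\<close>)
  next
    case 2
    have "((\<lambda>x. 0) has_real_derivative 0) (at x)" by simp
    then have "(flat m has_real_derivative 0) (at x)"
      by (rule has_field_derivative_transform_within_open[where S = "{..<0}"]) (use 2 in \<open>auto simp: flat_def\<close>)
    then show ?thesis using 2 by (simp add: flat_def)
  next
    case 3
    \<comment> \<open>At the origin the quotient from the right is \<open>flat (Suc m)\<close>,
      which tends to 0, and from the left it is constantly 0.\<close>
    have "((\<lambda>y. (flat m y - flat m 0) / (y - 0)) \<longlongrightarrow> 0) (at 0)" unfolding filterlim_at_split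
    proof
      have "eventually (\<lambda>y. (flat m y - flat m 0) / (y - 0) = 0) (at_left (0::real))"
        unfolding eventually_at_left_field by (intro exI[of _ "-1"]) (auto simp: flat_def)
      then show "((\<lambda>y. (flat m y - flat m 0) / (y - 0)) \<longlongrightarrow> 0) (at_left 0)"
        by (rule tendsto_eventually)
      have "eventually (\<lambda>y. flat (Suc m) y = (flat m y - flat m 0) / (y - 0)) (at_right (0::real))"
        unfolding eventually_at_right_field by (intro exI[of _ 1]) (auto simp: flat_def)
      with flat_tendsto_0 show "((\<lambda>y. (flat m y - flat m 0) / (y - 0)) \<longlongrightarrow> 0) (at_right 0)"
        by (rule Lim_transform_eventually)
    qed
    then show ?thesis using 3 by (simp add: has_field_derivative_iff flat_def)
  qed
qed

lemma Ck_flat: "Ck k (flat m)"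
proof (induction k arbitrary: m)
  case 0
  show ?case by (auto intro!: continuous_at_imp_continuous_on DERIV_isCont[OF flat_deriv])
next
  case (Suc k)
  show ?case
  proof (rule Ck_SucI)
    show "(flat m has_derivative (\<lambda>h. (flat (m + 2) x - real m * flat (m + 1) x) * h)) (at x)" for x
      using flat_deriv by (simp add: has_field_derivative_def)
    show "Ck k (\<lambda>x. (flat (m + 2) x - real m * flat (m + 1) x) * h)" for h
      by (intro Ck_mult Ck_const Ck_diff Suc.IH)
  qed
qed

text \<open>The classical smooth transition from 0 (left of 0) to 1 (right of 1). The same function
  rounds the boxes below, cuts off in phase space and localises in time.\<close>

definition smooth_step :: "real \<Rightarrow> real" where
  "smooth_step x = flat 0 x * inverse (flat 0 x + flat 0 (1 - x))"

lemma flat_denominator_pos: "flat 0 x + flat 0 (1 - x) > 0"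
  by (cases "x > 0"; cases "x < 1") (auto simp: flat_def intro: add_pos_pos)

lemma Ck_smooth_step: "Ck k smooth_step"
proof -
  have "Ck k (\<lambda>x. flat 0 (1 + - x))"
    by (intro Ck_compose_affine Ck_flat bounded_linear_minus bounded_linear_ident)
  then have "Ck k (\<lambda>x. flat 0 (1 - x))" by simp
  then have "Ck k (\<lambda>x. flat 0 x * inverse (flat 0 x + flat 0 (1 - x)))"
    using flat_denominator_pos by (intro Ck_mult Ck_inverse Ck_add Ck_flat) (auto simp: less_le)
  then show ?thesis by (simp add: smooth_step_def[abs_def])
qed

lemma smooth_step_0 [simp]: "x \<le> 0 \<Longrightarrow> smooth_step x = 0" by (simp add: smooth_step_def flat_def)

lemma smooth_step_1 [simp]: "x \<ge> 1 \<Longrightarrow> smooth_step x = 1" by (simp add: smooth_step_def flat_def)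

lemma smooth_step_bounds: "0 \<le> smooth_step x" "smooth_step x \<le> 1"
proof -
  have nonneg: "flat 0 x \<ge> 0" "flat 0 (1 - x) \<ge> 0" by (auto simp: flat_def)
  with flat_denominator_pos[of x] show "0 \<le> smooth_step x" "smooth_step x \<le> 1"
    by (auto simp: smooth_step_def field_simps)
qed

section \<open>Test functions and their derivatives\<close>

lemma test_functionI:
  assumes "\<And>k. Ck k \<phi>" "bounded S" "\<And>x. \<phi> x \<noteq> 0 \<Longrightarrow> x \<in> S"
  shows "test_function \<phi>" unfolding test_function_def
proof (intro conjI allI assms(1))
  have "bounded {x. \<phi> x \<noteq> 0}" by (rule bounded_subset[OF assms(2)]) (use assms(3) in auto)
  then show "compact (closure {x. \<phi> x \<noteq> 0})" by (simp add: compact_closure)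
qed

lemma test_function_Ck: "test_function \<phi> \<Longrightarrow> Ck k \<phi>" by (simp add: test_function_def)

lemma test_function_continuous: "test_function \<phi> \<Longrightarrow> continuous_on A \<phi>"
  using test_function_Ck[of \<phi> 0] by (auto intro: continuous_on_subset)

text \<open>Off the closed support the function is zero on an open set, so one radius serves the
  function and all its directional derivatives.\<close>

lemma test_function_support:
  assumes "test_function \<phi>"
  obtains R where "R > 0" "\<And>x. norm x \<ge> R \<Longrightarrow> \<phi> x = 0"
    "\<And>x h. norm x \<ge> R \<Longrightarrow> FD \<phi> x h = 0"
proof -
  have "bounded (closure {x. \<phi> x \<noteq> 0})" using assms by (simp add: test_function_def compact_imp_bounded)
  then obtain R where R: "R > 0" "\<And>x. x \<in> closure {x. \<phi> x \<noteq> 0} \<Longrightarrow> norm x < R"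
    unfolding bounded_pos_less by auto
  have "FD \<phi> x h = 0" if x: "norm x \<ge> R" for x h
  proof -
    have "((\<lambda>_. 0) has_derivative (\<lambda>_. 0)) (at x)" by simp
    then have "(\<phi> has_derivative (\<lambda>_. 0)) (at x)"
    proof (rule has_derivative_transform_within_open[where s = "- closure {x. \<phi> x \<noteq> 0}"])
      show "x \<in> - closure {x. \<phi> x \<noteq> 0}" using R(2)[of x] x by force
      show "0 = \<phi> y" if "y \<in> - closure {x. \<phi> x \<noteq> 0}" for y
        using that closure_subset[of "{x. \<phi> x \<noteq> 0}"] by auto
    qed auto
    then show ?thesis using frechet_derivative_at by metis
  qed
  moreover have "\<phi> x = 0" if "norm x \<ge> R" for x
    using R(2)[of x] that closure_subset[of "{x. \<phi> x \<noteq> 0}"] by fastforce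
  ultimately show thesis using that R(1) by blast
qed

lemma test_function_derivative:
  assumes "test_function \<phi>"
  shows "test_function (\<lambda>x. FD \<phi> x h)"
proof -
  obtain R where R: "\<And>x h. norm x \<ge> R \<Longrightarrow> FD \<phi> x h = 0"
    using test_function_support[OF assms] by metis
  show ?thesis
  proof (rule test_functionI[where S = "cball 0 R"])
    show "Ck k (\<lambda>x. FD \<phi> x h)" for k by (rule Ck_SucD(2)[OF test_function_Ck[OF assms]])
    show "FD \<phi> x h \<noteq> 0 \<Longrightarrow> x \<in> cball 0 R" for x using R[of x h] by force
  qed simp
qed

lemma test_function_bounded:
  assumes "test_function \<phi>"
  obtains B where "B \<ge> 0" "\<And>x. \<bar>\<phi> x\<bar> \<le> B"
proof -
  obtain R where R: "R > 0" "\<And>x. norm x \<ge> R \<Longrightarrow> \<phi> x = 0" using test_function_support[OF assms] by metis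
  have "compact (\<phi> ` cball 0 R)" by (intro compact_continuous_image test_function_continuous assms) simp
  then obtain B where "\<forall>x\<in>cball 0 R. \<bar>\<phi> x\<bar> \<le> B"
    using compact_imp_bounded[of "\<phi> ` cball 0 R"] unfolding bounded_iff by auto
  then have "\<bar>\<phi> x\<bar> \<le> max B 0" for x using R(2)[of x] by (cases "norm x \<le> R") (auto simp: max.coboundedI1)
  then show thesis using that[of "max B 0"] by simp
qed

text \<open>Each of the finitely many basis directions gives a test function and hence a bound;
  linearity in the direction assembles them.\<close>

lemma test_function_derivative_bounded:
  assumes "test_function \<phi>"
  obtains B where "B \<ge> 0" "\<And>x h. \<bar>FD \<phi> x h\<bar> \<le> B * norm h"
proof -
  let ?D = "\<lambda>x. FD \<phi> x"
  have "\<exists>C\<ge>0. \<forall>x. \<bar>?D x b\<bar> \<le> C" for b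
    using test_function_bounded[OF test_function_derivative[OF assms]] by metis
  then obtain C where C: "\<And>b. C b \<ge> 0" "\<And>x b. \<bar>?D x b\<bar> \<le> C b" by metis
  have lin: "linear (?D x)" for x
    using Ck_SucD(1)[OF test_function_Ck[OF assms, of "Suc 0"]] has_derivative_linear by blast
  have "\<bar>?D x h\<bar> \<le> (\<Sum>b\<in>Basis. C b) * norm h" for x h
  proof -
    have "?D x h = ?D x (\<Sum>b\<in>Basis. (h \<bullet> b) *\<^sub>R b)" by (simp add: euclidean_representation)
    also have "\<dots> = (\<Sum>b\<in>Basis. (h \<bullet> b) * ?D x b)"
      by (simp add: linear_sum[OF lin] linear_cmul[OF lin])
    finally have "\<bar>?D x h\<bar> \<le> (\<Sum>b\<in>Basis. \<bar>(h \<bullet> b) * ?D x b\<bar>)" by (simp add: sum_abs)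
    also have "\<dots> \<le> (\<Sum>b\<in>Basis. norm h * C b)"
      by (intro sum_mono) (auto simp: abs_mult Basis_le_norm intro!: mult_mono C)
    finally show ?thesis by (simp add: sum_distrib_left mult.commute)
  qed
  moreover have "(\<Sum>b\<in>Basis. C b) \<ge> 0" by (intro sum_nonneg C)
  ultimately show thesis using that by blast
qed

lemma test_function_Lipschitz:
  assumes "test_function \<phi>"
  obtains B where "B \<ge> 0" "\<And>x y. \<bar>\<phi> x - \<phi> y\<bar> \<le> B * norm (x - y)"
proof -
  obtain B where B: "B \<ge> 0" "\<And>x h. \<bar>FD \<phi> x h\<bar> \<le> B * norm h"
    using test_function_derivative_bounded[OF assms] by metis
  have der: "(\<phi> has_derivative FD \<phi> x) (at x)" for x
    using Ck_SucD(1)[OF test_function_Ck[OF assms, of "Suc 0"]] .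
  have "norm (\<phi> x - \<phi> y) \<le> B * norm (x - y)" for x y
    by (rule differentiable_bound[where S = UNIV and f' = "\<lambda>x. FD \<phi> x"])
      (auto intro!: onorm_bound B der)
  then show thesis using that B(1) by simp
qed

text \<open>Serves to compare the transport term at the guiding center with the one at the position,
  which are at distance of order \<epsilon>.\<close>

lemma test_function_derivative_Lipschitz:
  assumes "test_function \<phi>"
  obtains B where "B \<ge> 0"
    "\<And>x y h. \<bar>FD \<phi> x h - FD \<phi> y h\<bar> \<le> B * norm (x - y) * norm h"
proof -
  let ?D = "\<lambda>x. FD \<phi> x"
  have "\<exists>C\<ge>0. \<forall>x y. \<bar>?D x b - ?D y b\<bar> \<le> C * norm (x - y)" for b
    using test_function_Lipschitz[OF test_function_derivative[OF assms]] by metis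
  then obtain C where C: "\<And>b. C b \<ge> 0" "\<And>x y b. \<bar>?D x b - ?D y b\<bar> \<le> C b * norm (x - y)" by metis
  have lin: "linear (?D x)" for x
    using Ck_SucD(1)[OF test_function_Ck[OF assms, of "Suc 0"]] has_derivative_linear by blast
  have "\<bar>?D x h - ?D y h\<bar> \<le> (\<Sum>b\<in>Basis. C b) * norm (x - y) * norm h" for x y h
  proof -
    have D: "?D x h = (\<Sum>b\<in>Basis. (h \<bullet> b) * ?D x b)" for x
    proof -
      have "?D x h = ?D x (\<Sum>b\<in>Basis. (h \<bullet> b) *\<^sub>R b)" by (simp add: euclidean_representation)
      then show ?thesis by (simp add: linear_sum[OF lin] linear_cmul[OF lin])
    qed
    have "?D x h - ?D y h = (\<Sum>b\<in>Basis. (h \<bullet> b) * (?D x b - ?D y b))"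
      by (subst (1 2) D) (simp add: sum_subtractf right_diff_distrib)
    then have "\<bar>?D x h - ?D y h\<bar> \<le> (\<Sum>b\<in>Basis. \<bar>(h \<bullet> b) * (?D x b - ?D y b)\<bar>)"
      by (simp add: sum_abs)
    also have "\<dots> \<le> (\<Sum>b\<in>Basis. norm h * (C b * norm (x - y)))"
      unfolding abs_mult by (intro sum_mono mult_mono C) (auto simp: Basis_le_norm)
    finally show ?thesis by (simp add: sum_distrib_left sum_distrib_right mult_ac)
  qed
  moreover have "(\<Sum>b\<in>Basis. C b) \<ge> 0" by (intro sum_nonneg C)
  ultimately show thesis using that by blast
qed

lemma emeasure_cball_less_top [simp]: "emeasure lborel (cball a R) < top"
  using emeasure_bounded_finite[of "cball a R"] by simp

lemma integrable_bounded_support: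
  fixes f :: "'a::euclidean_space \<Rightarrow> 'b::euclidean_space"
  assumes "f \<in> borel_measurable borel" "\<And>x. norm (f x) \<le> B" "\<And>x. norm x \<ge> R \<Longrightarrow> f x = 0"
  shows "integrable lborel f"
proof (rule Bochner_Integration.integrable_bound[where f = "\<lambda>x. indicator (cball 0 R) x * B"])
  show "integrable lborel (\<lambda>x::'a. indicator (cball 0 R) x * B)"
    by (intro integrable_mult_left integrable_real_indicator)
      simp_all
  show "AE x in lborel. norm (f x) \<le> norm (indicator (cball 0 R) x * B)"
  proof (rule AE_I2)
    fix x
    show "norm (f x) \<le> norm (indicator (cball 0 R) x * B)"
      using assms(2)[of x] assms(3)[of x] by (cases "norm x \<le> R") auto
  qed
qed (use assms in auto)

lemma test_function_borel [measurable_dest]: "test_function \<phi> \<Longrightarrow> \<phi> \<in> borel_measurable borel"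
  by (intro borel_measurable_continuous_onI test_function_continuous)

lemma test_function_integrable:
  assumes "test_function \<phi>"
  shows "integrable lborel \<phi>"
proof -
  obtain B where "\<And>x. norm (\<phi> x) \<le> B" using test_function_bounded[OF assms] by auto
  moreover obtain R where "\<And>x. norm x \<ge> R \<Longrightarrow> \<phi> x = 0" using test_function_support[OF assms] by metis
  ultimately show ?thesis by (rule integrable_bounded_support[OF test_function_borel[OF assms]])
qed

lemma integral_translate:
  fixes f :: "'a::euclidean_space \<Rightarrow> 'b::{banach, second_countable_topology}"
  assumes "f \<in> borel_measurable borel"
  shows "(LBINT x. f (x + a)) = (LBINT x. f x)"
proof -
  have "(LBINT x. f x) = (LINT x|distr lborel borel ((+) a). f x)" by (simp add: lborel_distr_plus)
  also have "\<dots> = (LBINT x. f (a + x))" by (rule integral_distr) (use assms in auto)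
  finally show ?thesis by (simp add: add.commute)
qed

lemma test_function_mult:
  assumes "test_function \<phi>" "\<And>k. Ck k g"
  shows "test_function (\<lambda>x. \<phi> x * g x)"
proof -
  obtain R where R: "\<And>x. norm x \<ge> R \<Longrightarrow> \<phi> x = 0" using test_function_support[OF assms(1)] by metis
  show ?thesis
  proof (rule test_functionI[where S = "cball 0 R"])
    show "\<phi> x * g x \<noteq> 0 \<Longrightarrow> x \<in> cball 0 R" for x using R[of x] by force
    show "Ck k (\<lambda>x. \<phi> x * g x)" for k by (intro Ck_mult test_function_Ck assms)
  qed simp
qed

text \<open>Translation invariance makes the integral of every difference quotient vanish.\<close>

lemma test_function_integral_derivative:
  fixes \<phi> :: "'a::euclidean_space \<Rightarrow> real"
  assumes \<phi>: "test_function \<phi>"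
  shows "(LBINT x. FD \<phi> x h) = 0"
proof -
  obtain B where B: "B \<ge> 0" "\<And>x y. \<bar>\<phi> x - \<phi> y\<bar> \<le> B * norm (x - y)"
    using test_function_Lipschitz[OF \<phi>] by metis
  obtain R where R: "R > 0" "\<And>x. norm x \<ge> R \<Longrightarrow> \<phi> x = 0" using test_function_support[OF \<phi>] by metis
  define s where "s n x = (\<phi> (x + (1 / real (Suc n)) *\<^sub>R h) - \<phi> x) * real (Suc n)" for n x
  have [measurable]: "\<phi> \<in> borel_measurable borel" by (rule test_function_borel[OF \<phi>])
  have s0: "(LBINT x. s n x) = 0" for n
  proof -
    have int: "integrable lborel \<phi>" by (rule test_function_integrable[OF \<phi>])
    have "integrable (distr lborel borel ((+) ((1 / real (Suc n)) *\<^sub>R h))) \<phi>"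
      using int by (simp add: lborel_distr_plus)
    then have int2: "integrable lborel (\<lambda>x. \<phi> (x + (1 / real (Suc n)) *\<^sub>R h))"
      by (subst (asm) integrable_distr_eq) (auto simp: add.commute)
    show ?thesis unfolding s_def using integral_translate[of \<phi> "(1 / real (Suc n)) *\<^sub>R h"] int int2 by simp
  qed
  have "(\<lambda>n. LBINT x. s n x) \<longlonglongrightarrow> (LBINT x. FD \<phi> x h)"
  proof (rule integral_dominated_convergence[where w = "\<lambda>x. indicator (cball 0 (R + norm h)) x * (B * norm h)"])
    show "integrable lborel (\<lambda>x::'a. indicator (cball 0 (R + norm h)) x * (B * norm h))"
      by (intro integrable_mult_left integrable_real_indicator) simp_all
    show "(\<lambda>x. FD \<phi> x h) \<in> borel_measurable lborel"
      using test_function_borel[OF test_function_derivative[OF \<phi>]] by simp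
    show "AE x in lborel. (\<lambda>n. s n x) \<longlonglongrightarrow> FD \<phi> x h"
    proof (rule AE_I2)
      fix x
      have lin: "linear (FD \<phi> x)"
        using Ck_SucD(1)[OF test_function_Ck[OF \<phi>, of "Suc 0"]] has_derivative_linear by blast
      have "((\<lambda>t. x + t *\<^sub>R h) has_derivative (\<lambda>t. t *\<^sub>R h)) (at 0)"
        by (auto intro!: derivative_eq_intros)
      moreover have "(\<phi> has_derivative FD \<phi> x) (at (x + 0 *\<^sub>R h))"
        using Ck_SucD(1)[OF test_function_Ck[OF \<phi>, of "Suc 0"]] by simp
      ultimately have "((\<lambda>t. \<phi> (x + t *\<^sub>R h)) has_derivative (\<lambda>t. FD \<phi> x (t *\<^sub>R h))) (at 0)"
        by (rule has_derivative_compose)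
      then have "((\<lambda>t. \<phi> (x + t *\<^sub>R h)) has_real_derivative FD \<phi> x h) (at 0)"
        by (simp add: has_field_derivative_def linear_cmul[OF lin] mult.commute[of _ "FD \<phi> x h"])
      then have "((\<lambda>t. (\<phi> (x + t *\<^sub>R h) - \<phi> x) / t) \<longlongrightarrow> FD \<phi> x h) (at 0)"
        by (simp add: has_field_derivative_iff)
      moreover have "filterlim (\<lambda>n. 1 / real (Suc n)) (at 0) sequentially"
        by (rule filterlim_atI[OF LIMSEQ_Suc[OF lim_1_over_n]]) auto
      ultimately have "(\<lambda>n. (\<phi> (x + (1 / real (Suc n)) *\<^sub>R h) - \<phi> x) / (1 / real (Suc n)))
          \<longlonglongrightarrow> FD \<phi> x h" by (rule filterlim_compose)
      then show "(\<lambda>n. s n x) \<longlonglongrightarrow> FD \<phi> x h" by (simp add: s_def)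
    qed
    show "AE x in lborel. norm (s n x) \<le> indicator (cball 0 (R + norm h)) x * (B * norm h)" for n
    proof (rule AE_I2)
      fix x
      \<comment> \<open>Steps no longer than \<open>h\<close> keep every difference quotient inside
        the ball of radius \<open>R + norm h\<close>, which yields an integrable majorant.\<close>
      have small: "norm ((1 / real (Suc n)) *\<^sub>R h) \<le> norm h"
        by (simp add: divide_simps mult_le_cancel_left1)
      show "norm (s n x) \<le> indicator (cball 0 (R + norm h)) x * (B * norm h)"
      proof (cases "norm x \<le> R + norm h")
        case True
        have "\<bar>\<phi> (x + (1 / real (Suc n)) *\<^sub>R h) - \<phi> x\<bar> \<le> B * norm ((1 / real (Suc n)) *\<^sub>R h)"
          using B(2)[of "x + (1 / real (Suc n)) *\<^sub>R h" x] by simp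
        then have "\<bar>\<phi> (x + (1 / real (Suc n)) *\<^sub>R h) - \<phi> x\<bar> * real (Suc n) \<le> B * norm h"
          by (simp add: field_simps)
        with True show ?thesis by (simp add: s_def abs_mult)
      next
        case False
        have "norm x \<le> norm (x + (1 / real (Suc n)) *\<^sub>R h) + norm ((1 / real (Suc n)) *\<^sub>R h)"
          by (metis add_diff_cancel_right' norm_triangle_ineq4)
        with False small have "norm (x + (1 / real (Suc n)) *\<^sub>R h) \<ge> R" by linarith
        moreover have "norm x \<ge> R" using False norm_ge_zero[of h] by linarith
        ultimately show ?thesis using False R(2) by (simp add: s_def)
      qed
    qed
  qed (auto simp: s_def)
  with s0 show ?thesis by (simp add: LIMSEQ_const_iff)
qed

section \<open>Square integrable functions\<close>

lemmas dominated_integrable = Bochner_Integration.integrable_bound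

abbreviation borel_fun :: "('a::topological_space \<Rightarrow> 'b::topological_space) \<Rightarrow> bool" where
  "borel_fun u \<equiv> u \<in> borel_measurable borel"

definition l2 :: "('a::euclidean_space \<Rightarrow> real) \<Rightarrow> bool" where
  "l2 u \<longleftrightarrow> u \<in> borel_measurable borel \<and> integrable lborel (\<lambda>x. (u x)\<^sup>2)"

abbreviation (input) borel2 :: "('a::topological_space \<times> 'b::topological_space) measure" where
  "borel2 \<equiv> borel \<Otimes>\<^sub>M borel"

abbreviation (input) lborel2 :: "('a::euclidean_space \<times> 'b::euclidean_space) measure" where
  "lborel2 \<equiv> lborel \<Otimes>\<^sub>M lborel"

abbreviation cutoff :: "real \<Rightarrow> 'a::real_normed_vector \<Rightarrow> real" where
  "cutoff R \<equiv> indicator (cball 0 R)"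

abbreviation sq_int :: "('a::euclidean_space \<Rightarrow> real) \<Rightarrow> real" where
  "sq_int u \<equiv> LBINT x. (u x)\<^sup>2"

abbreviation pairing :: "('a::euclidean_space \<Rightarrow> real) \<Rightarrow> ('a \<Rightarrow> real) \<Rightarrow> real" where
  "pairing u w \<equiv> LBINT x. u x * w x"

lemma Lp_mem_2_iff: "Lp_mem lborel 2 u \<longleftrightarrow> l2 u" for u :: "'a::euclidean_space \<Rightarrow> real"
  by (simp add: Lp_mem_def l2_def)

lemma l2_borel [measurable_dest]: "l2 u \<Longrightarrow> u \<in> borel_measurable borel" by (simp add: l2_def)

lemma l2_integrable: "l2 u \<Longrightarrow> integrable lborel (\<lambda>x. (u x)\<^sup>2)" by (simp add: l2_def)

lemma square_add_le: "((a::real) + b)\<^sup>2 \<le> 2 * a\<^sup>2 + 2 * b\<^sup>2"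
proof -
  have "0 \<le> (a - b)\<^sup>2" by simp
  then show ?thesis by (simp add: power2_eq_square algebra_simps)
qed

lemma square_diff_le: "((a::real) - b)\<^sup>2 \<le> 2 * a\<^sup>2 + 2 * b\<^sup>2"
  using square_add_le[of a "-b"] by simp

lemma l2_bound:
  assumes "l2 w" "borel_fun u" "AE x in lborel. \<bar>u x\<bar> \<le> \<bar>w x\<bar>"
  shows "l2 u" unfolding l2_def
proof
  have "AE x in lborel. norm ((u x)\<^sup>2) \<le> norm ((w x)\<^sup>2)"
    
    using assms(3)
  proof eventually_elim
    case (elim x)
    from power_mono[OF elim, of 2] show ?case by simp
  qed
  then show "integrable lborel (\<lambda>x. (u x)\<^sup>2)"
    by (rule dominated_integrable[OF l2_integrable[OF assms(1)], rotated])
      (use assms(2) in simp)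
qed fact

lemma l2_add: "l2 u \<Longrightarrow> l2 w \<Longrightarrow> l2 (\<lambda>x. u x + w x)" unfolding l2_def
proof (safe, goal_cases)
  case 2
  have "integrable lborel (\<lambda>x. 2 * (u x)\<^sup>2 + 2 * (w x)\<^sup>2)" using 2 by simp
  then show ?case by (rule dominated_integrable) (use 2 in \<open>auto intro!: AE_I2 simp: square_add_le\<close>)
qed auto

lemma l2_cmult: "l2 u \<Longrightarrow> l2 (\<lambda>x. c * u x)" by (auto simp: l2_def power_mult_distrib)

lemma l2_diff: "l2 u \<Longrightarrow> l2 w \<Longrightarrow> l2 (\<lambda>x. u x - w x)"
  using l2_add[of u "\<lambda>x. (-1) * w x"] l2_cmult[of w "-1"] by simp

lemma l2_mult_integrable:
  assumes "l2 u" "l2 w"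
  shows "integrable lborel (\<lambda>x. u x * w x)"
proof (rule dominated_integrable)
  show "integrable lborel (\<lambda>x. (u x)\<^sup>2 + (w x)\<^sup>2)" using assms by (simp add: l2_def)
  have "\<bar>a * b\<bar> \<le> a\<^sup>2 + b\<^sup>2" for a b :: real
    using sum_squares_bound[of "\<bar>a\<bar>" "\<bar>b\<bar>"] mult_nonneg_nonneg[OF abs_ge_zero abs_ge_zero, of a b]
    unfolding abs_mult power2_abs mult.assoc by linarith
  then show "AE x in lborel. norm (u x * w x) \<le> norm ((u x)\<^sup>2 + (w x)\<^sup>2)" by auto
qed (use assms in \<open>auto simp: l2_def\<close>)

text \<open>The quadratic in s given by the integral of (s u - w)^2 is never negative. Taking s = b
  / a gives the inequality; a = 0 leaves an affine function, whose slope must vanish.\<close>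

lemma l2_Cauchy_Schwarz:
  assumes "l2 u" "l2 w"
  shows "(pairing u w)\<^sup>2 \<le> sq_int u * sq_int w"
proof -
  define a b c where "a = sq_int u" and "b = pairing u w"
    and "c = sq_int w"
  have quad: "0 \<le> s\<^sup>2 * a - 2 * s * b + c" for s
  proof -
    have "0 \<le> (LBINT x. (s * u x - w x)\<^sup>2)" by simp
    also have "\<dots> = (LBINT x. s\<^sup>2 * (u x)\<^sup>2 - 2 * s * (u x * w x) + (w x)\<^sup>2)"
      by (intro Bochner_Integration.integral_cong) (auto simp: power2_diff power_mult_distrib)
    also have "\<dots> = s\<^sup>2 * a - 2 * s * b + c"
      using l2_mult_integrable[OF assms] assms by (simp add: a_def b_def c_def l2_def)
    finally show ?thesis .
  qed
  have "a \<ge> 0" by (simp add: a_def)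
  have "b\<^sup>2 \<le> a * c"
  proof (cases "a = 0")
    case True
    have "b = 0"
    proof (rule ccontr)
      assume "b \<noteq> 0"
      \<comment> \<open>At this point the affine function takes the value -1.\<close>
      then show False using quad[of "(c + 1) / (2 * b)"] True by (simp add: field_simps)
    qed
    with True show ?thesis by simp
  next
    case False
    with \<open>a \<ge> 0\<close> have "a > 0" by simp
    then show ?thesis using quad[of "b / a"] by (simp add: field_simps power2_eq_square)
  qed
  then show ?thesis by (simp add: a_def b_def c_def)
qed

lemma l2_Cauchy_Schwarz_abs:
  assumes "l2 u" "l2 w"
  shows "\<bar>LBINT x. u x * w x\<bar> \<le> sqrt (sq_int u) * sqrt (sq_int w)"
  using real_sqrt_le_mono[OF l2_Cauchy_Schwarz[OF assms]] by (simp add: real_sqrt_mult)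

lemma l2_integral_limit:
  assumes "l2 u" "\<And>n. l2 (U n)" "\<And>n. l2 (W n)" "\<And>n. sq_int (W n) \<le> C"
    "(\<lambda>n. LBINT x. (U n x - u x)\<^sup>2) \<longlonglongrightarrow> 0"
  shows "(\<lambda>n. LBINT x. (U n x - u x) * W n x) \<longlonglongrightarrow> 0"
proof (rule Lim_null_comparison)
  show "\<forall>\<^sub>F n in sequentially. norm (LBINT x. (U n x - u x) * W n x)
      \<le> sqrt (LBINT x. (U n x - u x)\<^sup>2) * sqrt C"
  proof (intro always_eventually allI)
    fix n
    have "norm (LBINT x. (U n x - u x) * W n x)
        \<le> sqrt (LBINT x. (U n x - u x)\<^sup>2) * sqrt (sq_int (W n))"
      using l2_Cauchy_Schwarz_abs[OF l2_diff[OF assms(2,1)] assms(3)] by simp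
    also have "\<dots> \<le> sqrt (LBINT x. (U n x - u x)\<^sup>2) * sqrt C"
      by (intro mult_left_mono real_sqrt_le_mono assms) simp
    finally show "norm (LBINT x. (U n x - u x) * W n x)
        \<le> sqrt (LBINT x. (U n x - u x)\<^sup>2) * sqrt C" .
  qed
  show "(\<lambda>n. sqrt (LBINT x. (U n x - u x)\<^sup>2) * sqrt C) \<longlonglongrightarrow> 0"
    using tendsto_mult_right[OF tendsto_real_sqrt[OF assms(5)], of "sqrt C"] by simp
qed

lemma l2_bounded_support:
  assumes "borel_fun u" "\<And>x. \<bar>u x\<bar> \<le> B" "\<And>x. norm x \<ge> R \<Longrightarrow> u x = 0"
  shows "l2 u" unfolding l2_def
proof
  have "norm ((u x)\<^sup>2) \<le> B\<^sup>2" for x using power_mono[OF assms(2)[of x], of 2] by simp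
  then show "integrable lborel (\<lambda>x. (u x)\<^sup>2)"
    by (rule integrable_bounded_support[rotated, where R = R]) (use assms in auto)
qed fact

lemma test_function_l2: "test_function \<phi> \<Longrightarrow> l2 \<phi>"
  using test_function_integrable[OF test_function_mult[of \<phi> \<phi>]]
  by (simp add: l2_def test_function_Ck power2_eq_square)

text \<open>The sequence and its limit are both below \<open>w\<close> in modulus, so 4 w^2
  dominates the squared differences.\<close>

lemma l2_dominated:
  fixes u w :: "'a::euclidean_space \<Rightarrow> real"
  assumes "l2 w" "borel_fun u" "\<And>n. borel_fun (U n)"
    "AE x in lborel. (\<lambda>n. U n x) \<longlonglongrightarrow> u x" "\<And>n. AE x in lborel. \<bar>U n x\<bar> \<le> w x"
  shows "l2 u" "\<And>n. l2 (U n)" "(\<lambda>n. LBINT x. (U n x - u x)\<^sup>2) \<longlonglongrightarrow> 0"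
proof -
  have [measurable]: "borel_fun w" "borel_fun u"
    "\<And>n. borel_fun (U n)" using assms by (auto simp: l2_def)
  have all: "AE x in lborel. \<forall>n. \<bar>U n x\<bar> \<le> w x" using assms(5) by (simp add: AE_all_countable)
  have lim: "AE x in lborel. \<bar>u x\<bar> \<le> w x" using assms(4) all
  proof eventually_elim
    case (elim x)
    show ?case by (rule LIMSEQ_le_const2[OF tendsto_rabs[OF elim(1)]]) (use elim in auto)
  qed
  show "l2 u" by (rule l2_bound[OF assms(1,2)]) (use lim in \<open>eventually_elim, auto\<close>)
  show "l2 (U n)" for n by (rule l2_bound[OF assms(1,3)]) (use assms(5)[of n] in \<open>eventually_elim, auto\<close>)
  have "(\<lambda>n. LBINT x. (U n x - u x)\<^sup>2) \<longlonglongrightarrow> (LINT x::'a|lborel. (0::real))"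
  proof (rule integral_dominated_convergence[where w = "\<lambda>x. 4 * (w x)\<^sup>2"])
    show "integrable lborel (\<lambda>x. 4 * (w x)\<^sup>2)" using assms(1) by (simp add: l2_def)
    show "AE x in lborel. (\<lambda>n. (U n x - u x)\<^sup>2) \<longlonglongrightarrow> 0" using assms(4)
    proof eventually_elim
      case (elim x)
      from tendsto_power[OF tendsto_diff[OF elim tendsto_const[of "u x"]], of 2] show ?case by simp
    qed
    show "AE x in lborel. norm ((U n x - u x)\<^sup>2) \<le> 4 * (w x)\<^sup>2" for n using lim all
    proof eventually_elim
      case (elim x)
      then have "\<bar>U n x - u x\<bar> \<le> 2 * w x" using spec[OF elim(2), of n] by arith
      from power_mono[OF this, of 2] show ?case by (simp add: power_mult_distrib)
    qed
  qed measurable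
  then show "(\<lambda>n. LBINT x. (U n x - u x)\<^sup>2) \<longlonglongrightarrow> 0" by simp
qed

text \<open>A rounded indicator of a box whose corners are dyadic of level \<open>m\<close>, with
  transition layers of width 1/m. Integer parameters keep the family countable, as the diagonal
  extraction in \<open>L2_time_subsequence\<close> requires, and rounding makes its members test
  functions.\<close>

definition smooth_box :: "nat \<Rightarrow> int \<Rightarrow> int \<Rightarrow> int \<Rightarrow> int \<Rightarrow> R2 \<Rightarrow> real" where
  "smooth_box m a1 a2 b1 b2 x =
     smooth_step (real m * (x $ 1 - of_int a1 / 2 ^ m)) * smooth_step (real m * (of_int b1 / 2 ^ m - x $ 1))
   * (smooth_step (real m * (x $ 2 - of_int a2 / 2 ^ m)) * smooth_step (real m * (of_int b2 / 2 ^ m - x $ 2)))"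

lemma mem_box_R2: "x \<in> box a b \<longleftrightarrow> a $ 1 < x $ 1 \<and> x $ 1 < b $ 1 \<and> a $ 2 < x $ 2 \<and> x $ 2 < b $ 2"
  for x :: R2 by (auto simp: mem_box_cart forall_2)

lemma smooth_box_support:
  assumes "smooth_box m a1 a2 b1 b2 x \<noteq> 0"
  shows "of_int a1 / 2 ^ m < x $ 1" "x $ 1 < of_int b1 / 2 ^ m"
    "of_int a2 / 2 ^ m < x $ 2" "x $ 2 < of_int b2 / 2 ^ m"
proof -
  have pos: "0 < y" if "smooth_step (real m * y) \<noteq> 0" for y
    using that smooth_step_0[of "real m * y"] by (smt (verit) mult_nonneg_nonpos of_nat_0_le_iff)
  from assms have "smooth_step (real m * (x $ 1 - of_int a1 / 2 ^ m)) \<noteq> 0"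
    "smooth_step (real m * (of_int b1 / 2 ^ m - x $ 1)) \<noteq> 0"
    "smooth_step (real m * (x $ 2 - of_int a2 / 2 ^ m)) \<noteq> 0"
    "smooth_step (real m * (of_int b2 / 2 ^ m - x $ 2)) \<noteq> 0" by (auto simp: smooth_box_def)
  from this[THEN pos] show "of_int a1 / 2 ^ m < x $ 1" "x $ 1 < of_int b1 / 2 ^ m"
    "of_int a2 / 2 ^ m < x $ 2" "x $ 2 < of_int b2 / 2 ^ m" by auto
qed

lemma smooth_box_bounds: "0 \<le> smooth_box m a1 a2 b1 b2 x" "smooth_box m a1 a2 b1 b2 x \<le> 1"
  unfolding smooth_box_def by (intro mult_nonneg_nonneg mult_le_one smooth_step_bounds)+

lemma test_function_smooth_box: "test_function (smooth_box m a1 a2 b1 b2)"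
proof (rule test_functionI[where S = "box (vector [of_int a1 / 2 ^ m, of_int a2 / 2 ^ m])
      (vector [of_int b1 / 2 ^ m, of_int b2 / 2 ^ m])"])
  fix k
  have aff: "Ck k (\<lambda>x::R2. c + d * x $ i)" for c d i
    by (intro Ck_add Ck_const Ck_cmult Ck_linear bounded_linear_vec_nth)
  have "Ck k (\<lambda>x::R2. smooth_step (real m * (x $ i - c)))" for c i
    using Ck_compose_real[OF Ck_smooth_step aff[of "- real m * c" "real m" i]] by (simp add: algebra_simps)
  moreover have "Ck k (\<lambda>x::R2. smooth_step (real m * (c - x $ i)))" for c i
    using Ck_compose_real[OF Ck_smooth_step aff[of "real m * c" "- real m" i]] by (simp add: algebra_simps)
  ultimately show "Ck k (smooth_box m a1 a2 b1 b2)" unfolding smooth_box_def[abs_def] by (intro Ck_mult)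
qed (use smooth_box_support in \<open>auto simp: mem_box_R2\<close>)

lemma dyadic_approx:
  "(\<lambda>m. of_int \<lceil>2 ^ m * a\<rceil> / 2 ^ m) \<longlonglongrightarrow> (a::real)" "(\<lambda>m. of_int \<lfloor>2 ^ m * a\<rfloor> / 2 ^ m) \<longlonglongrightarrow> (a::real)"
proof -
  have z: "(\<lambda>m. 1 / 2 ^ m) \<longlonglongrightarrow> (0::real)"
    using LIMSEQ_realpow_zero[of "1/2::real"] by (simp add: power_one_over)
  show "(\<lambda>m. of_int \<lceil>2 ^ m * a\<rceil> / 2 ^ m) \<longlonglongrightarrow> (a::real)"
  proof (rule tendsto_sandwich[OF _ _ tendsto_const tendsto_add[OF tendsto_const z, simplified]])
    show "\<forall>\<^sub>F m in sequentially. a \<le> of_int \<lceil>2 ^ m * a\<rceil> / 2 ^ m"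
      by (intro always_eventually allI) (simp add: field_simps)
    have "of_int \<lceil>2 ^ m * a\<rceil> / 2 ^ m \<le> (2 ^ m * a + 1) / 2 ^ m" for m
      by (intro divide_right_mono) (linarith, simp)
    then show "\<forall>\<^sub>F m in sequentially. of_int \<lceil>2 ^ m * a\<rceil> / 2 ^ m \<le> a + 1 / 2 ^ m"
      by (simp add: add_divide_distrib)
  qed
  show "(\<lambda>m. of_int \<lfloor>2 ^ m * a\<rfloor> / 2 ^ m) \<longlonglongrightarrow> (a::real)"
  proof (rule tendsto_sandwich[OF _ _ tendsto_diff[OF tendsto_const z, simplified] tendsto_const])
    show "\<forall>\<^sub>F m in sequentially. of_int \<lfloor>2 ^ m * a\<rfloor> / 2 ^ m \<le> a"
      by (intro always_eventually allI) (simp add: field_simps)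
    have "(2 ^ m * a - 1) / 2 ^ m \<le> of_int \<lfloor>2 ^ m * a\<rfloor> / 2 ^ m" for m
      by (intro divide_right_mono) (linarith, simp)
    then show "\<forall>\<^sub>F m in sequentially. a - 1 / 2 ^ m \<le> of_int \<lfloor>2 ^ m * a\<rfloor> / 2 ^ m"
      by (simp add: diff_divide_distrib)
  qed
qed

lemma smooth_step_tendsto_1:
  assumes "c \<longlonglongrightarrow> (d::real)" "d > 0"
  shows "\<forall>\<^sub>F m in sequentially. smooth_step (real m * c m) = 1"
proof -
  have "\<forall>\<^sub>F m in sequentially. c m > d / 2" using assms by (intro order_tendstoD) auto
  moreover obtain N :: nat where N: "real N * (d / 2) > 1" using spec[OF reals_Archimedean3[of "d/2"], of 1] assms(2) by auto
  have "\<forall>\<^sub>F m in sequentially. m \<ge> N" by (rule eventually_ge_at_top)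
  ultimately show ?thesis
  proof eventually_elim
    case (elim m)
    have "real N * (d / 2) \<le> real m * c m" using elim assms(2) by (intro mult_mono) auto
    with N show ?case by (intro smooth_step_1) linarith
  qed
qed

text \<open>The corners are rounded inwards, so each approximation lies below the indicator, which
  then serves as its own majorant. At a point of the open box the distances to the sides stay
  positive while the layers shrink like 1/m, so the value is eventually 1.\<close>

lemma smooth_box_limit:
  fixes a b :: R2
  defines "w \<equiv> \<lambda>m. smooth_box m \<lceil>2 ^ m * a $ 1\<rceil> \<lceil>2 ^ m * a $ 2\<rceil> \<lfloor>2 ^ m * b $ 1\<rfloor> \<lfloor>2 ^ m * b $ 2\<rfloor>"
  shows "(\<lambda>m. w m x) \<longlonglongrightarrow> indicator (box a b) x" "\<bar>w m x\<bar> \<le> indicator (box a b) x"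
proof -
  have w0: "x \<in> box a b" if nz: "w m x \<noteq> 0" for m
  proof -
    have "c \<le> of_int \<lceil>2 ^ m * c\<rceil> / 2 ^ m" "of_int \<lfloor>2 ^ m * c\<rfloor> / 2 ^ m \<le> c" for c :: real
      by (simp_all add: field_simps)
    with smooth_box_support[OF nz[unfolded w_def]] show ?thesis
      unfolding mem_box_R2 by (meson le_less_trans less_le_trans)
  qed
  show "\<bar>w m x\<bar> \<le> indicator (box a b) x"
  proof (cases "w m x = 0")
    case False
    with w0 smooth_box_bounds show ?thesis by (simp add: w_def)
  qed simp
  show "(\<lambda>m. w m x) \<longlonglongrightarrow> indicator (box a b) x"
  proof (cases "x \<in> box a b")
    case True
    then have pos: "x $ 1 - a $ 1 > 0" "b $ 1 - x $ 1 > 0" "x $ 2 - a $ 2 > 0" "b $ 2 - x $ 2 > 0"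
      by (auto simp: mem_box_R2)
    note lims = tendsto_diff[OF tendsto_const dyadic_approx(1)] tendsto_diff[OF dyadic_approx(2) tendsto_const]
    have "\<forall>\<^sub>F m in sequentially. w m x = 1"
      using smooth_step_tendsto_1[OF lims(1) pos(1)] smooth_step_tendsto_1[OF lims(2) pos(2)]
        smooth_step_tendsto_1[OF lims(1) pos(3)] smooth_step_tendsto_1[OF lims(2) pos(4)]
      by eventually_elim (simp add: w_def smooth_box_def)
    with True show ?thesis by (simp add: tendsto_eventually)
  next
    case False
    with w0 have "w m x = 0" for m by blast
    with False show ?thesis by simp
  qed
qed

lemma l2_indicator: "A \<in> sets borel \<Longrightarrow> bounded A \<Longrightarrow> l2 (indicator A)"
proof -
  assume A: "A \<in> sets borel" "bounded A"
  then obtain R where "\<And>x. x \<in> A \<Longrightarrow> norm x < R" using bounded_pos_less[of A] by auto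
  then have "x \<notin> A" if "norm x \<ge> R" for x using that by (auto simp: not_less[symmetric])
  with A show ?thesis by (intro l2_bounded_support[where B = 1 and R = R]) (auto simp: indicator_def)
qed

text \<open>A linear, \<open>L\<^sup>2\<close>-closed property of functions holds on all of \<open>L\<^sup>2\<close> as soon as it holds for a
  countable family of test functions.\<close>

lemma l2_density:
  fixes P :: "(R2 \<Rightarrow> real) \<Rightarrow> bool"
  assumes u: "l2 u"
    and add: "\<And>u w. l2 u \<Longrightarrow> l2 w \<Longrightarrow> P u \<Longrightarrow> P w \<Longrightarrow> P (\<lambda>x. u x + w x)"
    and cmult: "\<And>c u. l2 u \<Longrightarrow> P u \<Longrightarrow> P (\<lambda>x. c * u x)"
    and lim: "\<And>U u. l2 u \<Longrightarrow> (\<And>n. l2 (U n)) \<Longrightarrow> (\<And>n. P (U n)) \<Longrightarrow>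
      (\<lambda>n. LBINT x. (U n x - u x)\<^sup>2) \<longlonglongrightarrow> 0 \<Longrightarrow> P u"
    and base: "\<And>m a1 a2 b1 b2. P (smooth_box m a1 a2 b1 b2)"
  shows "P u"
proof -
  have box: "P (indicator (box a b))" for a b
  proof (rule lim)
    show "(\<lambda>n. LBINT x. (smooth_box n \<lceil>2 ^ n * a $ 1\<rceil> \<lceil>2 ^ n * a $ 2\<rceil> \<lfloor>2 ^ n * b $ 1\<rfloor> \<lfloor>2 ^ n * b $ 2\<rfloor> x
        - indicator (box a b) x)\<^sup>2) \<longlonglongrightarrow> 0"
      by (rule l2_dominated(3)[where w = "indicator (box a b)"])
        (intro l2_indicator smooth_box_limit AE_I2 test_function_borel test_function_smooth_box
          borel_measurable_indicator bounded_box; simp)+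
    show "l2 (indicator (box a b))" by (intro l2_indicator bounded_box) simp
  qed (rule test_function_l2[OF test_function_smooth_box] base)+
  \<comment> \<open>The box with both corners at 0 is empty, and its indicator is the zero
    function.\<close>
  have zero: "P (\<lambda>x. 0)" using box[of 0 0] by (simp add: indicator_def[abs_def])
  \<comment> \<open>Indicators of arbitrary Borel sets need not lie in L2, so every set is
    intersected with a bounded box before the Dynkin argument.\<close>
  define Q where "Q N = box (vec (- real N)) (vec (real N) :: R2)" for N
  have Q: "Q N \<in> sets borel" "bounded (Q N)" for N by (auto simp: Q_def)
  have ind: "P (indicator (A \<inter> Q N))" if "A \<in> sets borel" for A N
  proof -
    have A: "A \<in> sigma_sets UNIV (range (\<lambda>(a, b). box a b :: R2 set))"
      using that by (simp add: borel_eq_box)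
    have stable: "Int_stable (range (\<lambda>(a, b). box a b :: R2 set))" by (auto simp: Int_stable_def box_Int_box)
    have subset: "range (\<lambda>(a, b). box a b :: R2 set) \<subseteq> Pow UNIV" by simp
    have bor: "B \<in> sigma_sets UNIV (range (\<lambda>(a, b). box a b :: R2 set)) \<Longrightarrow> B \<in> sets borel" for B
      by (simp add: borel_eq_box)
    from stable subset A show ?thesis
    proof (induction rule: sigma_sets_induct_disjoint)
      case (basic B)
      then obtain a b where "B = box a b" by auto
      then have "\<exists>c d. B \<inter> Q N = box c d" by (auto simp: Q_def box_Int_box)
      then show ?case using box by metis
    next
      case empty
      then show ?case using zero by (simp add: indicator_def[abs_def])
    next
      case (compl B)
      have l: "l2 (indicator (B \<inter> Q N))"
        using bor[OF compl(1)] Q(1)[of N] bounded_subset[OF Q(2)[of N], of "B \<inter> Q N"] by (intro l2_indicator) auto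
      \<comment> \<open>The complement is taken relative to \<open>Q N\<close>, where it is a linear
        combination of indicators already covered.\<close>
      have "P (\<lambda>x. indicator (Q N) x + (-1) * indicator (B \<inter> Q N) x)"
        using compl box by (intro add cmult l l2_indicator Q l2_cmult) (auto simp: Q_def)
      moreover have "(\<lambda>x. indicator (Q N) x + (-1) * indicator (B \<inter> Q N) x) = (indicator ((UNIV - B) \<inter> Q N) :: R2 \<Rightarrow> real)"
        by (auto simp: indicator_def)
      ultimately show ?case by simp
    next
      case (union B)
      have B: "B i \<in> sets borel" for i using union bor by auto
      have l: "l2 (indicator (B i \<inter> Q N))" for i
        using B[of i] Q(1)[of N] bounded_subset[OF Q(2)[of N], of "B i \<inter> Q N"] by (intro l2_indicator) auto
      have part: "l2 (\<lambda>x. \<Sum>i<n. indicator (B i \<inter> Q N) x) \<and> P (\<lambda>x. \<Sum>i<n. indicator (B i \<inter> Q N) x)" for n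
      proof (induction n)
        case 0
        show ?case using zero by (simp add: l2_def)
      next
        case (Suc n)
        then show ?case using add[OF _ l _ union(3)] l2_add[OF _ l] by auto
      qed
      have eq: "(\<Sum>i<n. indicator (B i \<inter> Q N) x) = (indicator ((\<Union>i<n. B i) \<inter> Q N) x :: real)" for n x
      proof -
        have "disjoint_family_on (\<lambda>i. B i \<inter> Q N) {..<n}"
          using union(1) by (auto simp: disjoint_family_on_def)
        then have "(\<Sum>i<n. indicator (B i \<inter> Q N) x) = (indicator (\<Union>i<n. B i \<inter> Q N) x :: real)"
          by (intro indicator_UN_disjoint[symmetric]) auto
        moreover have "(\<Union>i<n. B i \<inter> Q N) = (\<Union>i<n. B i) \<inter> Q N" by auto
        ultimately show ?thesis by simp
      qed
      have "(\<lambda>n. indicator ((\<Union>i<n. B i) \<inter> Q N) x :: real) \<longlonglongrightarrow> indicator (\<Union> (range B) \<inter> Q N) x" for x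
      proof (cases "x \<in> \<Union> (range B) \<inter> Q N")
        case True
        then obtain i where "x \<in> B i" by auto
        then have "\<forall>\<^sub>F n in sequentially. indicator ((\<Union>i<n. B i) \<inter> Q N) x = (1::real)"
          using True by (intro eventually_sequentiallyI[of "Suc i"]) (auto simp: indicator_def)
        with True show ?thesis by (simp add: tendsto_eventually)
      next
        case False
        then have "indicator ((\<Union>i<n. B i) \<inter> Q N) x = (0::real)" for n by (auto simp: indicator_def)
        with False show ?thesis by simp
      qed
      note lim_ind = this
      show ?case
      proof (rule lim[where U = "\<lambda>n x. \<Sum>i<n. indicator (B i \<inter> Q N) x"])
        have UB: "\<Union> (range B) \<inter> Q N \<in> sets borel" using B Q(1)[of N] by auto
        then show "l2 (indicator (\<Union> (range B) \<inter> Q N))"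
          by (rule l2_indicator) (rule bounded_subset[OF Q(2)[of N]], simp)
        show "P (\<lambda>x. \<Sum>i<n. indicator (B i \<inter> Q N) x)" for n using part by blast
        show l: "l2 (\<lambda>x. \<Sum>i<n. indicator (B i \<inter> Q N) x)" for n using part by blast
        show "(\<lambda>n. LBINT x. ((\<Sum>i<n. indicator (B i \<inter> Q N) x) - indicator (\<Union> (range B) \<inter> Q N) x)\<^sup>2)
            \<longlonglongrightarrow> (0::real)"
        proof (rule l2_dominated(3)[where w = "indicator (Q N)"
              and U = "\<lambda>n x. \<Sum>i<n. indicator (B i \<inter> Q N) x"
              and u = "indicator (\<Union> (range B) \<inter> Q N)"])
          show "l2 (indicator (Q N))" by (rule l2_indicator[OF Q])
          show "indicator (\<Union> (range B) \<inter> Q N) \<in> borel_measurable borel" using UB by simp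
          show "AE x in lborel. (\<lambda>n. \<Sum>i<n. indicator (B i \<inter> Q N) x)
              \<longlonglongrightarrow> (indicator (\<Union> (range B) \<inter> Q N) x :: real)"
            unfolding eq using lim_ind by simp
          show "AE x in lborel. \<bar>\<Sum>i<n. indicator (B i \<inter> Q N) x\<bar> \<le> (indicator (Q N) x :: real)" for n
            unfolding eq by (intro AE_I2) (auto simp: indicator_def)
          show "borel_fun (\<lambda>x. \<Sum>i<n. indicator (B i \<inter> Q N) x :: real)" for n
            by (rule l2_borel[OF l])
        qed
      qed
    qed
  qed
  have [measurable]: "borel_fun u" using u by (simp add: l2_def)
  \<comment> \<open>The simple functions satisfy |F i| \<le> 2 |u|; this factor 2 reappears in the
    majorant |2 u| of the truncations \<open>W i\<close>.\<close>
  obtain F where "\<forall>i. simple_function borel (F i)" "\<forall>x\<in>space borel. (\<lambda>i. F i x) \<longlonglongrightarrow> u x"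
    "\<forall>i. \<forall>x\<in>space borel. dist (F i x) 0 \<le> 2 * dist (u x) 0"
    using borel_measurable_implies_sequence_metric[OF \<open>u \<in> borel_measurable borel\<close>, of 0] by metis
  then have F: "\<And>i. simple_function borel (F i)" "\<And>x. (\<lambda>i. F i x) \<longlonglongrightarrow> u x"
    "\<And>i x. dist (F i x) 0 \<le> 2 * dist (u x) 0" by simp_all
  have [measurable]: "borel_fun (F i)" for i using F(1) by (rule borel_measurable_simple_function)
  define W where "W i x = F i x * indicator (Q i) x" for i x
  have W: "l2 (W i) \<and> P (W i)" for i
  proof -
    have fin: "finite (range (F i))" using simple_functionD(1)[OF F(1)[of i]] by simp
    have ms: "F i -` {y} \<in> sets borel" for y using simple_functionD(2)[OF F(1)[of i]] by simp
    have l: "l2 (indicator (F i -` {y} \<inter> Q i))" for y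
      using ms[of y] Q(1)[of i] bounded_subset[OF Q(2)[of i], of "F i -` {y} \<inter> Q i"] by (intro l2_indicator) auto
    have "l2 (\<lambda>x. \<Sum>y\<in>S. y * indicator (F i -` {y} \<inter> Q i) x) \<and> P (\<lambda>x. \<Sum>y\<in>S. y * indicator (F i -` {y} \<inter> Q i) x)"
      if "finite S" for S using that
    proof induction
      case empty
      show ?case using zero by (simp add: l2_def)
    next
      case (insert y S)
      have y: "l2 (\<lambda>x. y * indicator (F i -` {y} \<inter> Q i) x)" by (rule l2_cmult[OF l])
      moreover have "P (\<lambda>x. y * indicator (F i -` {y} \<inter> Q i) x)" by (rule cmult[OF l ind[OF ms]])
      ultimately have "l2 (\<lambda>x. y * indicator (F i -` {y} \<inter> Q i) x + (\<Sum>y\<in>S. y * indicator (F i -` {y} \<inter> Q i) x))"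
        "P (\<lambda>x. y * indicator (F i -` {y} \<inter> Q i) x + (\<Sum>y\<in>S. y * indicator (F i -` {y} \<inter> Q i) x))"
        using insert.IH by (intro l2_add add; blast)+
      then show ?case by (simp only: sum.insert[OF insert.hyps] simp_thms)
    qed
    from this[OF fin] have "l2 (\<lambda>x. \<Sum>y\<in>range (F i). y * indicator (F i -` {y} \<inter> Q i) x) \<and>
      P (\<lambda>x. \<Sum>y\<in>range (F i). y * indicator (F i -` {y} \<inter> Q i) x)" .
    moreover have "(\<Sum>y\<in>range (F i). y * indicator (F i -` {y} \<inter> Q i) x) = W i x" for x
    proof -
      have "y * indicator (F i -` {y} \<inter> Q i) x = (if y = F i x then W i x else 0)" for y
        by (auto simp: indicator_def W_def)
      moreover have "(\<Sum>y\<in>range (F i). if y = F i x then W i x else 0) = W i x"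
        by (subst sum.delta[OF fin]) simp
      ultimately show ?thesis by (simp only:)
    qed
    ultimately show ?thesis by (simp only:)
  qed
  have Wlim: "(\<lambda>i. W i x) \<longlonglongrightarrow> u x" for x
  proof -
    obtain N :: nat where N: "real N > norm x" using reals_Archimedean2 by blast
    have "x \<in> Q i" if "i \<ge> N" for i
    proof -
      have "\<bar>x $ j\<bar> < real i" for j using component_le_norm_cart[of x j] N that by linarith
      from this[of 1] this[of 2] show ?thesis by (auto simp: Q_def mem_box_R2)
    qed
    then have "\<forall>\<^sub>F i in sequentially. F i x = W i x"
      by (intro eventually_sequentiallyI[of N]) (simp add: W_def)
    with F(2) show ?thesis by (rule Lim_transform_eventually)
  qed
  have "(\<lambda>n. LBINT x. (W n x - u x)\<^sup>2) \<longlonglongrightarrow> 0"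
  proof (rule l2_dominated(3)[where w = "\<lambda>x. \<bar>2 * u x\<bar>"])
    show "l2 (\<lambda>x. \<bar>2 * u x\<bar>)" using l2_cmult[OF u, of 2] by (simp add: l2_def)
    show "AE x in lborel. \<bar>W n x\<bar> \<le> \<bar>2 * u x\<bar>" for n
      using F(3)[of n] by (intro AE_I2) (auto simp: W_def indicator_def abs_mult)
    show "borel_fun (W n)" for n using W by (auto simp: l2_def)
  qed (auto simp: Wlim)
  with W show ?thesis by (intro lim[OF u, of W]) simp_all
qed

section \<open>Weakly convergent families of densities\<close>

text \<open>By Cauchy-Schwarz the same \<open>m\<close> serves every \<open>V\<close> in an L2 ball.
  This uniformity lets statements that are uniform in n and t pass from the approximants to
  \<open>u\<close>.\<close>

lemma l2_uniform_approximation: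
  fixes u :: "'a::euclidean_space \<Rightarrow> real"
  assumes "l2 u" "\<And>n. l2 (U n)" "(\<lambda>n. LBINT x. (U n x - u x)\<^sup>2) \<longlonglongrightarrow> 0" "0 < \<epsilon>"
  obtains m where "\<And>V :: 'a \<Rightarrow> real. l2 V \<Longrightarrow> sq_int V \<le> C \<Longrightarrow>
    \<bar>(LBINT x. u x * V x) - pairing (U m) V\<bar> < \<epsilon>"
proof -
  have "(\<lambda>n. sqrt (LBINT x. (U n x - u x)\<^sup>2) * sqrt \<bar>C\<bar>) \<longlonglongrightarrow> 0"
    using tendsto_mult_right[OF tendsto_real_sqrt[OF assms(3)], of "sqrt \<bar>C\<bar>"] by simp
  from order_tendstoD(2)[OF this \<open>0 < \<epsilon>\<close>] obtain m where
    m: "sqrt (LBINT x. (U m x - u x)\<^sup>2) * sqrt \<bar>C\<bar> < \<epsilon>"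
    by (auto simp: eventually_sequentially)
  show thesis
  proof (rule that[of m])
    fix V :: "'a \<Rightarrow> real" assume V: "l2 V" "sq_int V \<le> C"
    have "pairing (U m) V - pairing u V = (LBINT x. (U m x - u x) * V x)"
      using l2_mult_integrable[OF assms(2) V(1)] l2_mult_integrable[OF assms(1) V(1)] by (simp add: left_diff_distrib)
    then have "\<bar>(LBINT x. u x * V x) - pairing (U m) V\<bar> = \<bar>LBINT x. (U m x - u x) * V x\<bar>"
      by linarith
    also have "\<dots> \<le> sqrt (LBINT x. (U m x - u x)\<^sup>2) * sqrt (sq_int V)"
      by (rule l2_Cauchy_Schwarz_abs[OF l2_diff[OF assms(2,1)] V(1)])
    also have "\<dots> \<le> sqrt (LBINT x. (U m x - u x)\<^sup>2) * sqrt \<bar>C\<bar>"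
      by (intro mult_left_mono real_sqrt_le_mono) (use V in auto)
    also note m
    finally show "\<bar>(LBINT x. u x * V x) - pairing (U m) V\<bar> < \<epsilon>" .
  qed
qed

lemma l2_pairing_add:
  assumes "l2 u" "l2 w" "l2 V"
  shows "(LBINT x. (u x + w x) * V x) = pairing u V + pairing w V"
  using l2_mult_integrable[OF assms(1,3)] l2_mult_integrable[OF assms(2,3)] by (simp add: distrib_right)

text \<open>Three terms of size e / 3: two from replacing \<open>u\<close> by an approximant,
  uniformly over an L2 ball that contains all \<open>W n\<close> and \<open>w\<close>, and one from
  convergence for that approximant.\<close>

lemma l2_weak_convergence_density:
  fixes w :: "R2 \<Rightarrow> real"
  assumes W: "\<And>n. l2 (W n)" "\<And>n. sq_int (W n) \<le> C" and w: "l2 w"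
    and base: "\<And>m a1 a2 b1 b2. (\<lambda>n. LBINT x. smooth_box m a1 a2 b1 b2 x * W n x)
      \<longlonglongrightarrow> (LBINT x. smooth_box m a1 a2 b1 b2 x * w x)"
    and u: "l2 u"
  shows "(\<lambda>n. pairing u (W n)) \<longlonglongrightarrow> pairing u w" using u
proof (rule l2_density[where P = "\<lambda>u. (\<lambda>n. pairing u (W n)) \<longlonglongrightarrow> pairing u w"])
  fix u u' :: "R2 \<Rightarrow> real"
  assume "l2 u" "l2 u'" "(\<lambda>n. pairing u (W n)) \<longlonglongrightarrow> pairing u w"
    "(\<lambda>n. pairing u' (W n)) \<longlonglongrightarrow> pairing u' w"
  then show "(\<lambda>n. LBINT x. (u x + u' x) * W n x) \<longlonglongrightarrow> (LBINT x. (u x + u' x) * w x)"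
    by (simp add: l2_pairing_add W w tendsto_add)
next
  fix c and u :: "R2 \<Rightarrow> real"
  assume "(\<lambda>n. pairing u (W n)) \<longlonglongrightarrow> pairing u w"
  then show "(\<lambda>n. LBINT x. c * u x * W n x) \<longlonglongrightarrow> (LBINT x. c * u x * w x)"
    by (simp add: mult.assoc tendsto_mult_left)
next
  fix U and u :: "R2 \<Rightarrow> real"
  assume u: "l2 u" and U: "\<And>n. l2 (U n)" "(\<lambda>n. LBINT x. (U n x - u x)\<^sup>2) \<longlonglongrightarrow> 0"
    and conv: "\<And>k. (\<lambda>n. pairing (U k) (W n)) \<longlonglongrightarrow> pairing (U k) w"
  show "(\<lambda>n. pairing u (W n)) \<longlonglongrightarrow> pairing u w"
  proof (rule LIMSEQ_I)
    fix e :: real assume "0 < e"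
    then obtain m where m: "\<And>V. l2 V \<Longrightarrow> sq_int V \<le> max C (sq_int w) \<Longrightarrow>
        \<bar>(LBINT x. u x * V x) - pairing (U m) V\<bar> < e / 3"
      using l2_uniform_approximation[OF u U, of "e / 3" "max C (sq_int w)"] by auto
    obtain N where N: "\<And>n. n \<ge> N \<Longrightarrow> \<bar>(LBINT x. U m x * W n x) - pairing (U m) w\<bar> < e / 3"
      using LIMSEQ_D[OF conv, of "e / 3" m] \<open>0 < e\<close> by auto
    show "\<exists>N. \<forall>n\<ge>N. norm ((LBINT x. u x * W n x) - pairing u w) < e"
    proof (intro exI allI impI)
      fix n assume "N \<le> n"
      have "sq_int (W n) \<le> max C (sq_int w)" using W(2)[of n] by linarith
      from N[OF \<open>N \<le> n\<close>] m[OF W(1) this] m[OF w max.cobounded2]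
      show "norm ((LBINT x. u x * W n x) - pairing u w) < e" unfolding real_norm_def by linarith
    qed
  qed
qed (rule base)

text \<open>An Ascoli argument. Countably many pairs of a smooth box and a rational time are handled
  by diagonal extraction; equicontinuity carries convergence from rational times to all of [0,T],
  and density carries it to every \<phi> in L2. The modulus contains \<open>e n\<close> because the
  densities are equicontinuous only up to an error that vanishes along the sequence, which suffices
  for a Cauchy property.\<close>

lemma L2_time_subsequence:
  fixes r :: "nat \<Rightarrow> real \<Rightarrow> R2 \<Rightarrow> real"
  assumes l2: "\<And>n t. 0 \<le> t \<Longrightarrow> l2 (r n t)"
    and bound: "\<And>n t. 0 \<le> t \<Longrightarrow> (LBINT x. (r n t x)\<^sup>2) \<le> C"
    and e: "e \<longlonglongrightarrow> 0" "\<And>n. 0 \<le> e n"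
    and equi: "\<And>\<phi>. test_function \<phi> \<Longrightarrow> \<exists>B\<ge>0. \<forall>n. \<forall>s\<ge>0. \<forall>t\<ge>0.
      \<bar>(LBINT x. \<phi> x * r n t x) - pairing \<phi> (r n s)\<bar> \<le> B * (\<bar>t - s\<bar> + e n)"
  obtains \<sigma> where "strict_mono (\<sigma> :: nat \<Rightarrow> nat)"
    "\<And>\<phi> T. l2 \<phi> \<Longrightarrow> uniformly_Cauchy_on {0..T} (\<lambda>n t. LBINT x. \<phi> x * r (\<sigma> n) t x)"
proof -
  \<comment> \<open>The index \<open>k\<close> codes a smooth box together with the time p / (q +
    1).\<close>
  define P where "P k s \<longleftrightarrow> (case from_nat k of (m, a1, a2, b1, b2, p, q) \<Rightarrow>
      convergent (\<lambda>n. LBINT x. smooth_box m a1 a2 b1 b2 x * r (s n) (real (p::nat) / real (Suc q)) x))"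
    for k and s :: "nat \<Rightarrow> nat"
  interpret subseqs P
  proof
    fix k and s :: "nat \<Rightarrow> nat"
    obtain m a1 a2 b1 b2 p q where k: "from_nat k = (m :: nat, a1 :: int, a2 :: int, b1 :: int, b2 :: int, p :: nat, q :: nat)"
      by (metis prod_cases7)
    let ?X = "\<lambda>n. LBINT x. smooth_box m a1 a2 b1 b2 x * r (s n) (real p / real (Suc q)) x"
    have "bounded (range ?X)"
    proof (rule boundedI)
      fix y assume "y \<in> range ?X"
      then obtain n where y: "y = ?X n" by auto
      have "norm y \<le> sqrt (LBINT x. (smooth_box m a1 a2 b1 b2 x)\<^sup>2)
          * sqrt (LBINT x. (r (s n) (real p / real (Suc q)) x)\<^sup>2)" unfolding y real_norm_def
        by (intro l2_Cauchy_Schwarz_abs test_function_l2 test_function_smooth_box l2) simp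
      also have "\<dots> \<le> sqrt (LBINT x. (smooth_box m a1 a2 b1 b2 x)\<^sup>2) * sqrt C"
        by (intro mult_left_mono real_sqrt_le_mono bound) auto
      finally show "norm y \<le> sqrt (LBINT x. (smooth_box m a1 a2 b1 b2 x)\<^sup>2) * sqrt C" .
    qed
    from bounded_imp_convergent_subsequence[OF this] obtain l \<tau> where \<tau>: "strict_mono \<tau>" "(?X \<circ> \<tau>) \<longlonglongrightarrow> l" by auto
    then show "\<exists>r'. strict_mono r' \<and> P k (s \<circ> r')"
      by (intro exI[of _ \<tau>]) (auto simp: P_def k o_def convergent_def)
  qed
  define \<sigma> where "\<sigma> = diagseq"
  have \<sigma>: "strict_mono \<sigma>" unfolding \<sigma>_def by (rule subseq_diagseq)
  have conv: "convergent (\<lambda>n. LBINT x. smooth_box m a1 a2 b1 b2 x * r (\<sigma> n) (real p / real (Suc q)) x)"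
    for m a1 a2 b1 b2 p q
  proof -
    define k where "k = to_nat (m, a1, a2, b1, b2, p, q)"
    have "P k (diagseq \<circ> ((+) (Suc k)))"
    proof (rule diagseq_holds)
      show "P j (s \<circ> \<tau>)" if "strict_mono \<tau>" "P j s" for \<tau> s j
      proof -
        obtain m a1 a2 b1 b2 p q where j: "from_nat j = (m :: nat, a1 :: int, a2 :: int, b1 :: int, b2 :: int, p :: nat, q :: nat)"
          by (metis prod_cases7)
        from that have "convergent (\<lambda>n. LBINT x. smooth_box m a1 a2 b1 b2 x * r (s n) (real p / real (Suc q)) x)"
          by (simp add: P_def j)
        from convergent_subseq_convergent[OF this that(1)] show ?thesis by (simp add: P_def j o_def)
      qed
    qed
    then have "convergent (\<lambda>n. LBINT x. smooth_box m a1 a2 b1 b2 x * r (\<sigma> (n + Suc k)) (real p / real (Suc q)) x)"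
      by (simp add: P_def k_def \<sigma>_def o_def add.commute)
    then show ?thesis by (subst (asm) convergent_ignore_initial_segment)
  qed
  have base: "uniformly_Cauchy_on {0..T} (\<lambda>n t. LBINT x. smooth_box m a1 a2 b1 b2 x * r (\<sigma> n) t x)"
    for T m a1 a2 b1 b2
  proof (rule uniformly_Cauchy_onI)
    fix d :: real assume "0 < d"
    let ?X = "\<lambda>n t. LBINT x. smooth_box m a1 a2 b1 b2 x * r (\<sigma> n) t x"
    obtain B where B: "B \<ge> 0" "\<And>n s t. s \<ge> 0 \<Longrightarrow> t \<ge> 0 \<Longrightarrow> \<bar>?X n t - ?X n s\<bar> \<le> B * (\<bar>t - s\<bar> + e (\<sigma> n))"
      using equi[OF test_function_smooth_box[of m a1 a2 b1 b2]] by blast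
    \<comment> \<open>Budget: d/3 for moving to the grid time at index n, d/3 for the same at n',
      and d/3 at the grid time itself. Each move splits into d/6 for the mesh 1 / (q + 1) and d/6
      for the error \<open>e\<close>.\<close>
    have "(\<lambda>q. B * (1 / real (Suc q))) \<longlonglongrightarrow> B * 0"
      by (intro tendsto_intros LIMSEQ_Suc[OF lim_1_over_n])
    then have "\<forall>\<^sub>F q in sequentially. B * (1 / real (Suc q)) < d / 6"
      by (rule order_tendstoD(2)) (use \<open>0 < d\<close> in simp)
    then obtain q where q: "B * (1 / real (Suc q)) < d / 6" unfolding eventually_sequentially by blast
    have "(\<lambda>n. B * e (\<sigma> n)) \<longlonglongrightarrow> B * 0"
      using LIMSEQ_subseq_LIMSEQ[OF e(1) \<sigma>] by (intro tendsto_intros) (simp add: o_def)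
    then have ev: "\<forall>\<^sub>F n in sequentially. B * e (\<sigma> n) < d / 6"
      using order_tendstoD(2)[of _ "B * 0" sequentially "d / 6"] \<open>0 < d\<close> by simp
    \<comment> \<open>Only finitely many grid times are needed for [0,T], so a maximum over them
      gives one index for all t.\<close>
    define p0 where "p0 = nat \<lceil>T * real (Suc q)\<rceil>"
    have "\<exists>N. \<forall>n\<ge>N. \<forall>n'\<ge>N. \<bar>?X n (real p / real (Suc q)) - ?X n' (real p / real (Suc q))\<bar> < d / 3" for p
      using convergent_Cauchy[OF conv[of m a1 a2 b1 b2 p q]] \<open>0 < d\<close>
      unfolding Cauchy_def dist_real_def by (meson divide_pos_pos zero_less_numeral)
    then have "\<forall>p. \<exists>N. \<forall>n\<ge>N. \<forall>n'\<ge>N. \<bar>?X n (real p / real (Suc q)) - ?X n' (real p / real (Suc q))\<bar> < d / 3"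
      by (rule allI)
    from choice[OF this] obtain N where N: "\<And>p n n'. n \<ge> N p \<Longrightarrow> n' \<ge> N p \<Longrightarrow>
        \<bar>?X n (real p / real (Suc q)) - ?X n' (real p / real (Suc q))\<bar> < d / 3" by blast
    from ev obtain N0 where N0: "\<And>n. n \<ge> N0 \<Longrightarrow> B * e (\<sigma> n) < d / 6" by (auto simp: eventually_sequentially)
    define M where "M = max N0 (Max (N ` {..p0}))"
    show "\<exists>M. \<forall>t\<in>{0..T}. \<forall>n\<ge>M. \<forall>n'\<ge>M. dist (?X n t) (?X n' t) < d"
    proof (intro exI[of _ M] ballI allI impI)
      fix t n n' assume t: "t \<in> {0..T}" and n: "M \<le> n" "M \<le> n'"
      define p where "p = nat \<lfloor>t * real (Suc q)\<rfloor>"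
      define s where "s = real p / real (Suc q)"
      have tq: "0 \<le> t * real (Suc q)" using t by simp
      then have p: "real p \<le> t * real (Suc q)" "t * real (Suc q) < real p + 1" unfolding p_def by linarith+
      have "t * real (Suc q) \<le> T * real (Suc q)" using t by (intro mult_right_mono) auto
      then have "p \<le> p0" unfolding p_def p0_def by linarith
      then have "N p \<le> M" unfolding M_def by (intro max.coboundedI2 Max_ge) auto
      have "s \<le> t" "t \<le> s + 1 / real (Suc q)" "s \<ge> 0" using p by (auto simp: s_def field_simps)
      then have ts: "\<bar>t - s\<bar> \<le> 1 / real (Suc q)" "\<bar>s - t\<bar> \<le> 1 / real (Suc q)" by auto
      have near: "\<bar>?X i t - ?X i s\<bar> < d / 3" if "i \<ge> M" for i
      proof -
        have "\<bar>?X i t - ?X i s\<bar> \<le> B * (\<bar>t - s\<bar> + e (\<sigma> i))" using B(2)[of s t i] \<open>s \<ge> 0\<close> t by simp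
        also have "\<dots> \<le> B * (1 / real (Suc q)) + B * e (\<sigma> i)"
          using mult_left_mono[OF ts(1) B(1)] by (simp add: distrib_left)
        also have "\<dots> < d / 3" using q N0[of i] that unfolding M_def by linarith
        finally show ?thesis .
      qed
      have "\<bar>?X n s - ?X n' s\<bar> < d / 3" unfolding s_def using N[of p n n'] \<open>N p \<le> M\<close> n by linarith
      with near[OF n(1)] near[OF n(2)] show "dist (?X n t) (?X n' t) < d" unfolding dist_real_def by linarith
    qed
  qed
  show thesis
  proof (rule that[OF \<sigma>])
    fix \<phi> :: "R2 \<Rightarrow> real" and T assume "l2 \<phi>"
    then show "uniformly_Cauchy_on {0..T} (\<lambda>n t. LBINT x. \<phi> x * r (\<sigma> n) t x)"
    proof (rule l2_density[where P = "\<lambda>\<phi>. uniformly_Cauchy_on {0..T} (\<lambda>n t. LBINT x. \<phi> x * r (\<sigma> n) t x)"])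
      fix u w :: "R2 \<Rightarrow> real"
      assume l: "l2 u" "l2 w" and
        uc: "uniformly_Cauchy_on {0..T} (\<lambda>n t. LBINT x. u x * r (\<sigma> n) t x)" and
        wc: "uniformly_Cauchy_on {0..T} (\<lambda>n t. LBINT x. w x * r (\<sigma> n) t x)"
      show "uniformly_Cauchy_on {0..T} (\<lambda>n t. LBINT x. (u x + w x) * r (\<sigma> n) t x)"
      proof (rule uniformly_Cauchy_onI)
        fix d :: real assume d: "0 < d"
        obtain N1 where N1: "\<forall>t\<in>{0..T}. \<forall>m\<ge>N1. \<forall>n\<ge>N1. dist (pairing u (r (\<sigma> m) t)) (LBINT x. u x * r (\<sigma> n) t x) < d / 2"
          using uc d unfolding uniformly_Cauchy_on_def by (meson half_gt_zero)
        obtain N2 where N2: "\<forall>t\<in>{0..T}. \<forall>m\<ge>N2. \<forall>n\<ge>N2. dist (pairing w (r (\<sigma> m) t)) (LBINT x. w x * r (\<sigma> n) t x) < d / 2"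
          using wc d unfolding uniformly_Cauchy_on_def by (meson half_gt_zero)
        show "\<exists>M. \<forall>t\<in>{0..T}. \<forall>m\<ge>M. \<forall>n\<ge>M. dist (LBINT x. (u x + w x) * r (\<sigma> m) t x) (LBINT x. (u x + w x) * r (\<sigma> n) t x) < d"
        proof (intro exI[of _ "max N1 N2"] ballI allI impI)
          fix t m n assume t: "t \<in> {0..T}" and "max N1 N2 \<le> m" "max N1 N2 \<le> n"
          then have "dist (pairing u (r (\<sigma> m) t)) (LBINT x. u x * r (\<sigma> n) t x) < d / 2"
            "dist (pairing w (r (\<sigma> m) t)) (LBINT x. w x * r (\<sigma> n) t x) < d / 2" using N1 N2 by auto
          moreover have "0 \<le> t" using t by simp
          ultimately show "dist (LBINT x. (u x + w x) * r (\<sigma> m) t x) (LBINT x. (u x + w x) * r (\<sigma> n) t x) < d"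
            unfolding dist_real_def l2_pairing_add[OF l l2[OF \<open>0 \<le> t\<close>]] by linarith
        qed
      qed
    next
      fix c and u :: "R2 \<Rightarrow> real"
      assume uc: "uniformly_Cauchy_on {0..T} (\<lambda>n t. LBINT x. u x * r (\<sigma> n) t x)"
      show "uniformly_Cauchy_on {0..T} (\<lambda>n t. LBINT x. c * u x * r (\<sigma> n) t x)"
      proof (rule uniformly_Cauchy_onI)
        fix d :: real assume d: "0 < d"
        have pos: "0 < d / (\<bar>c\<bar> + 1)" using d by simp
        obtain N1 where N1: "\<forall>t\<in>{0..T}. \<forall>m\<ge>N1. \<forall>n\<ge>N1. dist (pairing u (r (\<sigma> m) t)) (LBINT x. u x * r (\<sigma> n) t x) < d / (\<bar>c\<bar> + 1)"
          using uc pos unfolding uniformly_Cauchy_on_def by meson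
        show "\<exists>M. \<forall>t\<in>{0..T}. \<forall>m\<ge>M. \<forall>n\<ge>M. dist (LBINT x. c * u x * r (\<sigma> m) t x) (LBINT x. c * u x * r (\<sigma> n) t x) < d"
        proof (intro exI[of _ N1] ballI allI impI)
          fix t m n assume "t \<in> {0..T}" "N1 \<le> m" "N1 \<le> n"
          then have le: "\<bar>(LBINT x. u x * r (\<sigma> m) t x) - pairing u (r (\<sigma> n) t)\<bar> < d / (\<bar>c\<bar> + 1)"
            using N1 by (auto simp: dist_real_def)
          have "\<bar>c\<bar> * \<bar>(LBINT x. u x * r (\<sigma> m) t x) - pairing u (r (\<sigma> n) t)\<bar> \<le> \<bar>c\<bar> * (d / (\<bar>c\<bar> + 1))"
            using le by (intro mult_left_mono) auto
          also have "\<dots> < d" using d by (simp add: field_simps)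
          finally show "dist (LBINT x. c * u x * r (\<sigma> m) t x) (LBINT x. c * u x * r (\<sigma> n) t x) < d"
            by (simp add: mult.assoc dist_real_def flip: right_diff_distrib abs_mult)
        qed
      qed
    next
      fix U and u :: "R2 \<Rightarrow> real"
      assume u: "l2 u" and U: "\<And>n. l2 (U n)" "(\<lambda>n. LBINT x. (U n x - u x)\<^sup>2) \<longlonglongrightarrow> 0"
        and cau: "\<And>k. uniformly_Cauchy_on {0..T} (\<lambda>n t. LBINT x. U k x * r (\<sigma> n) t x)"
      show "uniformly_Cauchy_on {0..T} (\<lambda>n t. LBINT x. u x * r (\<sigma> n) t x)"
      proof (rule uniformly_Cauchy_onI)
        fix d :: real assume d: "0 < d"
        then obtain k where k: "\<And>V. l2 V \<Longrightarrow> sq_int V \<le> C \<Longrightarrow>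
            \<bar>(LBINT x. u x * V x) - pairing (U k) V\<bar> < d / 3"
          using l2_uniform_approximation[OF u U, of "d / 3" C] by auto
        obtain N where N: "\<forall>t\<in>{0..T}. \<forall>m\<ge>N. \<forall>n\<ge>N. dist (pairing (U k) (r (\<sigma> m) t)) (LBINT x. U k x * r (\<sigma> n) t x) < d / 3"
          using cau[of k] d unfolding uniformly_Cauchy_on_def by (meson divide_pos_pos zero_less_numeral)
        show "\<exists>M. \<forall>t\<in>{0..T}. \<forall>m\<ge>M. \<forall>n\<ge>M. dist (pairing u (r (\<sigma> m) t)) (LBINT x. u x * r (\<sigma> n) t x) < d"
        proof (intro exI[of _ N] ballI allI impI)
          fix t m n assume t: "t \<in> {0..T}" and "N \<le> m" "N \<le> n"
          then have "\<bar>(LBINT x. U k x * r (\<sigma> m) t x) - pairing (U k) (r (\<sigma> n) t)\<bar> < d / 3"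
            using N by (auto simp: dist_real_def)
          moreover have "0 \<le> t" using t by simp
          note k[OF l2[OF this] bound[OF this]]
          from this[of "\<sigma> m"] this[of "\<sigma> n"]
          have "\<bar>(LBINT x. u x * r (\<sigma> m) t x) - pairing (U k) (r (\<sigma> m) t)\<bar> < d / 3"
            "\<bar>(LBINT x. u x * r (\<sigma> n) t x) - pairing (U k) (r (\<sigma> n) t)\<bar> < d / 3" .
          ultimately show "dist (pairing u (r (\<sigma> m) t)) (LBINT x. u x * r (\<sigma> n) t x) < d"
            unfolding dist_real_def by linarith
        qed
      qed
    qed (rule base)
  qed
qed

section \<open>Weak limits that depend measurably on time\<close>

lemma l2_Fatou:
  fixes u :: "'a::euclidean_space \<Rightarrow> real"
  assumes "borel_fun u" "\<And>n. l2 (U n)" "AE x in lborel. (\<lambda>n. U n x) \<longlonglongrightarrow> u x"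
    "\<And>n. sq_int (U n) \<le> C"
  shows "l2 u" "sq_int u \<le> C"
proof -
  have [measurable]: "borel_fun u" "\<And>n. borel_fun (U n)" using assms by (auto simp: l2_def)
  have C: "0 \<le> C" using order_trans[OF integral_nonneg_AE assms(4)[of 0]] by simp
  have "(\<integral>\<^sup>+x. ennreal ((u x)\<^sup>2) \<partial>lborel) = (\<integral>\<^sup>+x. liminf (\<lambda>n. ennreal ((U n x)\<^sup>2)) \<partial>lborel)"
  proof (rule nn_integral_cong_AE)
    show "AE x in lborel. ennreal ((u x)\<^sup>2) = liminf (\<lambda>n. ennreal ((U n x)\<^sup>2))" using assms(3)
    proof eventually_elim
      case (elim x)
      have "(\<lambda>n. ennreal ((U n x)\<^sup>2)) \<longlonglongrightarrow> ennreal ((u x)\<^sup>2)"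
        by (intro tendsto_ennrealI tendsto_power elim)
      from lim_imp_Liminf[OF _ this] show ?case by simp
    qed
  qed
  also have "\<dots> \<le> liminf (\<lambda>n. \<integral>\<^sup>+x. ennreal ((U n x)\<^sup>2) \<partial>lborel)"
    by (rule nn_integral_liminf) measurable
  also have "\<dots> \<le> ennreal C"
  proof (rule Liminf_le)
    have "(\<integral>\<^sup>+x. ennreal ((U n x)\<^sup>2) \<partial>lborel) \<le> ennreal C" for n
      using assms(4)[of n] l2_integrable[OF assms(2)[of n]]
      by (subst nn_integral_eq_integral) (auto intro: ennreal_leI)
    then show "\<forall>\<^sub>F n in sequentially. (\<integral>\<^sup>+x. ennreal ((U n x)\<^sup>2) \<partial>lborel) \<le> ennreal C" by simp
  qed simp
  finally have nn: "(\<integral>\<^sup>+x. ennreal ((u x)\<^sup>2) \<partial>lborel) \<le> ennreal C" .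
  then have int: "integrable lborel (\<lambda>x. (u x)\<^sup>2)"
    by (intro integrableI_nonneg) (auto simp: less_top[symmetric] top_unique intro: le_less_trans)
  then show "l2 u" by (simp add: l2_def)
  show "sq_int u \<le> C" using nn C by (subst (asm) nn_integral_eq_integral[OF int]) auto
qed

text \<open>Completeness of \<open>L\<^sup>2\<close> with a limit that is jointly measurable in a parameter: the subsequence
  which converges almost everywhere is chosen measurably in the parameter.\<close>

lemma l2_complete_measurable:
  fixes g :: "nat \<Rightarrow> real \<Rightarrow> 'a::euclidean_space \<Rightarrow> real"
  assumes [measurable]: "\<And>k. case_prod (g k) \<in> borel_measurable borel"
    and l2: "\<And>k t. l2 (g k t)"
    and Cauchy: "\<And>t e. 0 < e \<Longrightarrow> \<exists>K. \<forall>k\<ge>K. \<forall>l\<ge>K. (LBINT x. (g k t x - g l t x)\<^sup>2) \<le> e"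
  obtains \<rho> where "borel_fun (case_prod \<rho>)" "\<And>t. l2 (\<rho> t)"
    "\<And>t. (\<lambda>k. LBINT x. (g k t x - \<rho> t x)\<^sup>2) \<longlonglongrightarrow> 0"
proof -
  have gm [measurable]: "case_prod (g k) \<in> borel_measurable borel2" for k using assms(1) by (simp add: borel_prod)
  have gt [measurable]: "g k t \<in> borel_measurable borel" for k t using l2 by (simp add: l2_def)
  define d where "d k l t = (LBINT x. (g k t x - g l t x)\<^sup>2)" for k l t
  have [measurable]: "d k l \<in> borel_measurable borel" for k l unfolding d_def[abs_def] by measurable
  define Q where "Q j t K \<longleftrightarrow> (\<forall>k\<ge>K. \<forall>l\<ge>K. d k l t \<le> (1/8) ^ j)" for j t and K :: nat
  \<comment> \<open>The least admissible index depends measurably on t, since \<open>Q\<close> is a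
    countable conjunction of measurable conditions.\<close>
  define \<kappa> where "\<kappa> j t = (LEAST K. Q j t K)" for j t
  have Q: "Q j t (\<kappa> j t)" for j t
    unfolding \<kappa>_def by (rule LeastI_ex) (use Cauchy[of "(1/8) ^ j" t] in \<open>auto simp: Q_def d_def\<close>)
  have \<kappa>_mono: "\<kappa> i t \<le> \<kappa> j t" if "i \<le> j" for i j t
  proof -
    have "Q i t (\<kappa> j t)"
      using Q[of j t] power_decreasing[OF that, of "1/8::real"] unfolding Q_def by (meson order_trans le_numeral_extra zero_le_divide_1_iff zero_le_numeral divide_le_eq_1_pos zero_less_numeral one_le_numeral)
    then show ?thesis unfolding \<kappa>_def[of i] by (rule Least_le)
  qed
  have [measurable]: "\<kappa> j \<in> borel \<rightarrow>\<^sub>M count_space UNIV" for j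
    unfolding \<kappa>_def[abs_def] Q_def by measurable
  define h where "h j t x = g (\<kappa> j t) t x" for j t x
  have hm [measurable]: "(\<lambda>p. h j (fst p) (snd p)) \<in> borel_measurable borel2" for j unfolding h_def
    by (rule measurable_compose_countable[where f = "\<lambda>k p. g k (fst p) (snd p)" and g = "\<lambda>p. \<kappa> j (fst p)"])
      (use gm in \<open>simp_all add: case_prod_beta'\<close>)
  \<comment> \<open>\<open>lim\<close> yields a jointly measurable function on the whole space; for
    each t it is shown to be the true limit at almost every x.\<close>
  define \<rho> where "\<rho> t x = lim (\<lambda>j. h j t x)" for t x
  have \<rho>m: "(\<lambda>p. \<rho> (fst p) (snd p)) \<in> borel_measurable borel2"
    unfolding \<rho>_def by measurable
  have \<rho>t: "borel_fun (\<rho> t)" for t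
    using measurable_compose[OF measurable_Pair1', OF _ \<rho>m, of t] by simp
  have step: "(LBINT x. (h (Suc j) t x - h j t x)\<^sup>2) \<le> (1/8) ^ j" for j t
    using Q[of j t] \<kappa>_mono[of j "Suc j" t] by (auto simp: Q_def d_def h_def)
  have l2h: "l2 (h j t)" for j t using l2[of "\<kappa> j t" t] by (simp add: h_def[abs_def])
  have ht [measurable]: "h j t \<in> borel_measurable borel" for j t using l2h by (simp add: l2_def)
  have conv: "AE x in lborel. (\<lambda>j. h j t x) \<longlonglongrightarrow> \<rho> t x" for t
  proof -
    \<comment> \<open>The squared L2 distances are at most 8^(-j), so the weights 4^j still leave a
      convergent series. Its terms tend to 0 almost everywhere, hence the increments of
      \<open>h\<close> are eventually below 2^(-j) and \<open>h j\<close> converges.\<close>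
    let ?f = "\<lambda>j x. 4 ^ j * (h (Suc j) t x - h j t x)\<^sup>2"
    have "(\<integral>\<^sup>+x. (\<Sum>j. ennreal (?f j x)) \<partial>lborel) = (\<Sum>j. \<integral>\<^sup>+x. ennreal (?f j x) \<partial>lborel)"
      by (rule nn_integral_suminf) measurable
    also have "\<dots> \<le> (\<Sum>j. ennreal ((1/2) ^ j))"
    proof (rule suminf_le)
      fix j
      have int: "integrable lborel (?f j)" using l2_integrable[OF l2_diff[OF l2h l2h]] by simp
      have "(\<integral>\<^sup>+x. ennreal (?f j x) \<partial>lborel) = ennreal (4 ^ j * (LBINT x. (h (Suc j) t x - h j t x)\<^sup>2))"
        using nn_integral_eq_integral[OF int] by simp
      also have "\<dots> \<le> ennreal (4 ^ j * (1/8) ^ j)" by (intro ennreal_leI mult_left_mono step) simp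
      also have "4 ^ j * (1/8) ^ j = ((1/2) ^ j :: real)" by (simp flip: power_mult_distrib)
      finally show "(\<integral>\<^sup>+x. ennreal (?f j x) \<partial>lborel) \<le> ennreal ((1/2) ^ j)" .
    qed auto
    also have "\<dots> < \<infinity>"
      by (subst suminf_ennreal2) (simp_all add: summable_geometric less_top[symmetric])
    finally have "AE x in lborel. (\<Sum>j. ennreal (?f j x)) \<noteq> \<infinity>"
      by (intro nn_integral_noteq_infinite) (auto simp: less_top)
    then show ?thesis
    proof eventually_elim
      case (elim x)
      then have "summable (\<lambda>j. ?f j x)" by (intro summable_suminf_not_top) auto
      then have "(\<lambda>j. ?f j x) \<longlonglongrightarrow> 0" by (rule summable_LIMSEQ_zero)
      then have ev: "\<forall>\<^sub>F j in sequentially. ?f j x < 1" by (rule order_tendstoD) simp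
      have "summable (\<lambda>j. h (Suc j) t x - h j t x)"
      proof (rule summable_comparison_test_ev)
        show "\<forall>\<^sub>F j in sequentially. norm (h (Suc j) t x - h j t x) \<le> (1/2) ^ j" using ev
        proof eventually_elim
          case (elim j)
          have "(2 ^ j)\<^sup>2 = (4 ^ j :: real)" by (simp add: power2_eq_square flip: power_mult_distrib)
          with elim have "(2 ^ j * (h (Suc j) t x - h j t x))\<^sup>2 \<le> 1" by (simp only: power_mult_distrib)
          then have "\<bar>2 ^ j * (h (Suc j) t x - h j t x)\<bar> \<le> 1" by (rule abs_square_le_1[THEN iffD1])
          then have "2 ^ j * \<bar>h (Suc j) t x - h j t x\<bar> \<le> 1" by (simp only: abs_mult power_abs abs_numeral)
          then show ?case by (simp add: power_one_over pos_le_divide_eq mult.commute)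
        qed
      qed (simp add: summable_geometric)
      then have "convergent (\<lambda>j. \<Sum>i<j. h (Suc i) t x - h i t x)" by (simp add: summable_iff_convergent)
      then have "convergent (\<lambda>j. h j t x - h 0 t x)" using sum_lessThan_telescope[of "\<lambda>j. h j t x"] by simp
      then have "convergent (\<lambda>j. (h j t x - h 0 t x) + h 0 t x)" by (intro convergent_add convergent_const)
      then show "(\<lambda>j. h j t x) \<longlonglongrightarrow> \<rho> t x" by (simp add: \<rho>_def convergent_LIMSEQ_iff)
    qed
  qed
  \<comment> \<open>Fatou turns the Cauchy bound into a bound on the distance to the limit.\<close>
  have fat: "l2 (\<lambda>x. g k t x - \<rho> t x) \<and> (LBINT x. (g k t x - \<rho> t x)\<^sup>2) \<le> (1/8) ^ j" if "k \<ge> \<kappa> j t" for k j t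
  proof -
    have ae: "AE x in lborel. (\<lambda>i. g k t x - h (i + j) t x) \<longlonglongrightarrow> g k t x - \<rho> t x"
      using conv[of t]
    proof eventually_elim
      case (elim x)
      show ?case by (intro tendsto_diff tendsto_const LIMSEQ_ignore_initial_segment[OF elim])
    qed
    have "(LBINT x. (g k t x - h (i + j) t x)\<^sup>2) \<le> (1/8) ^ j" for i
      using Q[of j t] that \<kappa>_mono[of j "i + j" t] by (auto simp: Q_def d_def h_def)
    moreover have "borel_fun (\<lambda>x. g k t x - \<rho> t x)" using gt \<rho>t by (rule borel_measurable_diff)
    ultimately show ?thesis using l2_Fatou[OF _ l2_diff[OF l2 l2h] ae] by blast
  qed
  show thesis
  proof (rule that[of \<rho>])
    show "borel_fun (case_prod \<rho>)" using \<rho>m by (simp add: borel_prod case_prod_beta')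
    show "l2 (\<rho> t)" for t
      using l2_diff[OF l2[of "\<kappa> 0 t" t] conjunct1[OF fat[OF order_refl[of "\<kappa> 0 t"]]]] by simp
    show "(\<lambda>k. LBINT x. (g k t x - \<rho> t x)\<^sup>2) \<longlonglongrightarrow> 0" for t
    proof (rule LIMSEQ_I)
      fix e :: real assume "0 < e"
      then obtain j where j: "(1/8) ^ j < e" using real_arch_pow_inv[of e "1/8"] by auto
      show "\<exists>K. \<forall>k\<ge>K. norm ((LBINT x. (g k t x - \<rho> t x)\<^sup>2) - 0) < e"
        using fat[of j t] j by (intro exI[of _ "\<kappa> j t"]) fastforce
    qed
  qed
qed

text \<open>The kernel of averaging over the dyadic square of side 2^(-k) that contains
  \<open>x\<close>, that is, of conditional expectation onto the grid of level \<open>k\<close>; 4^k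
  is the reciprocal of the area.\<close>

definition dyadic_kernel :: "nat \<Rightarrow> R2 \<Rightarrow> R2 \<Rightarrow> real" where
  "dyadic_kernel k x y =
     (if \<lfloor>2 ^ k * x $ 1\<rfloor> = \<lfloor>2 ^ k * y $ 1\<rfloor> \<and> \<lfloor>2 ^ k * x $ 2\<rfloor> = \<lfloor>2 ^ k * y $ 2\<rfloor> then 4 ^ k else 0)"

lemma borel_measurable_vec_nth [measurable (raw)]:
  "f \<in> borel_measurable M \<Longrightarrow> (\<lambda>x. (f x :: R2) $ i) \<in> borel_measurable M"
  by (rule borel_measurable_continuous_on[where f = "\<lambda>x. x $ i"]) (intro continuous_intros)

lemma dyadic_kernel_measurable [measurable]:
  "case_prod (dyadic_kernel k) \<in> borel_measurable borel2"
proof -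
  have "case_prod (dyadic_kernel k) = (\<lambda>p. if real_of_int \<lfloor>2 ^ k * fst p $ 1\<rfloor> = real_of_int \<lfloor>2 ^ k * snd p $ 1\<rfloor>
      \<and> real_of_int \<lfloor>2 ^ k * fst p $ 2\<rfloor> = real_of_int \<lfloor>2 ^ k * snd p $ 2\<rfloor> then 4 ^ k else 0)"
    by (auto simp: dyadic_kernel_def fun_eq_iff)
  also have "\<dots> \<in> borel_measurable borel2"
  proof -
    have [measurable]: "Measurable.pred borel2
        (\<lambda>p :: R2 \<times> R2. real_of_int \<lfloor>2 ^ k * fst p $ i\<rfloor> = real_of_int \<lfloor>2 ^ k * snd p $ i\<rfloor>)" for i
      unfolding pred_def by (rule borel_measurable_eq) measurable
    show ?thesis by measurable
  qed
  finally show ?thesis .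
qed

lemma dyadic_kernel_sym: "dyadic_kernel k x y = dyadic_kernel k y x" by (auto simp: dyadic_kernel_def)

lemma dyadic_kernel_bounds: "0 \<le> dyadic_kernel k x y" "dyadic_kernel k x y \<le> 4 ^ k"
  by (auto simp: dyadic_kernel_def)

lemma dyadic_kernel_borel [measurable]: "dyadic_kernel k x \<in> borel_measurable borel"
  using measurable_compose[OF measurable_Pair1' dyadic_kernel_measurable, of x k] by simp

lemma dyadic_kernel_support:
  assumes "dyadic_kernel k x y \<noteq> 0"
  shows "norm (x - y) \<le> 2 / 2 ^ k"
proof -
  have "\<bar>a - b\<bar> \<le> 1 / 2 ^ k" if "\<lfloor>2 ^ k * a\<rfloor> = \<lfloor>2 ^ k * b\<rfloor>" for a b :: real
  proof -
    have "\<bar>2 ^ k * a - 2 ^ k * b\<bar> \<le> 1" using that by linarith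
    then have "2 ^ k * \<bar>a - b\<bar> \<le> 1" by (simp add: abs_mult flip: right_diff_distrib)
    then show ?thesis by (simp add: field_simps)
  qed
  with assms have "\<bar>x $ 1 - y $ 1\<bar> \<le> 1 / 2 ^ k" "\<bar>x $ 2 - y $ 2\<bar> \<le> 1 / 2 ^ k"
    by (auto simp: dyadic_kernel_def split: if_splits)
  moreover have "norm (x - y) \<le> \<bar>x $ 1 - y $ 1\<bar> + \<bar>x $ 2 - y $ 2\<bar>"
    using norm_le_l1_cart[of "x - y"] by (simp add: UNIV_2)
  ultimately show ?thesis by simp
qed

lemma dyadic_kernel_support': "norm y \<ge> norm x + 3 \<Longrightarrow> dyadic_kernel k x y = 0"
proof (rule ccontr)
  assume y: "norm y \<ge> norm x + 3" and "dyadic_kernel k x y \<noteq> 0"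
  from dyadic_kernel_support[OF this(2)] have "norm (x - y) \<le> 2 / 2 ^ k" .
  also have "2 / 2 ^ k \<le> (2::real)" by (simp add: field_simps)
  finally show False using y norm_triangle_ineq2[of y x] by (simp add: norm_minus_commute)
qed

lemma l2_dyadic_kernel: "l2 (dyadic_kernel k x)" by (rule l2_bounded_support[where B = "4 ^ k" and R = "norm x + 3"])
    (use dyadic_kernel_bounds[of k x] in \<open>auto simp: dyadic_kernel_support'\<close>)

lemma integrable_dyadic_kernel: "integrable lborel (dyadic_kernel k x)"
  by (rule integrable_bounded_support[where B = "4 ^ k" and R = "norm x + 3"])
    (use dyadic_kernel_bounds[of k x] in \<open>auto simp: dyadic_kernel_support'\<close>)

text \<open>The half-open square lies between an open and a closed box of equal area 1 / 4^k, which
  cancels the height of the kernel.\<close>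

lemma integral_dyadic_kernel: "(LBINT y. dyadic_kernel k x y) = 1"
proof -
  define a b :: R2 where "a = vector [of_int \<lfloor>2 ^ k * x $ 1\<rfloor> / 2 ^ k, of_int \<lfloor>2 ^ k * x $ 2\<rfloor> / 2 ^ k]"
    and "b = vector [(of_int \<lfloor>2 ^ k * x $ 1\<rfloor> + 1) / 2 ^ k, (of_int \<lfloor>2 ^ k * x $ 2\<rfloor> + 1) / 2 ^ k]"
  define S where "S = {y. dyadic_kernel k x y \<noteq> 0}"
  have fl: "\<lfloor>2 ^ k * c\<rfloor> = n \<longleftrightarrow> of_int n / 2 ^ k \<le> c \<and> c < (of_int n + 1) / 2 ^ k" for c :: real and n
    by (simp add: floor_eq_iff field_simps)
  have S: "S = {y. a $ 1 \<le> y $ 1 \<and> y $ 1 < b $ 1 \<and> a $ 2 \<le> y $ 2 \<and> y $ 2 < b $ 2}"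
  proof -
    have "dyadic_kernel k x y \<noteq> 0 \<longleftrightarrow> \<lfloor>2 ^ k * y $ 1\<rfloor> = \<lfloor>2 ^ k * x $ 1\<rfloor> \<and> \<lfloor>2 ^ k * y $ 2\<rfloor> = \<lfloor>2 ^ k * x $ 2\<rfloor>" for y
      by (auto simp: dyadic_kernel_def)
    then show ?thesis unfolding S_def fl a_def b_def by simp
  qed
  have Sb: "S \<in> sets borel" unfolding S_def by measurable
  have sub: "box a b \<subseteq> S" "S \<subseteq> cbox a b" by (auto simp: S mem_box_R2 mem_box_cart forall_2)
  have ab: "a $ i \<le> b $ i" for i using exhaust_2[of i] by (auto simp: a_def b_def divide_right_mono)
  have "cbox a b \<noteq> {}" using ab by (auto simp: interval_ne_empty_cart)
  then have "measure lborel (cbox a b) = (b $ 1 - a $ 1) * (b $ 2 - a $ 2)" by (simp add: content_cbox_cart UNIV_2)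
  also have "\<dots> = 1 / 4 ^ k" 
  proof -
    have "b $ 1 - a $ 1 = 1 / 2 ^ k" "b $ 2 - a $ 2 = 1 / 2 ^ k" by (simp_all add: a_def b_def add_divide_distrib)
    moreover have "(2::real) ^ k * 2 ^ k = 4 ^ k" by (simp flip: power_mult_distrib)
    ultimately show ?thesis by simp
  qed
  finally have c: "measure lborel (cbox a b) = 1 / 4 ^ k" .
  then have o: "measure lborel (box a b) = 1 / 4 ^ k" by (simp only: measure_lborel_box_eq measure_lborel_cbox_eq)
  have "S \<in> fmeasurable lborel" by (rule fmeasurableI2[OF fmeasurable_cbox sub(2)]) (use Sb in simp)
  then have "measure lborel S = 1 / 4 ^ k"
    using measure_mono_fmeasurable[OF sub(1), of lborel] measure_mono_fmeasurable[OF sub(2), of lborel]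
      Sb c o fmeasurable_cbox[of a b] by (intro antisym) simp_all
  moreover have "(LBINT y. dyadic_kernel k x y) = (LBINT y. 4 ^ k * indicator S y)"
    by (intro Bochner_Integration.integral_cong) (auto simp: S_def indicator_def dyadic_kernel_def)
  ultimately show ?thesis using Sb by simp
qed

definition dyadic_average :: "nat \<Rightarrow> (R2 \<Rightarrow> real) \<Rightarrow> R2 \<Rightarrow> real" where
  "dyadic_average k u x = pairing (dyadic_kernel k x) u"

lemma dyadic_average_measurable_param:
  assumes [measurable]: "case_prod u \<in> borel_measurable (M \<Otimes>\<^sub>M borel)"
  shows "(\<lambda>p. dyadic_average k (u (fst p)) (snd p)) \<in> borel_measurable (M \<Otimes>\<^sub>M borel)"
proof -
  have "(\<lambda>(p, y). dyadic_kernel k (snd p) y * u (fst p) y) \<in> borel_measurable ((M \<Otimes>\<^sub>M borel) \<Otimes>\<^sub>M lborel)"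
    by measurable
  from sigma_finite_measure.borel_measurable_lebesgue_integral[OF sigma_finite_lborel this]
  show ?thesis by (simp add: dyadic_average_def)
qed

lemma dyadic_average_borel [measurable]:
  assumes [measurable]: "borel_fun u"
  shows "dyadic_average k u \<in> borel_measurable borel"
proof -
  have "(\<lambda>(x, y). dyadic_kernel k x y * u y) \<in> borel_measurable (borel \<Otimes>\<^sub>M lborel)" by measurable
  from sigma_finite_measure.borel_measurable_lebesgue_integral[OF sigma_finite_lborel this]
  show ?thesis by (simp add: dyadic_average_def[abs_def])
qed

lemma integrable_dyadic_kernel_square:
  assumes "l2 u"
  shows "integrable lborel2 (\<lambda>(x, y). dyadic_kernel k x y * (u x)\<^sup>2)"
    "integrable lborel2 (\<lambda>(x, y). dyadic_kernel k x y * (u y)\<^sup>2)"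
proof -
  have [measurable]: "borel_fun u" using assms by (simp add: l2_def)
  show *: "integrable lborel2 (\<lambda>(x, y). dyadic_kernel k x y * (u x)\<^sup>2)"
  proof (rule lborel_pair.Fubini_integrable)
    show "integrable lborel (\<lambda>x. LBINT y. norm (case (x, y) of (x, y) \<Rightarrow> dyadic_kernel k x y * (u x)\<^sup>2))"
      using l2_integrable[OF assms] integral_dyadic_kernel dyadic_kernel_bounds by (simp add: abs_mult)
    show "AE x in lborel. integrable lborel (\<lambda>y. case (x, y) of (x, y) \<Rightarrow> dyadic_kernel k x y * (u x)\<^sup>2)"
      using integrable_dyadic_kernel by simp
  qed measurable
  from lborel_pair.integrable_product_swap[OF this]
  show "integrable lborel2 (\<lambda>(x, y). dyadic_kernel k x y * (u y)\<^sup>2)"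
    by (simp add: case_prod_beta' dyadic_kernel_sym)
qed

text \<open>Jensen's inequality for the probability density \<open>dyadic_kernel k x\<close>,
  obtained from Cauchy-Schwarz after writing the kernel as a product of two square roots. Fubini and
  the symmetry of the kernel then give the contraction.\<close>

lemma l2_dyadic_average:
  assumes "l2 u"
  shows "l2 (dyadic_average k u)" "(LBINT x. (dyadic_average k u x)\<^sup>2) \<le> sq_int u"
proof -
  have [measurable]: "borel_fun u" using assms by (simp add: l2_def)
  note int = integrable_dyadic_kernel_square(2)[OF assms, of k]
  have ae: "AE x in lborel. integrable lborel (\<lambda>y. dyadic_kernel k x y * (u y)\<^sup>2)"
    using lborel_pair.AE_integrable_fst'[OF int] by simp
  have int': "integrable lborel (\<lambda>x. LBINT y. dyadic_kernel k x y * (u y)\<^sup>2)"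
    using lborel_pair.integrable_fst'[OF int] by simp
  have le: "AE x in lborel. (dyadic_average k u x)\<^sup>2 \<le> (LBINT y. dyadic_kernel k x y * (u y)\<^sup>2)"
    using ae
  proof eventually_elim
    case (elim x)
    let ?s = "\<lambda>y. sqrt (dyadic_kernel k x y)"
    have sq: "(?s y)\<^sup>2 = dyadic_kernel k x y" for y using dyadic_kernel_bounds(1) by simp
    have "(LBINT y. ?s y * (?s y * u y))\<^sup>2
        \<le> sq_int ?s * (LBINT y. (?s y * u y)\<^sup>2)"
    proof (rule l2_Cauchy_Schwarz)
      show "l2 ?s" using integrable_dyadic_kernel sq by (simp add: l2_def)
      show "l2 (\<lambda>y. ?s y * u y)" using elim sq by (simp add: l2_def power_mult_distrib)
    qed
    then show ?case
      by (simp add: sq power_mult_distrib integral_dyadic_kernel dyadic_average_def flip: mult.assoc power2_eq_square)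
  qed
  have m: "dyadic_average k u \<in> borel_measurable borel" by measurable
  have i2: "integrable lborel (\<lambda>x. (dyadic_average k u x)\<^sup>2)"
    by (rule dominated_integrable[OF int']) (use le m in \<open>auto elim: eventually_mono\<close>)
  then show "l2 (dyadic_average k u)" using m by (simp add: l2_def)
  have "(LBINT x. (dyadic_average k u x)\<^sup>2) \<le> (LBINT x. LBINT y. dyadic_kernel k x y * (u y)\<^sup>2)"
    by (rule integral_mono_AE[OF i2 int' le])
  also have "\<dots> = (LBINT y. LBINT x. dyadic_kernel k x y * (u y)\<^sup>2)"
    using lborel_pair.Fubini_integral[OF int] by simp
  also have "\<dots> = sq_int u" by (subst dyadic_kernel_sym) (simp add: integral_dyadic_kernel)
  finally show "(LBINT x. (dyadic_average k u x)\<^sup>2) \<le> sq_int u" .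
qed

text \<open>Fubini with a symmetric kernel; |a b| \<le> a^2 + b^2 supplies the integrable
  majorant.\<close>

lemma dyadic_average_selfadjoint:
  assumes "l2 u" "l2 w"
  shows "pairing (dyadic_average k u) w = pairing u (dyadic_average k w)"
proof -
  have [measurable]: "borel_fun u" "borel_fun w" using assms by (auto simp: l2_def)
  have int: "integrable lborel2 (\<lambda>(x, y). dyadic_kernel k x y * u y * w x)"
  proof (rule dominated_integrable)
    show "integrable lborel2 (\<lambda>p. (case p of (x, y) \<Rightarrow> dyadic_kernel k x y * (u y)\<^sup>2)
        + (case p of (x, y) \<Rightarrow> dyadic_kernel k x y * (w x)\<^sup>2))"
      by (intro Bochner_Integration.integrable_add integrable_dyadic_kernel_square assms)
    have "\<bar>a * b\<bar> \<le> a\<^sup>2 + b\<^sup>2" for a b :: real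
      using sum_squares_bound[of "\<bar>a\<bar>" "\<bar>b\<bar>"] mult_nonneg_nonneg[OF abs_ge_zero abs_ge_zero, of a b]
      unfolding abs_mult power2_abs mult.assoc by linarith
    then have "norm (dyadic_kernel k x y * u y * w x) \<le> norm (dyadic_kernel k x y * (u y)\<^sup>2 + dyadic_kernel k x y * (w x)\<^sup>2)" for x y
      using dyadic_kernel_bounds(1)[of k x y] by (auto simp: abs_mult mult.assoc intro!: mult_left_mono simp flip: distrib_left)
    then show "AE p in lborel \<Otimes>\<^sub>M lborel. norm (case p of (x, y) \<Rightarrow> dyadic_kernel k x y * u y * w x)
        \<le> norm ((case p of (x, y) \<Rightarrow> dyadic_kernel k x y * (u y)\<^sup>2) + (case p of (x, y) \<Rightarrow> dyadic_kernel k x y * (w x)\<^sup>2))"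
      by auto
  qed measurable
  have "pairing (dyadic_average k u) w = (LBINT x. LBINT y. dyadic_kernel k x y * u y * w x)"
    by (simp add: dyadic_average_def)
  also have "\<dots> = (LBINT y. LBINT x. dyadic_kernel k x y * u y * w x)"
    using lborel_pair.Fubini_integral[OF int] by simp
  also have "\<dots> = pairing u (dyadic_average k w)" unfolding dyadic_average_def
    by (subst dyadic_kernel_sym) (simp add: mult.assoc mult.left_commute flip: integral_mult_right_zero)
  finally show ?thesis .
qed

text \<open>A square of the finer level \<open>l\<close> lies inside one of level \<open>k\<close>,
  where the coarser kernel is constant, so averaging at level \<open>l\<close> leaves it
  unchanged.\<close>

lemma dyadic_average_mono_kernel:
  assumes "k \<le> l"
  shows "dyadic_average l (dyadic_kernel k x) z = dyadic_kernel k x z"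
proof -
  have fl: "\<lfloor>2 ^ k * a\<rfloor> = \<lfloor>2 ^ k * b\<rfloor>" if "\<lfloor>2 ^ l * a\<rfloor> = \<lfloor>2 ^ l * b\<rfloor>" for a b :: real
  proof -
    \<comment> \<open>The index at level \<open>k\<close> is the index at level \<open>l\<close>
      divided by 2^(l - k), so equality at the finer level implies equality at the coarser
      one.\<close>
    have "\<lfloor>2 ^ k * c\<rfloor> = \<lfloor>2 ^ l * c\<rfloor> div 2 ^ (l - k)" for c :: real
    proof -
      have "(2::real) ^ l = 2 ^ k * 2 ^ (l - k)" using assms by (simp flip: power_add)
      then have "2 ^ l * c / 2 ^ (l - k) = 2 ^ k * c" by simp
      then show ?thesis using floor_divide_real_eq_div[of "2 ^ (l - k)" "2 ^ l * c"] by simp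
    qed
    from this[of a] this[of b] that show ?thesis by simp
  qed
  have eq: "dyadic_kernel l z y * dyadic_kernel k x y = dyadic_kernel k x z * dyadic_kernel l z y" for y
  proof (cases "dyadic_kernel l z y = 0")
    case False
    then have "\<lfloor>2 ^ k * z $ 1\<rfloor> = \<lfloor>2 ^ k * y $ 1\<rfloor>" "\<lfloor>2 ^ k * z $ 2\<rfloor> = \<lfloor>2 ^ k * y $ 2\<rfloor>"
      by (auto simp: dyadic_kernel_def split: if_splits intro!: fl)
    then show ?thesis by (simp add: dyadic_kernel_def)
  qed simp
  have "dyadic_average l (dyadic_kernel k x) z = (LBINT y. dyadic_kernel k x z * dyadic_kernel l z y)"
    unfolding dyadic_average_def by (simp only: eq)
  then show ?thesis by (simp add: integral_dyadic_kernel)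
qed

text \<open>The tower property of conditional expectations: the finer average is moved onto the
  kernel by self-adjointness and absorbed there.\<close>

lemma dyadic_average_tower:
  assumes "l2 u" "k \<le> l"
  shows "dyadic_average k (dyadic_average l u) x = dyadic_average k u x"
proof -
  have "dyadic_average k (dyadic_average l u) x = (LBINT y. dyadic_average l (dyadic_kernel k x) y * u y)"
    unfolding dyadic_average_def[of k]
    using dyadic_average_selfadjoint[OF l2_dyadic_kernel assms(1), of l k x] by simp
  also have "\<dots> = pairing (dyadic_kernel k x) u" by (simp only: dyadic_average_mono_kernel[OF assms(2)])
  finally show ?thesis unfolding dyadic_average_def[of k u x] .
qed

text \<open>The kernel has L2 norm 2^k. The bound is uniform in \<open>x\<close> and over an L2
  ball, so at a fixed level limits may be taken under the integral.\<close>

lemma dyadic_average_bound: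
  assumes "l2 u" "sq_int u \<le> C"
  shows "\<bar>dyadic_average k u x\<bar> \<le> 2 ^ k * sqrt C"
proof -
  have "(dyadic_kernel k x y)\<^sup>2 = 4 ^ k * dyadic_kernel k x y" for y
    by (auto simp: dyadic_kernel_def power2_eq_square)
  then have "(LBINT y. (dyadic_kernel k x y)\<^sup>2) = 4 ^ k" by (simp add: integral_dyadic_kernel)
  moreover have "sqrt (4 ^ k) = (2 ^ k :: real)"
    by (intro real_sqrt_unique) (auto simp: power2_eq_square simp flip: power_mult_distrib)
  ultimately have "\<bar>dyadic_average k u x\<bar> \<le> 2 ^ k * sqrt (sq_int u)"
    using l2_Cauchy_Schwarz_abs[OF l2_dyadic_kernel assms(1), of k x] by (simp add: dyadic_average_def)
  also have "\<dots> \<le> 2 ^ k * sqrt C" by (intro mult_left_mono real_sqrt_le_mono assms) simp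
  finally show ?thesis .
qed

text \<open>Points of one square are at distance at most 2 / 2^k, so a Lipschitz function differs
  from its average by that order, and the averages stay supported in a ball enlarged by 3.\<close>

lemma dyadic_average_test_function:
  assumes "test_function \<phi>"
  shows "(\<lambda>k. LBINT x. (dyadic_average k \<phi> x - \<phi> x)\<^sup>2) \<longlonglongrightarrow> 0"
proof -
  obtain R where R: "R > 0" "\<And>x. norm x \<ge> R \<Longrightarrow> \<phi> x = 0" using test_function_support[OF assms] by metis
  obtain B where B: "B \<ge> 0" "\<And>x. \<bar>\<phi> x\<bar> \<le> B" using test_function_bounded[OF assms] by metis
  obtain L where L: "L \<ge> 0" "\<And>x y. \<bar>\<phi> x - \<phi> y\<bar> \<le> L * norm (x - y)" using test_function_Lipschitz[OF assms] by metis
  have [measurable]: "borel_fun \<phi>" by (rule test_function_borel[OF assms])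
  note int = l2_mult_integrable[OF l2_dyadic_kernel test_function_l2[OF assms]]
  have bound: "\<bar>dyadic_average k \<phi> x\<bar> \<le> B * indicator (cball 0 (R + 3)) x" for k x
  proof (cases "norm x \<le> R + 3")
    case True
    have "\<bar>dyadic_average k \<phi> x\<bar> \<le> (LBINT y. \<bar>dyadic_kernel k x y * \<phi> y\<bar>)"
      unfolding dyadic_average_def by (rule integral_abs_bound)
    also have "\<dots> \<le> (LBINT y. dyadic_kernel k x y * B)"
    proof (rule integral_mono)
      show "integrable lborel (\<lambda>y. \<bar>dyadic_kernel k x y * \<phi> y\<bar>)" by (rule integrable_abs[OF int])
      show "integrable lborel (\<lambda>y. dyadic_kernel k x y * B)" by (rule integrable_mult_left[OF integrable_dyadic_kernel])
      show "\<bar>dyadic_kernel k x y * \<phi> y\<bar> \<le> dyadic_kernel k x y * B" for y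
        using mult_left_mono[OF B(2) dyadic_kernel_bounds(1)] by (simp add: abs_mult dyadic_kernel_bounds)
    qed
    finally show ?thesis using True by (simp add: integral_dyadic_kernel)
  next
    case False
    have "dyadic_kernel k x y * \<phi> y = 0" for y
    proof (rule ccontr)
      assume "dyadic_kernel k x y * \<phi> y \<noteq> 0"
      then have "dyadic_kernel k y x \<noteq> 0" "\<phi> y \<noteq> 0" using dyadic_kernel_sym[of k x y] by simp_all
      then have "dyadic_kernel k y x \<noteq> 0" "norm y < R" using R(2)[of y] by (simp, linarith)
      then show False using dyadic_kernel_support'[of y x k] False by linarith
    qed
    then have "dyadic_average k \<phi> x = 0"
      unfolding dyadic_average_def by (simp only: Bochner_Integration.integral_zero)
    then show ?thesis using False by simp
  qed
  show ?thesis
  proof (rule l2_dominated(3)[where w = "\<lambda>x. B * indicator (cball 0 (R + 3)) x"])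
    show "l2 (\<lambda>x::R2. B * indicator (cball 0 (R + 3)) x)" by (intro l2_cmult l2_indicator) auto
    show "AE x in lborel. (\<lambda>k. dyadic_average k \<phi> x) \<longlonglongrightarrow> \<phi> x"
    proof (rule AE_I2)
      fix x
      have "\<bar>dyadic_average k \<phi> x - \<phi> x\<bar> \<le> L * (2 / 2 ^ k)" for k
      proof -
        have "dyadic_average k \<phi> x - \<phi> x = (LBINT y. dyadic_kernel k x y * (\<phi> y - \<phi> x))"
          using int[of k x] integrable_dyadic_kernel[of k x]
          by (simp add: dyadic_average_def right_diff_distrib integral_dyadic_kernel)
        then have "\<bar>dyadic_average k \<phi> x - \<phi> x\<bar> \<le> (LBINT y. \<bar>dyadic_kernel k x y * (\<phi> y - \<phi> x)\<bar>)"
          by (simp add: integral_abs_bound)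
        also have "\<dots> \<le> (LBINT y. dyadic_kernel k x y * (L * (2 / 2 ^ k)))"
        proof (rule integral_mono)
          show "integrable lborel (\<lambda>y. \<bar>dyadic_kernel k x y * (\<phi> y - \<phi> x)\<bar>)"
          proof (rule integrable_abs)
            have "integrable lborel (\<lambda>y. dyadic_kernel k x y * \<phi> y - dyadic_kernel k x y * \<phi> x)"
              by (rule Bochner_Integration.integrable_diff[OF int integrable_mult_left[OF integrable_dyadic_kernel]])
            then show "integrable lborel (\<lambda>y. dyadic_kernel k x y * (\<phi> y - \<phi> x))"
              by (simp only: right_diff_distrib)
          qed
          fix y
          show "\<bar>dyadic_kernel k x y * (\<phi> y - \<phi> x)\<bar> \<le> dyadic_kernel k x y * (L * (2 / 2 ^ k))"
          proof (cases "dyadic_kernel k x y = 0")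
            case False
            have "\<bar>\<phi> y - \<phi> x\<bar> \<le> L * (2 / 2 ^ k)"
              using L(2)[of y x] mult_left_mono[OF dyadic_kernel_support[OF False] L(1)]
              by (simp add: norm_minus_commute)
            from mult_left_mono[OF this dyadic_kernel_bounds(1)[of k x y]] show ?thesis
              by (simp add: abs_mult dyadic_kernel_bounds)
          qed simp
        qed (rule integrable_mult_left[OF integrable_dyadic_kernel])
        finally show ?thesis by (simp add: integral_dyadic_kernel)
      qed
      moreover have "(\<lambda>k. L * (2 / 2 ^ k)) \<longlonglongrightarrow> 0"
        using tendsto_mult_left[OF LIMSEQ_realpow_zero[of "1/2::real"], of "2 * L"]
        by (simp add: power_one_over field_simps)
      ultimately have "(\<lambda>k. dyadic_average k \<phi> x - \<phi> x) \<longlonglongrightarrow> 0"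
        using Lim_null_comparison[of "\<lambda>k. dyadic_average k \<phi> x - \<phi> x" "\<lambda>k. L * (2 / 2 ^ k)" sequentially]
        by simp
      then show "(\<lambda>k. dyadic_average k \<phi> x) \<longlonglongrightarrow> \<phi> x" by (rule LIM_zero_cancel)
    qed
    show "dyadic_average k \<phi> \<in> borel_measurable borel" for k by measurable
    show "AE x in lborel. \<bar>dyadic_average k \<phi> x\<bar> \<le> B * indicator (cball 0 (R + 3)) x" for k
      using bound by simp
  qed measurable
qed

text \<open>The dyadic averages of the weak limit form an \<open>L\<^sup>2\<close>-bounded martingale. They are pointwise limits,
  hence jointly measurable in the parameter, and so is their \<open>L\<^sup>2\<close> limit.\<close>

lemma L2_weak_limit_measurable:
  fixes w :: "nat \<Rightarrow> real \<Rightarrow> R2 \<Rightarrow> real"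
  assumes wm: "\<And>n. case_prod (w n) \<in> borel_measurable borel"
    and l2: "\<And>n t. l2 (w n t)" and C: "\<And>n t. (LBINT x. (w n t x)\<^sup>2) \<le> C"
    and conv: "\<And>\<phi> t. l2 \<phi> \<Longrightarrow> convergent (\<lambda>n. pairing \<phi> (w n t))"
  obtains \<rho> where "borel_fun (case_prod \<rho>)" "\<And>t. l2 (\<rho> t)" "\<And>t. sq_int (\<rho> t) \<le> C"
    "\<And>\<phi> t. l2 \<phi> \<Longrightarrow> (\<lambda>n. pairing \<phi> (w n t)) \<longlonglongrightarrow> pairing \<phi> (\<rho> t)"
proof -
  have [measurable]: "case_prod (w n) \<in> borel_measurable borel2" for n using wm by (simp add: borel_prod)
  have C0: "0 \<le> C" using order_trans[OF integral_nonneg_AE C[of 0 0]] by simp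
  define g where "g k t x = lim (\<lambda>n. dyadic_average k (w n t) x)" for k t x
  \<comment> \<open>For a fixed square the average is a pairing with an L2 function, so weak
    convergence provides a limit at every \<open>x\<close>.\<close>
  have glim: "(\<lambda>n. dyadic_average k (w n t) x) \<longlonglongrightarrow> g k t x" for k t x
    using conv[OF l2_dyadic_kernel, of k x t] unfolding g_def dyadic_average_def convergent_LIMSEQ_iff .
  have gm: "case_prod (g k) \<in> borel_measurable borel" for k
  proof -
    have [measurable]: "(\<lambda>p. dyadic_average k (w n (fst p)) (snd p)) \<in> borel_measurable borel2" for n
      by (rule dyadic_average_measurable_param) measurable
    have "(\<lambda>p. g k (fst p) (snd p)) \<in> borel_measurable borel2" unfolding g_def by measurable
    then show ?thesis by (simp add: borel_prod case_prod_beta')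
  qed
  have gt [measurable]: "g k t \<in> borel_measurable borel" for k t

  proof (rule borel_measurable_LIMSEQ_metric)
    show "dyadic_average k (w n t) \<in> borel_measurable borel" for n
      by (rule dyadic_average_borel[OF l2_borel[OF l2]])
    show "(\<lambda>n. dyadic_average k (w n t) x) \<longlonglongrightarrow> g k t x" for x by (rule glim)
  qed
  have gbound: "\<bar>g k t x\<bar> \<le> 2 ^ k * sqrt C" for k t x
    by (rule LIMSEQ_le_const2[OF tendsto_rabs[OF glim]]) (use dyadic_average_bound[OF l2 C] in auto)
  have gl2: "l2 (g k t)" "(LBINT x. (g k t x)\<^sup>2) \<le> C" for k t

  proof -
    have "l2 (dyadic_average k (w n t))" "(LBINT x. (dyadic_average k (w n t) x)\<^sup>2) \<le> C" for n
      using l2_dyadic_average[OF l2[of n t], of k] C[of n t] by (blast, linarith)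
    moreover have "AE x in lborel. (\<lambda>n. dyadic_average k (w n t) x) \<longlonglongrightarrow> g k t x" using glim by simp
    ultimately show "l2 (g k t)" "(LBINT x. (g k t x)\<^sup>2) \<le> C"
      using l2_Fatou[OF gt, of "\<lambda>n. dyadic_average k (w n t)" k t C] by blast+
  qed
  have tower: "dyadic_average k (g l t) x = g k t x" if "k \<le> l" for k l t x
  proof (rule LIMSEQ_unique)
    have "(\<lambda>n. dyadic_average k (dyadic_average l (w n t)) x) \<longlonglongrightarrow> dyadic_average k (g l t) x"
      unfolding dyadic_average_def[of k]
    proof (rule integral_dominated_convergence[where w = "\<lambda>y. dyadic_kernel k x y * (2 ^ l * sqrt C)"])
      have [measurable]: "w n t \<in> borel_measurable borel" for n using l2 by (simp add: l2_def)
      show "(\<lambda>y. dyadic_kernel k x y * dyadic_average l (w n t) y) \<in> borel_measurable lborel" for n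
        by measurable
      show "AE y in lborel. norm (dyadic_kernel k x y * dyadic_average l (w n t) y) \<le> dyadic_kernel k x y * (2 ^ l * sqrt C)" for n
        using dyadic_average_bound[OF l2 C] dyadic_kernel_bounds(1)
        by (intro AE_I2) (auto simp: abs_mult intro!: mult_left_mono)
      show "AE y in lborel. (\<lambda>n. dyadic_kernel k x y * dyadic_average l (w n t) y) \<longlonglongrightarrow> dyadic_kernel k x y * g l t y"
        by (intro AE_I2 tendsto_mult tendsto_const glim)
    qed (use integrable_dyadic_kernel in auto)
    then show "(\<lambda>n. dyadic_average k (w n t) x) \<longlonglongrightarrow> dyadic_average k (g l t) x"
      by (simp add: dyadic_average_tower[OF l2 that])
  qed (rule glim)
  \<comment> \<open>Pythagoras for the martingale. The squared norms therefore increase with the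
    level, and being bounded by \<open>C\<close> they force the Cauchy property in L2.\<close>
  have orth: "(LBINT x. (g l t x - g k t x)\<^sup>2) = (LBINT x. (g l t x)\<^sup>2) - (LBINT x. (g k t x)\<^sup>2)"
    if "k \<le> l" for k l t
  proof -
    have "pairing (g k t) (g k t) = (LBINT x. dyadic_average k (g l t) x * g k t x)" by (simp add: tower[OF that])
    also have "\<dots> = (LBINT x. g l t x * dyadic_average k (g k t) x)"
      by (rule dyadic_average_selfadjoint[OF gl2(1) gl2(1)])
    also have "\<dots> = pairing (g l t) (g k t)" by (simp add: tower)
    finally have eq: "pairing (g l t) (g k t) = (LBINT x. (g k t x)\<^sup>2)" by (simp add: power2_eq_square)
    have "(LBINT x. (g l t x - g k t x)\<^sup>2)
        = (LBINT x. (g l t x)\<^sup>2 + (g k t x)\<^sup>2 - 2 * (g l t x * g k t x))"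
      by (simp add: power2_diff mult.assoc)
    also have "\<dots> = (LBINT x. (g l t x)\<^sup>2) + (LBINT x. (g k t x)\<^sup>2) - 2 * pairing (g l t) (g k t)"
      using l2_integrable[OF gl2(1)] l2_mult_integrable[OF gl2(1) gl2(1)] by simp
    finally show ?thesis using eq by simp
  qed
  have Cauchy: "\<exists>K. \<forall>k\<ge>K. \<forall>l\<ge>K. (LBINT x. (g k t x - g l t x)\<^sup>2) \<le> e" if "0 < e" for t e
  proof -
    let ?N = "\<lambda>k. LBINT x. (g k t x)\<^sup>2"
    have mono: "?N k \<le> ?N l" if "k \<le> l" for k l
    proof -
      have "0 \<le> (LBINT x. (g l t x - g k t x)\<^sup>2)" by simp
      with orth[OF that] show ?thesis by simp
    qed
    obtain L where "?N \<longlonglongrightarrow> L"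
      using incseq_convergent[of ?N C] mono gl2(2) unfolding incseq_def by metis
    then have "convergent ?N" by (rule convergentI)
    from Cauchy_convergent_iff[THEN iffD2, OF this] that obtain K where
      K: "\<And>k l. k \<ge> K \<Longrightarrow> l \<ge> K \<Longrightarrow> \<bar>?N k - ?N l\<bar> < e"
      unfolding Cauchy_def dist_real_def by meson
    show ?thesis
    proof (intro exI allI impI)
      fix k l assume kl: "K \<le> k" "K \<le> l"
      show "(LBINT x. (g k t x - g l t x)\<^sup>2) \<le> e"
      proof (cases "k \<le> l")
        case True
        then show ?thesis using orth[OF True, of t] K[OF kl] by (simp add: power2_commute)
      next
        case False
        then have "l \<le> k" by simp
        from orth[OF this, of t] K[OF kl] show ?thesis by simp
      qed
    qed
  qed
  obtain \<rho> where \<rho>: "borel_fun (case_prod \<rho>)" "\<And>t. l2 (\<rho> t)"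
    "\<And>t. (\<lambda>k. LBINT x. (g k t x - \<rho> t x)\<^sup>2) \<longlonglongrightarrow> 0"
  proof (rule l2_complete_measurable[where g = g])
    show "case_prod (g k) \<in> borel_measurable borel" for k by (rule gm)
    show "l2 (g k t)" for k t by (rule gl2)
    show "\<exists>K. \<forall>k\<ge>K. \<forall>l\<ge>K. (LBINT x. (g k t x - g l t x)\<^sup>2) \<le> e" if "0 < e" for t e
      using that by (rule Cauchy)
  qed blast
  have base: "(\<lambda>n. pairing \<phi> (w n t)) \<longlonglongrightarrow> pairing \<phi> (\<rho> t)" if \<phi>: "test_function \<phi>" for \<phi> t
  proof -
    have l\<phi>: "l2 \<phi>" by (rule test_function_l2[OF \<phi>])
    define \<Lambda> where "\<Lambda> = lim (\<lambda>n. pairing \<phi> (w n t))"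
    have \<Lambda>: "(\<lambda>n. pairing \<phi> (w n t)) \<longlonglongrightarrow> \<Lambda>"
      using conv[OF l\<phi>] unfolding \<Lambda>_def convergent_LIMSEQ_iff .
    \<comment> \<open>Moving the average from \<open>w n t\<close> onto \<phi> leaves an error bound
      that is independent of n.\<close>
    have "\<bar>(LBINT x. g k t x * \<phi> x) - \<Lambda>\<bar> \<le> sqrt (LBINT x. (dyadic_average k \<phi> x - \<phi> x)\<^sup>2) * sqrt C" for k
    proof -
      have "(\<lambda>n. LBINT x. dyadic_average k (w n t) x * \<phi> x) \<longlonglongrightarrow> pairing (g k t) \<phi>"
      proof (rule integral_dominated_convergence[where w = "\<lambda>x. 2 ^ k * sqrt C * \<bar>\<phi> x\<bar>"])
        have [measurable]: "w n t \<in> borel_measurable borel" "borel_fun \<phi>" for n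
          using l2 test_function_borel[OF \<phi>] by (auto simp: l2_def)
        show "(\<lambda>x. g k t x * \<phi> x) \<in> borel_measurable lborel" by measurable
        show "(\<lambda>x. dyadic_average k (w n t) x * \<phi> x) \<in> borel_measurable lborel" for n by measurable
        show "integrable lborel (\<lambda>x. 2 ^ k * sqrt C * \<bar>\<phi> x\<bar>)" using test_function_integrable[OF \<phi>] by simp
        show "AE x in lborel. (\<lambda>n. dyadic_average k (w n t) x * \<phi> x) \<longlonglongrightarrow> g k t x * \<phi> x"
          by (intro AE_I2 tendsto_mult tendsto_const glim)
        show "AE x in lborel. norm (dyadic_average k (w n t) x * \<phi> x) \<le> 2 ^ k * sqrt C * \<bar>\<phi> x\<bar>" for n
          using dyadic_average_bound[OF l2 C] by (intro AE_I2) (auto simp: abs_mult intro!: mult_right_mono)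
      qed
      then have lim: "(\<lambda>n. (LBINT x. dyadic_average k (w n t) x * \<phi> x) - pairing \<phi> (w n t))
          \<longlonglongrightarrow> pairing (g k t) \<phi> - \<Lambda>" by (intro tendsto_diff \<Lambda>)
      have le: "\<bar>(LBINT x. dyadic_average k (w n t) x * \<phi> x) - pairing \<phi> (w n t)\<bar>
          \<le> sqrt (LBINT x. (dyadic_average k \<phi> x - \<phi> x)\<^sup>2) * sqrt C" for n
      proof -
        have "(LBINT x. dyadic_average k (w n t) x * \<phi> x) - pairing \<phi> (w n t)
            = pairing (dyadic_average k \<phi>) (w n t) - pairing \<phi> (w n t)"
          using dyadic_average_selfadjoint[OF l2 l\<phi>] by (simp add: mult.commute)
        also have "\<dots> = (LBINT x. (dyadic_average k \<phi> x - \<phi> x) * w n t x)"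
          using l2_mult_integrable[OF l2_dyadic_average(1)[OF l\<phi>] l2] l2_mult_integrable[OF l\<phi> l2]
          by (simp add: left_diff_distrib)
        also have "\<bar>\<dots>\<bar> \<le> sqrt (LBINT x. (dyadic_average k \<phi> x - \<phi> x)\<^sup>2) * sqrt (LBINT x. (w n t x)\<^sup>2)"
          by (intro l2_Cauchy_Schwarz_abs l2_diff l2_dyadic_average l\<phi> l2)
        also have "\<dots> \<le> sqrt (LBINT x. (dyadic_average k \<phi> x - \<phi> x)\<^sup>2) * sqrt C"
          by (intro mult_left_mono real_sqrt_le_mono C) simp
        finally show ?thesis .
      qed
      show ?thesis by (rule LIMSEQ_le_const2[OF tendsto_rabs[OF lim]]) (use le in auto)
    qed
    moreover have "(\<lambda>k. sqrt (LBINT x. (dyadic_average k \<phi> x - \<phi> x)\<^sup>2) * sqrt C) \<longlonglongrightarrow> 0"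
    proof -
      have "(\<lambda>k. sqrt (LBINT x. (dyadic_average k \<phi> x - \<phi> x)\<^sup>2)) \<longlonglongrightarrow> sqrt 0"
        by (intro tendsto_real_sqrt dyadic_average_test_function \<phi>)
      from tendsto_mult[OF this tendsto_const[of "sqrt C"]] show ?thesis by simp
    qed
    ultimately have "(\<lambda>k. (pairing (g k t) \<phi>) - \<Lambda>) \<longlonglongrightarrow> 0"
      using Lim_null_comparison[of "\<lambda>k. (pairing (g k t) \<phi>) - \<Lambda>"
          "\<lambda>k. sqrt (LBINT x. (dyadic_average k \<phi> x - \<phi> x)\<^sup>2) * sqrt C" sequentially] by simp
    then have lim1: "(\<lambda>k. pairing (g k t) \<phi>) \<longlonglongrightarrow> \<Lambda>" by (rule LIM_zero_cancel)
    have "(\<lambda>k. LBINT x. (g k t x - \<rho> t x) * \<phi> x) \<longlonglongrightarrow> 0"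
      by (rule l2_integral_limit[where C = "LBINT x. (\<phi> x)\<^sup>2"]) (auto simp: \<rho> gl2 l\<phi>)
    then have "(\<lambda>k. (pairing (g k t) \<phi>) - pairing (\<rho> t) \<phi>) \<longlonglongrightarrow> 0"
      using l2_mult_integrable[OF gl2(1) l\<phi>] l2_mult_integrable[OF \<rho>(2) l\<phi>] by (simp add: left_diff_distrib)
    then have "(\<lambda>k. pairing (g k t) \<phi>) \<longlonglongrightarrow> pairing (\<rho> t) \<phi>" by (rule LIM_zero_cancel)
    with lim1 have "\<Lambda> = pairing \<phi> (\<rho> t)" using LIMSEQ_unique by (auto simp: mult.commute)
    with \<Lambda> show ?thesis by simp
  qed
  show thesis
  proof (rule that[OF \<rho>(1,2)])
    show "(\<lambda>n. pairing \<phi> (w n t)) \<longlonglongrightarrow> pairing \<phi> (\<rho> t)" if "l2 \<phi>" for \<phi> t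
      by (rule l2_weak_convergence_density[where C = C])
        (use that in \<open>auto intro: l2 C \<rho>(2) base test_function_smooth_box\<close>)
    then have "(\<lambda>n. pairing (\<rho> t) (w n t)) \<longlonglongrightarrow> pairing (\<rho> t) (\<rho> t)" for t
      using \<rho>(2) by blast
    note lim = this
    \<comment> \<open>Weak lower semicontinuity of the norm: the limit itself is taken as the test
      function.\<close>
    show "sq_int (\<rho> t) \<le> C" for t
    proof -
      let ?a = "LBINT x. (\<rho> t x)\<^sup>2"
      have a0: "0 \<le> ?a" by simp
      have lim': "(\<lambda>n. pairing (\<rho> t) (w n t)) \<longlonglongrightarrow> ?a"
        using lim[of t] by (simp add: power2_eq_square)
      have "?a \<le> sqrt ?a * sqrt C"
      proof (rule LIMSEQ_le_const2[OF lim'], intro exI allI impI)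
        fix n :: nat
        have "pairing (\<rho> t) (w n t) \<le> sqrt ?a * sqrt (LBINT x. (w n t x)\<^sup>2)"
          using l2_Cauchy_Schwarz_abs[OF \<rho>(2) l2] by (rule order_trans[OF abs_ge_self])
        also have "\<dots> \<le> sqrt ?a * sqrt C" by (intro mult_left_mono real_sqrt_le_mono C) simp
        finally show "pairing (\<rho> t) (w n t) \<le> sqrt ?a * sqrt C" .
      qed
      moreover have "?a = sqrt ?a * sqrt ?a" using a0 by simp
      ultimately have le: "sqrt ?a * sqrt ?a \<le> sqrt ?a * sqrt C" by (simp only:)
      have "sqrt ?a \<le> sqrt C"
      proof (cases "sqrt ?a = 0")
        case True
        show ?thesis unfolding True using C0 by simp
      next
        case False
        then have "0 < sqrt ?a" using a0 real_sqrt_ge_zero[OF a0] by linarith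
        with le show ?thesis by (rule mult_left_le_imp_le)
      qed
      then show ?thesis by simp
    qed
  qed
qed

lemma nn_integral_translate:
  fixes f :: "'a::euclidean_space \<Rightarrow> ennreal"
  assumes "borel_fun f"
  shows "(\<integral>\<^sup>+x. f (x - a) \<partial>lborel) = (\<integral>\<^sup>+x. f x \<partial>lborel)"
proof -
  have "(\<integral>\<^sup>+x. f x \<partial>lborel) = (\<integral>\<^sup>+x. f x \<partial>distr lborel borel ((+) (- a)))"
    by (simp add: lborel_distr_plus)
  also have "\<dots> = (\<integral>\<^sup>+x. f (- a + x) \<partial>lborel)"
    by (rule nn_integral_distr) (use assms in auto)
  finally show ?thesis by simp
qed

section \<open>The Coulomb field\<close>

text \<open>The singular part of a kernel |z|^(-a), integrable in the plane for 0 < a < 2. At the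
  origin \<open>powr\<close> gives the value 0.\<close>

definition near_weight :: "real \<Rightarrow> real \<Rightarrow> R2 \<Rightarrow> real" where
  "near_weight a d z = (if norm z < d then norm z powr - a else 0)"

lemma near_weight_nonneg: "0 \<le> near_weight a d z" by (simp add: near_weight_def)

lemma near_weight_borel [measurable]: "near_weight a d \<in> borel_measurable borel"
  unfolding near_weight_def[abs_def] by measurable

lemma near_weight_minus: "near_weight a d (x - y) = near_weight a d (y - x)"
  by (simp add: near_weight_def norm_minus_commute)

lemma emeasure_ball_R2: "0 \<le> r \<Longrightarrow> emeasure lborel (ball (c::R2) r) = ennreal (unit_ball_vol 2 * r\<^sup>2)"
  by (simp add: emeasure_ball)

text \<open>Dyadic annuli: where |z| lies between \<delta> / 2^(j+1) and \<delta> / 2^j the weight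
  is at most \<open>c j\<close>, and the enclosing disc has area of order \<delta>^2 / 4^j. The
  products form a geometric series with ratio q = 2^(a-2), below 1 because a < 2. The power of
  \<delta> is recorded since the near part has to become small in the compactness argument.\<close>

lemma nn_integral_near_weight:
  assumes a: "0 < a" "a < 2"
  obtains C where "0 \<le> C" "\<And>\<delta>. 0 < \<delta> \<Longrightarrow> (\<integral>\<^sup>+z. ennreal (near_weight a \<delta> z) \<partial>lborel) \<le> ennreal (C * \<delta> powr (2 - a))"
proof -
  define V where "V = unit_ball_vol 2"
  define q where "q = (2::real) powr (a - 2)"
  have q: "0 < q" "q < 1" using a by (auto simp: q_def powr_less_one)
  have V: "0 \<le> V" by (simp add: V_def)
  define C where "C = V * 2 powr a / (1 - q)"
  have "(\<integral>\<^sup>+z. ennreal (near_weight a \<delta> z) \<partial>lborel) \<le> ennreal (C * \<delta> powr (2 - a))" if \<delta>: "0 < \<delta>" for \<delta>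
  proof -
    define c where "c j = (\<delta> / 2 ^ Suc j) powr - a" for j
    have "ennreal (near_weight a \<delta> z) \<le> (\<Sum>j. ennreal (c j) * indicator (ball 0 (\<delta> / 2 ^ j)) z)" for z
    proof (cases "z = 0 \<or> \<delta> \<le> norm z")
      case True
      then show ?thesis by (auto simp: near_weight_def)
    next
      case False
      then have z: "0 < norm z" "norm z < \<delta>" by auto
      have "\<exists>j. \<delta> / 2 ^ Suc j \<le> norm z"
      proof -
        obtain n where "(1/2) ^ n < norm z / \<delta>" using real_arch_pow_inv[of "norm z / \<delta>" "1/2"] z \<delta> by auto
        then have "\<delta> / 2 ^ n < norm z" using \<delta> by (simp add: power_one_over field_simps)
        moreover have "\<delta> / 2 ^ Suc n \<le> \<delta> / 2 ^ n" using \<delta> by (simp add: field_simps)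
        ultimately show ?thesis by (intro exI[of _ n]) linarith
      qed
      define j where "j = (LEAST j. \<delta> / 2 ^ Suc j \<le> norm z)"
      have j: "\<delta> / 2 ^ Suc j \<le> norm z" unfolding j_def by (rule LeastI_ex) fact
      have "norm z < \<delta> / 2 ^ j"
      proof (cases j)
        case 0
        with z show ?thesis by simp
      next
        case (Suc i)
        then have "i < j" by simp
        from not_less_Least[OF this[unfolded j_def]] show ?thesis unfolding Suc by simp
      qed
      then have zj: "z \<in> ball 0 (\<delta> / 2 ^ j)" by simp
      have "near_weight a \<delta> z = norm z powr - a" using z by (simp add: near_weight_def)
      also have "\<dots> \<le> c j" unfolding c_def using a j \<delta> by (intro powr_mono2') auto
      finally have "ennreal (near_weight a \<delta> z) \<le> ennreal (c j) * indicator (ball 0 (\<delta> / 2 ^ j)) z"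
        using zj by (simp add: ennreal_leI)
      also have "\<dots> \<le> (\<Sum>j. ennreal (c j) * indicator (ball 0 (\<delta> / 2 ^ j)) z)"
      proof -
        have "F j \<le> suminf F" for F :: "nat \<Rightarrow> ennreal" using sum_le_suminf[of F "{j}"] by simp
        then show ?thesis .
      qed
      finally show ?thesis .
    qed
    then have "(\<integral>\<^sup>+z. ennreal (near_weight a \<delta> z) \<partial>lborel)
        \<le> (\<integral>\<^sup>+z. (\<Sum>j. ennreal (c j) * indicator (ball 0 (\<delta> / 2 ^ j)) z) \<partial>(lborel :: R2 measure))"
      by (intro nn_integral_mono) auto
    also have "\<dots> = (\<Sum>j. \<integral>\<^sup>+z. ennreal (c j) * indicator (ball 0 (\<delta> / 2 ^ j)) z \<partial>(lborel :: R2 measure))"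
      by (rule nn_integral_suminf) (rule borel_measurable_times_ennreal, simp, rule borel_measurable_indicator, simp add: borel_open)
    also have "\<dots> = (\<Sum>j. ennreal (V * 2 powr a * \<delta> powr (2 - a) * q ^ j))"
    proof (rule suminf_cong)
      fix j
      have "(\<integral>\<^sup>+z. ennreal (c j) * indicator (ball 0 (\<delta> / 2 ^ j)) z \<partial>(lborel :: R2 measure))
          = ennreal (c j) * ennreal (V * (\<delta> / 2 ^ j)\<^sup>2)"
        using \<delta> by (simp add: nn_integral_cmult_indicator emeasure_ball_R2 V_def del: emeasure_lborel_ball_finite)
      also have "\<dots> = ennreal (c j * (V * (\<delta> / 2 ^ j)\<^sup>2))"
        by (rule ennreal_mult[symmetric]) (auto simp: c_def V)
      also have "c j * (V * (\<delta> / 2 ^ j)\<^sup>2) = V * 2 powr a * \<delta> powr (2 - a) * q ^ j"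
      proof -
        have p: "(2::real) ^ j = 2 powr real j" by (simp add: powr_realpow)
        have d: "\<delta> / 2 ^ Suc j = \<delta> powr 1 * 2 powr (- real j - 1)"
          using \<delta> by (simp add: powr_diff powr_minus p field_simps)
        have c: "c j = \<delta> powr (- a) * 2 powr (a * real j + a)"
          unfolding c_def d using \<delta> by (simp add: powr_mult powr_powr algebra_simps)
        have d2: "(\<delta> / 2 ^ j)\<^sup>2 = \<delta> powr 2 * 2 powr (- 2 * real j)"

        proof -
          have "(2 powr real j)\<^sup>2 = (2::real) powr (2 * real j)" by (simp add: power2_eq_square flip: powr_add)
          then have "(\<delta> / 2 ^ j)\<^sup>2 = \<delta>\<^sup>2 / 2 powr (2 * real j)" unfolding p power_divide by (simp only:)
          then show ?thesis using \<delta> by (simp add: powr_minus divide_inverse)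
        qed
        have q': "q ^ j = 2 powr ((a - 2) * real j)" unfolding q_def by (simp add: powr_power mult.commute)
        have e1: "2 powr (a * real j + a) * 2 powr (- 2 * real j) = 2 powr a * (2::real) powr ((a - 2) * real j)"
          by (simp add: algebra_simps flip: powr_add)
        have e2: "\<delta> powr (- a) * \<delta> powr 2 = \<delta> powr (2 - a)" by (simp flip: powr_add)
        have "\<delta> powr (- a) * 2 powr (a * real j + a) * (V * (\<delta> powr 2 * 2 powr (- 2 * real j)))
            = V * (\<delta> powr (- a) * \<delta> powr 2) * (2 powr (a * real j + a) * 2 powr (- 2 * real j))"
          by (simp only: mult_ac)
        then show ?thesis unfolding c d2 q' e1 e2 by (simp only: mult_ac)
      qed
      finally show "(\<integral>\<^sup>+z. ennreal (c j) * indicator (ball 0 (\<delta> / 2 ^ j)) z \<partial>(lborel :: R2 measure))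
          = ennreal (V * 2 powr a * \<delta> powr (2 - a) * q ^ j)" .
    qed
    also have "\<dots> = ennreal (\<Sum>j. V * 2 powr a * \<delta> powr (2 - a) * q ^ j)"
      using q V by (intro suminf_ennreal2 summable_mult summable_geometric) auto
    also have "(\<Sum>j. V * 2 powr a * \<delta> powr (2 - a) * q ^ j) = C * \<delta> powr (2 - a)"
      using q by (subst suminf_mult) (simp_all add: summable_geometric suminf_geometric C_def)
    finally show ?thesis .
  qed
  moreover have "0 \<le> C" using q V by (simp add: C_def)
  ultimately show thesis using that by blast
qed

lemma nn_integral_near_weight_translate:
  "(\<integral>\<^sup>+y. ennreal (near_weight a d (x - y)) \<partial>lborel) = (\<integral>\<^sup>+z. ennreal (near_weight a d z) \<partial>lborel)"
  "(\<integral>\<^sup>+y. ennreal (near_weight a d (y - x)) \<partial>lborel) = (\<integral>\<^sup>+z. ennreal (near_weight a d z) \<partial>lborel)"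
proof -
  show *: "(\<integral>\<^sup>+y. ennreal (near_weight a d (y - x)) \<partial>lborel) = (\<integral>\<^sup>+z. ennreal (near_weight a d z) \<partial>lborel)"
    by (rule nn_integral_translate) measurable
  then show "(\<integral>\<^sup>+y. ennreal (near_weight a d (x - y)) \<partial>lborel) = (\<integral>\<^sup>+z. ennreal (near_weight a d z) \<partial>lborel)"
    by (subst near_weight_minus)
qed

definition near_potential :: "real \<Rightarrow> real \<Rightarrow> (R2 \<Rightarrow> real) \<Rightarrow> R2 \<Rightarrow> ennreal" where
  "near_potential a d u x = (\<integral>\<^sup>+y. ennreal (near_weight a d (x - y) * \<bar>u y\<bar>) \<partial>lborel)"

lemma near_potential_borel [measurable]:
  assumes [measurable]: "borel_fun u"
  shows "near_potential a d u \<in> borel_measurable borel"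
proof -
  have "(\<lambda>(x, y). ennreal (near_weight a d (x - y) * \<bar>u y\<bar>)) \<in> borel_measurable (borel \<Otimes>\<^sub>M lborel)"
    by measurable
  from sigma_finite_measure.borel_measurable_nn_integral[OF sigma_finite_lborel this]
  show ?thesis by (simp add: near_potential_def[abs_def])
qed

text \<open>Cauchy-Schwarz with |z|^(-a) = |z|^(-b) |z|^(-c); translation invariance makes the first
  factor independent of \<open>x\<close>.\<close>

lemma near_potential_square:
  assumes [measurable]: "borel_fun u" and b: "a = b + c"
  shows "(near_potential a \<delta> u x)\<^sup>2
      \<le> (\<integral>\<^sup>+z. ennreal (near_weight (2 * b) \<delta> z) \<partial>lborel) * (\<integral>\<^sup>+y. ennreal (near_weight (2 * c) \<delta> (x - y) * (u y)\<^sup>2) \<partial>lborel)"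
proof -
  have prod: "near_weight a \<delta> z = near_weight b \<delta> z * near_weight c \<delta> z" for z
    by (simp add: near_weight_def b flip: powr_add)
  have sq: "(near_weight d \<delta> z)\<^sup>2 = near_weight (2 * d) \<delta> z" for d z
    by (simp add: near_weight_def power2_eq_square flip: powr_add)
  have "near_potential a \<delta> u x
      = (\<integral>\<^sup>+y. ennreal (near_weight b \<delta> (x - y)) * ennreal (near_weight c \<delta> (x - y) * \<bar>u y\<bar>) \<partial>lborel)"
    unfolding near_potential_def prod
    by (intro nn_integral_cong) (simp add: near_weight_nonneg mult.assoc flip: ennreal_mult)
  then have "(near_potential a \<delta> u x)\<^sup>2 \<le> (\<integral>\<^sup>+y. (ennreal (near_weight b \<delta> (x - y)))\<^sup>2 \<partial>lborel)
      * (\<integral>\<^sup>+y. (ennreal (near_weight c \<delta> (x - y) * \<bar>u y\<bar>))\<^sup>2 \<partial>lborel)"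
    by (simp only:) (rule Cauchy_Schwarz_nn_integral; measurable)
  then show ?thesis
    by (simp add: ennreal_power near_weight_nonneg power_mult_distrib sq nn_integral_near_weight_translate(1))
qed

lemma nn_integral_near_weight_swap:
  assumes [measurable]: "borel_fun u" "borel_fun w"
    and "\<And>y. 0 \<le> u y" "\<And>x. 0 \<le> w x"
  shows "(\<integral>\<^sup>+x. ennreal (w x) * (\<integral>\<^sup>+y. ennreal (near_weight a d (x - y) * u y) \<partial>lborel) \<partial>lborel)
    = (\<integral>\<^sup>+y. ennreal (u y) * (\<integral>\<^sup>+x. ennreal (near_weight a d (y - x) * w x) \<partial>lborel) \<partial>lborel)"
proof -
  have "(\<integral>\<^sup>+x. ennreal (w x) * (\<integral>\<^sup>+y. ennreal (near_weight a d (x - y) * u y) \<partial>lborel) \<partial>lborel)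
      = (\<integral>\<^sup>+x. \<integral>\<^sup>+y. ennreal (w x * (near_weight a d (x - y) * u y)) \<partial>lborel \<partial>lborel)"
    using assms near_weight_nonneg by (simp add: ennreal_mult nn_integral_cmult)
  also have "\<dots> = (\<integral>\<^sup>+y. \<integral>\<^sup>+x. ennreal (w x * (near_weight a d (x - y) * u y)) \<partial>lborel \<partial>lborel)"
    by (rule lborel_pair.Fubini'[symmetric]) measurable
  also have "\<dots> = (\<integral>\<^sup>+y. \<integral>\<^sup>+x. ennreal (u y * (near_weight a d (y - x) * w x)) \<partial>lborel \<partial>lborel)"
    by (intro nn_integral_cong) (simp add: near_weight_minus[of a d _ "_ :: R2"] mult_ac norm_minus_commute near_weight_def)
  also have "\<dots> = (\<integral>\<^sup>+y. ennreal (u y) * (\<integral>\<^sup>+x. ennreal (near_weight a d (y - x) * w x) \<partial>lborel) \<partial>lborel)"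
    using assms near_weight_nonneg by (simp add: ennreal_mult nn_integral_cmult)
  finally show ?thesis .
qed

text \<open>Young's inequality for the convolution of L1 with L2, from the splitting 1 = 1/2 + 1/2
  of the exponent. The factor (c d)^2 makes the near part small with \<open>d\<close>.\<close>

lemma nn_integral_near_potential_square:
  obtains c where "0 \<le> c" "\<And>d u. 0 < d \<Longrightarrow> u \<in> borel_measurable borel \<Longrightarrow>
    (\<integral>\<^sup>+x. (near_potential 1 d u x)\<^sup>2 \<partial>lborel) \<le> ennreal ((c * d)\<^sup>2) * (\<integral>\<^sup>+y. ennreal ((u y)\<^sup>2) \<partial>lborel)"
proof -
  obtain c where c: "0 \<le> c" "\<And>d. 0 < d \<Longrightarrow> (\<integral>\<^sup>+z. ennreal (near_weight 1 d z) \<partial>lborel) \<le> ennreal (c * d powr (2 - 1))"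
    using nn_integral_near_weight[of 1] by auto
  have "(\<integral>\<^sup>+x. (near_potential 1 d u x)\<^sup>2 \<partial>lborel) \<le> ennreal ((c * d)\<^sup>2) * (\<integral>\<^sup>+y. ennreal ((u y)\<^sup>2) \<partial>lborel)"
    if d: "0 < d" and [measurable]: "borel_fun u" for d u
  proof -
    define W where "W = (\<integral>\<^sup>+z. ennreal (near_weight 1 d z) \<partial>lborel)"
    have W: "W \<le> ennreal (c * d)" using c(2)[OF d] d by (simp add: W_def)
    have "(\<integral>\<^sup>+x. (near_potential 1 d u x)\<^sup>2 \<partial>lborel)
        \<le> (\<integral>\<^sup>+x. W * (\<integral>\<^sup>+y. ennreal (near_weight 1 d (x - y) * (u y)\<^sup>2) \<partial>lborel) \<partial>lborel)"
      using near_potential_square[of u 1 "1/2" "1/2" d] by (intro nn_integral_mono) (simp add: W_def)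
    also have "\<dots> = W * (\<integral>\<^sup>+x. ennreal 1 * (\<integral>\<^sup>+y. ennreal (near_weight 1 d (x - y) * (u y)\<^sup>2) \<partial>lborel) \<partial>lborel)"
      by (subst nn_integral_cmult) simp_all
    also have "\<dots> = W * (\<integral>\<^sup>+y. ennreal ((u y)\<^sup>2) * (\<integral>\<^sup>+x. ennreal (near_weight 1 d (y - x) * 1) \<partial>lborel) \<partial>lborel)"
      by (subst nn_integral_near_weight_swap) auto
    also have "\<dots> = W * (\<integral>\<^sup>+y. ennreal ((u y)\<^sup>2) * W \<partial>lborel)"
      by (simp add: nn_integral_near_weight_translate(1) W_def)
    also have "\<dots> = W * W * (\<integral>\<^sup>+y. ennreal ((u y)\<^sup>2) \<partial>lborel)"
      by (subst nn_integral_multc) (simp_all add: mult_ac)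
    also have "\<dots> \<le> ennreal (c * d) * ennreal (c * d) * (\<integral>\<^sup>+y. ennreal ((u y)\<^sup>2) \<partial>lborel)"
      by (intro mult_right_mono mult_mono W) auto
    also have "ennreal (c * d) * ennreal (c * d) = ennreal ((c * d)\<^sup>2)"
      using c d by (simp add: power2_eq_square flip: ennreal_mult)
    finally show ?thesis .
  qed
  with c(1) show thesis using that by blast
qed

text \<open>A majorant of the modulus of the Coulomb field, valued in \<open>ennreal\<close> so that
  it can be estimated before any integrability is known.\<close>

definition coulomb_potential :: "(R2 \<Rightarrow> real) \<Rightarrow> R2 \<Rightarrow> ennreal" where
  "coulomb_potential u x = (\<integral>\<^sup>+y. ennreal (\<bar>u y\<bar> / norm (x - y)) \<partial>lborel)"

lemma coulomb_potential_borel [measurable]: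
  assumes [measurable]: "borel_fun u"
  shows "borel_fun (coulomb_potential u)"
proof -
  have "(\<lambda>(x, y). ennreal (\<bar>u y\<bar> / norm (x - y))) \<in> borel_measurable (borel \<Otimes>\<^sub>M lborel)"
    by measurable
  from sigma_finite_measure.borel_measurable_nn_integral[OF sigma_finite_lborel this]
  show ?thesis by (simp add: coulomb_potential_def[abs_def])
qed

lemma inverse_norm_le_near_weight: "1 / norm (z :: R2) \<le> near_weight 1 1 z + 1"
proof (cases "norm z < 1")
  case True
  then show ?thesis by (simp add: near_weight_def powr_minus divide_inverse)
next
  case False
  then have "1 / norm z \<le> 1" by (simp add: divide_le_eq)
  with False show ?thesis by (simp add: near_weight_def)
qed

lemma coulomb_potential_le:
  assumes [measurable]: "borel_fun u"
  shows "coulomb_potential u x \<le> near_potential 1 1 u x + (\<integral>\<^sup>+y. ennreal \<bar>u y\<bar> \<partial>lborel)"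
proof -
  have "\<bar>u y\<bar> / norm (x - y) \<le> near_weight 1 1 (x - y) * \<bar>u y\<bar> + \<bar>u y\<bar>" for y
    using mult_left_mono[OF inverse_norm_le_near_weight[of "x - y"], of "\<bar>u y\<bar>"] by (simp add: algebra_simps)
  then have "coulomb_potential u x \<le> (\<integral>\<^sup>+y. ennreal (near_weight 1 1 (x - y) * \<bar>u y\<bar>) + ennreal \<bar>u y\<bar> \<partial>lborel)"
    unfolding coulomb_potential_def
    by (intro nn_integral_mono) (simp add: near_weight_nonneg ennreal_leI flip: ennreal_plus)
  also have "\<dots> = near_potential 1 1 u x + (\<integral>\<^sup>+y. ennreal \<bar>u y\<bar> \<partial>lborel)"
    unfolding near_potential_def by (rule nn_integral_add) measurable
  finally show ?thesis .
qed

text \<open>The near part is estimated by the sup bound, the far part by the L1 bound. For the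
  densities the sup bound is not uniform in \<epsilon>; it yields finiteness and integrability
  rather than the uniform estimates.\<close>

lemma coulomb_potential_bounded:
  obtains c where "0 \<le> c" "\<And>u L M x. u \<in> borel_measurable borel \<Longrightarrow> AE y in lborel. \<bar>u y\<bar> \<le> L \<Longrightarrow> 0 \<le> L \<Longrightarrow>
     (\<integral>\<^sup>+y. ennreal \<bar>u y\<bar> \<partial>lborel) \<le> ennreal M \<Longrightarrow> 0 \<le> M \<Longrightarrow> coulomb_potential u x \<le> ennreal (c * L + M)"
proof -
  obtain c where c: "0 \<le> c" "(\<integral>\<^sup>+z. ennreal (near_weight 1 1 z) \<partial>lborel) \<le> ennreal c"
    using nn_integral_near_weight[of 1] by (metis mult.right_neutral powr_one_eq_one zero_less_one one_less_numeral_iff semiring_norm(76))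
  have "coulomb_potential u x \<le> ennreal (c * L + M)"
    if [measurable]: "borel_fun u" and L: "AE y in lborel. \<bar>u y\<bar> \<le> L" "0 \<le> L"
      and M: "(\<integral>\<^sup>+y. ennreal \<bar>u y\<bar> \<partial>lborel) \<le> ennreal M" "0 \<le> M" for u L M x
  proof -
    have "near_potential 1 1 u x \<le> (\<integral>\<^sup>+y. ennreal (near_weight 1 1 (x - y)) * ennreal L \<partial>lborel)"
      unfolding near_potential_def
    proof (rule nn_integral_mono_AE)
      show "AE y in lborel. ennreal (near_weight 1 1 (x - y) * \<bar>u y\<bar>) \<le> ennreal (near_weight 1 1 (x - y)) * ennreal L"
        using L(1) by eventually_elim (simp add: L near_weight_nonneg mult_left_mono ennreal_leI flip: ennreal_mult)
    qed
    also have "\<dots> = (\<integral>\<^sup>+z. ennreal (near_weight 1 1 z) \<partial>lborel) * ennreal L"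
      by (subst nn_integral_multc) (simp_all add: nn_integral_near_weight_translate(1))
    also have "\<dots> \<le> ennreal c * ennreal L" by (intro mult_right_mono c) simp
    also have "\<dots> = ennreal (c * L)" using c L by (simp add: ennreal_mult)
    finally have "coulomb_potential u x \<le> ennreal (c * L) + ennreal M"
      using coulomb_potential_le[OF that(1), of x] M(1) by (meson add_mono order_trans)
    then show ?thesis using c L M by (simp flip: ennreal_plus)
  qed
  with c(1) show thesis using that by blast
qed

lemma ennreal_square_add_le: "((a::ennreal) + b)\<^sup>2 \<le> 2 * a\<^sup>2 + 2 * b\<^sup>2"
proof -
  consider "a = top" | "b = top" | x y where "a = ennreal x" "b = ennreal y" "0 \<le> x" "0 \<le> y"
    by (cases a; cases b) auto
  then show ?thesis
  proof cases
    case 3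
    have "ennreal ((x + y)\<^sup>2) \<le> ennreal (2 * x\<^sup>2 + 2 * y\<^sup>2)" by (intro ennreal_leI square_add_le)
    also have "\<dots> = 2 * a\<^sup>2 + 2 * b\<^sup>2" using 3 by (simp add: ennreal_power ennreal_mult)
    finally show ?thesis using 3 by (simp add: ennreal_power flip: ennreal_plus)
  qed (auto simp: ennreal_mult_eq_top_iff power2_eq_square ennreal_top_mult)
qed

text \<open>Two Cauchy-Schwarz splittings of the kernel replace the Hardy-Littlewood-Sobolev inequality:
  \<open>1/|z|\<close> is \<open>|z| powr (-3/4) * |z| powr (-1/4)\<close>, and the weight \<open>|z| powr (-1/2)\<close> left over
  after interchanging the integrals is absorbed by \<open>a b \<le> a\<^sup>2 + b\<^sup>2\<close>.\<close>

lemma nn_integral_density_potential_square: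
  assumes "0 \<le> M" "0 \<le> S"
  obtains K where "0 \<le> K" "\<And>u. borel_fun u \<Longrightarrow> (\<integral>\<^sup>+y. ennreal \<bar>u y\<bar> \<partial>lborel) \<le> ennreal M \<Longrightarrow>
     (\<integral>\<^sup>+y. ennreal ((u y)\<^sup>2) \<partial>lborel) \<le> ennreal S \<Longrightarrow>
     (\<integral>\<^sup>+x. ennreal \<bar>u x\<bar> * (coulomb_potential u x)\<^sup>2 \<partial>lborel) \<le> ennreal K"
proof -
  obtain c1 where c1: "0 \<le> c1" "(\<integral>\<^sup>+z. ennreal (near_weight 1 1 z) \<partial>lborel) \<le> ennreal c1"
    using nn_integral_near_weight[of 1] by (metis mult.right_neutral powr_one_eq_one zero_less_one one_less_numeral_iff semiring_norm(76))
  obtain c2 where c2: "0 \<le> c2" "(\<integral>\<^sup>+z. ennreal (near_weight (3/2) 1 z) \<partial>lborel) \<le> ennreal c2"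
  proof -
    have "0 < (3/2::real)" "(3/2::real) < 2" by auto
    from nn_integral_near_weight[OF this] show thesis using that
      by (metis mult.right_neutral powr_one_eq_one zero_less_one)
  qed
  \<comment> \<open>The two summands belong to the near part and to the far part of the kernel, the
    latter giving a potential of at most \<open>M\<close>.\<close>
  define K where "K = 2 * (c2 * (S * (c1 + S))) + 2 * (M\<^sup>2 * M)"
  have "(\<integral>\<^sup>+x. ennreal \<bar>u x\<bar> * (coulomb_potential u x)\<^sup>2 \<partial>lborel) \<le> ennreal K"
    if [measurable]: "borel_fun u" and M: "(\<integral>\<^sup>+y. ennreal \<bar>u y\<bar> \<partial>lborel) \<le> ennreal M"
      and S: "(\<integral>\<^sup>+y. ennreal ((u y)\<^sup>2) \<partial>lborel) \<le> ennreal S" for u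
  proof -
    define N where "N = near_potential 1 1 u"
    have [measurable]: "borel_fun N" unfolding N_def by measurable
    \<comment> \<open>The square of |z|^(-1/2) is the integrable weight |z|^(-1), which contributes
      \<open>c1\<close>; the square of the density contributes \<open>S\<close>.\<close>
    have half: "(\<integral>\<^sup>+x. ennreal (near_weight (1/2) 1 (y - x) * \<bar>u x\<bar>) \<partial>lborel) \<le> ennreal (c1 + S)" for y
    proof -
      have "near_weight (1/2) 1 z * b \<le> near_weight 1 1 z + b\<^sup>2" if "0 \<le> b" for z b
      proof -
        have "near_weight 1 1 z = (near_weight (1/2) 1 z)\<^sup>2"
          by (simp add: near_weight_def power2_eq_square flip: powr_add)
        moreover have "2 * (near_weight (1/2) 1 z * b) \<le> (near_weight (1/2) 1 z)\<^sup>2 + b\<^sup>2"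
          using sum_squares_bound[of "near_weight (1/2) 1 z" b] by (simp add: mult.assoc)
        moreover have "0 \<le> near_weight (1/2) 1 z * b" using that near_weight_nonneg by simp
        ultimately show ?thesis by linarith
      qed
      then have "(\<integral>\<^sup>+x. ennreal (near_weight (1/2) 1 (y - x) * \<bar>u x\<bar>) \<partial>lborel)
          \<le> (\<integral>\<^sup>+x. ennreal (near_weight 1 1 (y - x)) + ennreal ((u x)\<^sup>2) \<partial>lborel)"
        by (intro nn_integral_mono) (metis abs_ge_zero ennreal_leI ennreal_plus near_weight_nonneg power2_abs zero_le_power2)
      also have "\<dots> = (\<integral>\<^sup>+x. ennreal (near_weight 1 1 (y - x)) \<partial>lborel) + (\<integral>\<^sup>+x. ennreal ((u x)\<^sup>2) \<partial>lborel)"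
        by (rule nn_integral_add) measurable
      also have "\<dots> \<le> ennreal c1 + ennreal S"
        unfolding nn_integral_near_weight_translate by (intro add_mono c1 S)
      finally show ?thesis using c1 assms by simp
    qed
    have "(\<integral>\<^sup>+x. ennreal \<bar>u x\<bar> * (N x)\<^sup>2 \<partial>lborel)
        \<le> (\<integral>\<^sup>+x. ennreal c2 * (ennreal \<bar>u x\<bar> * (\<integral>\<^sup>+y. ennreal (near_weight (1/2) 1 (x - y) * (u y)\<^sup>2) \<partial>lborel)) \<partial>lborel)"
    proof (rule nn_integral_mono)
      fix x
      have "(N x)\<^sup>2 \<le> (\<integral>\<^sup>+z. ennreal (near_weight (3/2) 1 z) \<partial>lborel) * (\<integral>\<^sup>+y. ennreal (near_weight (1/2) 1 (x - y) * (u y)\<^sup>2) \<partial>lborel)"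
        using near_potential_square[of u 1 "3/4" "1/4" 1 x] by (simp add: N_def)
      also have "\<dots> \<le> ennreal c2 * (\<integral>\<^sup>+y. ennreal (near_weight (1/2) 1 (x - y) * (u y)\<^sup>2) \<partial>lborel)"
        by (intro mult_right_mono c2) simp
      finally have "ennreal \<bar>u x\<bar> * (N x)\<^sup>2
          \<le> ennreal \<bar>u x\<bar> * (ennreal c2 * (\<integral>\<^sup>+y. ennreal (near_weight (1/2) 1 (x - y) * (u y)\<^sup>2) \<partial>lborel))"
        by (rule mult_left_mono) simp
      then show "ennreal \<bar>u x\<bar> * (N x)\<^sup>2
          \<le> ennreal c2 * (ennreal \<bar>u x\<bar> * (\<integral>\<^sup>+y. ennreal (near_weight (1/2) 1 (x - y) * (u y)\<^sup>2) \<partial>lborel))"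
        by (simp only: mult.left_commute)
    qed
    also have "\<dots> = ennreal c2 * (\<integral>\<^sup>+x. ennreal \<bar>u x\<bar> * (\<integral>\<^sup>+y. ennreal (near_weight (1/2) 1 (x - y) * (u y)\<^sup>2) \<partial>lborel) \<partial>lborel)"
      by (rule nn_integral_cmult) measurable
    also have "\<dots> = ennreal c2 * (\<integral>\<^sup>+y. ennreal ((u y)\<^sup>2) * (\<integral>\<^sup>+x. ennreal (near_weight (1/2) 1 (y - x) * \<bar>u x\<bar>) \<partial>lborel) \<partial>lborel)"
      by (subst nn_integral_near_weight_swap) auto
    also have "\<dots> \<le> ennreal c2 * (\<integral>\<^sup>+y. ennreal ((u y)\<^sup>2) * ennreal (c1 + S) \<partial>lborel)"
      by (intro mult_left_mono nn_integral_mono half) auto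
    also have "\<dots> = ennreal c2 * ((\<integral>\<^sup>+y. ennreal ((u y)\<^sup>2) \<partial>lborel) * ennreal (c1 + S))"
      by (subst nn_integral_multc) auto
    also have "\<dots> \<le> ennreal c2 * (ennreal S * ennreal (c1 + S))"
      by (intro mult_left_mono mult_right_mono S) auto
    finally have N2: "(\<integral>\<^sup>+x. ennreal \<bar>u x\<bar> * (N x)\<^sup>2 \<partial>lborel) \<le> ennreal (c2 * (S * (c1 + S)))"
      using c1 c2 assms by (simp add: ennreal_mult)
    have "(\<integral>\<^sup>+x. ennreal \<bar>u x\<bar> * (coulomb_potential u x)\<^sup>2 \<partial>lborel)
        \<le> (\<integral>\<^sup>+x. 2 * (ennreal \<bar>u x\<bar> * (N x)\<^sup>2) + ennreal (2 * M\<^sup>2) * ennreal \<bar>u x\<bar> \<partial>lborel)"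
    proof (rule nn_integral_mono)
      fix x
      have "coulomb_potential u x \<le> N x + ennreal M"
        using coulomb_potential_le[OF that(1), of x] M unfolding N_def by (meson add_left_mono order_trans)
      then have "(coulomb_potential u x)\<^sup>2 \<le> (N x + ennreal M)\<^sup>2" by (intro power_mono) auto
      also have "\<dots> \<le> 2 * (N x)\<^sup>2 + 2 * (ennreal M)\<^sup>2" by (rule ennreal_square_add_le)
      also have "2 * (ennreal M)\<^sup>2 = ennreal (2 * M\<^sup>2)" using assms by (simp add: ennreal_power ennreal_mult)
      finally have "ennreal \<bar>u x\<bar> * (coulomb_potential u x)\<^sup>2 \<le> ennreal \<bar>u x\<bar> * (2 * (N x)\<^sup>2 + ennreal (2 * M\<^sup>2))"
        by (intro mult_left_mono) auto
      then show "ennreal \<bar>u x\<bar> * (coulomb_potential u x)\<^sup>2 \<le> 2 * (ennreal \<bar>u x\<bar> * (N x)\<^sup>2) + ennreal (2 * M\<^sup>2) * ennreal \<bar>u x\<bar>"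
        by (simp add: distrib_left mult.left_commute mult.commute)
    qed
    also have "\<dots> = 2 * (\<integral>\<^sup>+x. ennreal \<bar>u x\<bar> * (N x)\<^sup>2 \<partial>lborel) + ennreal (2 * M\<^sup>2) * (\<integral>\<^sup>+x. ennreal \<bar>u x\<bar> \<partial>lborel)"
      by (simp add: nn_integral_add nn_integral_cmult)
    also have "\<dots> \<le> 2 * ennreal (c2 * (S * (c1 + S))) + ennreal (2 * M\<^sup>2) * ennreal M"
      by (intro add_mono mult_left_mono N2 M) auto
    also have "\<dots> = ennreal K"
    proof -
      have "2 * ennreal (c2 * (S * (c1 + S))) = ennreal (2 * (c2 * (S * (c1 + S))))"
        using c1 c2 assms by (subst ennreal_mult) auto
      moreover have "ennreal (2 * M\<^sup>2) * ennreal M = ennreal (2 * (M\<^sup>2 * M))"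
        using assms by (subst ennreal_mult[symmetric]) (auto simp: mult.assoc)
      ultimately show ?thesis unfolding K_def using c1 c2 assms by (subst ennreal_plus) auto
    qed
    finally show ?thesis .
  qed
  moreover have "0 \<le> K" using c1 c2 assms by (simp add: K_def)
  ultimately show thesis using that by blast
qed

lemma pred_mem_cball [measurable]: "Measurable.pred borel (\<lambda>x :: 'a::euclidean_space. x \<in> cball a R)"
proof -
  have "{x. x \<in> cball a R} \<in> sets borel" by simp
  then show ?thesis by (simp add: pred_def)
qed

lemma coulomb_kernel_borel [measurable]: "borel_fun coulomb_kernel"
  unfolding coulomb_kernel_def[abs_def] by measurable

lemma laplace_kernel_borel [measurable]: "borel_fun laplace_kernel"
  unfolding laplace_kernel_def[abs_def] by measurable

lemma norm_coulomb_kernel: "norm (coulomb_kernel z) = 1 / norm z"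
  by (cases "z = 0") (simp_all add: coulomb_kernel_def power2_eq_square field_simps)

lemma kernel_convolution_measurable:
  fixes k :: "R2 \<Rightarrow> 'b::euclidean_space"
  assumes [measurable]: "borel_fun k" "case_prod u \<in> borel_measurable (M \<Otimes>\<^sub>M borel)"
  shows "(\<lambda>p. kernel_convolution k (u (fst p)) (snd p)) \<in> borel_measurable (M \<Otimes>\<^sub>M borel)"
proof -
  have "(\<lambda>(p, y). u (fst p) y *\<^sub>R k (snd p - y)) \<in> borel_measurable ((M \<Otimes>\<^sub>M borel) \<Otimes>\<^sub>M lborel)"
    by measurable
  from sigma_finite_measure.borel_measurable_lebesgue_integral[OF sigma_finite_lborel this]
  show ?thesis by (simp add: kernel_convolution_def)
qed

lemma kernel_convolution_borel:
  fixes k :: "R2 \<Rightarrow> 'b::euclidean_space"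
  assumes [measurable]: "borel_fun k" "borel_fun u"
  shows "kernel_convolution k u \<in> borel_measurable borel"
proof -
  have "(\<lambda>(x, y). u y *\<^sub>R k (x - y)) \<in> borel_measurable (borel \<Otimes>\<^sub>M lborel)" by measurable
  from sigma_finite_measure.borel_measurable_lebesgue_integral[OF sigma_finite_lborel this]
  show ?thesis by (simp add: kernel_convolution_def[abs_def])
qed

abbreviation field :: "(R2 \<Rightarrow> real) \<Rightarrow> R2 \<Rightarrow> R2" where
  "field \<equiv> kernel_convolution coulomb_kernel"

lemma coulomb_field_integrable:
  assumes [measurable]: "borel_fun u" and fin: "coulomb_potential u x < \<infinity>"
  shows "integrable lborel (\<lambda>y. u y *\<^sub>R coulomb_kernel (x - y))"
proof (rule integrableI_bounded)
  show "(\<integral>\<^sup>+y. ennreal (norm (u y *\<^sub>R coulomb_kernel (x - y))) \<partial>lborel) < \<infinity>"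
    using fin by (simp add: norm_coulomb_kernel coulomb_potential_def)
qed measurable

lemma norm_coulomb_field_le: "ennreal (norm (field u x)) \<le> coulomb_potential u x"
proof (cases "integrable lborel (\<lambda>y. u y *\<^sub>R coulomb_kernel (x - y))")
  case True
  from integral_norm_bound_ennreal[OF this] show ?thesis
    by (simp add: kernel_convolution_def coulomb_potential_def norm_coulomb_kernel)
next
  case False
  then show ?thesis by (simp add: kernel_convolution_def not_integrable_integral_eq)
qed

text \<open>The two bounds mirror the splitting of the Coulomb kernel: L1 controls its bounded far
  part, L2 its singular part. Estimates on fields that have to be uniform in \<epsilon> and t are
  stated over this class.\<close>

definition L12_bounded :: "real \<Rightarrow> real \<Rightarrow> (R2 \<Rightarrow> real) \<Rightarrow> bool" where
  "L12_bounded M S u \<longleftrightarrow> integrable lborel u \<and> (LBINT x. \<bar>u x\<bar>) \<le> M \<and> l2 u \<and> (sq_int u) \<le> S"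

lemma L12_boundedD:
  assumes "L12_bounded M S u"
  shows "integrable lborel u" "borel_fun u" "l2 u" "sq_int u \<le> S" "0 \<le> M" "0 \<le> S"
    "(\<integral>\<^sup>+x. ennreal \<bar>u x\<bar> \<partial>lborel) \<le> ennreal M" "(\<integral>\<^sup>+x. ennreal ((u x)\<^sup>2) \<partial>lborel) \<le> ennreal S"
    "(LBINT x. \<bar>u x\<bar>) \<le> M"
proof -
  show u: "integrable lborel u" "borel_fun u" "l2 u" "sq_int u \<le> S"
    "(LBINT x. \<bar>u x\<bar>) \<le> M" using assms by (auto simp: L12_bounded_def l2_def)
  have "0 \<le> (LBINT x. \<bar>u x\<bar>)" "0 \<le> sq_int u" by simp_all
  with u show "0 \<le> M" "0 \<le> S" by linarith+
  show "(\<integral>\<^sup>+x. ennreal \<bar>u x\<bar> \<partial>lborel) \<le> ennreal M"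
    using u by (subst nn_integral_eq_integral) (auto intro!: ennreal_leI)
  show "(\<integral>\<^sup>+x. ennreal ((u x)\<^sup>2) \<partial>lborel) \<le> ennreal S"
    using u l2_integrable[OF u(3)] by (subst nn_integral_eq_integral) (auto intro!: ennreal_leI)
qed

text \<open>The passage from \<open>ennreal\<close> to real functions: the near potential is finite
  almost everywhere, so later estimates can use ordinary integrals.\<close>

lemma near_potential_L2:
  obtains c where "0 \<le> c" "\<And>d M S u. 0 < d \<Longrightarrow> L12_bounded M S u \<Longrightarrow>
      (AE x in lborel. near_potential 1 d u x < \<infinity>) \<and> l2 (\<lambda>x. enn2real (near_potential 1 d u x)) \<and>
      (LBINT x. (enn2real (near_potential 1 d u x))\<^sup>2) \<le> (c * d)\<^sup>2 * S"
proof -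
  obtain c where c: "0 \<le> c" "\<And>d u. 0 < d \<Longrightarrow> u \<in> borel_measurable borel \<Longrightarrow>
    (\<integral>\<^sup>+x. (near_potential 1 d u x)\<^sup>2 \<partial>lborel) \<le> ennreal ((c * d)\<^sup>2) * (\<integral>\<^sup>+y. ennreal ((u y)\<^sup>2) \<partial>lborel)"
    using nn_integral_near_potential_square by blast
  show thesis
  proof (rule that[OF c(1)])
    fix d M S :: real and u assume d: "0 < d" and u: "L12_bounded M S u"
    note D = L12_boundedD[OF u]
    note [measurable] = D(2)
    have le: "(\<integral>\<^sup>+x. (near_potential 1 d u x)\<^sup>2 \<partial>lborel) \<le> ennreal ((c * d)\<^sup>2 * S)"
      using order_trans[OF c(2)[OF d D(2)] mult_left_mono[OF D(8)]] D(6) by (simp add: ennreal_mult)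
    then have "(\<integral>\<^sup>+x. (near_potential 1 d u x)\<^sup>2 \<partial>lborel) \<noteq> \<infinity>" by (auto simp: top_unique)
    then have "AE x in lborel. (near_potential 1 d u x)\<^sup>2 \<noteq> \<infinity>"
      by (intro nn_integral_noteq_infinite) auto
    then have fin: "AE x in lborel. near_potential 1 d u x < \<infinity>"
      by eventually_elim (auto simp: power2_eq_square less_top[symmetric])
    have eq: "(\<integral>\<^sup>+x. ennreal ((enn2real (near_potential 1 d u x))\<^sup>2) \<partial>lborel) = (\<integral>\<^sup>+x. (near_potential 1 d u x)\<^sup>2 \<partial>lborel)"
      by (rule nn_integral_cong_AE) (use fin in \<open>eventually_elim, simp add: ennreal_enn2real flip: ennreal_power\<close>)
    have int: "integrable lborel (\<lambda>x. (enn2real (near_potential 1 d u x))\<^sup>2)"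
      by (rule integrableI_nonneg) (use le eq in \<open>auto simp: less_top[symmetric] top_unique\<close>)
    have "(LBINT x. (enn2real (near_potential 1 d u x))\<^sup>2) \<le> (c * d)\<^sup>2 * S"
      using le D(6) unfolding eq[symmetric] by (subst (asm) nn_integral_eq_integral[OF int]) auto
    with fin int show "(AE x in lborel. near_potential 1 d u x < \<infinity>) \<and> l2 (\<lambda>x. enn2real (near_potential 1 d u x)) \<and>
      (LBINT x. (enn2real (near_potential 1 d u x))\<^sup>2) \<le> (c * d)\<^sup>2 * S" by (simp add: l2_def)
  qed
qed

lemma L12_bounded_potential_finite:
  assumes "L12_bounded M S u"
  shows "AE x in lborel. coulomb_potential u x < \<infinity>"
proof -
  note D = L12_boundedD[OF assms]
  have "AE x in lborel. near_potential 1 1 u x < \<infinity>" using near_potential_L2 assms zero_less_one by metis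
  then show ?thesis
  proof eventually_elim
    case (elim x)
    have "coulomb_potential u x \<le> near_potential 1 1 u x + ennreal M"
      using coulomb_potential_le[OF D(2), of x] D(7) by (meson add_left_mono order_trans)
    also have "\<dots> < \<infinity>" using elim by simp
    finally show ?case .
  qed
qed

lemma is_convolution_coulomb:
  assumes "L12_bounded M S u"
  shows "is_convolution coulomb_kernel u (field u)" unfolding is_convolution_def
  using L12_bounded_potential_finite[OF assms] coulomb_field_integrable[OF L12_boundedD(2)[OF assms]]
  by (auto elim: eventually_mono)

lemma L12_bounded_diff:
  assumes "L12_bounded M S u" "L12_bounded M S w"
  shows "L12_bounded (2 * M) (4 * S) (\<lambda>x. u x - w x)"
proof -
  note D = L12_boundedD[OF assms(1)] L12_boundedD[OF assms(2)]
  have "(LBINT x. \<bar>u x - w x\<bar>) \<le> (LBINT x. \<bar>u x\<bar> + \<bar>w x\<bar>)"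
    by (rule integral_mono) (use D(1,10) in auto)
  also have "\<dots> \<le> 2 * M" using D(1,9,10,18) by simp
  finally have 1: "(LBINT x. \<bar>u x - w x\<bar>) \<le> 2 * M" .
  have "(LBINT x. (u x - w x)\<^sup>2) \<le> (LBINT x. 2 * (u x)\<^sup>2 + 2 * (w x)\<^sup>2)"
    by (rule integral_mono) (use l2_integrable[OF l2_diff[OF D(3,12)]] l2_integrable[OF D(3)] l2_integrable[OF D(12)] square_diff_le in auto)
  also have "\<dots> \<le> 4 * S" using l2_integrable[OF D(3)] l2_integrable[OF D(12)] D(4,13) by simp
  finally show ?thesis using 1 D l2_diff[OF D(3,12)] by (simp add: L12_bounded_def)
qed

text \<open>Linearity is available where both convolution integrals converge, hence almost
  everywhere.\<close>

lemma coulomb_field_diff: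
  assumes "L12_bounded M S u" "L12_bounded M S w"
  shows "AE x in lborel. field (\<lambda>x. u x - w x) x
      = field u x - field w x" using is_convolution_coulomb[OF assms(1)] is_convolution_coulomb[OF assms(2)]
  unfolding is_convolution_def by eventually_elim (simp add: kernel_convolution_def scaleR_left_diff_distrib)

text \<open>The near part lies in L2 globally, but the far part is merely bounded, by
  \<open>M\<close>, so square integrability is claimed on balls.\<close>

lemma coulomb_field_L2_loc:
  assumes "0 \<le> M" "0 \<le> S"
  obtains C where "\<And>u. L12_bounded M S u \<Longrightarrow>
      integrable lborel (\<lambda>x. cutoff R x * (norm (field u x))\<^sup>2) \<and>
      (LBINT x. cutoff R x * (norm (field u x))\<^sup>2) \<le> C"
proof -
  obtain c where c: "\<And>d M S u. 0 < d \<Longrightarrow> L12_bounded M S u \<Longrightarrow>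
      (AE x in lborel. near_potential 1 d u x < \<infinity>) \<and> l2 (\<lambda>x. enn2real (near_potential 1 d u x)) \<and>
      (LBINT x. (enn2real (near_potential 1 d u x))\<^sup>2) \<le> (c * d)\<^sup>2 * S"
    using near_potential_L2 by metis
  let ?I = "\<lambda>x :: R2. cutoff R x :: real"
  have intI: "integrable lborel ?I" by (rule integrable_real_indicator) auto
  show thesis
  proof (rule that[of "2 * (c\<^sup>2 * S) + 2 * M\<^sup>2 * (LBINT x. ?I x)"])
    fix u assume u: "L12_bounded M S u"
    note D = L12_boundedD[OF u]
    note [measurable] = D(2)
    let ?n = "\<lambda>x. enn2real (near_potential 1 1 u x)"
    have n: "AE x in lborel. near_potential 1 1 u x < \<infinity>" "l2 ?n" "sq_int ?n \<le> c\<^sup>2 * S"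
      using c[of 1 M S u] u by auto
    let ?B = "\<lambda>x. 2 * (?n x)\<^sup>2 + 2 * M\<^sup>2 * ?I x"
    have intB: "integrable lborel ?B" using l2_integrable[OF n(2)] intI by simp
    have le: "AE x in lborel. ?I x * (norm (field u x))\<^sup>2 \<le> ?B x" using n(1)
    proof eventually_elim
      case (elim x)
      have "ennreal (norm (field u x)) \<le> near_potential 1 1 u x + ennreal M"
        using norm_coulomb_field_le[of u x] coulomb_potential_le[OF D(2), of x] D(7) by (meson add_left_mono order_trans)
      also have "\<dots> = ennreal (?n x + M)" using elim D(5) by (simp add: ennreal_enn2real ennreal_plus)
      finally have "norm (field u x) \<le> ?n x + M" by (rule ennreal_le_iff[THEN iffD1, rotated]) (use D(5) in simp)
      then have "(norm (field u x))\<^sup>2 \<le> (?n x + M)\<^sup>2" by (rule power_mono) simp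
      also have "\<dots> \<le> 2 * (?n x)\<^sup>2 + 2 * M\<^sup>2" by (rule square_add_le)
      finally show ?case by (simp add: indicator_def)
    qed
    have [measurable]: "borel_fun (field u)" by (rule kernel_convolution_borel) measurable
    have m: "(\<lambda>x. ?I x * (norm (field u x))\<^sup>2) \<in> borel_measurable lborel" by measurable
    have int: "integrable lborel (\<lambda>x. ?I x * (norm (field u x))\<^sup>2)"
      by (rule dominated_integrable[OF intB m]) (use le in \<open>eventually_elim, simp\<close>)
    have "(LBINT x. ?I x * (norm (field u x))\<^sup>2) \<le> (LBINT x. ?B x)"
      by (rule integral_mono_AE[OF int intB le])
    also have "\<dots> \<le> 2 * (c\<^sup>2 * S) + 2 * M\<^sup>2 * (LBINT x. ?I x)"
      using l2_integrable[OF n(2)] intI n(3) by simp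
    finally show "integrable lborel (\<lambda>x. ?I x * (norm (field u x))\<^sup>2) \<and>
      (LBINT x. ?I x * (norm (field u x))\<^sup>2) \<le> 2 * (c\<^sup>2 * S) + 2 * M\<^sup>2 * (LBINT x. ?I x)"
      using int by simp
  qed
qed

text \<open>The part of the kernel away from the origin and from infinity maps weakly null sequences to
  pointwise null sequences; the remaining parts are small in \<open>L\<^sup>2\<close> uniformly along the sequence.\<close>

lemma coulomb_field_compact:
  assumes g: "\<And>j. L12_bounded M S (g j)"
    and weak: "\<And>\<phi>. l2 \<phi> \<Longrightarrow> (\<lambda>j. pairing \<phi> (g j)) \<longlonglongrightarrow> 0"
  shows "(\<lambda>j. LBINT x. cutoff R x * (norm (field (g j) x))\<^sup>2) \<longlonglongrightarrow> 0"
proof -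
  note D = L12_boundedD[OF g]
  have gb [measurable]: "borel_fun (g j)" for j by (rule D(2))
  have M: "0 \<le> M" and S: "0 \<le> S" by (rule D(5), rule D(6))
  obtain c where c: "\<And>\<delta> M S u. 0 < \<delta> \<Longrightarrow> L12_bounded M S u \<Longrightarrow>
      (AE x in lborel. near_potential 1 \<delta> u x < \<infinity>) \<and> l2 (\<lambda>x. enn2real (near_potential 1 \<delta> u x)) \<and>
      (LBINT x. (enn2real (near_potential 1 \<delta> u x))\<^sup>2) \<le> (c * \<delta>)\<^sup>2 * S"
    using near_potential_L2 by metis
  let ?I = "\<lambda>x :: R2. cutoff R x :: real"
  let ?E = "\<lambda>j. field (g j)"
  have intI: "integrable lborel ?I" by (rule integrable_real_indicator) auto
  define V where "V = (LBINT x. ?I x)"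
  have V: "0 \<le> V" by (simp add: V_def)
  \<comment> \<open>The first two terms are of order \<delta>^2 uniformly in j; \<open>X\<close> is
    the contribution of the truncated kernel and vanishes as j grows with \<delta> fixed.\<close>
  have key: "\<exists>X. X \<longlonglongrightarrow> 0 \<and> (\<forall>j. (LBINT x. ?I x * (norm (?E j x))\<^sup>2) \<le> 3 * ((c * \<delta>)\<^sup>2 * S) + 3 * ((\<delta> * M)\<^sup>2 * V) + X j)"
    if \<delta>: "0 < \<delta>" for \<delta>
  proof -
    define k where "k z = (if \<delta> \<le> norm z \<and> norm z \<le> 1 / \<delta> then coulomb_kernel z else 0)" for z
    have [measurable]: "borel_fun k" unfolding k_def[abs_def] by measurable
    have kb: "norm (k z) \<le> 1 / \<delta>" for z
      using \<delta> by (auto simp: k_def norm_coulomb_kernel intro!: frac_le)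
    \<comment> \<open>Truncation removes the singular part inside radius \<delta> and a tail of size
      below \<delta> outside radius 1 / \<delta>.\<close>
    have kd: "norm (coulomb_kernel z - k z) \<le> near_weight 1 \<delta> z + \<delta>" for z
      using \<delta> by (auto simp: k_def near_weight_def norm_coulomb_kernel powr_minus divide_simps mult.commute)
    define m where "m j = kernel_convolution k (g j)" for j
    have mb [measurable]: "borel_fun (m j)" for j unfolding m_def by (rule kernel_convolution_borel) measurable
    have intk: "integrable lborel (\<lambda>y. g j y *\<^sub>R k (x - y))" for j x
    proof (rule dominated_integrable[of _ "\<lambda>y. g j y * (1 / \<delta>)"])
      show "integrable lborel (\<lambda>y. g j y * (1 / \<delta>))" using D(1) by simp
      show "AE y in lborel. norm (g j y *\<^sub>R k (x - y)) \<le> norm (g j y * (1 / \<delta>))"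
      proof (rule AE_I2)
        fix y
        show "norm (g j y *\<^sub>R k (x - y)) \<le> norm (g j y * (1 / \<delta>))"
          using mult_left_mono[OF kb[of "x - y"], of "\<bar>g j y\<bar>"] \<delta> by (simp add: abs_mult)
      qed
    qed measurable
    have mbound: "norm (m j x) \<le> M / \<delta>" for j x
    proof -
      have "norm (m j x) \<le> (LBINT y. norm (g j y *\<^sub>R k (x - y)))"
        unfolding m_def kernel_convolution_def by (rule integral_norm_bound)
      also have "\<dots> \<le> (LBINT y. \<bar>g j y\<bar> * (1 / \<delta>))"
      proof (rule integral_mono)
        show "integrable lborel (\<lambda>y. norm (g j y *\<^sub>R k (x - y)))" by (rule integrable_norm[OF intk])
        show "integrable lborel (\<lambda>y. \<bar>g j y\<bar> * (1 / \<delta>))" using D(1) by simp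
        show "norm (g j y *\<^sub>R k (x - y)) \<le> \<bar>g j y\<bar> * (1 / \<delta>)" for y
          using mult_left_mono[OF kb, of "\<bar>g j y\<bar>"] by simp
      qed
      also have "\<dots> \<le> M / \<delta>" using D(9)[of j] \<delta> by (simp add: divide_right_mono)
      finally show ?thesis .
    qed
    \<comment> \<open>Each component of \<open>k (x - y)\<close>, as a function of \<open>y\<close>,
      is bounded with compact support, so it is an admissible weak test function.\<close>
    have mlim: "(\<lambda>j. m j x) \<longlonglongrightarrow> 0" for x
    proof (rule vec_tendstoI)
      fix i
      have "l2 (\<lambda>y. k (x - y) $ i)"
      proof (rule l2_bounded_support[where B = "1 / \<delta>" and R = "norm x + 1 / \<delta> + 1"])
        show "borel_fun (\<lambda>y. k (x - y) $ i)" by measurable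
        show "\<bar>k (x - y) $ i\<bar> \<le> 1 / \<delta>" for y using component_le_norm_cart[of "k (x - y)" i] kb[of "x - y"] by linarith
        show "k (x - y) $ i = 0" if "norm y \<ge> norm x + 1 / \<delta> + 1" for y
          using that norm_triangle_ineq2[of y x] by (simp add: k_def norm_minus_commute)
      qed
      from weak[OF this] have "(\<lambda>j. LBINT y. g j y * k (x - y) $ i) \<longlonglongrightarrow> 0" by (simp add: mult.commute)
      moreover have "m j x $ i = (LBINT y. g j y * k (x - y) $ i)" for j
        using integral_bounded_linear[OF bounded_linear_vec_nth[of i] intk[of j x]]
        by (simp add: m_def kernel_convolution_def)
      ultimately show "(\<lambda>j. m j x $ i) \<longlonglongrightarrow> 0 $ i" by simp
    qed
    have mI: "integrable lborel (\<lambda>x. ?I x * (norm (m j x))\<^sup>2)" for j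
    proof (rule dominated_integrable[of _ "\<lambda>x. ?I x * (M / \<delta>)\<^sup>2"])
      show "integrable lborel (\<lambda>x. ?I x * (M / \<delta>)\<^sup>2)" using intI by simp
      show "AE x in lborel. norm (?I x * (norm (m j x))\<^sup>2) \<le> norm (?I x * (M / \<delta>)\<^sup>2)"
        using mbound by (intro AE_I2) (auto simp: indicator_def intro!: power_mono)
    qed measurable
    have "(\<lambda>j. LBINT x. ?I x * (norm (m j x))\<^sup>2) \<longlonglongrightarrow> (LINT x::R2|lborel. (0::real))"
    proof (rule integral_dominated_convergence[where w = "\<lambda>x. ?I x * (M / \<delta>)\<^sup>2"])
      show "integrable lborel (\<lambda>x. ?I x * (M / \<delta>)\<^sup>2)" using intI by simp
      show "AE x in lborel. (\<lambda>j. ?I x * (norm (m j x))\<^sup>2) \<longlonglongrightarrow> 0"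
      proof (rule AE_I2)
        fix x
        have "(\<lambda>j. ?I x * (norm (m j x))\<^sup>2) \<longlonglongrightarrow> ?I x * (norm (0::R2))\<^sup>2"
          by (intro tendsto_mult tendsto_const tendsto_power tendsto_norm mlim)
        then show "(\<lambda>j. ?I x * (norm (m j x))\<^sup>2) \<longlonglongrightarrow> 0" by simp
      qed
      show "AE x in lborel. norm (?I x * (norm (m j x))\<^sup>2) \<le> ?I x * (M / \<delta>)\<^sup>2" for j
        using mbound by (intro AE_I2) (auto simp: indicator_def intro!: power_mono)
    qed measurable
    then have X: "(\<lambda>j. 3 * (LBINT x. ?I x * (norm (m j x))\<^sup>2)) \<longlonglongrightarrow> 0"
      using tendsto_mult_left[of _ 0 sequentially 3] by simp
    have "(LBINT x. ?I x * (norm (?E j x))\<^sup>2)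
        \<le> 3 * ((c * \<delta>)\<^sup>2 * S) + 3 * ((\<delta> * M)\<^sup>2 * V) + 3 * (LBINT x. ?I x * (norm (m j x))\<^sup>2)" for j
    proof -
      let ?n = "\<lambda>x. enn2real (near_potential 1 \<delta> (g j) x)"
      have n: "AE x in lborel. near_potential 1 \<delta> (g j) x < \<infinity>" "l2 ?n" "sq_int ?n \<le> (c * \<delta>)\<^sup>2 * S"
        using c[OF \<delta> g[of j]] by auto
      let ?B = "\<lambda>x. 3 * (?n x)\<^sup>2 + 3 * (\<delta> * M)\<^sup>2 * ?I x + 3 * (?I x * (norm (m j x))\<^sup>2)"
      have intB: "integrable lborel ?B" using l2_integrable[OF n(2)] intI mI by simp
      have "(LBINT x. ?I x * (norm (?E j x))\<^sup>2) \<le> (LBINT x. ?B x)"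
      proof (rule integral_mono_AE'[OF intB])
        show "AE x in lborel. ?I x * (norm (?E j x))\<^sup>2 \<le> ?B x"
          using n(1) L12_bounded_potential_finite[OF g[of j]]
        proof eventually_elim
          case (elim x)
          have intE: "integrable lborel (\<lambda>y. g j y *\<^sub>R coulomb_kernel (x - y))"
            by (rule coulomb_field_integrable[OF gb elim(2)])
          have "?E j x - m j x = (LBINT y. g j y *\<^sub>R (coulomb_kernel (x - y) - k (x - y)))"
            using intE intk by (simp add: m_def kernel_convolution_def scaleR_right_diff_distrib)
          moreover have "integrable lborel (\<lambda>y. g j y *\<^sub>R (coulomb_kernel (x - y) - k (x - y)))"
            using intE intk by (simp add: scaleR_right_diff_distrib)
          ultimately have "ennreal (norm (?E j x - m j x))
              \<le> (\<integral>\<^sup>+y. ennreal (norm (g j y *\<^sub>R (coulomb_kernel (x - y) - k (x - y)))) \<partial>lborel)"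
            by (simp only: integral_norm_bound_ennreal)
          also have "\<dots> \<le> (\<integral>\<^sup>+y. ennreal (near_weight 1 \<delta> (x - y) * \<bar>g j y\<bar>) + ennreal \<delta> * ennreal \<bar>g j y\<bar> \<partial>lborel)"
          proof (rule nn_integral_mono)
            fix y
            have "norm (g j y *\<^sub>R (coulomb_kernel (x - y) - k (x - y))) \<le> near_weight 1 \<delta> (x - y) * \<bar>g j y\<bar> + \<delta> * \<bar>g j y\<bar>"
              using mult_left_mono[OF kd[of "x - y"], of "\<bar>g j y\<bar>"] unfolding norm_scaleR distrib_left
              by (simp add: mult.commute)
            then show "ennreal (norm (g j y *\<^sub>R (coulomb_kernel (x - y) - k (x - y))))
                \<le> ennreal (near_weight 1 \<delta> (x - y) * \<bar>g j y\<bar>) + ennreal \<delta> * ennreal \<bar>g j y\<bar>"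
              using \<delta> by (simp add: near_weight_nonneg ennreal_leI flip: ennreal_plus ennreal_mult)
          qed
          also have "\<dots> = near_potential 1 \<delta> (g j) x + ennreal \<delta> * (\<integral>\<^sup>+y. ennreal \<bar>g j y\<bar> \<partial>lborel)"
            by (simp add: nn_integral_add nn_integral_cmult near_potential_def)
          also have "\<dots> \<le> near_potential 1 \<delta> (g j) x + ennreal \<delta> * ennreal M"
            by (intro add_left_mono mult_left_mono D(7)) simp
          also have "\<dots> = ennreal (?n x + \<delta> * M)"
            using elim(1) \<delta> M by (simp add: ennreal_enn2real ennreal_plus ennreal_mult)
          finally have "norm (?E j x - m j x) \<le> ?n x + \<delta> * M"
            by (rule ennreal_le_iff[THEN iffD1, rotated]) (use \<delta> M in simp)
          then have "norm (?E j x) \<le> (?n x + \<delta> * M) + norm (m j x)"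
            using norm_triangle_ineq2[of "?E j x" "m j x"] by linarith
          then have "(norm (?E j x))\<^sup>2 \<le> ((?n x + \<delta> * M) + norm (m j x))\<^sup>2" by (rule power_mono) simp
          also have "\<dots> \<le> 3 * (?n x)\<^sup>2 + 3 * (\<delta> * M)\<^sup>2 + 3 * (norm (m j x))\<^sup>2"
          proof -
            have "(a + b + d)\<^sup>2 \<le> 3 * a\<^sup>2 + 3 * b\<^sup>2 + 3 * d\<^sup>2" for a b d :: real
            proof -
              have "0 \<le> (a - b)\<^sup>2 + (b - d)\<^sup>2 + (a - d)\<^sup>2" by simp
              then show ?thesis by (simp add: power2_eq_square algebra_simps)
            qed
            then show ?thesis .
          qed
          finally show ?case by (simp add: indicator_def)
        qed
        show "AE x in lborel. 0 \<le> ?B x" by (intro AE_I2) simp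
      qed
      also have "\<dots> = 3 * sq_int ?n + 3 * (\<delta> * M)\<^sup>2 * V + 3 * (LBINT x. ?I x * (norm (m j x))\<^sup>2)"
        using l2_integrable[OF n(2)] intI mI by (simp add: V_def)
      also have "\<dots> \<le> 3 * ((c * \<delta>)\<^sup>2 * S) + 3 * ((\<delta> * M)\<^sup>2 * V) + 3 * (LBINT x. ?I x * (norm (m j x))\<^sup>2)"
        using n(3) by simp
      finally show ?thesis .
    qed
    with X show ?thesis by blast
  qed
  show ?thesis
  proof (rule LIMSEQ_I)
    fix e :: real assume e: "0 < e"
    define A where "A = 3 * (c\<^sup>2 * S) + 3 * (M\<^sup>2 * V)"
    have A: "0 \<le> A" using S V by (simp add: A_def)
    \<comment> \<open>This makes A \<delta>^2 at most e / 2; the 1 added to \<open>A\<close> covers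
      the case A = 0.\<close>
    define \<delta> where "\<delta> = sqrt (e / (2 * (A + 1)))"
    have \<delta>: "0 < \<delta>" using e A by (simp add: \<delta>_def)
    have "\<delta>\<^sup>2 = e / (2 * (A + 1))" using e A by (simp add: \<delta>_def)
    then have "2 * \<delta>\<^sup>2 + A * (2 * \<delta>\<^sup>2) = e" using e A by (simp add: field_simps)
    then have "A * \<delta>\<^sup>2 \<le> e / 2" using zero_le_power2[of \<delta>] by linarith
    then have small: "3 * ((c * \<delta>)\<^sup>2 * S) + 3 * ((\<delta> * M)\<^sup>2 * V) \<le> e / 2"
      by (simp add: A_def power_mult_distrib algebra_simps)
    obtain X where X: "X \<longlonglongrightarrow> 0"
      "\<And>j. (LBINT x. ?I x * (norm (?E j x))\<^sup>2) \<le> 3 * ((c * \<delta>)\<^sup>2 * S) + 3 * ((\<delta> * M)\<^sup>2 * V) + X j"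
      using key[OF \<delta>] by blast
    have "\<forall>\<^sub>F j in sequentially. X j < e / 2" using X(1) e by (intro order_tendstoD) auto
    then obtain N where N: "\<And>j. j \<ge> N \<Longrightarrow> X j < e / 2" by (auto simp: eventually_sequentially)
    show "\<exists>N. \<forall>j\<ge>N. norm ((LBINT x. ?I x * (norm (?E j x))\<^sup>2) - 0) < e"
    proof (intro exI allI impI)
      fix j assume "N \<le> j"
      have "0 \<le> (LBINT x. ?I x * (norm (?E j x))\<^sup>2)" by (rule Bochner_Integration.integral_nonneg) simp
      with X(2)[of j] N[OF \<open>N \<le> j\<close>] small show "norm ((LBINT x. ?I x * (norm (?E j x))\<^sup>2) - 0) < e"
        by simp
    qed
  qed
qed

section \<open>The logarithmic potential\<close>

lemma Ck_ln:
  assumes "\<And>x. 0 < f x" "Ck k f"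
  shows "Ck k (\<lambda>x. ln (f x))"
proof (cases k)
  case 0
  with assms show ?thesis by (auto intro!: continuous_intros simp: less_le)
next
  case (Suc l)
  with assms have f: "Ck (Suc l) f" by simp
  show ?thesis unfolding Suc
  proof (rule Ck_SucI)
    show "((\<lambda>x. ln (f x)) has_derivative (\<lambda>h. FD f x h * inverse (f x))) (at x)" for x
      by (rule has_derivative_ln[OF assms(1) Ck_SucD(1)[OF f]])
    show "Ck l (\<lambda>x. FD f x h * inverse (f x))" for h
      using assms(1) by (intro Ck_mult Ck_SucD(2)[OF f] Ck_inverse Ck_mono[OF f]) (simp add: less_le)
  qed
qed

lemma perp_nth [simp]: "perp v $ 1 = - (v $ 2)" "perp v $ 2 = v $ 1" by (simp_all add: perp_def)

lemma vec_eq_R2: "v = w \<longleftrightarrow> v $ 1 = w $ 1 \<and> v $ 2 = w $ 2" for v w :: R2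
  by (auto simp: vec_eq_iff forall_2)

lemma norm_perp [simp]: "norm (perp v) = norm v" by (simp add: norm_vec_def L2_set_def UNIV_2 add.commute)

lemma bounded_linear_perp: "bounded_linear perp" by (rule bounded_linear_intro[where K = 1]) (simp_all add: vec_eq_R2)

lemma perp_borel [measurable]: "borel_fun perp"
  by (intro borel_measurable_continuous_onI linear_continuous_on bounded_linear_perp)

lemma inner_R2: "v \<bullet> w = v $ 1 * w $ 1 + v $ 2 * w $ 2" for v w :: R2 by (simp add: inner_vec_def UNIV_2)

lemma integrable_over_norm:
  fixes \<phi> :: "R2 \<Rightarrow> real"
  assumes [measurable]: "borel_fun \<phi>" and B: "\<And>x. \<bar>\<phi> x\<bar> \<le> B" and R: "\<And>x. norm x \<ge> R \<Longrightarrow> \<phi> x = 0"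
  shows "integrable lborel (\<lambda>x. \<bar>\<phi> x\<bar> / norm (x - y))"
proof (rule integrableI_nonneg)
  have "integrable lborel \<phi>" by (rule integrable_bounded_support[OF assms(1) _ R]) (use B in auto)
  then have M: "(\<integral>\<^sup>+x. ennreal \<bar>\<phi> x\<bar> \<partial>lborel) \<le> ennreal (LBINT x. \<bar>\<phi> x\<bar>)"
    by (subst nn_integral_eq_integral) auto
  have B0: "0 \<le> B" using B[of 0] by linarith
  obtain c where "\<And>u L M x. u \<in> borel_measurable borel \<Longrightarrow> AE y in lborel. \<bar>u y\<bar> \<le> L \<Longrightarrow> 0 \<le> L \<Longrightarrow>
     (\<integral>\<^sup>+y. ennreal \<bar>u y\<bar> \<partial>lborel) \<le> ennreal M \<Longrightarrow> 0 \<le> M \<Longrightarrow> coulomb_potential u x \<le> ennreal (c * L + M)"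
    using coulomb_potential_bounded by metis
  from this[OF assms(1) AE_I2[OF B] B0 M, of y]
  have "coulomb_potential \<phi> y \<le> ennreal (c * B + (LBINT x. \<bar>\<phi> x\<bar>))" by simp
  also have "\<dots> < \<infinity>" by simp
  finally show "(\<integral>\<^sup>+x. ennreal (\<bar>\<phi> x\<bar> / norm (x - y)) \<partial>lborel) < \<infinity>"
    by (simp add: coulomb_potential_def norm_minus_commute)
qed auto

lemma abs_ln_norm_le: "\<bar>ln (norm z)\<bar> \<le> 1 / norm z + norm (z :: R2)"
proof (cases "z = 0")
  case False
  then have r: "0 < norm z" by simp
  have "ln (norm z) \<le> norm z" using ln_le_minus_one[OF r] by simp
  moreover have "- ln (norm z) \<le> 1 / norm z" using ln_le_minus_one[of "1 / norm z"] r by (simp add: ln_div)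
  moreover have "0 < 1 / norm z" using r by simp
  ultimately show ?thesis using r by linarith
qed simp

lemma abs_laplace_kernel_le: "\<bar>laplace_kernel z\<bar> \<le> 1 / norm z + norm z"
proof -
  have "\<bar>laplace_kernel z\<bar> = \<bar>ln (norm z)\<bar> / (2 * pi)" by (simp add: laplace_kernel_def)
  also have "\<dots> \<le> \<bar>ln (norm z)\<bar> / 1" by (rule divide_left_mono) (use pi_ge_two in auto)
  finally show ?thesis using abs_ln_norm_le[of z] by simp
qed

text \<open>The function ln |z| is replaced by half of ln (|z|^2 + c), which is smooth everywhere;
  its product with \<phi> is a test function, so the derivative of the product integrates to 0. Then
  c tends to 0, with majorants built from 1 / |x - y| and powers of |x - y|.\<close>

lemma log_kernel_weak_derivative:
  fixes \<phi> :: "R2 \<Rightarrow> real"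
  assumes \<phi>: "test_function \<phi>"
  shows "(LBINT x. \<phi> x * (coulomb_kernel (x - y) \<bullet> h)) = - (LBINT x. ln (norm (x - y)) * FD \<phi> x h)"
proof -
  define c where "c n = 1 / real (Suc n)" for n
  have c: "0 < c n" "c n \<le> 1" for n by (auto simp: c_def)
  have clim: "c \<longlonglongrightarrow> 0" unfolding c_def by (rule LIMSEQ_Suc[OF lim_1_over_n])
  define s where "s n x = (x - y) \<bullet> (x - y) + c n" for n and x :: R2
  have s: "0 < s n x" for n x using c[of n] by (simp add: s_def add_nonneg_pos)
  define u where "u n x = 1 / 2 * ln (s n x)" for n x
  have Cs: "Ck k (s n)" for k n
  proof -
    have "Ck k (\<lambda>x::R2. (- y + x) \<bullet> (- y + x))"
      by (rule Ck_compose_affine[OF bounded_linear_ident Ck_inner])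
    then show ?thesis unfolding s_def[abs_def] by (intro Ck_add Ck_const) simp
  qed
  have Cu: "Ck k (u n)" for k n unfolding u_def[abs_def] by (intro Ck_cmult Ck_ln s Cs)
  let ?D = "\<lambda>x. FD \<phi> x h"
  have du: "(u n has_derivative (\<lambda>h. ((x - y) \<bullet> h) / s n x)) (at x)" for n x

  proof -
    have d0: "((\<lambda>x. x - y) has_derivative (\<lambda>h. h)) (at x)" by (auto intro!: derivative_eq_intros)
    have "(s n has_derivative (\<lambda>h. (x - y) \<bullet> h + h \<bullet> (x - y))) (at x)"
      unfolding s_def[abs_def] using has_derivative_inner[OF d0 d0] by (rule has_derivative_add_const)
    note d = has_derivative_mult_right[OF has_derivative_ln[OF s this], of "1 / 2"]
    have "1 / 2 * (((x - y) \<bullet> h + h \<bullet> (x - y)) * inverse (s n x)) = ((x - y) \<bullet> h) / s n x" for h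
    proof -
      have "1 / 2 * ((a + a) * inverse b) = a / b" for a b :: real by (cases "b = 0") (simp_all add: field_simps)
      then show ?thesis unfolding inner_commute[of h "x - y"] .
    qed
    from d[unfolded this] show ?thesis unfolding u_def[abs_def] .
  qed
  have zero: "(LBINT x. \<phi> x * (((x - y) \<bullet> h) / s n x) + ?D x * u n x) = 0" for n
  proof -
    have D: "((\<lambda>x. \<phi> x * u n x) has_derivative (\<lambda>h. \<phi> x * (((x - y) \<bullet> h) / s n x) + FD \<phi> x h * u n x)) (at x)" for x
      by (rule has_derivative_mult[OF Ck_SucD(1)[OF test_function_Ck[OF \<phi>]] du])
    have "frechet_derivative (\<lambda>x. \<phi> x * u n x) (at x) h = \<phi> x * (((x - y) \<bullet> h) / s n x) + ?D x * u n x" for x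
      by (rule fun_cong[OF frechet_derivative_at[OF D], symmetric])
    with test_function_integral_derivative[OF test_function_mult[OF \<phi> Cu], of n h] show ?thesis by simp
  qed
  note test = test_function_derivative[OF \<phi>, of h]
  have [measurable]: "borel_fun \<phi>" "?D \<in> borel_measurable borel"
    using test_function_borel \<phi> test by auto
  have sm [measurable]: "borel_fun (s n)" "borel_fun (u n)" for n
    unfolding u_def[abs_def] s_def[abs_def] by measurable
  obtain B1 where B1: "\<And>x. \<bar>\<phi> x\<bar> \<le> B1" using test_function_bounded[OF \<phi>] by metis
  obtain B2 where B2: "\<And>x. \<bar>?D x\<bar> \<le> B2" using test_function_bounded[OF test] by metis
  obtain R where R: "\<And>x. norm x \<ge> R \<Longrightarrow> \<phi> x = 0" "\<And>x. norm x \<ge> R \<Longrightarrow> ?D x = 0" "R > 0"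
    using test_function_support[OF \<phi>] by metis
  have i1: "integrable lborel (\<lambda>x. \<bar>\<phi> x\<bar> / norm (x - y))" by (rule integrable_over_norm[OF _ B1 R(1)]) measurable
  have i2: "integrable lborel (\<lambda>x. \<bar>?D x\<bar> / norm (x - y))" by (rule integrable_over_norm[OF _ B2 R(2)]) measurable
  have i3: "integrable lborel (\<lambda>x. \<bar>?D x\<bar> * (norm (x - y) + (norm (x - y))\<^sup>2))"
  proof (rule integrable_bounded_support[where R = R and B = "B2 * ((R + norm y) + (R + norm y)\<^sup>2)"])
    fix x
    show "norm (\<bar>?D x\<bar> * (norm (x - y) + (norm (x - y))\<^sup>2)) \<le> B2 * ((R + norm y) + (R + norm y)\<^sup>2)"
    proof (cases "norm x \<ge> R")
      case True
      have "0 \<le> B2" using B2[of 0] by linarith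
      then show ?thesis using R(2)[OF True] R(3) by simp
    next
      case False
      then have "norm (x - y) \<le> R + norm y" using norm_triangle_ineq4[of x y] by linarith
      then have "norm (x - y) + (norm (x - y))\<^sup>2 \<le> (R + norm y) + (R + norm y)\<^sup>2"
        by (intro add_mono power_mono) auto
      with B2[of x] have "\<bar>?D x\<bar> * (norm (x - y) + (norm (x - y))\<^sup>2) \<le> B2 * ((R + norm y) + (R + norm y)\<^sup>2)"
        by (intro mult_mono) auto
      then show ?thesis by (simp add: abs_mult)
    qed
  qed (use R in auto)
  have sx: "s n x = (norm (x - y))\<^sup>2 + c n" for n x by (simp add: s_def power2_norm_eq_inner)
  have dist0: "AE x in lborel. x \<noteq> y" using AE_lborel_singleton[of y] .
  have slim: "(\<lambda>n. s n x) \<longlonglongrightarrow> (norm (x - y))\<^sup>2" for x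
    unfolding sx using tendsto_add[OF tendsto_const clim] by simp
  have b1: "\<bar>\<phi> x * (((x - y) \<bullet> h) / s n x)\<bar> \<le> norm h * (\<bar>\<phi> x\<bar> / norm (x - y))" for n x
  proof (cases "x = y")
    case False
    then have r: "0 < norm (x - y)" by simp
    have "\<bar>(x - y) \<bullet> h\<bar> / s n x \<le> (norm (x - y) * norm h) / (norm (x - y))\<^sup>2"
      using r c[of n] by (intro frac_le Cauchy_Schwarz_ineq2) (auto simp: sx)
    also have "\<dots> = norm h / norm (x - y)" using r by (simp add: power2_eq_square)
    finally have "\<bar>\<phi> x\<bar> * (\<bar>(x - y) \<bullet> h\<bar> / s n x) \<le> \<bar>\<phi> x\<bar> * (norm h / norm (x - y))"
      by (rule mult_left_mono) simp
    then show ?thesis using s[of n x] by (simp add: abs_mult mult.commute)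
  qed simp
  \<comment> \<open>From above, ln s \<le> s - 1 and c \<le> 1 give r^2; from below, s is at least
    r^2. One bound thus serves all n.\<close>
  have b2: "\<bar>u n x\<bar> \<le> 1 / norm (x - y) + (norm (x - y) + (norm (x - y))\<^sup>2)" if "x \<noteq> y" for n x
  proof -
    define r where "r = norm (x - y)"
    have r: "0 < r" using that by (simp add: r_def)
    have "ln (s n x) \<le> s n x - 1" by (rule ln_le_minus_one[OF s])
    moreover have "s n x = r\<^sup>2 + c n" by (simp add: sx r_def)
    ultimately have up: "u n x \<le> r\<^sup>2" unfolding u_def using c(2)[of n] zero_le_power2[of r] by linarith
    have "ln (r\<^sup>2) \<le> ln (s n x)" using r c[of n] by (intro ln_mono) (auto simp: sx r_def)
    then have "ln r \<le> u n x" using r by (simp add: u_def ln_realpow)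
    then have lo: "- (1 / r + r) \<le> u n x" using abs_ln_norm_le[of "x - y"] by (simp add: r_def)
    have "0 \<le> r\<^sup>2" "0 < 1 / r" using r by auto
    with up lo r show ?thesis unfolding r_def[symmetric] by linarith
  qed
  have lim1: "(\<lambda>n. LBINT x. \<phi> x * (((x - y) \<bullet> h) / s n x)) \<longlonglongrightarrow> (LBINT x. \<phi> x * (coulomb_kernel (x - y) \<bullet> h))"
  proof (rule integral_dominated_convergence[where w = "\<lambda>x. norm h * (\<bar>\<phi> x\<bar> / norm (x - y))"])
    show "integrable lborel (\<lambda>x. norm h * (\<bar>\<phi> x\<bar> / norm (x - y)))" using i1 by (rule integrable_mult_right)
    show "AE x in lborel. (\<lambda>n. \<phi> x * (((x - y) \<bullet> h) / s n x)) \<longlonglongrightarrow> \<phi> x * (coulomb_kernel (x - y) \<bullet> h)"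
      using dist0
    proof eventually_elim
      case (elim x)
      have "(\<lambda>n. \<phi> x * (((x - y) \<bullet> h) / s n x)) \<longlonglongrightarrow> \<phi> x * (((x - y) \<bullet> h) / (norm (x - y))\<^sup>2)"
        using elim by (intro tendsto_mult tendsto_const tendsto_divide slim) simp
      then show ?case by (simp add: coulomb_kernel_def divide_inverse mult.commute mult.left_commute)
    qed
    show "AE x in lborel. norm (\<phi> x * (((x - y) \<bullet> h) / s n x)) \<le> norm h * (\<bar>\<phi> x\<bar> / norm (x - y))" for n
      using b1 by simp
  qed measurable
  have i23: "integrable lborel (\<lambda>x. \<bar>?D x\<bar> / norm (x - y) + \<bar>?D x\<bar> * (norm (x - y) + (norm (x - y))\<^sup>2))"
    using i2 i3 by (rule Bochner_Integration.integrable_add)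
  have b3: "AE x in lborel. norm (?D x * u n x) \<le> \<bar>?D x\<bar> / norm (x - y) + \<bar>?D x\<bar> * (norm (x - y) + (norm (x - y))\<^sup>2)" for n
    using dist0
  proof eventually_elim
    case (elim x)
    from mult_left_mono[OF b2[OF elim, of n], of "\<bar>?D x\<bar>"] show ?case by (simp add: abs_mult distrib_left)
  qed
  have lim2: "(\<lambda>n. pairing ?D (u n)) \<longlonglongrightarrow> (LBINT x. ?D x * ln (norm (x - y)))"
  proof (rule integral_dominated_convergence[OF _ _ i23 _ b3])
    show "AE x in lborel. (\<lambda>n. ?D x * u n x) \<longlonglongrightarrow> ?D x * ln (norm (x - y))" using dist0
    proof eventually_elim
      case (elim x)
      have "(\<lambda>n. ?D x * u n x) \<longlonglongrightarrow> ?D x * (1 / 2 * ln ((norm (x - y))\<^sup>2))"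
        unfolding u_def using elim by (intro tendsto_mult tendsto_const tendsto_ln slim) simp
      then show ?case using elim by (simp add: ln_realpow)
    qed
  qed measurable
  have "(LBINT x. \<phi> x * (((x - y) \<bullet> h) / s n x)) + pairing ?D (u n) = 0" for n
  proof -
    have "integrable lborel (\<lambda>x. \<phi> x * (((x - y) \<bullet> h) / s n x))"
      by (rule dominated_integrable[OF integrable_mult_right[OF i1, of "norm h"]])
        (use b1 in \<open>simp_all add: AE_I2\<close>)
    moreover have "integrable lborel (\<lambda>x. ?D x * u n x)"
    proof (rule dominated_integrable[OF i23])
      show "AE x in lborel. norm (?D x * u n x) \<le> norm (\<bar>?D x\<bar> / norm (x - y) + \<bar>?D x\<bar> * (norm (x - y) + (norm (x - y))\<^sup>2))"
        using b3[of n] by eventually_elim simp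
    qed measurable
    ultimately show ?thesis using zero[of n] by simp
  qed
  with tendsto_add[OF lim1 lim2]
  have "(LBINT x. \<phi> x * (coulomb_kernel (x - y) \<bullet> h)) + (LBINT x. ?D x * ln (norm (x - y))) = 0"
    by (simp add: LIMSEQ_const_iff)
  then show ?thesis by (simp add: mult.commute add_eq_0_iff)
qed

text \<open>A common majorant for the uses of Fubini below: 1 / |x - y| serves the Coulomb kernel,
  and together with |x - y| it serves the logarithm. The growing term is paid for by a first moment
  of \<open>u\<close>.\<close>

lemma integrable_coulomb_pair:
  assumes u: "L12_bounded M S u" and mom: "integrable lborel (\<lambda>y. norm y * \<bar>u y\<bar>)"
  shows "integrable lborel2
    (\<lambda>(x, y). cutoff R x * (\<bar>u y\<bar> / norm (x - y) + norm (x - y) * \<bar>u y\<bar>))"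
proof -
  note D = L12_boundedD[OF u]
  note [measurable] = D(2)
  let ?I = "\<lambda>x :: R2. cutoff R x :: real"
  have intI: "integrable lborel ?I" by (rule integrable_real_indicator) auto
  obtain c where c: "\<And>d M S u. 0 < d \<Longrightarrow> L12_bounded M S u \<Longrightarrow>
      (AE x in lborel. near_potential 1 d u x < \<infinity>) \<and> l2 (\<lambda>x. enn2real (near_potential 1 d u x)) \<and>
      (LBINT x. (enn2real (near_potential 1 d u x))\<^sup>2) \<le> (c * d)\<^sup>2 * S"
    using near_potential_L2 by metis
  let ?n = "\<lambda>x. enn2real (near_potential 1 1 u x)"
  have n: "AE x in lborel. near_potential 1 1 u x < \<infinity>" "l2 ?n" using c[of 1 M S u] u by auto
  have n1: "integrable lborel (\<lambda>x. ?I x * ?n x)"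
    using l2_mult_integrable[OF l2_indicator[of "cball 0 R"] n(2)] by simp
  have f1: "integrable lborel2 (\<lambda>(x, y). ?I x * (\<bar>u y\<bar> / norm (x - y)))"
  proof (rule integrableI_bounded)
    have "(\<integral>\<^sup>+p. ennreal (norm (case p of (x, y) \<Rightarrow> ?I x * (\<bar>u y\<bar> / norm (x - y)))) \<partial>lborel2)
        = (\<integral>\<^sup>+x. \<integral>\<^sup>+y. ennreal (?I x) * ennreal (\<bar>u y\<bar> / norm (x - y)) \<partial>lborel \<partial>lborel)"
    proof -
      have e: "ennreal (norm (case (x, y) of (x, y) \<Rightarrow> ?I x * (\<bar>u y\<bar> / norm (x - y))))
          = ennreal (?I x) * ennreal (\<bar>u y\<bar> / norm (x - y))" for x y
        by (simp add: abs_mult flip: ennreal_mult)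
      have "(\<lambda>p. ennreal (norm (case p of (x, y) \<Rightarrow> ?I x * (\<bar>u y\<bar> / norm (x - y)))))
          \<in> borel_measurable lborel2" by measurable
      from lborel.nn_integral_fst[OF this] show ?thesis by (simp only: e)
    qed
    also have "\<dots> = (\<integral>\<^sup>+x. ennreal (?I x) * coulomb_potential u x \<partial>lborel)"
      by (simp add: nn_integral_cmult coulomb_potential_def)
    also have "\<dots> \<le> (\<integral>\<^sup>+x. ennreal (?I x * ?n x + M * ?I x) \<partial>lborel)"
    proof (rule nn_integral_mono_AE)
      show "AE x in lborel. ennreal (?I x) * coulomb_potential u x \<le> ennreal (?I x * ?n x + M * ?I x)" using n(1)
      proof eventually_elim
        case (elim x)
        have "coulomb_potential u x \<le> near_potential 1 1 u x + ennreal M"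
          using coulomb_potential_le[OF D(2), of x] D(7) by (meson add_left_mono order_trans)
        also have "\<dots> = ennreal (?n x + M)" using elim D(5) by (simp add: ennreal_enn2real ennreal_plus)
        finally show ?case by (simp add: indicator_def)
      qed
    qed
    also have "\<dots> < \<infinity>" using n1 intI D(5) by (subst nn_integral_eq_integral) auto
    finally show "(\<integral>\<^sup>+p. ennreal (norm (case p of (x, y) \<Rightarrow> ?I x * (\<bar>u y\<bar> / norm (x - y)))) \<partial>lborel2) < \<infinity>" .
  qed measurable
  have f2: "integrable lborel2 (\<lambda>(x, y). ?I x * (\<bar>R\<bar> * \<bar>u y\<bar> + norm y * \<bar>u y\<bar>))"
  proof (rule lborel_pair.Fubini_integrable)
    have "(LBINT y. norm (case (x, y) of (x, y) \<Rightarrow> ?I x * (\<bar>R\<bar> * \<bar>u y\<bar> + norm y * \<bar>u y\<bar>)))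
        = ?I x * (LBINT y. \<bar>R\<bar> * \<bar>u y\<bar> + norm y * \<bar>u y\<bar>)" for x by (simp add: abs_mult)
    then show "integrable lborel (\<lambda>x. LBINT y. norm (case (x, y) of (x, y) \<Rightarrow> ?I x * (\<bar>R\<bar> * \<bar>u y\<bar> + norm y * \<bar>u y\<bar>)))"
      using intI by simp
    show "AE x in lborel. integrable lborel (\<lambda>y. case (x, y) of (x, y) \<Rightarrow> ?I x * (\<bar>R\<bar> * \<bar>u y\<bar> + norm y * \<bar>u y\<bar>))"
      using D(1) mom by (intro AE_I2) simp
  qed measurable
  show ?thesis
  proof (rule dominated_integrable[OF Bochner_Integration.integrable_add[OF f1 f2]])
    show "AE p in lborel \<Otimes>\<^sub>M lborel. norm (case p of (x, y) \<Rightarrow> ?I x * (\<bar>u y\<bar> / norm (x - y) + norm (x - y) * \<bar>u y\<bar>))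
        \<le> norm ((case p of (x, y) \<Rightarrow> ?I x * (\<bar>u y\<bar> / norm (x - y))) + (case p of (x, y) \<Rightarrow> ?I x * (\<bar>R\<bar> * \<bar>u y\<bar> + norm y * \<bar>u y\<bar>)))"
    proof (rule AE_I2)
      fix p :: "R2 \<times> R2"
      obtain x y where p: "p = (x, y)" by force
      show "norm (case p of (x, y) \<Rightarrow> ?I x * (\<bar>u y\<bar> / norm (x - y) + norm (x - y) * \<bar>u y\<bar>))
        \<le> norm ((case p of (x, y) \<Rightarrow> ?I x * (\<bar>u y\<bar> / norm (x - y))) + (case p of (x, y) \<Rightarrow> ?I x * (\<bar>R\<bar> * \<bar>u y\<bar> + norm y * \<bar>u y\<bar>)))"
      proof (cases "x \<in> cball 0 R")
        case True
        then have "norm (x - y) \<le> \<bar>R\<bar> + norm y" using norm_triangle_ineq4[of x y] by simp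
        from mult_right_mono[OF this, of "\<bar>u y\<bar>"] True show ?thesis by (simp add: p distrib_right)
      qed (simp add: p)
    qed
  qed measurable
qed

text \<open>The form in which the majorant is applied; the radius \<open>R\<close> comes from the
  compact support of the test function in \<open>x\<close>.\<close>

lemma integrable_pair_dominated:
  fixes F :: "R2 \<times> R2 \<Rightarrow> 'b::euclidean_space"
  assumes u: "L12_bounded M S u" and mom: "integrable lborel (\<lambda>y. norm y * \<bar>u y\<bar>)"
    and Fm: "F \<in> borel_measurable lborel2"
    and F: "\<And>x y. norm (F (x, y)) \<le> B * (\<bar>u y\<bar> / norm (x - y) + norm (x - y) * \<bar>u y\<bar>)"
      "\<And>x y. norm x \<ge> R \<Longrightarrow> F (x, y) = 0"
  shows "integrable lborel2 F"
proof (rule dominated_integrable[OF integrable_mult_right[OF integrable_coulomb_pair[OF u mom, of R], of B]])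
  show "AE p in lborel \<Otimes>\<^sub>M lborel. norm (F p) \<le> norm (B * (case p of (x, y) \<Rightarrow>
      cutoff R x * (\<bar>u y\<bar> / norm (x - y) + norm (x - y) * \<bar>u y\<bar>)))"
  proof (rule AE_I2)
    fix p :: "R2 \<times> R2"
    obtain x y where p: "p = (x, y)" by force
    show "norm (F p) \<le> norm (B * (case p of (x, y) \<Rightarrow>
        cutoff R x * (\<bar>u y\<bar> / norm (x - y) + norm (x - y) * \<bar>u y\<bar>)))"
    proof (cases "x \<in> cball 0 R")
      case True
      have "norm (F p) \<le> \<bar>B * (\<bar>u y\<bar> / norm (x - y) + norm (x - y) * \<bar>u y\<bar>)\<bar>"
        using F(1)[of x y] unfolding p by linarith
      with True show ?thesis by (simp add: p)
    next
      case False
      with F(2)[of x y] show ?thesis by (simp add: p)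
    qed
  qed
qed (rule Fm)

lemma density_laplace_kernel_le:
  "\<bar>u y * laplace_kernel (x - y)\<bar> \<le> \<bar>u y\<bar> / norm (x - y) + norm (x - y) * \<bar>u y\<bar>"
proof -
  have "\<bar>u y\<bar> * \<bar>laplace_kernel (x - y)\<bar> \<le> \<bar>u y\<bar> * (1 / norm (x - y) + norm (x - y))"
    by (rule mult_left_mono[OF abs_laplace_kernel_le]) simp
  then show ?thesis by (simp add: abs_mult distrib_left mult.commute)
qed

text \<open>For nonzero \<open>c\<close> both integrands are integrable or neither is, and in the
  second case both integrals are 0 by the convention for Bochner integrals.\<close>

lemma integral_scaleR_left_const:
  fixes c :: "'b::euclidean_space"
  shows "(LINT y|M. f y *\<^sub>R c) = (LINT y|M. f y) *\<^sub>R c"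
proof (cases "c = 0 \<or> integrable M f")
  case False
  have "\<not> integrable M (\<lambda>y. f y *\<^sub>R c)"
  proof
    assume "integrable M (\<lambda>y. f y *\<^sub>R c)"
    from integrable_inner_left[OF this, of c] have "integrable M (\<lambda>y. f y * (c \<bullet> c))" by simp
    then show False using False by simp
  qed
  with False show ?thesis by (simp add: not_integrable_integral_eq)
qed auto

lemma laplace_convolution_pairing:
  fixes a :: "R2 \<Rightarrow> 'b::euclidean_space"
  assumes u: "L12_bounded M S u" and mom: "integrable lborel (\<lambda>y. norm y * \<bar>u y\<bar>)"
    and am [measurable]: "borel_fun a" and a: "\<And>x. norm (a x) \<le> B" "\<And>x. norm x \<ge> R \<Longrightarrow> a x = 0"
  shows "integrable lborel (\<lambda>x. kernel_convolution laplace_kernel u x *\<^sub>R a x)"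
    "(LBINT x. kernel_convolution laplace_kernel u x *\<^sub>R a x)
      = (LBINT y. u y *\<^sub>R (LBINT x. laplace_kernel (x - y) *\<^sub>R a x))"
proof -
  note D = L12_boundedD[OF u]
  note [measurable] = D(2)
  let ?\<psi> = "kernel_convolution laplace_kernel u"
  have int: "integrable lborel2 (\<lambda>p. (u (snd p) * laplace_kernel (fst p - snd p)) *\<^sub>R a (fst p))"
  proof (rule integrable_pair_dominated[OF u mom, where B = B and R = R])
    fix x y
    show "norm ((u (snd (x, y)) * laplace_kernel (fst (x, y) - snd (x, y))) *\<^sub>R a (fst (x, y)))
        \<le> B * (\<bar>u y\<bar> / norm (x - y) + norm (x - y) * \<bar>u y\<bar>)"
      using mult_mono[OF a(1)[of x] density_laplace_kernel_le[of u y x]] order_trans[OF norm_ge_zero a(1)[of x]] by (simp add: mult.commute)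
  qed (use a in auto)
  have eq: "(LBINT y. (u y * laplace_kernel (x - y)) *\<^sub>R a x) = ?\<psi> x *\<^sub>R a x" for x
    by (simp add: kernel_convolution_def integral_scaleR_left_const)
  show "integrable lborel (\<lambda>x. ?\<psi> x *\<^sub>R a x)"
    using lborel_pair.integrable_fst'[OF int] by (simp add: eq)
  have "(LBINT x. ?\<psi> x *\<^sub>R a x) = (LBINT y. LBINT x. (u y * laplace_kernel (x - y)) *\<^sub>R a x)"
    using lborel_pair.Fubini_integral[of "\<lambda>x y. (u y * laplace_kernel (x - y)) *\<^sub>R a x"] int by (simp add: eq split_beta')
  then show "(LBINT x. ?\<psi> x *\<^sub>R a x) = (LBINT y. u y *\<^sub>R (LBINT x. laplace_kernel (x - y) *\<^sub>R a x))"
    by (simp flip: scaleR_scaleR)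
qed

lemma coulomb_field_pairing:
  fixes a :: "R2 \<Rightarrow> real"
  assumes u: "L12_bounded M S u" and mom: "integrable lborel (\<lambda>y. norm y * \<bar>u y\<bar>)"
    and am [measurable]: "borel_fun a" and a: "\<And>x. \<bar>a x\<bar> \<le> B" "\<And>x. norm x \<ge> R \<Longrightarrow> a x = 0"
  shows "integrable lborel (\<lambda>x. a x *\<^sub>R field u x)"
    "(LBINT x. a x *\<^sub>R field u x)
      = (LBINT y. u y *\<^sub>R (LBINT x. a x *\<^sub>R coulomb_kernel (x - y)))"
proof -
  note D = L12_boundedD[OF u]
  note [measurable] = D(2)
  let ?E = "field u"
  have K: "norm (u y *\<^sub>R coulomb_kernel (x - y)) \<le> \<bar>u y\<bar> / norm (x - y) + norm (x - y) * \<bar>u y\<bar>" for x y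
    by (simp add: norm_coulomb_kernel)
  have int: "integrable lborel2 (\<lambda>p. a (fst p) *\<^sub>R (u (snd p) *\<^sub>R coulomb_kernel (fst p - snd p)))"
  proof (rule integrable_pair_dominated[OF u mom, where B = B and R = R])
    fix x y
    show "norm (a (fst (x, y)) *\<^sub>R (u (snd (x, y)) *\<^sub>R coulomb_kernel (fst (x, y) - snd (x, y))))
        \<le> B * (\<bar>u y\<bar> / norm (x - y) + norm (x - y) * \<bar>u y\<bar>)"
      using mult_mono[OF a(1)[of x] K[where x = x and y = y]] order_trans[OF abs_ge_zero a(1)[of x]]
        by (simp add: abs_mult mult.assoc)
  qed (use a in auto)
  have eq: "(LBINT y. a x *\<^sub>R (u y *\<^sub>R coulomb_kernel (x - y))) = a x *\<^sub>R ?E x" for x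
    by (simp only: kernel_convolution_def integral_scaleR_right)
  show "integrable lborel (\<lambda>x. a x *\<^sub>R ?E x)"
    using lborel_pair.integrable_fst'[OF int] by (simp only: fst_conv snd_conv eq)
  have "(LBINT x. a x *\<^sub>R ?E x) = (LBINT x. LBINT y. a x *\<^sub>R (u y *\<^sub>R coulomb_kernel (x - y)))"
    by (simp only: eq)
  also have "\<dots> = (LBINT y. LBINT x. a x *\<^sub>R (u y *\<^sub>R coulomb_kernel (x - y)))"
    using lborel_pair.Fubini_integral[of "\<lambda>x y. a x *\<^sub>R (u y *\<^sub>R coulomb_kernel (x - y))"] int by (simp only: split_beta')
  also have "\<dots> = (LBINT y. u y *\<^sub>R (LBINT x. a x *\<^sub>R coulomb_kernel (x - y)))"
  proof -
    have "(LBINT x. a x *\<^sub>R (u y *\<^sub>R coulomb_kernel (x - y))) = u y *\<^sub>R (LBINT x. a x *\<^sub>R coulomb_kernel (x - y))" for y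
      by (subst integral_scaleR_right[symmetric]) (simp add: mult.commute)
    then show ?thesis by (simp only:)
  qed
  finally show "(LBINT x. a x *\<^sub>R ?E x) = (LBINT y. u y *\<^sub>R (LBINT x. a x *\<^sub>R coulomb_kernel (x - y)))" .
qed

text \<open>Fubini moves the test function onto the kernel, where the claim is that the gradient of
  ln |z| is the Coulomb kernel. Rotation and the factor 1 / (2 pi) form a bounded linear map
  \<open>T\<close>, which passes through the integrals.\<close>

lemma laplace_convolution_weak_gradient:
  assumes u: "L12_bounded M S u" and mom: "integrable lborel (\<lambda>y. norm y * \<bar>u y\<bar>)"
  shows "is_convolution laplace_kernel u (kernel_convolution laplace_kernel u)"
    and "has_weak_perp_gradient (kernel_convolution laplace_kernel u)
      (\<lambda>x. perp (field u x) /\<^sub>R (2 * pi))"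
proof -
  note D = L12_boundedD[OF u]
  note [measurable] = D(2)
  note H = integrable_coulomb_pair[OF u mom]
  have ae: "AE x in lborel. integrable lborel (\<lambda>y. \<bar>u y\<bar> / norm (x - y) + norm (x - y) * \<bar>u y\<bar>)"
  proof -
    \<comment> \<open>Fubini gives integrable slices for almost every \<open>x\<close> in one ball;
      countably many balls cover the plane.\<close>
    have "AE x in lborel. \<forall>n::nat. integrable lborel (\<lambda>y. indicator (cball 0 (real n)) x * (\<bar>u y\<bar> / norm (x - y) + norm (x - y) * \<bar>u y\<bar>))"
      unfolding AE_all_countable using lborel_pair.AE_integrable_fst'[OF H] by simp
    then show ?thesis
    proof eventually_elim
      case (elim x)
      obtain n :: nat where "norm x \<le> real n" using real_arch_simple by blast
      then show ?case using spec[OF elim, of n] by simp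
    qed
  qed
  have conv: "AE x in lborel. integrable lborel (\<lambda>y. u y *\<^sub>R laplace_kernel (x - y))" using ae
  proof eventually_elim
    case (elim x)
    show ?case
    proof (rule dominated_integrable[OF elim])
      show "AE y in lborel. norm (u y *\<^sub>R laplace_kernel (x - y)) \<le> norm (\<bar>u y\<bar> / norm (x - y) + norm (x - y) * \<bar>u y\<bar>)"
        using density_laplace_kernel_le[where x = x] by (intro AE_I2) simp
    qed measurable
  qed
  then show "is_convolution laplace_kernel u (kernel_convolution laplace_kernel u)" by (simp add: is_convolution_def)
  define T :: "R2 \<Rightarrow> R2" where "T v = perp v /\<^sub>R (2 * pi)" for v
  have T: "bounded_linear T" unfolding T_def by (intro bounded_linear_const_scaleR bounded_linear_perp)
  let ?\<psi> = "kernel_convolution laplace_kernel u"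
  let ?E = "field u"
  note \<psi>int = laplace_convolution_pairing[OF u mom] and Eint = coulomb_field_pairing[OF u mom]
  show "has_weak_perp_gradient ?\<psi> (\<lambda>x. perp (?E x) /\<^sub>R (2 * pi))"
    unfolding has_weak_perp_gradient_def
  proof (intro conjI allI impI)
    fix K :: "R2 set" assume K: "compact K"
    then obtain R where R: "\<And>x. x \<in> K \<Longrightarrow> norm x < R" using bounded_pos_less compact_imp_bounded by metis
    have ind: "borel_fun (indicator K)" "\<And>x. \<bar>indicator K x\<bar> \<le> (1::real)" "\<And>x. norm x \<ge> R \<Longrightarrow> indicator K x = (0::real)"
      using borel_compact[OF K] R by (auto simp: indicator_def dest: leD)
    show "set_integrable lborel K ?\<psi>"
      unfolding set_integrable_def using \<psi>int(1)[of "indicator K :: R2 \<Rightarrow> real" 1 R] ind by (simp add: mult.commute)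
    have "integrable lborel (\<lambda>x. T (indicator K x *\<^sub>R ?E x))"
      by (rule integrable_bounded_linear[OF T Eint(1)[OF ind]])
    then show "set_integrable lborel K (\<lambda>x. perp (?E x) /\<^sub>R (2 * pi))"
      unfolding set_integrable_def by (simp add: T_def linear_cmul[OF bounded_linear.linear[OF bounded_linear_perp]] mult.commute)
  next
    fix \<phi> :: "R2 \<Rightarrow> real" assume \<phi>: "test_function \<phi>"
    let ?D = "\<lambda>i x. FD \<phi> x (axis i 1)"
    have grad: "gradient \<phi> x $ i = ?D i x" for x i by (simp add: gradient_def)
    have gradeq: "gradient \<phi> x = ?D 1 x *\<^sub>R axis 1 1 + ?D 2 x *\<^sub>R axis 2 1" for x
      by (simp add: vec_eq_R2 grad axis_def)
    have test: "test_function (?D i)" for i by (rule test_function_derivative[OF \<phi>])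
    have [measurable]: "borel_fun \<phi>" "?D i \<in> borel_measurable borel" for i
      using test_function_borel \<phi> test by auto
    have gm [measurable]: "borel_fun (gradient \<phi>)" unfolding gradeq[abs_def] by measurable
    obtain B where B: "\<And>x. \<bar>\<phi> x\<bar> \<le> B" using test_function_bounded[OF \<phi>] by metis
    obtain B1 B2 where B12: "\<And>x. \<bar>?D 1 x\<bar> \<le> B1" "\<And>x. \<bar>?D 2 x\<bar> \<le> B2" using test_function_bounded[OF test] by metis
    obtain R where R: "\<And>x. norm x \<ge> R \<Longrightarrow> \<phi> x = 0" "\<And>x h. norm x \<ge> R \<Longrightarrow> FD \<phi> x h = 0" "R > 0"
      using test_function_support[OF \<phi>] by metis
    have gb: "norm (gradient \<phi> x) \<le> B1 + B2" for x
      using norm_le_l1_cart[of "gradient \<phi> x"] B12[of x] by (simp add: UNIV_2 grad)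
    have gs: "gradient \<phi> x = 0" if "norm x \<ge> R" for x using R(2)[OF that] by (simp add: vec_eq_iff grad)
    \<comment> \<open>The claim for the translated kernel alone, proved componentwise; the factor 2
      pi undoes the normalisation of \<open>laplace_kernel\<close>.\<close>
    have key: "(LBINT x. \<phi> x *\<^sub>R coulomb_kernel (x - y)) = - (2 * pi) *\<^sub>R (LBINT x. laplace_kernel (x - y) *\<^sub>R gradient \<phi> x)" for y
    proof -
      have i1: "integrable lborel (\<lambda>x. \<phi> x *\<^sub>R coulomb_kernel (x - y))"
        by (rule dominated_integrable[OF integrable_over_norm[OF _ B R(1), where y = y]])
          (auto simp: norm_coulomb_kernel)
      have ng: "integrable lborel (\<lambda>x. norm (gradient \<phi> x) / norm (x - y))"
        using integrable_over_norm[of "\<lambda>x. norm (gradient \<phi> x)" "B1 + B2" R y] gb gs by simp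
      have ng2: "integrable lborel (\<lambda>x. norm (gradient \<phi> x) * norm (x - y))"
      proof (rule integrable_bounded_support[where R = R and B = "(B1 + B2) * (R + norm y)"])
        fix x
        have B12p: "0 \<le> B1 + B2" using order_trans[OF norm_ge_zero gb[of 0]] .
        show "norm (norm (gradient \<phi> x) * norm (x - y)) \<le> (B1 + B2) * (R + norm y)"
        proof (cases "norm x \<ge> R")
          case True
          then show ?thesis using gs[OF True] B12p R(3) by simp
        next
          case False
          then have "norm (x - y) \<le> R + norm y" using norm_triangle_ineq4[of x y] by linarith
          with gb[of x] B12p show ?thesis by (auto intro!: mult_mono)
        qed
      qed (use gs in auto)
      have i2: "integrable lborel (\<lambda>x. laplace_kernel (x - y) *\<^sub>R gradient \<phi> x)"
      proof (rule dominated_integrable[OF Bochner_Integration.integrable_add[OF ng ng2]])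
        show "AE x in lborel. norm (laplace_kernel (x - y) *\<^sub>R gradient \<phi> x)
            \<le> norm (norm (gradient \<phi> x) / norm (x - y) + norm (gradient \<phi> x) * norm (x - y))"
        proof (rule AE_I2)
          fix x
          have "norm (gradient \<phi> x) * \<bar>laplace_kernel (x - y)\<bar> \<le> norm (gradient \<phi> x) * (1 / norm (x - y) + norm (x - y))"
            by (rule mult_left_mono[OF abs_laplace_kernel_le]) simp
          then show "norm (laplace_kernel (x - y) *\<^sub>R gradient \<phi> x)
            \<le> norm (norm (gradient \<phi> x) / norm (x - y) + norm (gradient \<phi> x) * norm (x - y))"
            by (simp add: distrib_left mult.commute)
        qed
      qed measurable
      have "(LBINT x. \<phi> x *\<^sub>R coulomb_kernel (x - y)) $ i = - (2 * pi) * (LBINT x. laplace_kernel (x - y) *\<^sub>R gradient \<phi> x) $ i" for i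
      proof -
        have "(LBINT x. \<phi> x *\<^sub>R coulomb_kernel (x - y)) $ i = (LBINT x. \<phi> x * (coulomb_kernel (x - y) \<bullet> axis i 1))"
          using integral_bounded_linear[OF bounded_linear_vec_nth[of i] i1] by (simp add: inner_axis)
        also have "\<dots> = - (LBINT x. ln (norm (x - y)) * ?D i x)" by (rule log_kernel_weak_derivative[OF \<phi>])
        also have "\<dots> = - (2 * pi) * (LBINT x. laplace_kernel (x - y) * ?D i x)"
        proof -
          have "ln (norm (x - y)) * ?D i x = (2 * pi) * (laplace_kernel (x - y) * ?D i x)" for x
            by (simp add: laplace_kernel_def)
          then show ?thesis by (simp only: integral_mult_right_zero)
        qed
        also have "(LBINT x. laplace_kernel (x - y) * ?D i x) = (LBINT x. laplace_kernel (x - y) *\<^sub>R gradient \<phi> x) $ i"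
          using integral_bounded_linear[OF bounded_linear_vec_nth[of i] i2] by (simp add: grad)
        finally show ?thesis .
      qed
      then show ?thesis by (simp add: vec_eq_iff)
    qed
    have "(LBINT x. \<phi> x *\<^sub>R ?E x) = (LBINT y. u y *\<^sub>R (- (2 * pi) *\<^sub>R (LBINT x. laplace_kernel (x - y) *\<^sub>R gradient \<phi> x)))"
      using Eint(2)[of \<phi> B R] B R(1) by (simp only: key) simp
    also have "\<dots> = (LBINT y. - (2 * pi) *\<^sub>R (u y *\<^sub>R (LBINT x. laplace_kernel (x - y) *\<^sub>R gradient \<phi> x)))"
      by (simp only: scaleR_left_commute)
    also have "\<dots> = - (2 * pi) *\<^sub>R (LBINT x. ?\<psi> x *\<^sub>R gradient \<phi> x)"
      unfolding integral_scaleR_right using \<psi>int(2)[OF gm gb gs] by simp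
    finally have main: "(LBINT x. \<phi> x *\<^sub>R ?E x) = - (2 * pi) *\<^sub>R (LBINT x. ?\<psi> x *\<^sub>R gradient \<phi> x)" .
    note lin = linear_cmul[OF bounded_linear.linear[OF bounded_linear_perp]]
    have "(LBINT x. \<phi> x *\<^sub>R (perp (?E x) /\<^sub>R (2 * pi))) = (LBINT x. T (\<phi> x *\<^sub>R ?E x))"
      by (simp add: T_def lin mult.commute)
    also have "\<dots> = T (LBINT x. \<phi> x *\<^sub>R ?E x)"
      by (rule integral_bounded_linear[OF T Eint(1)[OF _ B R(1)]]) measurable
    also have "\<dots> = - perp (LBINT x. ?\<psi> x *\<^sub>R gradient \<phi> x)" unfolding main T_def lin by simp
    also have "\<dots> = - (LBINT x. ?\<psi> x *\<^sub>R perp (gradient \<phi> x))"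
      using integral_bounded_linear[OF bounded_linear_perp \<psi>int(1)[OF gm gb gs]] by (simp add: lin)
    finally show "(LBINT x. \<phi> x *\<^sub>R (perp (?E x) /\<^sub>R (2 * pi))) = - (LBINT x. ?\<psi> x *\<^sub>R perp (gradient \<phi> x))" .
  qed
qed

section \<open>Weak solutions of the Vlasov-Poisson system\<close>

lemma linear_frechet_derivative_Ck: "(\<And>k. Ck k \<phi>) \<Longrightarrow> linear (FD \<phi> x)"
  using Ck_SucD(1)[of 0 \<phi>] has_derivative_linear by blast

text \<open>The direction is expanded in the basis, so measurability jointly in point and direction
  follows from continuity of the partial derivatives.\<close>

lemma frechet_derivative_borel:
  fixes \<phi> :: "'a::euclidean_space \<Rightarrow> real"
  assumes \<phi>: "\<And>k. Ck k \<phi>" and [measurable]: "X \<in> borel_measurable M" "H \<in> borel_measurable M"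
  shows "(\<lambda>p. FD \<phi> (X p) (H p)) \<in> borel_measurable M"
proof -
  have eq: "FD \<phi> x h = (\<Sum>b\<in>Basis. (h \<bullet> b) * FD \<phi> x b)" for x h
  proof -
    note lin = linear_frechet_derivative_Ck[OF \<phi>, of x]
    have "FD \<phi> x h = FD \<phi> x (\<Sum>b\<in>Basis. (h \<bullet> b) *\<^sub>R b)"
      by (simp add: euclidean_representation)
    then show ?thesis by (simp add: linear_sum[OF lin] linear_cmul[OF lin])
  qed
  have [measurable]: "(\<lambda>p. FD \<phi> (X p) b) \<in> borel_measurable M" for b
  proof (rule measurable_compose[OF assms(2)])
    have "Ck 0 (\<lambda>x. FD \<phi> x b)" by (rule Ck_SucD(2)[OF \<phi>])
    then show "borel_fun (\<lambda>x. FD \<phi> x b)" by (simp add: borel_measurable_continuous_onI)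
  qed
  have "(\<lambda>p. \<Sum>b\<in>Basis. (H p \<bullet> b) * FD \<phi> (X p) b) \<in> borel_measurable M" by measurable
  then show ?thesis by (subst eq)
qed

text \<open>The class of the solution at fixed \<epsilon> over a bounded time interval. The bound
  \<open>L\<close> comes from the initial data and is uniform in \<epsilon>, whereas the radius
  \<open>R\<close> of the support is not controlled.\<close>

definition ess_bounded :: "real \<Rightarrow> real \<Rightarrow> ('a::euclidean_space \<Rightarrow> real) \<Rightarrow> bool" where
  "ess_bounded L R g \<longleftrightarrow> g \<in> borel_measurable borel \<and> (AE z in lborel. \<bar>g z\<bar> \<le> L \<and> (R < norm z \<longrightarrow> g z = 0))"

lemma ess_bounded_borel: "ess_bounded L R g \<Longrightarrow> g \<in> borel_measurable borel"
  by (simp add: ess_bounded_def)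

lemma integrable_ball_const: "integrable lborel (\<lambda>z::'a::euclidean_space. cutoff R z * (c::real))"
  by (intro integrable_mult_left integrable_real_indicator) simp_all

lemma ess_bounded_integrable:
  fixes w :: "'a::euclidean_space \<Rightarrow> 'b::euclidean_space"
  assumes g: "ess_bounded L R g" and w: "borel_fun w" "\<And>z. norm z \<le> R \<Longrightarrow> norm (w z) \<le> B"
  shows "integrable lborel (\<lambda>z. g z *\<^sub>R w z)"
    "(LBINT z. norm (g z *\<^sub>R w z)) \<le> L * B * measure lborel (cball (0::'a) R)"
proof -
  have gm: "borel_fun g" using g by (simp add: ess_bounded_def)
  have le: "AE z in lborel. norm (g z *\<^sub>R w z) \<le> cutoff R z * (L * B)"
    using g[unfolded ess_bounded_def, THEN conjunct2]
  proof eventually_elim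
    case (elim z)
    show ?case
    proof (cases "norm z \<le> R")
      case True
      have "\<bar>g z\<bar> * norm (w z) \<le> L * B"
        using elim w(2)[OF True] order_trans[OF norm_ge_zero w(2)[OF True]] by (intro mult_mono) auto
      with True show ?thesis by simp
    next
      case False
      with elim show ?thesis by simp
    qed
  qed
  show int: "integrable lborel (\<lambda>z. g z *\<^sub>R w z)"
    by (rule dominated_integrable[OF integrable_ball_const[of R "L * B"]])
      (use gm w(1) in measurable, use le in \<open>eventually_elim, simp\<close>)
  have "(LBINT z. norm (g z *\<^sub>R w z)) \<le> (LBINT z. indicator (cball (0::'a) R) z * (L * B))"
    by (rule integral_mono_AE[OF integrable_norm[OF int] integrable_ball_const le])
  then show "(LBINT z. norm (g z *\<^sub>R w z)) \<le> L * B * measure lborel (cball (0::'a) R)"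
    by (simp add: mult.commute)
qed

lemma ess_bounded_integrable_continuous:
  fixes w :: "'a::euclidean_space \<Rightarrow> real"
  assumes g: "ess_bounded L R g" and w: "continuous_on UNIV w"
  shows "integrable lborel (\<lambda>z. g z * w z)"
proof -
  have "compact (w ` cball 0 R)" using w by (intro compact_continuous_image continuous_on_subset[OF w]) auto
  then obtain B where "\<forall>z\<in>cball 0 R. norm (w z) \<le> B"
    using compact_imp_bounded[of "w ` cball 0 R"] unfolding bounded_iff by auto
  then show ?thesis using ess_bounded_integrable(1)[OF g borel_measurable_continuous_onI[OF w], of B] by simp
qed

lemma ess_bounded_integrable_self: "ess_bounded L R g \<Longrightarrow> integrable lborel g"
  using ess_bounded_integrable_continuous[of L R g "\<lambda>_. 1"] by simp

lemma ess_bounded_l2: "ess_bounded L R g \<Longrightarrow> l2 g"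
proof -
  assume g: "ess_bounded L R g"
  have "l2 (\<lambda>z::'a. cutoff R z * L)"
    using l2_cmult[OF l2_indicator[of "cball 0 R"], of L] by (simp add: mult.commute)
  then show "l2 g"
  proof (rule l2_bound)
    show "AE x in lborel. \<bar>g x\<bar> \<le> \<bar>cutoff R x * L\<bar>"
      using g[unfolded ess_bounded_def, THEN conjunct2] by eventually_elim (auto simp: indicator_def)
  qed (use g in \<open>simp add: ess_bounded_def\<close>)
qed

lemma ess_boundedI:
  assumes "Linf_mem lborel f" "Linf_norm lborel f \<le> ereal L" "compact K" "ess_supported_in K f" "\<And>z. z \<in> K \<Longrightarrow> norm z \<le> R"
  shows "ess_bounded L R f"
proof -
  have "AE z in lborel. ereal (norm (f z)) \<le> Linf_norm lborel f" unfolding Linf_norm_def by (rule esssup_AE)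
  then have "AE z in lborel. \<bar>f z\<bar> \<le> L \<and> (R < norm z \<longrightarrow> f z = 0)"
    using assms(4)[unfolded ess_supported_in_def]
  proof eventually_elim
    case (elim z)
    from order_trans[OF elim(1) assms(2)] have "\<bar>f z\<bar> \<le> L" by simp
    moreover have "f z = 0" if "R < norm z" using elim(2) assms(5)[of z] that by force
    ultimately show ?case by simp
  qed
  with assms(1) show ?thesis by (simp add: ess_bounded_def Linf_mem_def)
qed

lemma macro_density_borel:
  assumes [measurable]: "borel_fun g"
  shows "borel_fun (macro_density g)"
proof -
  have "g \<in> borel_measurable borel2" using assms by (simp add: borel_prod)
  then have "(\<lambda>(x, v). g (x, v)) \<in> borel_measurable (borel \<Otimes>\<^sub>M lborel)" by simp
  from sigma_finite_measure.borel_measurable_lebesgue_integral[OF sigma_finite_lborel this]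
  show ?thesis by (simp add: macro_density_def[abs_def])
qed

lemma AE_phase_sections:
  fixes P :: "'a::euclidean_space \<times> 'b::euclidean_space \<Rightarrow> bool"
  assumes "AE z in lborel. P z"
  shows "AE x in lborel. AE v in lborel. P (x, v)"
proof -
  have "AE z in lborel \<Otimes>\<^sub>M lborel. P z" using assms by (simp only: lborel_prod)
  then show ?thesis by (rule lborel_pair.AE_pair)
qed

lemma integral_phase_space:
  fixes h :: "R2 \<times> R2 \<Rightarrow> real"
  assumes "integrable lborel h"
  shows "(LBINT z. h z) = (LBINT x. LBINT v. h (x, v))"
    "integrable lborel (\<lambda>x. LBINT v. h (x, v))" "AE x in lborel. integrable lborel (\<lambda>v. h (x, v))"
proof -
  have h: "integrable lborel2 h" using assms by (simp add: lborel_prod)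
  show "(LBINT z. h z) = (LBINT x. LBINT v. h (x, v))"
    using lborel_pair.integral_fst'[OF h] by (simp add: lborel_prod)
  show "integrable lborel (\<lambda>x. LBINT v. h (x, v))" by (rule lborel_pair.integrable_fst'[OF h])
  show "AE x in lborel. integrable lborel (\<lambda>v. h (x, v))" by (rule lborel_pair.AE_integrable_fst'[OF h])
qed

lemma integral_macro_density:
  assumes "integrable lborel (\<lambda>z. w (fst z) * g z)"
  shows "pairing w (macro_density g) = (LBINT z. w (fst z) * g z)"
    "integrable lborel (\<lambda>x. w x * macro_density g x)"
  using integral_phase_space[OF assms] by (simp_all add: macro_density_def)

lemma ess_bounded_macro_density:
  assumes g: "ess_bounded L R g"
  shows "ess_bounded (L * measure lborel (cball (0::R2) R)) R (macro_density g)" unfolding ess_bounded_def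
proof
  show "borel_fun (macro_density g)" using g by (simp add: ess_bounded_def macro_density_borel)
  have [measurable]: "g \<in> borel_measurable borel2" using g by (simp add: ess_bounded_def borel_prod)
  have "AE x in lborel. AE v in lborel. \<bar>g (x, v)\<bar> \<le> L \<and> (R < norm (x, v) \<longrightarrow> g (x, v) = 0)"
    by (rule AE_phase_sections) (use g in \<open>simp add: ess_bounded_def\<close>)
  then show "AE x in lborel. \<bar>macro_density g x\<bar> \<le> L * measure lborel (cball (0::R2) R) \<and> (R < norm x \<longrightarrow> macro_density g x = 0)"
  proof eventually_elim
    case (elim x)
    have "norm v \<le> norm (x, v)" "norm x \<le> norm (x, v)" for v :: R2 by (auto simp: norm_Pair real_le_rsqrt)
    note nrm = this
    have "ess_bounded L R (\<lambda>v. g (x, v))" unfolding ess_bounded_def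
    proof
      show "borel_fun (\<lambda>v. g (x, v))" by measurable
      show "AE v in lborel. \<bar>g (x, v)\<bar> \<le> L \<and> (R < norm v \<longrightarrow> g (x, v) = 0)"
        using elim by eventually_elim (use nrm(1) in \<open>auto intro: less_le_trans\<close>)
    qed
    from ess_bounded_integrable[OF this, of "\<lambda>_. 1::real" 1]
    have "(LBINT v. \<bar>g (x, v)\<bar>) \<le> L * measure lborel (cball (0::R2) R)" by simp
    then have "\<bar>macro_density g x\<bar> \<le> L * measure lborel (cball (0::R2) R)"
      unfolding macro_density_def by (rule order_trans[OF integral_abs_bound])
    moreover have "macro_density g x = 0" if "R < norm x"
    proof -
      have "AE v in lborel. g (x, v) = 0"
        using elim by eventually_elim (use nrm(2) that in \<open>auto intro: less_le_trans\<close>)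
      then show ?thesis unfolding macro_density_def by (intro integral_eq_zero_AE)
    qed
    ultimately show ?case by simp
  qed
qed

text \<open>The constant depends on \<open>L\<close> and \<open>R\<close> alone, so it is uniform
  over a bounded time interval. Since \<open>R\<close> is not uniform in \<epsilon>, the bound is
  used for integrability.\<close>

lemma electric_field_bounded:
  obtains C where "0 \<le> C" "\<And>(g :: R2 \<times> R2 \<Rightarrow> real) x. ess_bounded L R g \<Longrightarrow> norm (electric_field g x) \<le> C"
    "\<And>(g :: R2 \<times> R2 \<Rightarrow> real) x. ess_bounded L R g \<Longrightarrow> integrable lborel (\<lambda>y. macro_density g y *\<^sub>R coulomb_kernel (x - y))"
proof -
  let ?V = "measure lborel (cball (0::R2) R)"
  define L' where "L' = \<bar>L\<bar> * ?V"
  define M where "M = L' * ?V"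
  obtain c where c: "0 \<le> c" "\<And>u L M x. u \<in> borel_measurable borel \<Longrightarrow> AE y in lborel. \<bar>u y\<bar> \<le> L \<Longrightarrow> 0 \<le> L \<Longrightarrow>
     (\<integral>\<^sup>+y. ennreal \<bar>u y\<bar> \<partial>lborel) \<le> ennreal M \<Longrightarrow> 0 \<le> M \<Longrightarrow> coulomb_potential u x \<le> ennreal (c * L + M)"
    using coulomb_potential_bounded by metis
  have pos: "0 \<le> L'" "0 \<le> M" by (auto simp: L'_def M_def)
  have pot: "coulomb_potential (macro_density g) x \<le> ennreal (c * L' + M)" if g: "ess_bounded L R g" for g :: "R2 \<times> R2 \<Rightarrow> real" and x
  proof -
    have "ess_bounded \<bar>L\<bar> R g" using g unfolding ess_bounded_def by (auto elim: eventually_mono)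
    from ess_bounded_macro_density[OF this] have \<rho>: "ess_bounded L' R (macro_density g)" by (simp add: L'_def)
    have "(LBINT y. \<bar>macro_density g y\<bar>) \<le> M"
      using ess_bounded_integrable(2)[OF \<rho>, of "\<lambda>_. 1::real" 1] by (simp add: M_def)
    then have "(\<integral>\<^sup>+y. ennreal \<bar>macro_density g y\<bar> \<partial>lborel) \<le> ennreal M"
      using ess_bounded_integrable_self[OF \<rho>] by (subst nn_integral_eq_integral) (auto intro!: ennreal_leI)
    moreover have "AE y in lborel. \<bar>macro_density g y\<bar> \<le> L'"
      using \<rho> unfolding ess_bounded_def by (auto elim: eventually_mono)
    ultimately show ?thesis using c(2)[OF ess_bounded_borel[OF \<rho>]] pos by blast
  qed
  show thesis
  proof (rule that[of "c * L' + M"])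
    show C0: "0 \<le> c * L' + M" using c(1) pos by simp
    fix g :: "R2 \<times> R2 \<Rightarrow> real" and x assume g: "ess_bounded L R g"
    have "ennreal (norm (electric_field g x)) \<le> ennreal (c * L' + M)"
      unfolding electric_field_def by (rule order_trans[OF norm_coulomb_field_le pot[OF g]])
    then show "norm (electric_field g x) \<le> c * L' + M" using C0 by (rule ennreal_le_iff[THEN iffD1, rotated])
    show "integrable lborel (\<lambda>y. macro_density g y *\<^sub>R coulomb_kernel (x - y))"
      using ess_bounded_borel[OF ess_bounded_macro_density[OF g]] le_less_trans[OF pot[OF g, of x] ennreal_less_top]
      by (intro coulomb_field_integrable) (simp_all add: infinity_ennreal_def)
  qed
qed

lemma electric_field_borel: "borel_fun g \<Longrightarrow> borel_fun (electric_field g)"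
  unfolding electric_field_def by (intro kernel_convolution_borel coulomb_kernel_borel macro_density_borel)

text \<open>\<open>time_measurable\<close> speaks of nonnegative times only; extension by 0 gives a
  Borel function on the whole space, to which Fubini over the full product applies.\<close>

definition positive_times :: "(real \<Rightarrow> 'a \<Rightarrow> real) \<Rightarrow> real \<Rightarrow> 'a \<Rightarrow> real" where
  "positive_times f t z = (if 0 \<le> t then f t z else 0)"

lemma positive_times_borel:
  fixes f :: "real \<Rightarrow> 'a::euclidean_space \<Rightarrow> real"
  assumes "time_measurable f"
  shows "case_prod (positive_times f) \<in> borel_measurable borel2"
proof -
  have "case_prod f \<in> borel_measurable (restrict_space borel ({0..} \<times> UNIV))"
    using assms by (simp add: time_measurable_def)
  moreover have "({0..} \<times> UNIV :: (real \<times> 'a) set) \<inter> space borel \<in> sets borel"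
    by (simp add: borel_closed closed_Times)
  ultimately have "(\<lambda>p. if p \<in> {0..} \<times> UNIV then case_prod f p else 0) \<in> borel_measurable (borel :: (real \<times> 'a) measure)"
    by (subst (asm) measurable_restrict_space_iff[where c = 0]) auto
  moreover have "(\<lambda>p. if p \<in> {0..} \<times> UNIV then case_prod f p else 0) = case_prod (positive_times f)"
    by (auto simp: positive_times_def fun_eq_iff)
  ultimately show ?thesis by (simp add: borel_prod)
qed

lemma macro_density_param_borel:
  fixes g :: "real \<Rightarrow> R2 \<times> R2 \<Rightarrow> real"
  assumes "case_prod g \<in> borel_measurable borel2"
  shows "case_prod (\<lambda>t. macro_density (g t)) \<in> borel_measurable borel2"
proof -
  have [measurable]: "case_prod g \<in> borel_measurable (borel \<Otimes>\<^sub>M borel2)" using assms by (simp add: borel_prod)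
  have "(\<lambda>(p, v). g (fst p) (snd p, v)) \<in> borel_measurable (borel2 \<Otimes>\<^sub>M lborel)" by measurable
  from sigma_finite_measure.borel_measurable_lebesgue_integral[OF sigma_finite_lborel this]
  show ?thesis by (simp add: macro_density_def case_prod_beta')
qed

lemma electric_field_param_borel:
  fixes g :: "real \<Rightarrow> R2 \<times> R2 \<Rightarrow> real"
  assumes "case_prod g \<in> borel_measurable borel2"
  shows "(\<lambda>p. electric_field (g (fst p)) (snd p)) \<in> borel_measurable borel2"
  using kernel_convolution_measurable[OF coulomb_kernel_borel macro_density_param_borel[OF assms]]
  by (simp add: electric_field_def)

definition vp_field :: "real \<Rightarrow> (R2 \<times> R2 \<Rightarrow> real) \<Rightarrow> R2 \<times> R2 \<Rightarrow> R2 \<times> R2" where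
  "vp_field \<epsilon> g z = (snd z /\<^sub>R \<epsilon>, electric_field g (fst z) /\<^sub>R \<epsilon> + perp (snd z) /\<^sub>R \<epsilon>\<^sup>2)"

lemma vp_field_bounded:
  assumes "0 < \<epsilon>"
  obtains C where "0 \<le> C" "\<And>(g :: R2 \<times> R2 \<Rightarrow> real) z. ess_bounded L R g \<Longrightarrow> norm z \<le> R' \<Longrightarrow> norm (vp_field \<epsilon> g z) \<le> C"
proof -
  obtain E where E: "0 \<le> E" "\<And>(g :: R2 \<times> R2 \<Rightarrow> real) x. ess_bounded L R g \<Longrightarrow> norm (electric_field g x) \<le> E"
    using electric_field_bounded by metis
  show thesis
  proof (rule that[of "\<bar>R'\<bar> / \<epsilon> + (E / \<epsilon> + \<bar>R'\<bar> / \<epsilon>\<^sup>2)"])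
    show "0 \<le> \<bar>R'\<bar> / \<epsilon> + (E / \<epsilon> + \<bar>R'\<bar> / \<epsilon>\<^sup>2)" using E assms by simp
    fix g :: "R2 \<times> R2 \<Rightarrow> real" and z assume g: "ess_bounded L R g" and z: "norm (z :: R2 \<times> R2) \<le> R'"
    have v: "norm (snd z) \<le> \<bar>R'\<bar>" using norm_snd_le[of "snd z" "fst z", unfolded prod.collapse] z by linarith
    have "norm (vp_field \<epsilon> g z) \<le> norm (snd z /\<^sub>R \<epsilon>) + norm (electric_field g (fst z) /\<^sub>R \<epsilon> + perp (snd z) /\<^sub>R \<epsilon>\<^sup>2)"
      unfolding vp_field_def by (rule norm_Pair_le)
    also have "\<dots> \<le> norm (snd z /\<^sub>R \<epsilon>) + (norm (electric_field g (fst z) /\<^sub>R \<epsilon>) + norm (perp (snd z) /\<^sub>R \<epsilon>\<^sup>2))"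
      by (intro add_left_mono norm_triangle_ineq)
    also have "\<dots> \<le> \<bar>R'\<bar> / \<epsilon> + (E / \<epsilon> + \<bar>R'\<bar> / \<epsilon>\<^sup>2)"
      using assms v E(2)[OF g, of "fst z"] by (intro add_mono) (simp_all add: divide_inverse mult.commute mult_left_mono)
    finally show "norm (vp_field \<epsilon> g z) \<le> \<bar>R'\<bar> / \<epsilon> + (E / \<epsilon> + \<bar>R'\<bar> / \<epsilon>\<^sup>2)" .
  qed
qed

lemma vp_field_borel: "borel_fun g \<Longrightarrow> vp_field \<epsilon> g \<in> borel_measurable borel"
proof -
  assume "borel_fun g"
  then have [measurable]: "borel_fun (electric_field g)" by (rule electric_field_borel)
  have "vp_field \<epsilon> g \<in> borel_measurable borel2" unfolding vp_field_def[abs_def] by measurable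
  then show ?thesis by (simp add: borel_prod)
qed

section \<open>Test functions without compact support in phase space\<close>

locale vp_solution =
  fixes \<epsilon> :: real and f0 :: "R2 \<times> R2 \<Rightarrow> real" and f :: "real \<Rightarrow> R2 \<times> R2 \<Rightarrow> real" and L :: real
  assumes eps: "0 < \<epsilon>" and sol: "vp_global_weak_solution \<epsilon> f0 f"
    and f0_Linf: "Linf_mem lborel f0" and f0_L: "Linf_norm lborel f0 \<le> ereal L"
    and f0_supp: "\<exists>K. compact K \<and> ess_supported_in K f0" and f0_nonneg: "AE z in lborel. 0 \<le> f0 z"
begin

lemma f0_bounded: obtains R where "ess_bounded L R f0"
proof -
  obtain K where K: "compact K" "ess_supported_in K f0" using f0_supp by blast
  obtain R where "\<And>z. z \<in> K \<Longrightarrow> norm z \<le> R" using compact_imp_bounded[OF K(1)] unfolding bounded_iff by blast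
  from ess_boundedI[OF f0_Linf f0_L K this] that show thesis by blast
qed

lemma f_bounded: obtains R where "\<And>t. t \<in> {0..T} \<Longrightarrow> ess_bounded L R (f t)"
proof -
  have "\<forall>T>0. \<exists>K. compact K \<and> (\<forall>t\<in>{0..T}. ess_supported_in K (f t))"
    using sol by (simp add: vp_global_weak_solution_def)
  \<comment> \<open>The support property is stated for positive times; \<open>max T 1\<close> covers
    the remaining \<open>T\<close>.\<close>
  then obtain K where K: "compact K" "\<And>t. t \<in> {0..max T 1} \<Longrightarrow> ess_supported_in K (f t)"
    by (metis less_max_iff_disj zero_less_one)
  obtain R where R: "\<And>z. z \<in> K \<Longrightarrow> norm z \<le> R" using compact_imp_bounded[OF K(1)] unfolding bounded_iff by blast
  show thesis
  proof (rule that[of R])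
    fix t assume t: "t \<in> {0..T}"
    have "Linf_mem lborel (f t)" "Linf_norm lborel (f t) \<le> Linf_norm lborel f0"
      using sol t by (auto simp: vp_global_weak_solution_def)
    with ess_boundedI[OF _ order_trans[OF _ f0_L] K(1) K(2) R] t show "ess_bounded L R (f t)" by auto
  qed
qed

lemma f_bounded_at: "0 \<le> t \<Longrightarrow> \<exists>R. ess_bounded L R (f t)"
  using f_bounded[of t] by (metis atLeastAtMost_iff order_refl)

lemma f_borel: "0 \<le> t \<Longrightarrow> borel_fun (f t)" using f_bounded_at ess_bounded_borel by blast

lemma f_time_measurable: "time_measurable f" using sol by (simp add: vp_global_weak_solution_def Linf_time_Linf_def)

text \<open>Up to time \<open>T\<close> the solution lives in one ball, so \<Psi> can be multiplied
  by a phase-space cut-off equal to 1 near that ball without changing either term of the weak form.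
  Polynomial moments and functions of the guiding center thus become admissible. The integral is
  also resolved into time slices.\<close>

lemma weak_form_time_compact:
  assumes \<Psi>: "\<And>k. Ck k \<Psi>" and T: "0 < T" "\<And>t z. T \<le> \<bar>t\<bar> \<Longrightarrow> \<Psi> (t, z) = 0"
  shows "integrable lborel (\<lambda>t. indicator {0..} t * (LBINT z. f t z * FD \<Psi> (t, z) (1, vp_field \<epsilon> (f t) z)))"
    "(LBINT t. indicator {0..} t * (LBINT z. f t z * FD \<Psi> (t, z) (1, vp_field \<epsilon> (f t) z)))
      + (LBINT z. f0 z * \<Psi> (0, z)) = 0"
proof -
  obtain R1 where R1: "\<And>t. t \<in> {0..T} \<Longrightarrow> ess_bounded L R1 (f t)" using f_bounded by blast
  obtain R0 where R0: "ess_bounded L R0 f0" using f0_bounded by blast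
  define R where "R = max R0 R1"
  have R: "R0 \<le> R" "R1 \<le> R" by (auto simp: R_def)
  \<comment> \<open>The cut-off is 1 where |z|^2 \<le> R^2 + 1 and 0 where |z|^2 \<ge> R^2 + 2; the
    squared norm keeps it smooth at the origin.\<close>
  define cut where "cut z = smooth_step (R\<^sup>2 + 2 - z \<bullet> z)" for z :: "R2 \<times> R2"
  have zz: "z \<bullet> z = (norm z)\<^sup>2" for z :: "R2 \<times> R2" by (simp add: power2_norm_eq_inner)
  have cut1: "cut z = 1" if "z \<bullet> z < R\<^sup>2 + 1" for z using that by (simp add: cut_def)
  have in1: "z \<bullet> z < R\<^sup>2 + 1" if "norm z \<le> R" for z :: "R2 \<times> R2"
    using power_mono[OF that norm_ge_zero, of 2] by (simp add: zz)
  define \<phi> where "\<phi> p = \<Psi> p * cut (snd p)" for p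
  have Ccut: "Ck k (\<lambda>p :: real \<times> R2 \<times> R2. cut (snd p))" for k
  proof -
    have "Ck k (\<lambda>p :: real \<times> R2 \<times> R2. (0 + snd p) \<bullet> (0 + snd p))"
      by (rule Ck_compose_affine[OF bounded_linear_snd Ck_inner])
    then have "Ck k (\<lambda>p :: real \<times> R2 \<times> R2. (R\<^sup>2 + 2) - snd p \<bullet> snd p)"
      by (intro Ck_diff Ck_const) simp
    from Ck_compose_real[OF Ck_smooth_step this] show ?thesis by (simp add: cut_def)
  qed
  have C\<phi>: "Ck k \<phi>" for k unfolding \<phi>_def[abs_def] by (intro Ck_mult \<Psi> Ccut)
  have \<phi>: "test_function \<phi>"
  proof (rule test_functionI[OF C\<phi>])
    show "bounded ({-T..T} \<times> cball (0 :: R2 \<times> R2) (R\<^sup>2 + 2))" by (intro bounded_Times bounded_cball) simp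
    fix p assume p: "\<phi> p \<noteq> 0"
    obtain t z where tz: "p = (t, z)" by (cases p)
    have t: "\<bar>t\<bar> < T" using p T(2)[of t z] unfolding tz \<phi>_def by force
    have "0 < R\<^sup>2 + 2 - z \<bullet> z" 
    proof -
      have "smooth_step (R\<^sup>2 + 2 - z \<bullet> z) \<noteq> 0" using p by (simp add: tz \<phi>_def cut_def)
      then show ?thesis by (meson not_less smooth_step_0)
    qed
    then have n2: "(norm z)\<^sup>2 < R\<^sup>2 + 2" by (simp add: zz)
    have "norm z \<le> R\<^sup>2 + 2"
    proof (rule ccontr)
      assume "\<not> norm z \<le> R\<^sup>2 + 2"
      then have "1 \<le> norm z" "R\<^sup>2 + 2 < norm z" using zero_le_power2[of R] by linarith+
      then show False using n2 mult_left_mono[of 1 "norm z" "norm z"] by (simp add: power2_eq_square)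
    qed
    with t show "p \<in> {-T..T} \<times> cball 0 (R\<^sup>2 + 2)" by (auto simp: tz)
  qed
  obtain B where B: "0 \<le> B" "\<And>p h. \<bar>FD \<phi> p h\<bar> \<le> B * norm h"
    using test_function_derivative_bounded[OF \<phi>] by metis
  define X where "X t z = (1::real, vp_field \<epsilon> (f t) z)" for t z
  define F where "F t z = f t z * FD \<phi> (t, z) (X t z)" for t z
  have late: "FD \<Phi> (t, z) h = 0" if "T < t" "\<And>t z. T \<le> \<bar>t\<bar> \<Longrightarrow> \<Phi> (t, z) = 0" for \<Phi> :: "real \<times> R2 \<times> R2 \<Rightarrow> real" and t z h
  proof -
    have "((\<lambda>_. 0) has_derivative (\<lambda>_. 0)) (at (t, z))" by simp
    then have "(\<Phi> has_derivative (\<lambda>_. 0)) (at (t, z))"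
    proof (rule has_derivative_transform_within_open[where s = "{T<..} \<times> UNIV"])
      show "open ({T<..} \<times> (UNIV :: (R2 \<times> R2) set))" by (intro open_Times) auto
      show "0 = \<Phi> p" if "p \<in> {T<..} \<times> UNIV" for p
        using that \<open>\<And>t z. T \<le> \<bar>t\<bar> \<Longrightarrow> \<Phi> (t, z) = 0\<close>[of "fst p" "snd p"] T(1) by auto
    qed (use that in auto)
    then show ?thesis using frechet_derivative_at by metis
  qed
  have \<phi>late: "\<phi> (t, z) = 0" if "T \<le> \<bar>t\<bar>" for t z using T(2)[OF that] by (simp add: \<phi>_def)
  have late_\<phi>: "FD \<phi> (t, z) h = 0" if "T < t" for t z h
    by (rule late[where \<Phi> = \<phi>]) (use that \<phi>late in auto)
  have late_\<Psi>: "FD \<Psi> (t, z) h = 0" if "T < t" for t z h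
    by (rule late[where \<Phi> = \<Psi>]) (use that T(2) in auto)
  \<comment> \<open>The cut-off is 1 on a neighbourhood of the ball, so the derivatives agree there
    as well as the values.\<close>
  have near: "FD \<phi> (t, z) h = FD \<Psi> (t, z) h" if "norm z \<le> R" for t z h
  proof -
    have "(\<phi> has_derivative FD \<Psi> (t, z)) (at (t, z))"
    proof (rule has_derivative_transform_within_open[where s = "UNIV \<times> {z. z \<bullet> z < R\<^sup>2 + 1}", OF Ck_SucD(1)[OF \<Psi>]])
      show "open (UNIV \<times> {z::R2 \<times> R2. z \<bullet> z < R\<^sup>2 + 1} :: (real \<times> R2 \<times> R2) set)"
        by (intro open_Times open_Collect_less continuous_intros) auto
    qed (use in1[OF that] in \<open>auto simp: \<phi>_def cut1\<close>)
    then show ?thesis using frechet_derivative_at by metis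
  qed
  have slice: "AE z in lborel. F t z = f t z * FD \<Psi> (t, z) (X t z)" if t: "0 \<le> t" for t
  proof (cases "t \<le> T")
    case True
    with t R1[of t] have "AE z in lborel. R1 < norm z \<longrightarrow> f t z = 0"
      unfolding ess_bounded_def by (auto elim: eventually_mono)
    then show ?thesis
    proof eventually_elim
      case (elim z)
      show ?case
      proof (cases "norm z \<le> R")
        case True
        then show ?thesis by (simp add: F_def near)
      next
        case False
        with elim R have "f t z = 0" by auto
        then show ?thesis by (simp add: F_def)
      qed
    qed
  next
    case False
    then have "T < t" by simp
    then show ?thesis by (simp add: F_def late_\<phi> late_\<Psi>)
  qed
  have [measurable]: "case_prod (positive_times f) \<in> borel_measurable borel2"
    by (rule positive_times_borel[OF f_time_measurable])
  have [measurable]: "(\<lambda>p. electric_field (positive_times f (fst p)) (snd p)) \<in> borel_measurable borel2"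
    by (rule electric_field_param_borel) measurable
  define G where "G p = indicator {0..} (fst p) * F (fst p) (snd p)" for p :: "real \<times> R2 \<times> R2"
  have G_eq: "G = (\<lambda>p. positive_times f (fst p) (snd p) * FD \<phi> (fst p, snd p)
      (1, snd (snd p) /\<^sub>R \<epsilon>, electric_field (positive_times f (fst p)) (fst (snd p)) /\<^sub>R \<epsilon> + perp (snd (snd p)) /\<^sub>R \<epsilon>\<^sup>2))"
    by (auto simp: fun_eq_iff G_def F_def X_def vp_field_def positive_times_def[abs_def] indicator_def)
  have Gm: "G \<in> borel_measurable (borel \<Otimes>\<^sub>M borel2)"
  proof -
    have m1 [measurable]: "(\<lambda>p. positive_times f (fst p) (snd p)) \<in> borel_measurable (borel \<Otimes>\<^sub>M borel2)"
      unfolding borel_prod[where 'a = R2 and 'b = R2] by measurable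
    have m2 [measurable]: "(\<lambda>p :: real \<times> R2 \<times> R2. electric_field (positive_times f (fst p)) (fst (snd p))) \<in> borel_measurable (borel \<Otimes>\<^sub>M borel2)"
      using measurable_compose[of "\<lambda>p :: real \<times> R2 \<times> R2. (fst p, fst (snd p))" "borel \<Otimes>\<^sub>M borel2" "borel \<Otimes>\<^sub>M borel"
          "\<lambda>p. electric_field (positive_times f (fst p)) (snd p)" borel] by simp
    have m3: "(\<lambda>p. (fst p, snd p)) \<in> borel_measurable (borel \<Otimes>\<^sub>M borel2 :: (real \<times> R2 \<times> R2) measure)"
      by (simp add: borel_prod)
    have m4: "(\<lambda>p. (1::real, snd (snd p) /\<^sub>R \<epsilon>, electric_field (positive_times f (fst p)) (fst (snd p)) /\<^sub>R \<epsilon> + perp (snd (snd p)) /\<^sub>R \<epsilon>\<^sup>2))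
        \<in> borel_measurable (borel \<Otimes>\<^sub>M borel2)" by (intro borel_measurable_Pair) measurable
    show ?thesis unfolding G_eq by (intro borel_measurable_times m1 frechet_derivative_borel[OF C\<phi> m3 m4])
  qed
  then have Gm': "G \<in> borel_measurable lborel2" by (simp add: borel_prod lborel_prod)
  define V where "V = measure lborel (cball (0 :: R2 \<times> R2) R1)"
  obtain A where A: "0 \<le> A" "\<And>(g :: R2 \<times> R2 \<Rightarrow> real) z. ess_bounded L R1 g \<Longrightarrow> norm z \<le> R1 \<Longrightarrow> norm (vp_field \<epsilon> g z) \<le> A"
    using vp_field_bounded[OF eps] by metis
  have Fint: "integrable lborel (F t) \<and> (LBINT z. norm (F t z)) \<le> L * (B * (1 + A)) * V" if t: "t \<in> {0..T}" for t
  proof -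
    have b: "\<bar>FD \<phi> (t, z) (X t z)\<bar> \<le> B * (1 + A)" if "norm z \<le> R1" for z
    proof -
      have "norm (X t z) \<le> 1 + A" unfolding X_def using norm_Pair_le[of "1::real" "vp_field \<epsilon> (f t) z"] A(2)[OF R1[OF t] that] by simp
      from mult_left_mono[OF this B(1)] B(2)[of "(t, z)" "X t z"] show ?thesis by linarith
    qed
    have "borel_fun (\<lambda>z. FD \<phi> (t, z) (X t z))"
    proof (rule frechet_derivative_borel[OF C\<phi>])
      show "borel_fun (Pair t)" by (intro borel_measurable_continuous_onI continuous_intros)
      show "borel_fun (X t)" unfolding X_def using t by (intro borel_measurable_Pair vp_field_borel f_borel) auto
    qed
    from ess_bounded_integrable[OF R1[OF t] this, of "B * (1 + A)"] b show ?thesis by (simp add: F_def[abs_def] V_def)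
  qed
  \<comment> \<open>Slices vanish for t outside [0,T] and are bounded in L1 by one constant inside;
    this gives integrability over the product.\<close>
  have Gint: "integrable lborel2 G"
  proof (rule lborel_pair.Fubini_integrable[OF Gm'])
    have Gz: "G (t, z) = 0" if "t \<notin> {0..T}" for t z
      using that late_\<phi>[of t] by (cases "0 \<le> t") (auto simp: G_def F_def)
    show "AE t in lborel. integrable lborel (\<lambda>z. G (t, z))"
    proof (rule AE_I2)
      fix t
      show "integrable lborel (\<lambda>z. G (t, z))"
      proof (cases "t \<in> {0..T}")
        case True
        then have "(\<lambda>z. G (t, z)) = F t" by (auto simp: G_def)
        with Fint[OF True] show ?thesis by simp
      next
        case False
        then have "(\<lambda>z. G (t, z)) = (\<lambda>_. 0)" using Gz[of t] by blast
        then show ?thesis by (simp only: Bochner_Integration.integrable_zero)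
      qed
    qed
    show "integrable lborel (\<lambda>t. LBINT z. norm (G (t, z)))"
    proof (rule dominated_integrable[where f = "\<lambda>t. indicator {0..T} t * (L * (B * (1 + A)) * V)"])
      show "integrable lborel (\<lambda>t::real. indicator {0..T} t * (L * (B * (1 + A)) * V))"
        by (intro integrable_mult_left integrable_real_indicator) (simp_all add: T(1) less_imp_le)
      show "(\<lambda>t. LBINT z. norm (G (t, z))) \<in> borel_measurable lborel" using Gm' by measurable
      show "AE t in lborel. norm (LBINT z. norm (G (t, z))) \<le> norm (indicator {0..T} t * (L * (B * (1 + A)) * V))"
      proof (rule AE_I2)
        fix t
        show "norm (LBINT z. norm (G (t, z))) \<le> norm (indicator {0..T} t * (L * (B * (1 + A)) * V))"
        proof (cases "t \<in> {0..T}")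
          case True
          then have "(LBINT z. norm (G (t, z))) = (LBINT z. norm (F t z))" by (simp add: G_def)
          moreover have "0 \<le> (LBINT z. norm (F t z))" by simp
          ultimately show ?thesis using Fint[OF True] True by simp linarith
        next
          case False
          then have "(\<lambda>z. norm (G (t, z))) = (\<lambda>_. 0)" using Gz[of t] by simp
          then show ?thesis by (simp only: Bochner_Integration.integral_zero) simp
        qed
      qed
    qed
  qed
  have sl: "(LBINT z. G (t, z)) = indicator {0..} t * (LBINT z. f t z * FD \<Psi> (t, z) (1, vp_field \<epsilon> (f t) z))" for t
  proof (cases "0 \<le> t")
    case True
    have [measurable]: "borel_fun (f t)" by (rule f_borel[OF True])
    have m: "borel_fun (\<lambda>z. FD \<Phi> (t, z) (X t z))" if "\<And>k. Ck k \<Phi>" for \<Phi>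
    proof (rule frechet_derivative_borel[OF that])
      show "borel_fun (Pair t)" by (intro borel_measurable_continuous_onI continuous_intros)
      show "borel_fun (X t)" unfolding X_def using True by (intro borel_measurable_Pair vp_field_borel f_borel) auto
    qed
    have "(LBINT z. F t z) = (LBINT z. f t z * FD \<Psi> (t, z) (X t z))"
    proof (rule integral_cong_AE)
      show "(\<lambda>z. F t z) \<in> borel_measurable lborel" unfolding F_def using m[OF C\<phi>] by simp
      show "(\<lambda>z. f t z * FD \<Psi> (t, z) (X t z)) \<in> borel_measurable lborel" using m[OF \<Psi>] by simp
    qed (rule slice[OF True])
    with True show ?thesis by (simp add: G_def X_def)
  qed (simp add: G_def)
  show int: "integrable lborel (\<lambda>t. indicator {0..} t * (LBINT z. f t z * FD \<Psi> (t, z) (1, vp_field \<epsilon> (f t) z)))"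
    using lborel_pair.integrable_fst'[OF Gint] by (simp only: sl)
  have "vp_weak_form \<epsilon> f0 f" using sol by (simp add: vp_global_weak_solution_def)
  with \<phi> have "set_lebesgue_integral lborel ({0..} \<times> UNIV) (\<lambda>(t, x, v).
        f t (x, v) * FD \<phi> (t, x, v) (1, v /\<^sub>R \<epsilon>, electric_field (f t) x /\<^sub>R \<epsilon> + perp v /\<^sub>R \<epsilon>\<^sup>2))
     + (LBINT z. f0 z * \<phi> (0, z)) = 0" unfolding vp_weak_form_def by blast
  moreover have "set_lebesgue_integral lborel ({0..} \<times> UNIV) (\<lambda>(t, x, v).
        f t (x, v) * FD \<phi> (t, x, v) (1, v /\<^sub>R \<epsilon>, electric_field (f t) x /\<^sub>R \<epsilon> + perp v /\<^sub>R \<epsilon>\<^sup>2))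
      = (LBINT p. G p)" unfolding set_lebesgue_integral_def
    by (intro Bochner_Integration.integral_cong) (auto simp: G_def F_def X_def vp_field_def indicator_def)
  moreover have "(LBINT p. G p) = (LBINT t. LBINT z. G (t, z))"
    using lborel_pair.integral_fst'[OF Gint] by (simp add: lborel_prod)
  moreover have "(LBINT z. f0 z * \<phi> (0, z)) = (LBINT z. f0 z * \<Psi> (0, z))"
  proof (rule integral_cong_AE)
    have [measurable]: "borel_fun f0" by (rule ess_bounded_borel[OF R0])
    have c0: "continuous_on UNIV (\<lambda>z. \<Phi> (0::real, z))" if "Ck 0 \<Phi>" for \<Phi> :: "real \<times> R2 \<times> R2 \<Rightarrow> real"
      using that by (auto intro!: continuous_on_compose2[of UNIV \<Phi>] continuous_intros)
    have [measurable]: "borel_fun (\<lambda>z. \<phi> (0, z))" "borel_fun (\<lambda>z. \<Psi> (0, z))"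
      by (rule borel_measurable_continuous_onI, rule c0, rule C\<phi> \<Psi>)+
    show "(\<lambda>z. f0 z * \<phi> (0, z)) \<in> borel_measurable lborel" "(\<lambda>z. f0 z * \<Psi> (0, z)) \<in> borel_measurable lborel"
      by measurable
    show "AE z in lborel. f0 z * \<phi> (0, z) = f0 z * \<Psi> (0, z)"
      using R0[unfolded ess_bounded_def, THEN conjunct2]
    proof eventually_elim
      case (elim z)
      show ?case
      proof (cases "norm z \<le> R")
        case True
        then show ?thesis using cut1[OF in1[OF True]] by (simp add: \<phi>_def)
      next
        case False
        with elim R have "f0 z = 0" by auto
        then show ?thesis by simp
      qed
    qed
  qed
  ultimately show "(LBINT t. indicator {0..} t * (LBINT z. f t z * FD \<Psi> (t, z) (1, vp_field \<epsilon> (f t) z)))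
      + (LBINT z. f0 z * \<Psi> (0, z)) = 0" by (simp add: sl)
qed

end

section \<open>From the weak form to values at single times\<close>

definition smooth_step_deriv :: "real \<Rightarrow> real" where
  "smooth_step_deriv u = FD smooth_step u 1"

lemma smooth_step_has_deriv: "(smooth_step has_real_derivative smooth_step_deriv u) (at u)"
proof -
  have d: "(smooth_step has_derivative FD smooth_step u) (at u)" by (rule Ck_SucD(1)[OF Ck_smooth_step])
  have "FD smooth_step u = (\<lambda>h. smooth_step_deriv u * h)"
  proof (rule ext)
    fix h :: real
    have "FD smooth_step u (h *\<^sub>R 1) = h *\<^sub>R FD smooth_step u 1"
      by (rule linear_cmul[OF has_derivative_linear[OF d]])
    then show "FD smooth_step u h = smooth_step_deriv u * h" by (simp add: smooth_step_deriv_def mult.commute)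
  qed
  with d show ?thesis by (simp add: has_field_derivative_def)
qed

lemma continuous_smooth_step_deriv: "continuous_on A smooth_step_deriv"
proof -
  have "Ck 0 (\<lambda>u. FD smooth_step u 1)" by (rule Ck_SucD(2)[OF Ck_smooth_step])
  then have "continuous_on UNIV smooth_step_deriv" by (simp add: smooth_step_deriv_def[abs_def])
  then show ?thesis by (rule continuous_on_subset) simp
qed

text \<open>The step is nonnegative and attains 0 at these points, so they are minima.\<close>

lemma smooth_step_deriv_0: "u \<le> 0 \<Longrightarrow> smooth_step_deriv u = 0"
  by (rule DERIV_local_min[OF smooth_step_has_deriv zero_less_one]) (auto simp: smooth_step_bounds)

lemma smooth_step_deriv_1: "1 \<le> u \<Longrightarrow> smooth_step_deriv u = 0"
  by (rule DERIV_local_max[OF smooth_step_has_deriv zero_less_one]) (auto simp: smooth_step_bounds)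

lemma smooth_step_deriv_borel [measurable]: "borel_fun smooth_step_deriv"
  by (rule borel_measurable_continuous_onI[OF continuous_smooth_step_deriv])

lemma smooth_step_borel [measurable]: "borel_fun smooth_step"
  using Ck_smooth_step[of 0] by (simp add: borel_measurable_continuous_onI)

lemma smooth_step_deriv_integral:
  "integrable lborel smooth_step_deriv" "(LBINT u. smooth_step_deriv u) = 1"
proof -
  have eq: "smooth_step_deriv u * indicator {0..1} u = smooth_step_deriv u" for u
    by (cases "u < 0"; cases "1 < u") (auto simp: smooth_step_deriv_0 smooth_step_deriv_1)
  have "(LBINT u. smooth_step_deriv u * indicator {0..1} u) = smooth_step 1 - smooth_step 0"
  proof (rule integral_FTC_Icc_real)
    show "isCont smooth_step_deriv x" for x
      using continuous_smooth_step_deriv[of UNIV] by (simp add: continuous_on_eq_continuous_at)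
  qed (simp_all add: smooth_step_has_deriv)
  then show "(LBINT u. smooth_step_deriv u) = 1" unfolding eq by simp
  \<comment> \<open>A Bochner integral different from 0 occurs only for an integrable
    function.\<close>
  then show "integrable lborel smooth_step_deriv"
    using not_integrable_integral_eq[of lborel smooth_step_deriv] by force
qed

lemma continuous_on_halfline:
  fixes g :: "real \<Rightarrow> 'a::topological_space"
  assumes "\<And>T. continuous_on {0..T} g"
  shows "continuous_on {0..} g" unfolding continuous_on_eq_continuous_within
proof
  fix t :: real assume t: "t \<in> {0..}"
  have "at t within {0..} = at t within {0..t + 1}" by (rule at_within_nhd[of t "{..<t+1}"]) auto
  moreover have "continuous (at t within {0..t + 1}) g"
    using assms[of "t + 1"] t unfolding continuous_on_eq_continuous_within by auto
  ultimately show "continuous (at t within {0..}) g" by simp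
qed

lemma l2_cutoff_continuous:
  fixes w :: "'a::euclidean_space \<Rightarrow> real"
  assumes "continuous_on UNIV w"
  shows "l2 (\<lambda>z. cutoff R z * w z)"
proof -
  have wm: "borel_fun w" by (rule borel_measurable_continuous_onI[OF assms])
  have "compact (w ` cball 0 R)" by (intro compact_continuous_image continuous_on_subset[OF assms]) auto
  then obtain B where B: "\<forall>z\<in>cball 0 R. \<bar>w z\<bar> \<le> B"
    using compact_imp_bounded[of "w ` cball 0 R"] unfolding bounded_iff by auto
  have "\<bar>cutoff R z * w z\<bar> \<le> max B 0" for z
    using B by (cases "z \<in> cball 0 R") (auto simp: max.coboundedI1)
  then show ?thesis
  proof (rule l2_bounded_support[rotated])
    show "borel_fun (\<lambda>z. cutoff R z * w z)"
      using wm by (intro borel_measurable_times borel_measurable_indicator) auto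
    show "cutoff R z * w z = 0" if "R + 1 \<le> norm z" for z using that by (simp add: indicator_def)
  qed
qed

context vp_solution
begin

text \<open>Weak continuity in L2 extends to weights that are only locally square integrable,
  because on [0,T] the supports of \<open>f t\<close> lie in one ball.\<close>

lemma pairing_continuous:
  assumes w: "\<And>R. l2 (\<lambda>z. cutoff R z * w z)"
  shows "continuous_on {0..} (\<lambda>t. pairing w (f t))"
proof (rule continuous_on_halfline)
  fix T
  obtain R where R: "\<And>t. t \<in> {0..T} \<Longrightarrow> ess_bounded L R (f t)" using f_bounded by blast
  have "C_L2_weak f" using sol by (simp add: vp_global_weak_solution_def)
  then have "continuous_on {0..} (\<lambda>t. LBINT z. cutoff R z * w z * f t z)"
    using w[of R] unfolding C_L2_weak_def Lp_mem_2_iff by blast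
  then have "continuous_on {0..T} (\<lambda>t. LBINT z. cutoff R z * w z * f t z)" by (rule continuous_on_subset) auto
  then show "continuous_on {0..T} (\<lambda>t. pairing w (f t))"
  proof (rule continuous_on_eq)
    fix t assume t: "t \<in> {0..T}"
    have ae: "AE z in lborel. R < norm z \<longrightarrow> f t z = 0"
      using R[OF t] unfolding ess_bounded_def by (auto elim: eventually_mono)
    have iff: "integrable lborel (\<lambda>z. cutoff R z * w z * f t z)"
      by (rule l2_mult_integrable[OF w ess_bounded_l2[OF R[OF t]]])
    have eq: "AE z in lborel. cutoff R z * w z * f t z = w z * f t z"
      using ae by eventually_elim (auto simp: indicator_def)
    obtain w' where "w' = (\<lambda>z. cutoff R z * w z * f t z)" by blast
    show "(LBINT z. cutoff R z * w z * f t z) = pairing w (f t)"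
    proof (rule integral_cong_AE)
      show "(\<lambda>z. cutoff R z * w z * f t z) \<in> borel_measurable lborel" using iff by auto
      have wb: "borel_fun w"
      proof (rule borel_measurable_LIMSEQ_real)
        show "(\<lambda>n. indicator (cball 0 (real n)) z * w z) \<longlonglongrightarrow> w z" for z
        proof (rule tendsto_eventually)
          obtain N :: nat where "norm z \<le> real N" using real_arch_simple by blast
          then show "\<forall>\<^sub>F n in sequentially. indicator (cball 0 (real n)) z * w z = w z"
            by (intro eventually_sequentiallyI[of N]) (auto simp: indicator_def)
        qed
        show "borel_fun (\<lambda>z. indicator (cball 0 (real n)) z * w z)" for n by (rule l2_borel[OF w])
      qed
      then show "(\<lambda>z. w z * f t z) \<in> borel_measurable lborel" using f_borel[of t] t by simp
    qed (rule eq)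
  qed
qed

lemma f_mult_continuous:
  assumes "0 \<le> t" "continuous_on UNIV w"
  shows "integrable lborel (\<lambda>z. f t z * w z)"
  using f_bounded_at[OF assms(1)] ess_bounded_integrable_continuous assms(2) by blast

lemma f_mult_derivative:
  assumes "0 \<le> t" "\<And>k. Ck k \<psi>"
  shows "integrable lborel (\<lambda>z. f t z * FD \<psi> z (vp_field \<epsilon> (f t) z))"
proof -
  obtain R where R: "ess_bounded L R (f t)" using f_bounded_at[OF assms(1)] by blast
  obtain A where A: "\<And>(g :: R2 \<times> R2 \<Rightarrow> real) z. ess_bounded L R g \<Longrightarrow> norm z \<le> R \<Longrightarrow> norm (vp_field \<epsilon> g z) \<le> A"
    using vp_field_bounded[OF eps] by metis
  let ?D = "\<lambda>b z. FD \<psi> z b"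
  have "\<exists>B\<ge>0. \<forall>z\<in>cball 0 R. \<bar>?D b z\<bar> \<le> B" for b
  proof -
    have "Ck 0 (?D b)" by (rule Ck_SucD(2)[OF assms(2)])
    then have "compact (?D b ` cball 0 R)" by (intro compact_continuous_image) (auto intro: continuous_on_subset)
    then obtain B where "\<forall>z\<in>cball 0 R. \<bar>?D b z\<bar> \<le> B"
      using compact_imp_bounded[of "?D b ` cball 0 R"] unfolding bounded_iff by auto
    then show ?thesis by (intro exI[of _ "max B 0"]) (auto simp: max.coboundedI1)
  qed
  then obtain B where B: "\<And>b. 0 \<le> B b" "\<And>b z. z \<in> cball 0 R \<Longrightarrow> \<bar>?D b z\<bar> \<le> B b" by metis
  have "norm (?D (vp_field \<epsilon> (f t) z) z) \<le> (\<Sum>b\<in>Basis. A * B b)" if z: "norm z \<le> R" for z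
  proof -
    note lin = linear_frechet_derivative_Ck[OF assms(2), of z]
    let ?h = "vp_field \<epsilon> (f t) z"
    have "?D ?h z = ?D (\<Sum>b\<in>Basis. (?h \<bullet> b) *\<^sub>R b) z" by (simp add: euclidean_representation)
    also have "\<dots> = (\<Sum>b\<in>Basis. (?h \<bullet> b) * ?D b z)" by (simp add: linear_sum[OF lin] linear_cmul[OF lin])
    finally have "\<bar>?D ?h z\<bar> \<le> (\<Sum>b\<in>Basis. \<bar>(?h \<bullet> b) * ?D b z\<bar>)" by (simp add: sum_abs)
    also have "\<dots> \<le> (\<Sum>b\<in>Basis. A * B b)"
    proof (rule sum_mono)
      fix b :: "R2 \<times> R2" assume "b \<in> Basis"
      then have "\<bar>?h \<bullet> b\<bar> \<le> A" using Basis_le_norm[of b ?h] A[OF R z] by linarith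
      moreover have "\<bar>?D b z\<bar> \<le> B b" using B(2) z by simp
      ultimately show "\<bar>(?h \<bullet> b) * ?D b z\<bar> \<le> A * B b"
        unfolding abs_mult using order_trans[OF norm_ge_zero A[OF R z]] by (intro mult_mono) auto
    qed
    finally show ?thesis by simp
  qed
  note bound = this
  have "borel_fun (\<lambda>z. ?D (vp_field \<epsilon> (f t) z) z)"
  proof (rule frechet_derivative_borel[OF assms(2)])
    show "borel_fun (\<lambda>z. z)" by simp
    show "vp_field \<epsilon> (f t) \<in> borel_measurable borel" by (rule vp_field_borel[OF f_borel[OF assms(1)]])
  qed
  from ess_bounded_integrable(1)[OF R this bound] show ?thesis by simp
qed

text \<open>Testing with \<open>\<theta>(t) \<psi>(x, v)\<close>, where \<open>\<theta>\<close> decreases smoothly from 1 to 0 between \<open>\<tau>\<close> and \<open>\<tau> + \<delta>\<close>,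
  and letting \<open>\<delta>\<close> tend to 0.\<close>

lemma pairing_identity:
  assumes \<psi>: "\<And>k. Ck k \<psi>" and \<tau>: "0 \<le> \<tau>"
  defines "b \<equiv> \<lambda>t. LBINT z. f t z * FD \<psi> z (vp_field \<epsilon> (f t) z)"
  shows "integrable lborel (\<lambda>t. indicator {0..\<tau>} t * b t)"
    "pairing (f \<tau>) \<psi> = pairing f0 \<psi> + (LBINT t. indicator {0..\<tau>} t * b t)"
proof -
  define a where "a t = pairing (f t) \<psi>" for t
  have \<psi>c: "continuous_on UNIV \<psi>" using \<psi>[of 0] by simp
  have acont: "continuous_on {0..} a"
    unfolding a_def using pairing_continuous[OF l2_cutoff_continuous[OF \<psi>c]] by (simp add: mult.commute)
  \<comment> \<open>The first factor is 1 for t \<ge> -1 and 0 for t \<le> -2: test functions live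
    on the whole time axis and must have compact support there.\<close>
  define \<theta> where "\<theta> \<sigma> d t = smooth_step (t + 2) * smooth_step ((\<sigma> + d - t) / d)" for \<sigma> d t :: real
  define \<theta>' where "\<theta>' \<sigma> d t = - (smooth_step_deriv ((\<sigma> + d - t) / d) / d)" for \<sigma> d t :: real
  have C\<theta>: "Ck k (\<theta> \<sigma> d)" for k \<sigma> d
  proof -
    have "Ck k (\<lambda>t::real. 2 + t)" "Ck k (\<lambda>t::real. (\<sigma> + d) / d + (- 1 / d) * t)"
      by (intro Ck_add Ck_const Ck_cmult Ck_linear bounded_linear_ident)+
    from Ck_mult[OF Ck_compose_real[OF Ck_smooth_step this(1)] Ck_compose_real[OF Ck_smooth_step this(2)]]
    show ?thesis unfolding \<theta>_def[abs_def] by (simp add: add.commute diff_divide_distrib)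
  qed
  have D\<theta>: "(\<theta> \<sigma> d has_real_derivative \<theta>' \<sigma> d t) (at t)" if "0 \<le> t" "0 < d" for \<sigma> d t
  proof -
    have 1: "((\<lambda>t. smooth_step (t + 2)) has_real_derivative smooth_step_deriv (t + 2) * 1) (at t)"
      by (rule DERIV_chain2[OF smooth_step_has_deriv]) (auto intro!: derivative_eq_intros)
    have 2: "((\<lambda>t. smooth_step ((\<sigma> + d - t) / d)) has_real_derivative smooth_step_deriv ((\<sigma> + d - t) / d) * (- 1 / d)) (at t)"
      by (rule DERIV_chain2[OF smooth_step_has_deriv]) (use that in \<open>auto intro!: derivative_eq_intros simp: field_simps\<close>)
    from DERIV_mult[OF 1 2] show ?thesis
      unfolding \<theta>_def[abs_def] \<theta>'_def using that by (simp add: smooth_step_deriv_1)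
  qed
  have \<theta>bounds: "\<bar>\<theta> \<sigma> d t\<bar> \<le> 1" for \<sigma> d t
    unfolding \<theta>_def abs_mult using smooth_step_bounds by (intro mult_le_one) auto
  have \<theta>1: "\<theta> \<sigma> d t = 1" if "0 \<le> t" "t \<le> \<sigma>" "0 < d" for \<sigma> d t
    using that by (simp add: \<theta>_def field_simps)
  have \<theta>0: "\<theta> \<sigma> d t = 0" if "\<sigma> + d \<le> t" "0 < d" for \<sigma> d t
    using that by (simp add: \<theta>_def divide_nonpos_pos)
  have \<theta>m [measurable]: "\<theta> \<sigma> d \<in> borel_measurable borel" "\<theta>' \<sigma> d \<in> borel_measurable borel" for \<sigma> d
    unfolding \<theta>_def[abs_def] \<theta>'_def[abs_def] by measurable
  let ?I = "indicator {0..} :: real \<Rightarrow> real"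
  have weak: "integrable lborel (\<lambda>t. ?I t * (\<theta> \<sigma> d t * b t + \<theta>' \<sigma> d t * a t)) \<and>
      (LBINT t. ?I t * (\<theta> \<sigma> d t * b t + \<theta>' \<sigma> d t * a t)) + pairing f0 \<psi> = 0"
    if \<sigma>: "0 \<le> \<sigma>" and d: "0 < d" "d \<le> 1" for \<sigma> d
  proof -
    define \<Psi> where "\<Psi> p = \<theta> \<sigma> d (fst p) * \<psi> (snd p)" for p :: "real \<times> R2 \<times> R2"
    have C\<Psi>: "Ck k \<Psi>" for k
    proof -
      have "Ck k (\<lambda>p :: real \<times> R2 \<times> R2. \<theta> \<sigma> d (0 + fst p))" "Ck k (\<lambda>p :: real \<times> R2 \<times> R2. \<psi> (0 + snd p))"
        by (intro Ck_compose_affine[OF bounded_linear_fst] Ck_compose_affine[OF bounded_linear_snd] C\<theta> \<psi>)+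
      then show ?thesis unfolding \<Psi>_def[abs_def] by (intro Ck_mult) simp_all
    qed
    have zero: "\<Psi> (t, z) = 0" if "\<sigma> + 3 \<le> \<bar>t\<bar>" for t z
    proof (cases "0 \<le> t")
      case True
      then show ?thesis using that d \<theta>0[of \<sigma> d t] by (simp add: \<Psi>_def)
    next
      case False
      then have "t + 2 \<le> 0" using that \<sigma> by linarith
      then show ?thesis by (simp add: \<Psi>_def \<theta>_def)
    qed
    have D: "FD \<Psi> (t, z) (1, X) = \<theta> \<sigma> d t * FD \<psi> z X + \<theta>' \<sigma> d t * \<psi> z"
      if "0 \<le> t" for t z X
    proof -
      have 1: "((\<lambda>p :: real \<times> R2 \<times> R2. \<theta> \<sigma> d (fst p)) has_derivative (\<lambda>h. \<theta>' \<sigma> d t * fst h)) (at (t, z))"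
        using has_derivative_compose[OF has_derivative_fst[OF has_derivative_ident], of "\<theta> \<sigma> d" "\<lambda>h. \<theta>' \<sigma> d t * h" "(t, z)" UNIV]
          D\<theta>[OF that d(1), of \<sigma>] by (simp add: has_field_derivative_def)
      have 2: "((\<lambda>p :: real \<times> R2 \<times> R2. \<psi> (snd p)) has_derivative (\<lambda>h. FD \<psi> z (snd h))) (at (t, z))"
        using has_derivative_compose[OF has_derivative_snd[OF has_derivative_ident], of \<psi> "FD \<psi> z" "(t, z)" UNIV]
          Ck_SucD(1)[OF \<psi>] by simp
      from frechet_derivative_at[OF has_derivative_mult[OF 1 2]] have
        "FD \<Psi> (t, z) = (\<lambda>h. \<theta> \<sigma> d (fst (t, z)) * FD \<psi> z (snd h) + \<theta>' \<sigma> d t * fst h * \<psi> (snd (t, z)))"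
        unfolding \<Psi>_def[abs_def] by (rule sym)
      then show ?thesis by simp
    qed
    have c: "?I t * (LBINT z. f t z * FD \<Psi> (t, z) (1, vp_field \<epsilon> (f t) z))
        = ?I t * (\<theta> \<sigma> d t * b t + \<theta>' \<sigma> d t * a t)" for t
    proof (cases "0 \<le> t")
      case True
      have "(LBINT z. f t z * FD \<Psi> (t, z) (1, vp_field \<epsilon> (f t) z))
          = (LBINT z. \<theta> \<sigma> d t * (f t z * FD \<psi> z (vp_field \<epsilon> (f t) z)) + \<theta>' \<sigma> d t * (f t z * \<psi> z))"
        by (simp add: D[OF True] algebra_simps)
      also have "\<dots> = \<theta> \<sigma> d t * b t + \<theta>' \<sigma> d t * a t"
        unfolding a_def b_def using f_mult_derivative[OF True \<psi>] f_mult_continuous[OF True \<psi>c] by simp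
      finally show ?thesis by simp
    qed simp
    have "0 < \<sigma> + 3" using \<sigma> by simp
    note W = weak_form_time_compact[OF C\<Psi> this zero]
    have "\<Psi> (0, z) = \<psi> z" for z using \<theta>1[of 0 \<sigma> d] \<sigma> d by (simp add: \<Psi>_def)
    with W show ?thesis unfolding c by simp
  qed
  \<comment> \<open>With width 1 the function \<theta> is 1 and its derivative 0 on [0,\<sigma>], so
    restricting the integrand of the weak form to this interval leaves \<open>b\<close>.\<close>
  have bint: "integrable lborel (\<lambda>t. indicator {0..\<sigma>} t * b t)" if \<sigma>: "0 \<le> \<sigma>" for \<sigma>
  proof -
    have "integrable lborel (\<lambda>t. indicator {0..\<sigma>} t *\<^sub>R (?I t * (\<theta> \<sigma> 1 t * b t + \<theta>' \<sigma> 1 t * a t)))"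
      using weak[OF \<sigma>, of 1] by (intro integrable_mult_indicator) auto
    moreover have "indicator {0..\<sigma>} t *\<^sub>R (?I t * (\<theta> \<sigma> 1 t * b t + \<theta>' \<sigma> 1 t * a t)) = indicator {0..\<sigma>} t * b t" for t
      using \<theta>1[of t \<sigma> 1] by (auto simp: indicator_def \<theta>'_def smooth_step_deriv_1)
    ultimately show ?thesis by (simp only:)
  qed
  show "integrable lborel (\<lambda>t. indicator {0..\<tau>} t * b t)" by (rule bint[OF \<tau>])
  define d where "d n = 1 / real (Suc n)" for n
  have d: "0 < d n" "d n \<le> 1" for n by (auto simp: d_def)
  have dlim: "d \<longlonglongrightarrow> 0" unfolding d_def by (rule LIMSEQ_Suc[OF lim_1_over_n])
  have am: "borel_fun (\<lambda>t. ?I t * a t)" using borel_measurable_continuous_on_indicator[OF _ acont] by simp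
  have b1: "integrable lborel (\<lambda>t. indicator {0..\<tau> + 1} t * b t)" using bint[of "\<tau> + 1"] \<tau> by simp
  have \<theta>b_eq: "?I t * (\<theta> \<tau> (d n) t * b t) = \<theta> \<tau> (d n) t * (indicator {0..\<tau> + 1} t * b t)" for n t
    using \<theta>0[of \<tau> "d n" t] d[of n] by (auto simp: indicator_def)
  have \<theta>b: "integrable lborel (\<lambda>t. ?I t * (\<theta> \<tau> (d n) t * b t))" for n
    unfolding \<theta>b_eq
  proof (rule dominated_integrable[OF b1])
    show "(\<lambda>t. \<theta> \<tau> (d n) t * (indicator {0..\<tau> + 1} t * b t)) \<in> borel_measurable lborel"
      by (rule borel_measurable_times[OF _ borel_measurable_integrable[OF b1]]) (simp add: \<theta>m)
    show "AE t in lborel. norm (\<theta> \<tau> (d n) t * (indicator {0..\<tau> + 1} t * b t)) \<le> norm (indicator {0..\<tau> + 1} t * b t)"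
      using \<theta>bounds by (intro AE_I2) (simp add: abs_mult mult_left_le_one_le)
  qed
  have \<theta>a: "integrable lborel (\<lambda>t. ?I t * (\<theta>' \<tau> (d n) t * a t))" for n
    using Bochner_Integration.integrable_diff[OF conjunct1[OF weak[OF \<tau> d(1,2)[of n]]] \<theta>b[of n]]
    by (simp add: algebra_simps)
  have sum: "(LBINT t. ?I t * (\<theta> \<tau> (d n) t * b t)) + (LBINT t. ?I t * (\<theta>' \<tau> (d n) t * a t)) + pairing f0 \<psi> = 0" for n
    using conjunct2[OF weak[OF \<tau> d(1,2)[of n]]] \<theta>b[of n] \<theta>a[of n] by (simp add: distrib_left)
  have lim1: "(\<lambda>n. LBINT t. ?I t * (\<theta> \<tau> (d n) t * b t)) \<longlonglongrightarrow> (LBINT t. indicator {0..\<tau>} t * b t)"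
  proof (rule integral_dominated_convergence[where w = "\<lambda>t. \<bar>indicator {0..\<tau> + 1} t * b t\<bar>"])
    show "integrable lborel (\<lambda>t. \<bar>indicator {0..\<tau> + 1} t * b t\<bar>)" using b1 by (rule integrable_abs)
    show "(\<lambda>t. indicator {0..\<tau>} t * b t) \<in> borel_measurable lborel" using bint[OF \<tau>] by auto
    show "(\<lambda>t. ?I t * (\<theta> \<tau> (d n) t * b t)) \<in> borel_measurable lborel" for n using \<theta>b[of n] by auto
    show "AE t in lborel. norm (?I t * (\<theta> \<tau> (d n) t * b t)) \<le> \<bar>indicator {0..\<tau> + 1} t * b t\<bar>" for n
      unfolding \<theta>b_eq using \<theta>bounds by (intro AE_I2) (simp add: abs_mult mult_left_le_one_le)
    show "AE t in lborel. (\<lambda>n. ?I t * (\<theta> \<tau> (d n) t * b t)) \<longlonglongrightarrow> indicator {0..\<tau>} t * b t"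
    proof (rule AE_I2, rule tendsto_eventually)
      fix t
      show "\<forall>\<^sub>F n in sequentially. ?I t * (\<theta> \<tau> (d n) t * b t) = indicator {0..\<tau>} t * b t"
      proof (cases "t \<le> \<tau>")
        case True
        then show ?thesis using \<theta>1[of t \<tau>] d(1) by (auto simp: indicator_def)
      next
        case False
        then have "\<forall>\<^sub>F n in sequentially. d n < t - \<tau>" using dlim by (intro order_tendstoD) auto
        then show ?thesis
        proof eventually_elim
          case (elim n)
          then show ?case using \<theta>0[of \<tau> "d n" t] d(1)[of n] False by (simp add: indicator_def)
        qed
      qed
    qed
  qed
  have "compact (a ` {0..\<tau> + 1})" by (intro compact_continuous_image continuous_on_subset[OF acont]) auto
  then have "bounded (a ` {0..\<tau> + 1})" by (rule compact_imp_bounded)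
  then obtain A where "\<forall>y\<in>a ` {0..\<tau> + 1}. norm y \<le> A" unfolding bounded_iff by blast
  then have A: "\<bar>a t\<bar> \<le> A" if "t \<in> {0..\<tau> + 1}" for t using that by simp
  \<comment> \<open>The substitution t = \<tau> + d - d u with d = \<open>d n\<close> turns
    \<theta>' into the fixed density \<open>smooth_step_deriv\<close>, of integral 1, up to sign,
    while the argument of \<open>a\<close> tends to \<tau>.\<close>
  define h where "h n u = smooth_step_deriv u * (?I (\<tau> + d n - d n * u) * a (\<tau> + d n - d n * u))" for n u
  have subst: "(LBINT t. ?I t * (\<theta>' \<tau> (d n) t * a t)) = - (LBINT u. h n u)" for n
  proof -
    have "(LBINT t. ?I t * (\<theta>' \<tau> (d n) t * a t))
        = \<bar>- d n\<bar> *\<^sub>R (LBINT u. ?I ((\<tau> + d n) + - d n * u) * (\<theta>' \<tau> (d n) ((\<tau> + d n) + - d n * u) * a ((\<tau> + d n) + - d n * u)))"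
      by (rule lborel_integral_real_affine) (use d(1)[of n] in simp)
    also have "\<dots> = (LBINT u. d n * (?I ((\<tau> + d n) + - d n * u) * (\<theta>' \<tau> (d n) ((\<tau> + d n) + - d n * u) * a ((\<tau> + d n) + - d n * u))))"
      using d(1)[of n] by simp
    also have "\<dots> = (LBINT u. - h n u)"
      using d(1)[of n] by (intro Bochner_Integration.integral_cong) (auto simp: h_def \<theta>'_def)
    finally show ?thesis by simp
  qed
  have mem: "\<tau> + d n - d n * u \<in> {0..\<tau> + 1}" if "u \<in> {0..1}" for n u
  proof -
    have "d n * u \<le> d n * 1" "0 \<le> d n * u" using that d(1)[of n] by (auto intro!: mult_left_mono mult_nonneg_nonneg simp: less_imp_le)
    with \<tau> d(2)[of n] show ?thesis by simp
  qed
  have out: "smooth_step_deriv u = 0" if "u \<notin> {0..1}" for u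
    using that by (cases "u < 0") (auto simp: smooth_step_deriv_0 smooth_step_deriv_1)
  have "(\<lambda>n. LBINT u. h n u) \<longlonglongrightarrow> (LBINT u. smooth_step_deriv u * a \<tau>)"
  proof (rule integral_dominated_convergence[where w = "\<lambda>u. \<bar>smooth_step_deriv u\<bar> * A"])
    show "integrable lborel (\<lambda>u. \<bar>smooth_step_deriv u\<bar> * A)" using smooth_step_deriv_integral(1) by simp
    show "h n \<in> borel_measurable lborel" for n
      unfolding h_def[abs_def] using measurable_compose[OF _ am, of "\<lambda>u. \<tau> + d n - d n * u" borel] by simp
    show "AE u in lborel. norm (h n u) \<le> \<bar>smooth_step_deriv u\<bar> * A" for n
    proof (rule AE_I2)
      fix u
      show "norm (h n u) \<le> \<bar>smooth_step_deriv u\<bar> * A"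
        using mult_left_mono[OF A[OF mem[of u n]], of "\<bar>smooth_step_deriv u\<bar>"] mem[of u n] out[of u]
        by (cases "u \<in> {0..1}") (auto simp: h_def abs_mult)
    qed
    show "AE u in lborel. (\<lambda>n. h n u) \<longlonglongrightarrow> smooth_step_deriv u * a \<tau>"
    proof (rule AE_I2)
      fix u
      show "(\<lambda>n. h n u) \<longlonglongrightarrow> smooth_step_deriv u * a \<tau>"
      proof (cases "u \<in> {0..1}")
        case True
        have "(\<lambda>n. \<tau> + d n - d n * u) \<longlonglongrightarrow> \<tau> + 0 - 0 * u" by (intro tendsto_intros dlim)
        then have "(\<lambda>n. a (\<tau> + d n - d n * u)) \<longlonglongrightarrow> a \<tau>"
          using mem[OF True] \<tau> by (intro continuous_on_tendsto_compose[OF acont]) auto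
        then have "(\<lambda>n. smooth_step_deriv u * a (\<tau> + d n - d n * u)) \<longlonglongrightarrow> smooth_step_deriv u * a \<tau>"
          by (rule tendsto_mult_left)
        then show ?thesis using mem[OF True] by (simp add: h_def)
      qed (simp add: h_def out)
    qed
  qed measurable
  then have lim2: "(\<lambda>n. LBINT t. ?I t * (\<theta>' \<tau> (d n) t * a t)) \<longlonglongrightarrow> - a \<tau>"
    unfolding subst using tendsto_minus by (fastforce simp: smooth_step_deriv_integral)
  have "(\<lambda>n. (LBINT t. ?I t * (\<theta> \<tau> (d n) t * b t)) + (LBINT t. ?I t * (\<theta>' \<tau> (d n) t * a t)) + pairing f0 \<psi>)
      \<longlonglongrightarrow> (LBINT t. indicator {0..\<tau>} t * b t) + - a \<tau> + pairing f0 \<psi>"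
    by (intro tendsto_add lim1 lim2 tendsto_const)
  then have "(LBINT t. indicator {0..\<tau>} t * b t) + - a \<tau> + pairing f0 \<psi> = 0"
    unfolding sum by (simp add: LIMSEQ_const_iff)
  then show "pairing (f \<tau>) \<psi> = pairing f0 \<psi> + (LBINT t. indicator {0..\<tau>} t * b t)"
    by (simp add: a_def)
qed

text \<open>The solution is tied to \<open>f0\<close> through the weak form; the identity at time 0
  recovers the initial value, the time integral being over a null set.\<close>

lemma pairing_initial:
  assumes "\<And>k. Ck k \<psi>"
  shows "pairing (f 0) \<psi> = pairing f0 \<psi>"
proof -
  have "(LBINT t. indicator {0..0::real} t * (LBINT z. f t z * FD \<psi> z (vp_field \<epsilon> (f t) z))) = 0"
    by (rule integral_eq_zero_AE) (use AE_lborel_singleton[of "0::real"] in \<open>eventually_elim, simp\<close>)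
  with pairing_identity(2)[OF assms order_refl] show ?thesis by simp
qed

lemma pairing_Lipschitz:
  assumes \<psi>: "\<And>k. Ck k \<psi>" and st: "0 \<le> s" "0 \<le> t"
    and C: "\<And>t. 0 \<le> t \<Longrightarrow> \<bar>LBINT z. f t z * FD \<psi> z (vp_field \<epsilon> (f t) z)\<bar> \<le> C"
  shows "\<bar>(LBINT z. f t z * \<psi> z) - pairing (f s) \<psi>\<bar> \<le> C * \<bar>t - s\<bar>"
proof -
  define b where "b t = (LBINT z. f t z * FD \<psi> z (vp_field \<epsilon> (f t) z))" for t
  have key: "\<bar>(LBINT z. f t z * \<psi> z) - pairing (f s) \<psi>\<bar> \<le> C * (t - s)" if "0 \<le> s" "s \<le> t" for s t
  proof -
    have t: "0 \<le> t" using that by simp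
    note I = pairing_identity[OF \<psi> \<open>0 \<le> s\<close>] pairing_identity[OF \<psi> t]
    have "pairing (f t) \<psi> - pairing (f s) \<psi>
        = (LBINT r. indicator {0..t} r * b r - indicator {0..s} r * b r)" using I by (simp add: b_def)
    also have "\<dots> = (LBINT r. indicator {s<..t} r * b r)"
      by (intro Bochner_Integration.integral_cong) (use that in \<open>auto simp: indicator_def\<close>)
    also have "\<bar>\<dots>\<bar> \<le> (LBINT r. \<bar>indicator {s<..t} r * b r\<bar>)" by (rule integral_abs_bound)
    also have "\<dots> \<le> (LBINT r. indicator {s<..t} r * C)"
    proof (rule integral_mono_AE')
      show "integrable lborel (\<lambda>r. indicator {s<..t} r * C)"
        using that by (intro integrable_mult_left integrable_real_indicator) auto
      show "AE r in lborel. \<bar>indicator {s<..t} r * b r\<bar> \<le> indicator {s<..t} r * C"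
        using C that by (intro AE_I2) (auto simp: indicator_def b_def)
      show "AE r in lborel. 0 \<le> indicator {s<..t} r * C"
        using order_trans[OF abs_ge_zero C[OF t]] by (intro AE_I2) (auto simp: indicator_def)
    qed
    also have "\<dots> = C * (t - s)" using that by (simp add: mult.commute)
    finally show ?thesis .
  qed
  show ?thesis
  proof (cases "s \<le> t")
    case True
    then show ?thesis using key[OF st(1) True] by simp
  next
    case False
    then have "t \<le> s" by simp
    from key[OF st(2) this] False show ?thesis by (simp add: abs_minus_commute)
  qed
qed

end

section \<open>Uniform bounds\<close>

text \<open>Replacing \<open>x \<cdot> perp K(x - y)\<close> by its antisymmetric part in \<open>(x, y)\<close> gives
  \<open>(x - y) \<cdot> perp (x - y) = 0\<close>.\<close>

lemma coulomb_field_no_torque: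
  assumes g: "ess_bounded L R g"
  shows "(LBINT x. g x * (x \<bullet> perp (field g x))) = 0"
proof -
  \<comment> \<open>A representative whose bounds hold everywhere, since the majorant for Fubini is
    required pointwise.\<close>
  define u where "u x = (if \<bar>g x\<bar> \<le> L \<and> norm x \<le> R then g x else 0)" for x
  have [measurable]: "borel_fun g" using g by (rule ess_bounded_borel)
  have um [measurable]: "borel_fun u" unfolding u_def[abs_def] by measurable
  have ae: "AE x in lborel. g x = u x"
    using g[unfolded ess_bounded_def, THEN conjunct2] by eventually_elim (auto simp: u_def)
  have u: "ess_bounded L R u" unfolding ess_bounded_def using um g[unfolded ess_bounded_def, THEN conjunct2] ae
    by (auto elim!: eventually_elim2)
  have ub: "\<bar>u x\<bar> \<le> \<bar>L\<bar>" "norm x > R \<Longrightarrow> u x = 0" for x by (auto simp: u_def)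
  have L12: "L12_bounded (LBINT x. \<bar>u x\<bar>) (sq_int u) u"
    using ess_bounded_integrable_self[OF u] ess_bounded_l2[OF u] by (simp add: L12_bounded_def)
  have mom: "integrable lborel (\<lambda>y. norm y * \<bar>u y\<bar>)"
    using integrable_abs[OF ess_bounded_integrable_continuous[OF u continuous_on_norm_id]]
    by (simp add: abs_mult mult.commute)
  let ?K = "\<lambda>x y. perp (coulomb_kernel (x - y))"
  have perp_scale: "perp (c *\<^sub>R v) = c *\<^sub>R perp v" for c v
    by (rule linear_cmul[OF bounded_linear.linear[OF bounded_linear_perp]])
  have int: "integrable lborel2 (\<lambda>p. u (fst p) * (fst p \<bullet> (u (snd p) *\<^sub>R ?K (fst p) (snd p))))"
  proof (rule integrable_pair_dominated[OF L12 mom, where B = "\<bar>L\<bar> * \<bar>R\<bar>" and R = "R + 1"])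
    fix x y
    show "norm (u (fst (x, y)) * (fst (x, y) \<bullet> (u (snd (x, y)) *\<^sub>R ?K (fst (x, y)) (snd (x, y)))))
        \<le> \<bar>L\<bar> * \<bar>R\<bar> * (\<bar>u y\<bar> / norm (x - y) + norm (x - y) * \<bar>u y\<bar>)"
    proof (cases "norm x > R")
      case True
      then show ?thesis using ub(2)[of x] by simp
    next
      case False
      have "\<bar>x \<bullet> (u y *\<^sub>R ?K x y)\<bar> \<le> norm x * norm (u y *\<^sub>R ?K x y)" by (rule Cauchy_Schwarz_ineq2)
      also have "\<dots> \<le> \<bar>R\<bar> * (\<bar>u y\<bar> / norm (x - y) + norm (x - y) * \<bar>u y\<bar>)"
        using False by (intro mult_mono) (auto simp: norm_coulomb_kernel)
      finally have "\<bar>u x\<bar> * \<bar>x \<bullet> (u y *\<^sub>R ?K x y)\<bar> \<le> \<bar>L\<bar> * (\<bar>R\<bar> * (\<bar>u y\<bar> / norm (x - y) + norm (x - y) * \<bar>u y\<bar>))"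
        using ub(1) by (intro mult_mono) auto
      then show ?thesis by (simp only: fst_conv snd_conv real_norm_def abs_mult[of "u x"] mult.assoc)
    qed
    show "u (fst (x, y)) * (fst (x, y) \<bullet> (u (snd (x, y)) *\<^sub>R ?K (fst (x, y)) (snd (x, y)))) = 0" if "R + 1 \<le> norm x"
      using ub(2)[of x] that by simp
  qed measurable
  define J where "J = (LBINT x. LBINT y. u x * (x \<bullet> (u y *\<^sub>R ?K x y)))"
  have inner: "integrable lborel (\<lambda>y. u y *\<^sub>R coulomb_kernel (x - y))" for x
  proof (rule coulomb_field_integrable[OF um])
    obtain c where "\<And>u L M x. u \<in> borel_measurable borel \<Longrightarrow> AE y in lborel. \<bar>u y\<bar> \<le> L \<Longrightarrow> 0 \<le> L \<Longrightarrow>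
     (\<integral>\<^sup>+y. ennreal \<bar>u y\<bar> \<partial>lborel) \<le> ennreal M \<Longrightarrow> 0 \<le> M \<Longrightarrow> coulomb_potential u x \<le> ennreal (c * L + M)"
      using coulomb_potential_bounded by metis
    from this[OF um AE_I2[OF ub(1)] abs_ge_zero L12_boundedD(7,5)[OF L12], of x]
    have "coulomb_potential u x \<le> ennreal (c * \<bar>L\<bar> + (LBINT x. \<bar>u x\<bar>))" .
    also have "\<dots> < \<infinity>" by simp
    finally show "coulomb_potential u x < \<infinity>" .
  qed
  have "(LBINT x. g x * (x \<bullet> perp (field g x)))
      = (LBINT x. u x * (x \<bullet> perp (field u x)))"
  proof (rule integral_cong_AE)
    have eqE: "field g x = field u x" for x unfolding kernel_convolution_def
    proof (rule integral_cong_AE)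
      show "AE y in lborel. g y *\<^sub>R coulomb_kernel (x - y) = u y *\<^sub>R coulomb_kernel (x - y)"
        using ae by eventually_elim simp
    qed measurable
    show "AE x in lborel. g x * (x \<bullet> perp (field g x))
        = u x * (x \<bullet> perp (field u x))" using ae by eventually_elim (simp add: eqE)
    have [measurable]: "borel_fun (field g)"
      "borel_fun (field u)" by (intro kernel_convolution_borel; measurable)+
    show "(\<lambda>x. g x * (x \<bullet> perp (field g x))) \<in> borel_measurable lborel"
      "(\<lambda>x. u x * (x \<bullet> perp (field u x))) \<in> borel_measurable lborel" by measurable
  qed
  also have "\<dots> = J" unfolding J_def
  proof (rule Bochner_Integration.integral_cong[OF refl])
    fix x
    have b: "bounded_linear (\<lambda>v. u x * (x \<bullet> perp v))"
      by (rule bounded_linear_compose[OF bounded_linear_mult_right bounded_linear_compose[OF bounded_linear_inner_right bounded_linear_perp]])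
    show "u x * (x \<bullet> perp (field u x)) = (LBINT y. u x * (x \<bullet> (u y *\<^sub>R ?K x y)))"
      using integral_bounded_linear[OF b inner[of x]] unfolding kernel_convolution_def perp_scale by (rule sym)
  qed
  also have "J = 0"
  proof -
    have J2: "J = (LBINT y. LBINT x. u x * (x \<bullet> (u y *\<^sub>R ?K x y)))"
      unfolding J_def using lborel_pair.Fubini_integral[of "\<lambda>x y. u x * (x \<bullet> (u y *\<^sub>R ?K x y))"] int
      by (simp only: split_beta')
    have int1: "integrable lborel (\<lambda>x. LBINT y. u x * (x \<bullet> (u y *\<^sub>R ?K x y)))"
      using lborel_pair.integrable_fst'[OF int] by (simp only: fst_conv snd_conv)
    have int2: "integrable lborel (\<lambda>x. LBINT y. u y * (y \<bullet> (u x *\<^sub>R ?K y x)))"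
      using lborel_pair.integrable_fst'[OF lborel_pair.integrable_product_swap[OF int]] by (simp add: case_prod_beta')
    have ae1: "AE x in lborel. integrable lborel (\<lambda>y. u x * (x \<bullet> (u y *\<^sub>R ?K x y)))"
      using lborel_pair.AE_integrable_fst'[OF int] by (simp only: fst_conv snd_conv)
    have ae2: "AE x in lborel. integrable lborel (\<lambda>y. u y * (y \<bullet> (u x *\<^sub>R ?K y x)))"
      using lborel_pair.AE_integrable_fst'[OF lborel_pair.integrable_product_swap[OF int]] by (simp add: case_prod_beta')
    have cancel: "u x * (x \<bullet> (u y *\<^sub>R ?K x y)) + u y * (y \<bullet> (u x *\<^sub>R ?K y x)) = 0" for x y
    proof -
      have "?K y x = - ?K x y" by (simp add: vec_eq_R2 coulomb_kernel_def norm_minus_commute[of y x] algebra_simps)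
      moreover have "(x - y) \<bullet> ?K x y = 0" by (simp add: inner_R2 coulomb_kernel_def)
      ultimately show ?thesis by (simp add: inner_diff_left algebra_simps)
    qed
    have "J + J = (LBINT x. (LBINT y. u x * (x \<bullet> (u y *\<^sub>R ?K x y))) + (LBINT y. u y * (y \<bullet> (u x *\<^sub>R ?K y x))))"
      using Bochner_Integration.integral_add[OF int1 int2] J2 J_def by simp
    also have "\<dots> = 0"
    proof (rule integral_eq_zero_AE)
      show "AE x in lborel. (LBINT y. u x * (x \<bullet> (u y *\<^sub>R ?K x y))) + (LBINT y. u y * (y \<bullet> (u x *\<^sub>R ?K y x))) = 0"
        using ae1 ae2
      proof eventually_elim
        case (elim x)
        from Bochner_Integration.integral_add[OF elim] show ?case unfolding cancel by simp
      qed
    qed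
    finally show "J = 0" by simp
  qed
  finally show ?thesis .
qed

text \<open>With r = |x - y| one has ln r \<le> r - 1 \<le> r^2 / 2 \<le> |x|^2 + |y|^2. An upper
  bound is what matters, because the interaction enters the energy with a minus sign; near the
  diagonal the logarithm has the favourable sign.\<close>

lemma potential_energy_upper_bound:
  fixes g :: "R2 \<Rightarrow> real"
  assumes g: "ess_bounded L R g" and pos: "AE x in lborel. 0 \<le> g x"
  shows "(LBINT p. ln (norm (fst p - snd p)) * g (fst p) * g (snd p))
    \<le> 2 * (LBINT x. g x) * (LBINT x. (norm x)\<^sup>2 * g x)"
proof -
  have gi: "integrable lborel g" by (rule ess_bounded_integrable_self[OF g])
  have mi: "integrable lborel (\<lambda>x. (norm x)\<^sup>2 * g x)"
    using ess_bounded_integrable_continuous[OF g, of "\<lambda>x. (norm x)\<^sup>2"] by (simp add: mult.commute continuous_intros)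
  have [measurable]: "borel_fun g" using g by (rule ess_bounded_borel)
  let ?f = "\<lambda>p. ((norm (fst p))\<^sup>2 + (norm (snd p))\<^sup>2) * g (fst p) * g (snd p)"
  have f1: "integrable lborel2 (\<lambda>p. ((norm (fst p))\<^sup>2 * g (fst p)) * g (snd p))"
  proof (rule lborel_pair.Fubini_integrable)
    show "integrable lborel (\<lambda>x. LBINT y. norm (((norm (fst (x, y)))\<^sup>2 * g (fst (x, y))) * g (snd (x, y))))"
      using integrable_abs[OF mi] by (simp add: abs_mult)
    show "AE x in lborel. integrable lborel (\<lambda>y. ((norm (fst (x, y)))\<^sup>2 * g (fst (x, y))) * g (snd (x, y)))"
      using gi by simp
  qed measurable
  have f2: "integrable lborel2 (\<lambda>p. g (fst p) * ((norm (snd p))\<^sup>2 * g (snd p)))"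
    using lborel_pair.integrable_product_swap[OF f1] by (simp add: case_prod_beta' mult.commute)
  have fint: "integrable lborel2 ?f" using Bochner_Integration.integrable_add[OF f1 f2] by (simp add: algebra_simps)
  have pos2: "AE p in lborel \<Otimes>\<^sub>M lborel. 0 \<le> g (fst p) \<and> 0 \<le> g (snd p)"
  proof (rule lborel_pair.AE_pair_measure)
    show "AE x in lborel. AE y in lborel. 0 \<le> g (fst (x, y)) \<and> 0 \<le> g (snd (x, y))"
      using pos by eventually_elim (use pos in simp)
  qed measurable
  have "(LINT p|lborel2. ln (norm (fst p - snd p)) * g (fst p) * g (snd p)) \<le> (LINT p|lborel2. ?f p)"
  proof (rule integral_mono_AE'[OF fint])
    have ln: "ln (norm (x - y)) \<le> (norm x)\<^sup>2 + (norm y)\<^sup>2" for x y :: R2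
    proof (cases "x = y")
      case False
      then have "ln (norm (x - y)) \<le> norm (x - y) - 1" by (intro ln_le_minus_one) simp
      moreover have "2 * norm (x - y) \<le> (norm (x - y))\<^sup>2 + 1"
        using sum_squares_bound[of "norm (x - y)" 1] by simp
      moreover have "(norm (x - y))\<^sup>2 \<le> (norm x + norm y)\<^sup>2" by (intro power_mono norm_triangle_ineq4) simp
      moreover have "(norm x + norm y)\<^sup>2 \<le> 2 * (norm x)\<^sup>2 + 2 * (norm y)\<^sup>2" by (rule square_add_le)
      ultimately show ?thesis by linarith
    qed simp
    show "AE p in lborel \<Otimes>\<^sub>M lborel. ln (norm (fst p - snd p)) * g (fst p) * g (snd p) \<le> ?f p"
      using pos2
    proof eventually_elim
      case (elim p)
      then show ?case using mult_right_mono[OF mult_right_mono[OF ln[of "fst p" "snd p"], of "g (fst p)"], of "g (snd p)"] by blast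
    qed
    show "AE p in lborel \<Otimes>\<^sub>M lborel. 0 \<le> ?f p" using pos2
    proof eventually_elim
      case (elim p)
      then show ?case by (metis add_nonneg_nonneg mult_nonneg_nonneg zero_le_power2)
    qed
  qed
  also have "(LINT p|lborel2. ?f p) = (LINT p|lborel2. (norm (fst p))\<^sup>2 * g (fst p) * g (snd p))
      + (LINT p|lborel2. g (fst p) * ((norm (snd p))\<^sup>2 * g (snd p)))"
    using Bochner_Integration.integral_add[OF f1 f2] by (simp add: algebra_simps)
  also have "\<dots> = 2 * (LBINT x. g x) * (LBINT x. (norm x)\<^sup>2 * g x)"
    using lborel_pair.integral_fst'[OF f1, symmetric] lborel_pair.integral_fst'[OF f2, symmetric] by (simp add: mult.commute)
  finally show ?thesis by (simp add: lborel_prod)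
qed

text \<open>Twice the kinetic energy is twice the energy plus the logarithmic interaction, and the
  latter is at most twice the mass times the second moment.\<close>

lemma kinetic_energy_bound:
  assumes g: "ess_bounded L R g" and pos: "AE z in lborel. 0 \<le> g z"
    and M: "(LBINT z. g z) \<le> M"
  shows "(LBINT z. (norm (snd z))\<^sup>2 * g z) \<le> 2 * energy g + 2 * M * (LBINT z. (norm (fst z))\<^sup>2 * g z)"
proof -
  note \<rho> = ess_bounded_macro_density[OF g]
  have \<rho>pos: "AE x in lborel. 0 \<le> macro_density g x" using AE_phase_sections[OF pos]
    by eventually_elim (auto simp: macro_density_def intro!: integral_nonneg_AE)
  have gi: "integrable lborel (\<lambda>z. 1 * g z)" using ess_bounded_integrable_self[OF g] by simp
  have mi: "integrable lborel (\<lambda>z. (norm (fst z))\<^sup>2 * g z)"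
    using ess_bounded_integrable_continuous[OF g, of "\<lambda>z. (norm (fst z))\<^sup>2"] by (simp add: mult.commute continuous_intros)
  have m0: "0 \<le> (LBINT z. (norm (fst z))\<^sup>2 * g z)"
    by (rule integral_nonneg_AE) (use pos in \<open>eventually_elim, simp\<close>)
  have mass: "(LBINT x. macro_density g x) = (LBINT z. g z)"
    using integral_macro_density(1)[of "\<lambda>_. 1" g] gi by simp
  have mom: "(LBINT x. (norm x)\<^sup>2 * macro_density g x) = (LBINT z. (norm (fst z))\<^sup>2 * g z)"
    by (rule integral_macro_density(1)[OF mi])
  have "energy g = 1 / 2 * (LBINT z. (norm (snd z))\<^sup>2 * g z)
      - 1 / 2 * (LBINT p. ln (norm (fst p - snd p)) * macro_density g (fst p) * macro_density g (snd p))"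
    unfolding energy_def by (simp add: case_prod_beta')
  moreover have "(LBINT p. ln (norm (fst p - snd p)) * macro_density g (fst p) * macro_density g (snd p))
      \<le> 2 * (LBINT z. g z) * (LBINT z. (norm (fst z))\<^sup>2 * g z)"
    using potential_energy_upper_bound[OF \<rho> \<rho>pos] by (simp only: mass mom)
  moreover have "2 * (LBINT z. g z) * (LBINT z. (norm (fst z))\<^sup>2 * g z) \<le> 2 * M * (LBINT z. (norm (fst z))\<^sup>2 * g z)"
    using M m0 by (intro mult_right_mono) auto
  ultimately show ?thesis by linarith
qed

text \<open>Optimisation in s. The choice s = sqrt (k / a) balances the two terms; for k = 0 there
  is no minimiser, and s = r / (2 a) gives r \<le> r / 2.\<close>

lemma square_le_of_split:
  assumes "\<And>s. 0 < s \<Longrightarrow> r \<le> a * s + k / s" "0 \<le> (r::real)" "0 < a" "0 \<le> k"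
  shows "r\<^sup>2 \<le> 4 * a * k"
proof (cases "k = 0")
  case True
  have "r \<le> a * (r / (2 * a))" if "0 < r" using assms(1)[of "r / (2 * a)"] that assms(3) True by simp
  then have "r = 0" using assms(2,3) by (cases "r = 0") (auto simp: field_simps)
  then show ?thesis using True by simp
next
  case False
  then have k: "0 < k" using assms(4) by simp
  define s where "s = sqrt (k / a)"
  have s: "0 < s" using k assms(3) by (simp add: s_def)
  have s2: "s\<^sup>2 = k / a" using k assms(3) by (simp add: s_def)
  then have ak: "a * s\<^sup>2 = k" using assms(3) by simp
  then have "k = a * s * s" by (simp add: power2_eq_square mult.assoc)
  then have "k / s = a * s" using s by simp
  then have "r \<le> 2 * a * s" using assms(1)[OF s] by simp
  then have "r\<^sup>2 \<le> (2 * a * s)\<^sup>2" using assms(2) by (intro power_mono)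
  also have "\<dots> = 4 * a * (a * s\<^sup>2)" by (simp add: power2_eq_square)
  also have "\<dots> = 4 * a * k" unfolding ak ..
  finally show ?thesis .
qed

text \<open>Velocity interpolation at fixed \<open>x\<close>: inside the disc |v|^2 < s the
  integrand is at most \<open>L\<close> and the area is proportional to s, outside it |v|^2 / s is
  at least 1. Optimising in s bounds the square of the density by the kinetic energy density at
  \<open>x\<close>; the exponent 2 comes from the two velocity dimensions.\<close>

lemma macro_density_L2_bound:
  assumes g: "ess_bounded L R g" and pos: "AE z in lborel. 0 \<le> g z" and L: "0 < L"
  shows "sq_int (macro_density g) \<le> 4 * (L * unit_ball_vol 2) * (LBINT z. (norm (snd z))\<^sup>2 * g z)"
proof -
  note \<rho> = ess_bounded_macro_density[OF g]
  define V where "V = unit_ball_vol (2::real)"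
  have V: "0 < V" by (simp add: V_def)
  have gm [measurable]: "g \<in> borel_measurable borel2" using g by (simp add: ess_bounded_def borel_prod)
  have ki: "integrable lborel (\<lambda>z. (norm (snd z))\<^sup>2 * g z)"
    using ess_bounded_integrable_continuous[OF g, of "\<lambda>z. (norm (snd z))\<^sup>2"] by (simp add: mult.commute continuous_intros)
  note K = integral_phase_space[OF ki]
  note G = integral_phase_space[OF ess_bounded_integrable_self[OF g]]
  let ?k = "\<lambda>x. LBINT v. (norm (snd (x, v)))\<^sup>2 * g (x, v)"
  have bnd: "AE z in lborel. \<bar>g z\<bar> \<le> L" using g unfolding ess_bounded_def by (auto elim: eventually_mono)
  have le: "AE x in lborel. (macro_density g x)\<^sup>2 \<le> 4 * (L * V) * ?k x"
    using AE_phase_sections[OF pos] AE_phase_sections[OF bnd] G(3) K(3)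
  proof eventually_elim
    case (elim x)
    show ?case
    proof (rule square_le_of_split)
      show "0 \<le> macro_density g x" unfolding macro_density_def using elim(1) by (rule integral_nonneg_AE)
      show "0 < L * V" using L V by simp
      show "0 \<le> ?k x" by (rule integral_nonneg_AE) (use elim(1) in \<open>eventually_elim, simp\<close>)
      fix s :: real assume s: "0 < s"
      define B where "B = ball (0::R2) (sqrt s)"
      have mB: "measure lborel B = V * s" using s by (simp add: B_def V_def content_ball)
      have Bi: "integrable lborel (\<lambda>v. indicator B v * L)"
        by (intro integrable_mult_left integrable_real_indicator) (simp_all add: B_def emeasure_ball_R2 s less_imp_le)
      have "macro_density g x \<le> (LBINT v. indicator B v * L + 1 / s * ((norm (snd (x, v)))\<^sup>2 * g (x, v)))"
        unfolding macro_density_def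
      proof (rule integral_mono_AE[OF elim(3)])
        show "integrable lborel (\<lambda>v. indicator B v * L + 1 / s * ((norm (snd (x, v)))\<^sup>2 * g (x, v)))"
          using Bi elim(4) by simp
        show "AE v in lborel. g (x, v) \<le> indicator B v * L + 1 / s * ((norm (snd (x, v)))\<^sup>2 * g (x, v))"
          using elim(1,2)
        proof eventually_elim
          case (elim v)
          show ?case
          proof (cases "v \<in> B")
            case True
            then show ?thesis using elim s by (simp add: add_increasing2)
          next
            case False
            then have "sqrt s \<le> norm v" by (simp add: B_def)
            then have "s \<le> (norm v)\<^sup>2" using s by (simp add: sqrt_le_D)
            then have "s * g (x, v) \<le> (norm v)\<^sup>2 * g (x, v)" using elim(1) by (rule mult_right_mono)
            then show ?thesis using False s by (simp add: field_simps)
          qed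
        qed
      qed
      also have "\<dots> = L * V * s + ?k x / s" using Bi elim(4) mB by simp
      finally show "macro_density g x \<le> L * V * s + ?k x / s" .
    qed
  qed
  have "sq_int (macro_density g) \<le> (LBINT x. 4 * (L * V) * ?k x)"
    by (rule integral_mono_AE[OF l2_integrable[OF ess_bounded_l2[OF \<rho>]] integrable_mult_right[OF K(2)] le])
  also have "\<dots> = 4 * (L * V) * (LBINT z. (norm (snd z))\<^sup>2 * g z)" using K(1) by simp
  finally show ?thesis by (simp add: V_def)
qed

context vp_solution
begin

lemma mass_conservation:
  assumes "0 \<le> t"
  shows "(LBINT z. f t z) = (LBINT z. f0 z)"
proof -
  have D: "frechet_derivative (\<lambda>z :: R2 \<times> R2. 1 :: real) (at z) = (\<lambda>_. 0)" for z
    by (rule frechet_derivative_at[OF has_derivative_const, symmetric])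
  from pairing_identity(2)[of "\<lambda>_. 1", OF Ck_const assms] show ?thesis by (simp add: D)
qed

text \<open>The L1 norm does not exceed its initial value and the integral is conserved, so |f t| -
  f t, which is nonnegative, has integral at most 0.\<close>

lemma f_nonneg:
  assumes t: "0 \<le> t"
  shows "AE z in lborel. 0 \<le> f t z"
proof -
  obtain R where R: "ess_bounded L R (f t)" using f_bounded_at[OF t] by blast
  obtain R0 where R0: "ess_bounded L R0 f0" using f0_bounded by blast
  note i = ess_bounded_integrable_self[OF R]
  have "Lp_norm lborel 1 (f t) \<le> Lp_norm lborel 1 f0" using sol t by (simp add: vp_global_weak_solution_def)
  then have "(LBINT z. \<bar>f t z\<bar>) \<le> (LBINT z. \<bar>f0 z\<bar>)" by (simp add: Lp_norm_def)
  also have "(LBINT z. \<bar>f0 z\<bar>) = (LBINT z. f0 z)"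
    by (rule integral_cong_AE) (use ess_bounded_borel[OF R0] f0_nonneg in \<open>auto elim: eventually_mono\<close>)
  finally have "(LBINT z. \<bar>f t z\<bar> - f t z) \<le> 0" using i mass_conservation[OF t] by simp
  moreover have "0 \<le> (LBINT z. \<bar>f t z\<bar> - f t z)" by (rule Bochner_Integration.integral_nonneg) simp
  ultimately have "(LBINT z. \<bar>f t z\<bar> - f t z) = 0" by simp
  then have "AE z in lborel. \<bar>f t z\<bar> - f t z = 0" using i by (subst (asm) integral_nonneg_eq_0_iff_AE) auto
  then show ?thesis by eventually_elim linarith
qed

text \<open>Along characteristics |x|^2 / 2 changes at the rate x . v / \<epsilon>. In \<epsilon> x
  . perp v the magnetic term contributes -x . v / \<epsilon>, the motion of x contributes v . perp v
  = 0, and the field contributes the torque x . perp E, which integrates to 0 against the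
  density.\<close>

lemma moment_identity:
  assumes t: "0 \<le> t"
  shows "(LBINT z. f t z * ((norm (fst z))\<^sup>2 / 2 + \<epsilon> * (fst z \<bullet> perp (snd z))))
    = (LBINT z. f0 z * ((norm (fst z))\<^sup>2 / 2 + \<epsilon> * (fst z \<bullet> perp (snd z))))"
proof -
  define \<psi> where "\<psi> z = (norm (fst z))\<^sup>2 / 2 + \<epsilon> * (fst z \<bullet> perp (snd z))" for z :: "R2 \<times> R2"
  have \<psi>_eq: "\<psi> z = 1 / 2 * (fst z \<bullet> fst z) + \<epsilon> * (snd z $ 1 * fst z $ 2 - fst z $ 1 * snd z $ 2)" for z
    by (simp add: \<psi>_def power2_norm_eq_inner inner_R2 algebra_simps)
  have C\<psi>: "Ck k \<psi>" for k
  proof -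
    have "Ck k (\<lambda>z :: R2 \<times> R2. (0 + fst z) \<bullet> (0 + fst z))" by (rule Ck_compose_affine[OF bounded_linear_fst Ck_inner])
    moreover have "Ck k (\<lambda>z :: R2 \<times> R2. fst z $ i)" for i
      by (rule Ck_linear[OF bounded_linear_compose[OF bounded_linear_vec_nth bounded_linear_fst]])
    moreover have "Ck k (\<lambda>z :: R2 \<times> R2. snd z $ i)" for i
      by (rule Ck_linear[OF bounded_linear_compose[OF bounded_linear_vec_nth bounded_linear_snd]])
    ultimately show ?thesis unfolding \<psi>_eq[abs_def] add_0 by (intro Ck_add Ck_cmult Ck_diff Ck_mult)
  qed
  have D: "FD \<psi> z (vp_field \<epsilon> (f s) z) = fst z \<bullet> perp (electric_field (f s) (fst z))" for z s
  proof -
    have perpd: "(perp has_derivative perp) F" for F by (rule bounded_linear_imp_has_derivative[OF bounded_linear_perp])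
    have "((\<lambda>z :: R2 \<times> R2. 1 / 2 * (fst z \<bullet> fst z) + \<epsilon> * (fst z \<bullet> perp (snd z))) has_derivative
        (\<lambda>h. 1 / 2 * (fst z \<bullet> fst h + fst h \<bullet> fst z) + \<epsilon> * (fst z \<bullet> perp (snd h) + fst h \<bullet> perp (snd z)))) (at z)"
      by (intro has_derivative_add has_derivative_mult_right has_derivative_inner has_derivative_fst has_derivative_snd
          has_derivative_ident has_derivative_compose[OF _ perpd])
    moreover have "(\<lambda>z :: R2 \<times> R2. 1 / 2 * (fst z \<bullet> fst z) + \<epsilon> * (fst z \<bullet> perp (snd z))) = \<psi>"
      by (simp add: \<psi>_def fun_eq_iff power2_norm_eq_inner)
    ultimately have d: "(\<psi> has_derivative
        (\<lambda>h. 1 / 2 * (fst z \<bullet> fst h + fst h \<bullet> fst z) + \<epsilon> * (fst z \<bullet> perp (snd h) + fst h \<bullet> perp (snd z)))) (at z)"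
      by (simp only:)
    show ?thesis unfolding frechet_derivative_at[OF d, symmetric]
      using eps by (simp add: vp_field_def inner_R2) (simp add: field_simps power2_eq_square)
  qed
  have zero: "(LBINT z. f s z * FD \<psi> z (vp_field \<epsilon> (f s) z)) = 0" if s: "0 \<le> s" for s
  proof -
    obtain R where R: "ess_bounded L R (f s)" using f_bounded_at[OF s] by blast
    have "integrable lborel (\<lambda>z. (fst z \<bullet> perp (electric_field (f s) (fst z))) * f s z)"
      using f_mult_derivative[OF s C\<psi>] by (simp add: D mult.commute)
    from integral_macro_density(1)[OF this]
    have "(LBINT z. (fst z \<bullet> perp (electric_field (f s) (fst z))) * f s z)
        = (LBINT x. macro_density (f s) x * (x \<bullet> perp (field (macro_density (f s)) x)))"
      by (simp add: electric_field_def mult.commute)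
    then show ?thesis using coulomb_field_no_torque[OF ess_bounded_macro_density[OF R]] by (simp add: D mult.commute)
  qed
  have "(LBINT s. indicator {0..t} s * (LBINT z. f s z * FD \<psi> z (vp_field \<epsilon> (f s) z))) = 0"
    by (rule integral_eq_zero_AE, rule AE_I2) (use zero in \<open>simp add: indicator_def\<close>)
  with pairing_identity(2)[of \<psi>, OF C\<psi> t] have "pairing (f t) \<psi> = pairing f0 \<psi>" by simp
  then show ?thesis by (simp only: \<psi>_def)
qed

end

section \<open>Motion of the guiding centers\<close>

definition gyro_center :: "real \<Rightarrow> R2 \<times> R2 \<Rightarrow> R2" where
  "gyro_center \<epsilon> z = fst z + \<epsilon> *\<^sub>R perp (snd z)"

lemma perp_perp: "perp (perp v) = - v" by (simp add: vec_eq_R2)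

lemma perp_add: "perp (v + w) = perp v + perp w" by (simp add: vec_eq_R2)

lemma perp_scaleR: "perp (c *\<^sub>R v) = c *\<^sub>R perp v" by (simp add: vec_eq_R2)

lemma bounded_linear_gyro_center: "bounded_linear (gyro_center \<epsilon>)" unfolding gyro_center_def[abs_def]
  by (intro bounded_linear_add bounded_linear_fst bounded_linear_const_scaleR
      bounded_linear_compose[OF bounded_linear_perp bounded_linear_snd])

text \<open>Along the characteristics the guiding center \<open>x + \<epsilon> perp v\<close> moves with velocity \<open>perp E\<close>; both fast
  terms cancel.\<close>

lemma gyro_center_vp_field: "\<epsilon> \<noteq> 0 \<Longrightarrow> gyro_center \<epsilon> (vp_field \<epsilon> g z) = perp (electric_field g (fst z))"
  by (simp add: gyro_center_def vp_field_def perp_add perp_scaleR perp_perp scaleR_add_right scaleR_diff_right power2_eq_square)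

lemma norm_gyro_center_diff: "0 \<le> \<epsilon> \<Longrightarrow> norm (gyro_center \<epsilon> z - fst z) = \<epsilon> * norm (snd z)"
  by (simp add: gyro_center_def)

lemma le_one_plus_square: "r \<le> 1 + r\<^sup>2" for r :: real
proof -
  have "0 \<le> (r - 1 / 2)\<^sup>2" by simp
  then show ?thesis by (simp add: power2_diff power_divide)
qed

lemma integral_abs_le:
  fixes h w :: "'a \<Rightarrow> real"
  assumes "integrable M w" "AE z in M. \<bar>h z\<bar> \<le> w z"
  shows "\<bar>LINT z|M. h z\<bar> \<le> (LINT z|M. w z)"
proof -
  have "\<bar>LINT z|M. h z\<bar> \<le> (LINT z|M. \<bar>h z\<bar>)" by (rule integral_abs_bound)
  also have "\<dots> \<le> (LINT z|M. w z)"
    by (rule integral_mono_AE'[OF assms]) (use assms(2) in \<open>eventually_elim, linarith\<close>)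
  finally show ?thesis .
qed

text \<open>No uniform sup bound on the field is at hand, but its square integrated against the
  density is bounded uniformly. This controls the drift perp E in the equicontinuity and residual
  estimates.\<close>

lemma weighted_field_bound:
  assumes "0 \<le> M" "0 \<le> S"
  obtains K where "0 \<le> K" "\<And>g L R. ess_bounded L R g \<Longrightarrow> AE z in lborel. 0 \<le> g z \<Longrightarrow> L12_bounded M S (macro_density g) \<Longrightarrow>
    integrable lborel (\<lambda>z. (norm (electric_field g (fst z)))\<^sup>2 * g z) \<and>
    (LBINT z. (norm (electric_field g (fst z)))\<^sup>2 * g z) \<le> K"
proof -
  obtain K where K: "0 \<le> K" "\<And>u. borel_fun u \<Longrightarrow> (\<integral>\<^sup>+y. ennreal \<bar>u y\<bar> \<partial>lborel) \<le> ennreal M \<Longrightarrow>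
     (\<integral>\<^sup>+y. ennreal ((u y)\<^sup>2) \<partial>lborel) \<le> ennreal S \<Longrightarrow>
     (\<integral>\<^sup>+x. ennreal \<bar>u x\<bar> * (coulomb_potential u x)\<^sup>2 \<partial>lborel) \<le> ennreal K"
    using nn_integral_density_potential_square[OF assms] by blast
  show thesis
  proof (rule that[OF K(1)])
    fix g :: "R2 \<times> R2 \<Rightarrow> real" and L R
    assume g: "ess_bounded L R g" and pos: "AE z in lborel. 0 \<le> g z" and L12: "L12_bounded M S (macro_density g)"
    note D = L12_boundedD[OF L12]
    obtain C where C: "\<And>x. norm (electric_field g x) \<le> C" using electric_field_bounded[of L R] g by metis
    have Em [measurable]: "borel_fun (electric_field g)" by (rule electric_field_borel[OF ess_bounded_borel[OF g]])
    have m: "(\<lambda>z :: R2 \<times> R2. (norm (electric_field g (fst z)))\<^sup>2) \<in> borel_measurable borel2" by measurable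
    have int: "integrable lborel (\<lambda>z. (norm (electric_field g (fst z)))\<^sup>2 * g z)"
      using ess_bounded_integrable(1)[OF g, of "\<lambda>z. (norm (electric_field g (fst z)))\<^sup>2" "C\<^sup>2"] m[unfolded borel_prod] power_mono[OF C norm_ge_zero, where n = 2]
      by (simp add: borel_prod mult.commute)
    have \<rho>pos: "AE x in lborel. 0 \<le> macro_density g x" using AE_phase_sections[OF pos]
      by eventually_elim (auto simp: macro_density_def intro!: integral_nonneg_AE)
    have "(LBINT z. (norm (electric_field g (fst z)))\<^sup>2 * g z) = (LBINT x. (norm (electric_field g x))\<^sup>2 * macro_density g x)"
      by (rule integral_macro_density(1)[OF int, symmetric])
    also have "\<dots> \<le> K"
    proof -
      have i: "integrable lborel (\<lambda>x. (norm (electric_field g x))\<^sup>2 * macro_density g x)" by (rule integral_macro_density(2)[OF int])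
      have "ennreal (LBINT x. (norm (electric_field g x))\<^sup>2 * macro_density g x)
          = (\<integral>\<^sup>+x. ennreal ((norm (electric_field g x))\<^sup>2 * macro_density g x) \<partial>lborel)"
        by (rule nn_integral_eq_integral[OF i, symmetric]) (use \<rho>pos in \<open>eventually_elim, simp\<close>)
      also have "\<dots> \<le> (\<integral>\<^sup>+x. ennreal \<bar>macro_density g x\<bar> * (coulomb_potential (macro_density g) x)\<^sup>2 \<partial>lborel)"
      proof (rule nn_integral_mono_AE)
        show "AE x in lborel. ennreal ((norm (electric_field g x))\<^sup>2 * macro_density g x)
            \<le> ennreal \<bar>macro_density g x\<bar> * (coulomb_potential (macro_density g) x)\<^sup>2"
          using \<rho>pos
        proof eventually_elim
          case (elim x)
          have "(ennreal (norm (electric_field g x)))\<^sup>2 \<le> (coulomb_potential (macro_density g) x)\<^sup>2"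
            unfolding electric_field_def by (intro power_mono norm_coulomb_field_le) simp
          from mult_left_mono[OF this, of "ennreal \<bar>macro_density g x\<bar>"] elim show ?case
            by (simp add: ennreal_power mult.commute ennreal_mult)
        qed
      qed
      also have "\<dots> \<le> ennreal K" by (rule K(2)[OF D(2,7,8)])
      finally show ?thesis using K(1) by (simp add: ennreal_le_iff)
    qed
    finally show "integrable lborel (\<lambda>z. (norm (electric_field g (fst z)))\<^sup>2 * g z) \<and>
      (LBINT z. (norm (electric_field g (fst z)))\<^sup>2 * g z) \<le> K" using int by simp
  qed
qed

lemma transport_term_measurable:
  fixes \<phi> :: "real \<times> R2 \<Rightarrow> real"
  assumes \<phi>: "test_function \<phi>" and [measurable]: "case_prod r \<in> borel_measurable borel2"
    "(\<lambda>p. e (fst p) (snd p)) \<in> borel_measurable borel2"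
  shows "(\<lambda>p. r (fst p) (snd p) * FD \<phi> (fst p, snd p) (1, perp (e (fst p) (snd p))))
      \<in> borel_measurable borel2"
    "borel_fun (\<lambda>t. LBINT x. r t x * FD \<phi> (t, x) (1, perp (e t x)))"
proof -
  have 1: "(\<lambda>p. (fst p, snd p)) \<in> borel_measurable (borel \<Otimes>\<^sub>M borel :: (real \<times> R2) measure)" by (simp add: borel_prod)
  have 2: "(\<lambda>p. (1::real, perp (e (fst p) (snd p)))) \<in> borel_measurable borel2"
    by (intro borel_measurable_Pair) measurable
  have 3: "(\<lambda>p. r (fst p) (snd p)) \<in> borel_measurable borel2" by measurable
  show m: "(\<lambda>p. r (fst p) (snd p) * FD \<phi> (fst p, snd p) (1, perp (e (fst p) (snd p))))
      \<in> borel_measurable borel2"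
    by (rule borel_measurable_times[OF 3 frechet_derivative_borel[OF test_function_Ck[OF \<phi>] 1 2]])
  then have "(\<lambda>(t, x). r t x * FD \<phi> (t, x) (1, perp (e t x))) \<in> borel_measurable (borel \<Otimes>\<^sub>M lborel)"
    by (simp add: case_prod_beta')
  from sigma_finite_measure.borel_measurable_lebesgue_integral[OF sigma_finite_lborel this]
  show "borel_fun (\<lambda>t. LBINT x. r t x * FD \<phi> (t, x) (1, perp (e t x)))" by simp
qed

text \<open>\<open>M\<close> bounds both mass and second moment, \<open>H\<close> the energy. The
  factor 1 + 2 M arises when the kinetic energy is expressed through the moment; smallness of its
  product with \<epsilon> lets the moment at time t be absorbed in
  \<open>moment_kinetic_bounds\<close>.\<close>

locale vp_solution_bounds = vp_solution +
  fixes M H :: real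
  assumes L_pos: "0 < L" and M_nonneg: "0 \<le> M" and H_nonneg: "0 \<le> H"
    and mass0: "(LBINT z. f0 z) \<le> M" and moment0: "(LBINT z. (norm (fst z))\<^sup>2 * f0 z) \<le> M"
    and energy0: "energy f0 \<le> H" and eps_small: "\<epsilon> \<le> 1" "\<epsilon> * (1 + 2 * M) \<le> 1 / 2"
begin

definition moment_bound :: real where "moment_bound = 3 * M + 8 * H"
definition kinetic_bound :: real where "kinetic_bound = 2 * H + 2 * M * moment_bound"

lemma bounds_nonneg: "0 \<le> moment_bound" "0 \<le> kinetic_bound"
  using M_nonneg H_nonneg by (auto simp: moment_bound_def kinetic_bound_def)

lemma moment_integrable:
  assumes "ess_bounded L R g"
  shows "integrable lborel (\<lambda>z. (norm (fst z))\<^sup>2 * g z)" "integrable lborel (\<lambda>z. (norm (snd z))\<^sup>2 * g z)"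
    "integrable lborel (\<lambda>z. (fst z \<bullet> perp (snd z)) * g z)" "integrable lborel (\<lambda>z. norm (snd z) * g z)" "integrable lborel g"
proof -
  have c: "continuous_on UNIV (\<lambda>z :: R2 \<times> R2. perp (snd z))"
    by (rule linear_continuous_on[OF bounded_linear_compose[OF bounded_linear_perp bounded_linear_snd]])
  note i = ess_bounded_integrable_continuous[OF assms]
  show "integrable lborel (\<lambda>z. (norm (fst z))\<^sup>2 * g z)" using i[of "\<lambda>z. (norm (fst z))\<^sup>2"] by (simp add: mult.commute continuous_intros)
  show "integrable lborel (\<lambda>z. (norm (snd z))\<^sup>2 * g z)" using i[of "\<lambda>z. (norm (snd z))\<^sup>2"] by (simp add: mult.commute continuous_intros)
  show "integrable lborel (\<lambda>z. (fst z \<bullet> perp (snd z)) * g z)"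
    using i[of "\<lambda>z. fst z \<bullet> perp (snd z)"] c by (simp add: mult.commute continuous_intros)
  show "integrable lborel (\<lambda>z. norm (snd z) * g z)" using i[of "\<lambda>z. norm (snd z)"] by (simp add: mult.commute continuous_intros)
  show "integrable lborel g" by (rule ess_bounded_integrable_self[OF assms])
qed

text \<open>Energy and moment estimates are solved simultaneously; the cross term is split by 2 |x|
  |v| \<le> |x|^2 + |v|^2.\<close>

lemma moment_kinetic_bounds:
  assumes t: "0 \<le> t"
  shows "(LBINT z. (norm (fst z))\<^sup>2 * f t z) \<le> moment_bound" "(LBINT z. (norm (snd z))\<^sup>2 * f t z) \<le> kinetic_bound"
proof -
  obtain R where R: "ess_bounded L R (f t)" using f_bounded_at[OF t] by blast
  obtain R0 where R0: "ess_bounded L R0 f0" using f0_bounded by blast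
  note pos = f_nonneg[OF t]
  let ?m = "\<lambda>g. LBINT z. (norm (fst z))\<^sup>2 * g z" and ?k = "\<lambda>g. LBINT z. (norm (snd z))\<^sup>2 * g z"
    and ?c = "\<lambda>g. LBINT z. (fst z \<bullet> perp (snd z)) * g z"
  have kin: "?k g \<le> 2 * H + 2 * M * ?m g" if "ess_bounded L R g" "AE z in lborel. 0 \<le> g z" "(LBINT z. g z) \<le> M" "energy g \<le> H" for g R
    using kinetic_energy_bound[OF that(1-3)] that(4) by linarith
  have "energy (f t) \<le> H" using sol t energy0 unfolding vp_global_weak_solution_def by (meson order_trans)
  with kin[OF R pos] mass_conservation[OF t] mass0 have k: "?k (f t) \<le> 2 * H + 2 * M * ?m (f t)" by simp
  have k0: "?k f0 \<le> 2 * H + 2 * M * ?m f0" by (rule kin[OF R0 f0_nonneg mass0 energy0])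
  have c: "\<bar>?c g\<bar> \<le> (?m g + ?k g) / 2" if g: "ess_bounded L R g" and gpos: "AE z in lborel. 0 \<le> g z" for g R
  proof -
    note I = moment_integrable[OF g]
    have "\<bar>?c g\<bar> \<le> (LBINT z. ((norm (fst z))\<^sup>2 * g z + (norm (snd z))\<^sup>2 * g z) / 2)"
    proof (rule integral_abs_le)
      show "integrable lborel (\<lambda>z. ((norm (fst z))\<^sup>2 * g z + (norm (snd z))\<^sup>2 * g z) / 2)" using I by simp
      show "AE z in lborel. \<bar>(fst z \<bullet> perp (snd z)) * g z\<bar> \<le> ((norm (fst z))\<^sup>2 * g z + (norm (snd z))\<^sup>2 * g z) / 2"
        using gpos
      proof eventually_elim
        case (elim z)
        have "\<bar>fst z \<bullet> perp (snd z)\<bar> \<le> norm (fst z) * norm (snd z)"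
          using Cauchy_Schwarz_ineq2[of "fst z" "perp (snd z)"] by simp
        also have "\<dots> \<le> ((norm (fst z))\<^sup>2 + (norm (snd z))\<^sup>2) / 2"
          using sum_squares_bound[of "norm (fst z)" "norm (snd z)"] by simp
        finally have "\<bar>fst z \<bullet> perp (snd z)\<bar> * g z \<le> ((norm (fst z))\<^sup>2 + (norm (snd z))\<^sup>2) / 2 * g z"
          using elim by (rule mult_right_mono)
        then show ?case using elim by (simp add: abs_mult distrib_right add_divide_distrib)
      qed
    qed
    then show ?thesis using I by simp
  qed
  have split: "(LBINT z. g z * ((norm (fst z))\<^sup>2 / 2 + \<epsilon> * (fst z \<bullet> perp (snd z)))) = ?m g / 2 + \<epsilon> * ?c g"
    if "ess_bounded L R g" for g R
  proof -
    note I = moment_integrable[OF that]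
    have "(LBINT z. g z * ((norm (fst z))\<^sup>2 / 2 + \<epsilon> * (fst z \<bullet> perp (snd z))))
        = (LBINT z. ((norm (fst z))\<^sup>2 * g z) / 2 + \<epsilon> * ((fst z \<bullet> perp (snd z)) * g z))"
      by (intro Bochner_Integration.integral_cong) (auto simp: algebra_simps)
    also have "\<dots> = ?m g / 2 + \<epsilon> * ?c g" using I by simp
    finally show ?thesis .
  qed
  have id: "?m (f t) / 2 + \<epsilon> * ?c (f t) = ?m f0 / 2 + \<epsilon> * ?c f0"
    using moment_identity[OF t] split[OF R] split[OF R0] by simp
  have m0: "0 \<le> ?m f0" by (rule integral_nonneg_AE) (use f0_nonneg in \<open>eventually_elim, simp\<close>)
  have mt: "0 \<le> ?m (f t)" by (rule integral_nonneg_AE) (use pos in \<open>eventually_elim, simp\<close>)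
  have "\<epsilon> * ?c f0 \<le> \<epsilon> * ((?m f0 + ?k f0) / 2)" "\<epsilon> * - ?c (f t) \<le> \<epsilon> * ((?m (f t) + ?k (f t)) / 2)"
    using c[OF R0 f0_nonneg] c[OF R pos] eps by (intro mult_left_mono; linarith)+
  moreover have "\<epsilon> * ((?m f0 + ?k f0) / 2) + \<epsilon> * ((?m (f t) + ?k (f t)) / 2)
      \<le> \<epsilon> * (1 + 2 * M) * ((?m f0 + ?m (f t)) / 2) + 2 * \<epsilon> * H"
  proof -
    have "(?m f0 + ?k f0) / 2 + (?m (f t) + ?k (f t)) / 2 \<le> (1 + 2 * M) * ((?m f0 + ?m (f t)) / 2) + 2 * H"
      using k k0 by (simp add: field_simps)
    from mult_left_mono[OF this, of \<epsilon>] eps show ?thesis by (simp add: algebra_simps)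
  qed
  moreover have "\<epsilon> * (1 + 2 * M) * ((?m f0 + ?m (f t)) / 2) \<le> 1 / 2 * ((?m f0 + ?m (f t)) / 2)"
    using eps_small(2) m0 mt by (intro mult_right_mono) auto
  moreover have "2 * \<epsilon> * H \<le> 2 * H" using eps_small(1) H_nonneg eps by (simp add: mult_left_le_one_le)
  \<comment> \<open>With m_t and m_0 the moments at time t and 0, the previous lines give m_t / 2
    \<le> m_0 / 2 + (m_0 + m_t) / 4 + 2 H. Collecting m_t yields the constants 3 and 8 of
    \<open>moment_bound\<close>.\<close>
  ultimately have "?m (f t) \<le> 3 * ?m f0 + 8 * H" using id by simp
  then show m: "?m (f t) \<le> moment_bound" using moment0 by (simp add: moment_bound_def)
  have "2 * M * ?m (f t) \<le> 2 * M * moment_bound" using m M_nonneg by (intro mult_left_mono) auto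
  then show "?k (f t) \<le> kinetic_bound" using k by (simp add: kinetic_bound_def)
qed

definition L2_bound :: real where "L2_bound = 4 * (L * unit_ball_vol 2) * kinetic_bound"

abbreviation \<rho> where "\<rho> t \<equiv> macro_density (f t)"

lemma L2_bound_nonneg: "0 \<le> L2_bound" using L_pos bounds_nonneg by (simp add: L2_bound_def)

lemma density_nonneg:
  assumes "0 \<le> t"
  shows "AE x in lborel. 0 \<le> \<rho> t x" using AE_phase_sections[OF f_nonneg[OF assms]]
  by eventually_elim (auto simp: macro_density_def intro!: integral_nonneg_AE)

lemma density_bounds:
  assumes t: "0 \<le> t"
  shows "L12_bounded M L2_bound (\<rho> t)" "integrable lborel (\<lambda>x. (norm x)\<^sup>2 * \<bar>\<rho> t x\<bar>)"
    "(LBINT x. (norm x)\<^sup>2 * \<bar>\<rho> t x\<bar>) \<le> moment_bound"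
proof -
  obtain R where R: "ess_bounded L R (f t)" using f_bounded_at[OF t] by blast
  note r = ess_bounded_macro_density[OF R] and I = moment_integrable[OF R]
  have [measurable]: "borel_fun (\<rho> t)" by (rule ess_bounded_borel[OF r])
  have "(LBINT x. \<bar>\<rho> t x\<bar>) = (LBINT x. 1 * \<rho> t x)"
    by (rule integral_cong_AE) (use density_nonneg[OF t] in \<open>auto elim: eventually_mono\<close>)
  also have "\<dots> = (LBINT z. f t z)" using integral_macro_density(1)[of "\<lambda>_. 1" "f t"] I(5) by simp
  also have "\<dots> \<le> M" using mass_conservation[OF t] mass0 by simp
  finally have mass: "(LBINT x. \<bar>\<rho> t x\<bar>) \<le> M" .
  have "4 * (L * unit_ball_vol 2) * (LBINT z. (norm (snd z))\<^sup>2 * f t z) \<le> L2_bound"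
    unfolding L2_bound_def using moment_kinetic_bounds(2)[OF t] L_pos by (intro mult_left_mono) auto
  with macro_density_L2_bound[OF R f_nonneg[OF t] L_pos] have "sq_int (\<rho> t) \<le> L2_bound" by linarith
  with mass show "L12_bounded M L2_bound (\<rho> t)"
    using ess_bounded_integrable_self[OF r] ess_bounded_l2[OF r] by (simp add: L12_bounded_def)
  have "(LBINT x. (norm x)\<^sup>2 * \<bar>\<rho> t x\<bar>) = (LBINT x. (norm x)\<^sup>2 * \<rho> t x)"
    by (rule integral_cong_AE) (use density_nonneg[OF t] in \<open>auto elim: eventually_mono\<close>)
  also have "\<dots> = (LBINT z. (norm (fst z))\<^sup>2 * f t z)" by (rule integral_macro_density(1)[OF I(1)])
  also have "\<dots> \<le> moment_bound" by (rule moment_kinetic_bounds(1)[OF t])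
  finally show "(LBINT x. (norm x)\<^sup>2 * \<bar>\<rho> t x\<bar>) \<le> moment_bound" .
  show "integrable lborel (\<lambda>x. (norm x)\<^sup>2 * \<bar>\<rho> t x\<bar>)"
    using integrable_abs[OF integral_macro_density(2)[OF I(1)]] by (simp add: abs_mult)
qed

lemma phase_bounds:
  assumes t: "0 \<le> t"
  shows "(LBINT z. f t z) \<le> M" "(LBINT z. norm (snd z) * f t z) \<le> M + kinetic_bound"
proof -
  obtain R where R: "ess_bounded L R (f t)" using f_bounded_at[OF t] by blast
  note I = moment_integrable[OF R]
  show m: "(LBINT z. f t z) \<le> M" using mass_conservation[OF t] mass0 by simp
  have "(LBINT z. norm (snd z) * f t z) \<le> (LBINT z. f t z + (norm (snd z))\<^sup>2 * f t z)"
  proof (rule integral_mono_AE)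
    show "AE z in lborel. norm (snd z) * f t z \<le> f t z + (norm (snd z))\<^sup>2 * f t z" using f_nonneg[OF t]
    proof eventually_elim
      case (elim z)
      have "norm (snd z) \<le> 1 + (norm (snd z))\<^sup>2" by (rule le_one_plus_square)
      from mult_right_mono[OF this elim] show ?case by (simp add: distrib_right)
    qed
  qed (use I in auto)
  also have "\<dots> \<le> M + kinetic_bound" using I m moment_kinetic_bounds(2)[OF t] by simp
  finally show "(LBINT z. norm (snd z) * f t z) \<le> M + kinetic_bound" .
qed

text \<open>A particle is at distance \<epsilon> |v| from its guiding center, and the first velocity
  moment is controlled by mass and kinetic energy.\<close>

lemma gyro_center_shift:
  assumes t: "0 \<le> t" and \<Phi>: "continuous_on UNIV \<Phi>" and B: "0 \<le> B" "\<And>x y. \<bar>\<Phi> x - \<Phi> y\<bar> \<le> B * norm (x - y)"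
  shows "\<bar>(LBINT z. f t z * \<Phi> (gyro_center \<epsilon> z)) - pairing \<Phi> (\<rho> t)\<bar> \<le> B * \<epsilon> * (M + kinetic_bound)"
proof -
  obtain R where R: "ess_bounded L R (f t)" using f_bounded_at[OF t] by blast
  have c1: "continuous_on UNIV (\<lambda>z. \<Phi> (gyro_center \<epsilon> z))"
    by (rule continuous_on_compose2[OF \<Phi> linear_continuous_on[OF bounded_linear_gyro_center]]) simp
  have c2: "continuous_on UNIV (\<lambda>z :: R2 \<times> R2. \<Phi> (fst z))"
    by (rule continuous_on_compose2[OF \<Phi> linear_continuous_on[OF bounded_linear_fst]]) simp
  note i1 = ess_bounded_integrable_continuous[OF R c1] and i2 = ess_bounded_integrable_continuous[OF R c2]
  have "pairing \<Phi> (\<rho> t) = (LBINT z. f t z * \<Phi> (fst z))"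
    using integral_macro_density(1)[of \<Phi> "f t"] i2 by (simp add: mult.commute)
  then have "(LBINT z. f t z * \<Phi> (gyro_center \<epsilon> z)) - pairing \<Phi> (\<rho> t)
      = (LBINT z. f t z * (\<Phi> (gyro_center \<epsilon> z) - \<Phi> (fst z)))"
    using i1 i2 by (simp add: right_diff_distrib)
  also have "\<bar>\<dots>\<bar> \<le> (LBINT z. B * \<epsilon> * (norm (snd z) * f t z))"
  proof (rule integral_abs_le)
    show "integrable lborel (\<lambda>z. B * \<epsilon> * (norm (snd z) * f t z))" using moment_integrable(4)[OF R] by simp
    show "AE z in lborel. \<bar>f t z * (\<Phi> (gyro_center \<epsilon> z) - \<Phi> (fst z))\<bar> \<le> B * \<epsilon> * (norm (snd z) * f t z)"
      using f_nonneg[OF t]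
    proof eventually_elim
      case (elim z)
      have "\<bar>\<Phi> (gyro_center \<epsilon> z) - \<Phi> (fst z)\<bar> \<le> B * (\<epsilon> * norm (snd z))"
        using B(2)[of "gyro_center \<epsilon> z" "fst z"] norm_gyro_center_diff[of \<epsilon> z] eps by simp
      from mult_left_mono[OF this elim] elim show ?case by (simp add: abs_mult mult_ac)
    qed
  qed
  also have "\<dots> \<le> B * \<epsilon> * (M + kinetic_bound)"
    using phase_bounds(2)[OF t] B(1) eps by (simp add: mult_left_mono)
  finally show ?thesis .
qed

lemma gyro_center_Ck:
  assumes "\<And>k. Ck k \<Phi>"
  shows "Ck k (\<lambda>z. \<Phi> (gyro_center \<epsilon> z))"
  using Ck_compose_affine[OF bounded_linear_gyro_center, of k \<Phi> 0 \<epsilon>] assms by simp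

text \<open>A function of the position alone varies at the rate v / \<epsilon>, so the test function
  is evaluated at the guiding center, where the rate is perp E and |E| \<le> 1 + |E|^2. Returning
  from center to position costs one shift at each of the two times, hence the factor 2.\<close>

lemma density_equicontinuous:
  assumes \<Phi>: "test_function \<Phi>" and B: "0 \<le> B" "\<And>x h. \<bar>FD \<Phi> x h\<bar> \<le> B * norm h" "\<And>x y. \<bar>\<Phi> x - \<Phi> y\<bar> \<le> B * norm (x - y)"
    and K: "\<And>t. 0 \<le> t \<Longrightarrow> integrable lborel (\<lambda>z. (norm (electric_field (f t) (fst z)))\<^sup>2 * f t z) \<and>
      (LBINT z. (norm (electric_field (f t) (fst z)))\<^sup>2 * f t z) \<le> K"
    and st: "0 \<le> s" "0 \<le> t"
  shows "\<bar>(LBINT x. \<Phi> x * \<rho> t x) - pairing \<Phi> (\<rho> s)\<bar>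
    \<le> B * (M + K) * \<bar>t - s\<bar> + 2 * (B * \<epsilon> * (M + kinetic_bound))"
proof -
  let ?\<psi> = "\<lambda>z. \<Phi> (gyro_center \<epsilon> z)"
  have D: "FD ?\<psi> z h = FD \<Phi> (gyro_center \<epsilon> z) (gyro_center \<epsilon> h)" for z h
    by (rule fun_cong[OF frechet_derivative_at[OF has_derivative_compose[OF
          bounded_linear_imp_has_derivative[OF bounded_linear_gyro_center] Ck_SucD(1)[OF test_function_Ck[OF \<Phi>]]]], symmetric])
  have "\<bar>LBINT z. f r z * FD ?\<psi> z (vp_field \<epsilon> (f r) z)\<bar> \<le> B * (M + K)" if r: "0 \<le> r" for r
  proof -
    obtain R where R: "ess_bounded L R (f r)" using f_bounded_at[OF r] by blast
    note i = moment_integrable(5)[OF R]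
    have "\<bar>LBINT z. f r z * FD ?\<psi> z (vp_field \<epsilon> (f r) z)\<bar>
        \<le> (LBINT z. B * (f r z + (norm (electric_field (f r) (fst z)))\<^sup>2 * f r z))"
    proof (rule integral_abs_le)
      show "integrable lborel (\<lambda>z. B * (f r z + (norm (electric_field (f r) (fst z)))\<^sup>2 * f r z))"
        using i K[OF r] by simp
      show "AE z in lborel. \<bar>f r z * FD ?\<psi> z (vp_field \<epsilon> (f r) z)\<bar>
          \<le> B * (f r z + (norm (electric_field (f r) (fst z)))\<^sup>2 * f r z)" using f_nonneg[OF r]
      proof eventually_elim
        case (elim z)
        let ?E = "electric_field (f r) (fst z)"
        have "\<bar>FD ?\<psi> z (vp_field \<epsilon> (f r) z)\<bar> \<le> B * norm ?E"
          unfolding D using B(2)[of "gyro_center \<epsilon> z" "perp ?E"] gyro_center_vp_field[of \<epsilon> "f r" z] eps by simp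
        also have "\<dots> \<le> B * (1 + (norm ?E)\<^sup>2)"
          using le_one_plus_square[of "norm ?E"] B(1) by (intro mult_left_mono)
        finally show ?case using mult_left_mono[OF _ elim] elim by (fastforce simp: abs_mult algebra_simps)
      qed
    qed
    also have "\<dots> = B * ((LBINT z. f r z) + (LBINT z. (norm (electric_field (f r) (fst z)))\<^sup>2 * f r z))"
      using i K[OF r] by simp
    also have "\<dots> \<le> B * (M + K)" using phase_bounds(1)[OF r] K[OF r] B(1) by (intro mult_left_mono) auto
    finally show ?thesis .
  qed
  from pairing_Lipschitz[of ?\<psi>, OF gyro_center_Ck[OF test_function_Ck[OF \<Phi>]] st this]
  have "\<bar>(LBINT z. f t z * ?\<psi> z) - pairing (f s) ?\<psi>\<bar> \<le> B * (M + K) * \<bar>t - s\<bar>" .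
  moreover note gyro_center_shift[OF st(1) test_function_continuous[OF \<Phi>] B(1,3)]
    gyro_center_shift[OF st(2) test_function_continuous[OF \<Phi>] B(1,3)]
  ultimately show ?thesis by linarith
qed

text \<open>Testing with \<phi> at the guiding center gives an exact identity. Moving the derivative
  of \<phi> back to the position costs \<epsilon> |v| (1 + |E|), and |v| |E| \<le> |v|^2 + |E|^2
  keeps this within the uniform bounds. In the constant, \<open>T\<close> stems from the time
  integral and 1 from the initial term.\<close>

lemma euler_residual:
  fixes \<phi> :: "real \<times> R2 \<Rightarrow> real"
  assumes \<phi>: "test_function \<phi>"
    and B: "0 \<le> B" "\<And>p q h. \<bar>FD \<phi> p h - FD \<phi> q h\<bar> \<le> B * norm (p - q) * norm h"
      "\<And>p q. \<bar>\<phi> p - \<phi> q\<bar> \<le> B * norm (p - q)"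
    and T: "0 < T" "\<And>p. T \<le> norm p \<Longrightarrow> \<phi> p = 0" "\<And>p h. T \<le> norm p \<Longrightarrow> FD \<phi> p h = 0"
    and K: "\<And>t. 0 \<le> t \<Longrightarrow> integrable lborel (\<lambda>z. (norm (electric_field (f t) (fst z)))\<^sup>2 * f t z) \<and>
      (LBINT z. (norm (electric_field (f t) (fst z)))\<^sup>2 * f t z) \<le> K"
  shows "\<bar>(LBINT t. indicator {0..} t * (LBINT x. \<rho> t x * FD \<phi> (t, x) (1, perp (electric_field (f t) x))))
      + (LBINT x. \<rho> 0 x * \<phi> (0, x))\<bar> \<le> \<epsilon> * (B * ((T + 1) * (M + 2 * kinetic_bound + K)))"
proof -
  define G where "G p = (fst p, gyro_center \<epsilon> (snd p))" for p :: "real \<times> R2 \<times> R2"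
  have G: "bounded_linear G" unfolding G_def[abs_def]
    by (intro bounded_linear_Pair bounded_linear_fst bounded_linear_compose[OF bounded_linear_gyro_center bounded_linear_snd])
  define \<Psi> where "\<Psi> p = \<phi> (G p)" for p
  have \<Psi>: "Ck k \<Psi>" for k
    using Ck_compose_affine[OF G, of k \<phi> 0] test_function_Ck[OF \<phi>] by (simp add: \<Psi>_def[abs_def])
  have D\<Psi>: "FD \<Psi> p h = FD \<phi> (G p) (G h)" for p h unfolding \<Psi>_def[abs_def]
    by (rule fun_cong[OF frechet_derivative_at[OF has_derivative_compose[OF
          bounded_linear_imp_has_derivative[OF G] Ck_SucD(1)[OF test_function_Ck[OF \<phi>]]]], symmetric])
  have normT: "T \<le> norm (t, x)" if "T \<le> \<bar>t\<bar>" for t :: real and x :: R2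
    using that norm_fst_le[of t x] by simp
  have \<Psi>T: "\<Psi> (t, z) = 0" if "T \<le> \<bar>t\<bar>" for t z
    using T(2)[OF normT[OF that]] by (simp add: \<Psi>_def G_def)
  define c where "c t = (LBINT z. f t z * FD \<Psi> (t, z) (1, vp_field \<epsilon> (f t) z))" for t
  define d where "d t = (LBINT x. \<rho> t x * FD \<phi> (t, x) (1, perp (electric_field (f t) x)))" for t
  \<comment> \<open>The kinetic bound is counted twice: once inside the bound on the first velocity
    moment and once by itself.\<close>
  define Q where "Q = B * \<epsilon> * (M + 2 * kinetic_bound + K)"
  have c0: "integrable lborel (\<lambda>t. indicator {0..} t * c t)" "(LBINT t. indicator {0..} t * c t) + (LBINT z. f0 z * \<Psi> (0, z)) = 0"
    using weak_form_time_compact[OF \<Psi> T(1) \<Psi>T] by (simp_all add: c_def)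
  have cd: "\<bar>c t - d t\<bar> \<le> Q" if t: "0 \<le> t" for t
  proof -
    obtain R where R: "ess_bounded L R (f t)" using f_bounded_at[OF t] by blast
    note I = moment_integrable[OF R]
    obtain C where C: "\<And>x. norm (electric_field (f t) x) \<le> C" using electric_field_bounded[of L R] R by metis
    obtain A where A: "A \<ge> 0" "\<And>p h. \<bar>FD \<phi> p h\<bar> \<le> A * norm h" using test_function_derivative_bounded[OF \<phi>] by metis
    let ?E = "electric_field (f t)"
    have e: "integrable lborel (\<lambda>z. (norm (?E (fst z)))\<^sup>2 * f t z)" using K[OF t] by blast
    have Em [measurable]: "?E \<in> borel_measurable borel" by (rule electric_field_borel[OF ess_bounded_borel[OF R]])
    have h: "norm (1::real, perp (?E x)) \<le> 1 + norm (?E x)" for x using norm_Pair_le[of "1::real" "perp (?E x)"] by simp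
    have bd: "\<bar>FD \<phi> p (1, perp (?E x))\<bar> \<le> A * (1 + C)" for p x
      using A(2)[of p "(1, perp (?E x))"] mult_left_mono[OF order_trans[OF h add_left_mono[OF C]], of A x] A(1) by linarith
    have gm: "borel_fun (gyro_center \<epsilon>)"
      by (rule borel_measurable_continuous_onI[OF linear_continuous_on[OF bounded_linear_gyro_center]])
    have Efm: "borel_fun (\<lambda>z :: R2 \<times> R2. perp (?E (fst z)))"
      using measurable_compose[OF measurable_compose[OF borel_measurable_continuous_onI[OF linear_continuous_on[OF bounded_linear_fst]] Em] perp_borel] .
    have hm: "borel_fun (\<lambda>z :: R2 \<times> R2. (1::real, perp (?E (fst z))))"
      by (rule borel_measurable_Pair) (simp, rule Efm)
    have pm: "borel_fun (\<lambda>z :: R2 \<times> R2. (t, P z))" if "borel_fun P" for P :: "R2 \<times> R2 \<Rightarrow> R2"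
      by (rule borel_measurable_Pair) (simp, rule that)
    have im: "integrable lborel (\<lambda>z. f t z * FD \<phi> (t, P z) (1, perp (?E (fst z))))"
      if "borel_fun P" for P
      using ess_bounded_integrable(1)[OF R frechet_derivative_borel[OF test_function_Ck[OF \<phi>] pm[OF that] hm], of "A * (1 + C)"] bd by simp
    have fm: "fst \<in> borel_measurable (borel :: (R2 \<times> R2) measure)"
      by (rule borel_measurable_continuous_onI[OF linear_continuous_on[OF bounded_linear_fst]])
    note i1 = im[OF gm] and i2 = im[OF fm]
    have ceq: "c t = (LBINT z. f t z * FD \<phi> (t, gyro_center \<epsilon> z) (1, perp (?E (fst z))))"
      unfolding c_def D\<Psi> using eps by (simp add: G_def gyro_center_vp_field)
    have deq: "d t = (LBINT z. f t z * FD \<phi> (t, fst z) (1, perp (?E (fst z))))"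
      using integral_macro_density(1)[of "\<lambda>x. FD \<phi> (t, x) (1, perp (?E x))" "f t"] i2
      by (simp add: d_def mult.commute)
    have cd_eq: "c t - d t = (LBINT z. f t z * (FD \<phi> (t, gyro_center \<epsilon> z) (1, perp (?E (fst z)))
        - FD \<phi> (t, fst z) (1, perp (?E (fst z)))))"
      unfolding ceq deq using i1 i2 by (simp add: right_diff_distrib)
    have "\<bar>c t - d t\<bar> \<le> (LBINT z. B * \<epsilon> * (norm (snd z) * f t z + ((norm (snd z))\<^sup>2 * f t z + (norm (?E (fst z)))\<^sup>2 * f t z)))"
      unfolding cd_eq
    proof (rule integral_abs_le)
      show "integrable lborel (\<lambda>z. B * \<epsilon> * (norm (snd z) * f t z + ((norm (snd z))\<^sup>2 * f t z + (norm (?E (fst z)))\<^sup>2 * f t z)))"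
        using I K[OF t] by simp
      show "AE z in lborel. \<bar>f t z * (FD \<phi> (t, gyro_center \<epsilon> z) (1, perp (?E (fst z)))
        - FD \<phi> (t, fst z) (1, perp (?E (fst z))))\<bar>
        \<le> B * \<epsilon> * (norm (snd z) * f t z + ((norm (snd z))\<^sup>2 * f t z + (norm (?E (fst z)))\<^sup>2 * f t z))"
        using f_nonneg[OF t]
      proof eventually_elim
        case (elim z)
        let ?h = "(1::real, perp (?E (fst z)))"
        have n: "norm ((t, gyro_center \<epsilon> z) - (t, fst z)) = \<epsilon> * norm (snd z)"
          using norm_gyro_center_diff[of \<epsilon> z] eps by (simp add: norm_Pair)
        have "\<bar>FD \<phi> (t, gyro_center \<epsilon> z) ?h - FD \<phi> (t, fst z) ?h\<bar>
            \<le> B * (\<epsilon> * norm (snd z)) * norm ?h"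
          using B(2)[where p = "(t, gyro_center \<epsilon> z)" and q = "(t, fst z)" and h = ?h] unfolding n .
        also have "\<dots> \<le> B * (\<epsilon> * norm (snd z)) * (1 + norm (?E (fst z)))"
          using B(1) eps by (intro mult_left_mono[OF h]) simp
        also have "\<dots> = B * \<epsilon> * (norm (snd z) + norm (snd z) * norm (?E (fst z)))" by (simp add: algebra_simps)
        also have "\<dots> \<le> B * \<epsilon> * (norm (snd z) + ((norm (snd z))\<^sup>2 + (norm (?E (fst z)))\<^sup>2))"
        proof (intro mult_left_mono add_left_mono)
          have "0 \<le> norm (snd z) * norm (?E (fst z))" by simp
          with sum_squares_bound[of "norm (snd z)" "norm (?E (fst z))"]
          show "norm (snd z) * norm (?E (fst z)) \<le> (norm (snd z))\<^sup>2 + (norm (?E (fst z)))\<^sup>2" by linarith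
        qed (use B(1) eps in simp)
        finally have "\<bar>FD \<phi> (t, gyro_center \<epsilon> z) ?h - FD \<phi> (t, fst z) ?h\<bar>
            \<le> B * \<epsilon> * (norm (snd z) + ((norm (snd z))\<^sup>2 + (norm (?E (fst z)))\<^sup>2))" .
        from mult_left_mono[OF this elim] have "\<bar>f t z * (FD \<phi> (t, gyro_center \<epsilon> z) ?h - FD \<phi> (t, fst z) ?h)\<bar>
            \<le> f t z * (B * \<epsilon> * (norm (snd z) + ((norm (snd z))\<^sup>2 + (norm (?E (fst z)))\<^sup>2)))"
          unfolding abs_mult abs_of_nonneg[OF elim] .
        also have "\<dots> = B * \<epsilon> * (norm (snd z) * f t z + ((norm (snd z))\<^sup>2 * f t z + (norm (?E (fst z)))\<^sup>2 * f t z))"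
          by (simp only: distrib_left distrib_right mult_ac)
        finally show ?case .
      qed
    qed
    also have "\<dots> = B * \<epsilon> * ((LBINT z. norm (snd z) * f t z) + ((LBINT z. (norm (snd z))\<^sup>2 * f t z)
        + (LBINT z. (norm (?E (fst z)))\<^sup>2 * f t z)))"
      by (simp only: Bochner_Integration.integral_mult_right_zero Bochner_Integration.integral_add[OF I(2) e]
          Bochner_Integration.integral_add[OF I(4) Bochner_Integration.integrable_add[OF I(2) e]])
    also have "\<dots> \<le> Q" unfolding Q_def
    proof (rule mult_left_mono)
      show "0 \<le> B * \<epsilon>" using B(1) eps by simp
    qed (use phase_bounds(2)[OF t] moment_kinetic_bounds(2)[OF t] K[OF t] in linarith)
    finally show ?thesis .
  qed
  have zero: "c t - d t = 0" if "T < t" for t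
  proof -
    have T': "T \<le> \<bar>t\<bar>" using that by simp
    show ?thesis unfolding c_def d_def D\<Psi> using T(3)[OF normT[OF T']] by (simp add: G_def)
  qed
  note pm = positive_times_borel[OF f_time_measurable]
  \<comment> \<open>Extension by 0 to negative times provides measurability in t; for t \<ge> 0 it
    agrees with \<open>d\<close>.\<close>
  define d' where "d' t = (LBINT x. macro_density (positive_times f t) x *
      FD \<phi> (t, x) (1, perp (electric_field (positive_times f t) x)))" for t
  have d'm: "borel_fun d'"
    using transport_term_measurable(2)[OF \<phi> macro_density_param_borel[OF pm] electric_field_param_borel[OF pm]] by (simp add: d'_def[abs_def])
  have dd': "indicator {0..} t * d t = indicator {0..} t * d' t" for t
  proof (cases "0 \<le> t")
    case True
    then have "positive_times f t = f t" by (simp add: positive_times_def fun_eq_iff)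
    then show ?thesis by (simp add: d_def d'_def)
  qed simp
  have dm: "(\<lambda>t. indicator {0..} t * d t) \<in> borel_measurable lborel" unfolding dd' using d'm by simp
  have Q: "0 \<le> Q" using cd[of 0] by simp
  let ?\<Delta> = "\<lambda>t. indicator {0..} t * c t - indicator {0..} t * d t"
  have le: "\<bar>?\<Delta> t\<bar> \<le> indicator {0..T} t * Q" for t
    using cd[of t] zero[of t] T(1) by (cases "0 \<le> t"; cases "t \<le> T") auto
  have Qi: "integrable lborel (\<lambda>t. indicator {0..T} t * Q)"
    by (intro integrable_mult_left integrable_real_indicator) (simp_all add: T(1) less_imp_le)
  have \<Delta>i: "integrable lborel ?\<Delta>" by (rule dominated_integrable[OF Qi]) (use c0(1) dm le Q in auto)
  have di: "integrable lborel (\<lambda>t. indicator {0..} t * d t)"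
    using Bochner_Integration.integrable_diff[OF c0(1) \<Delta>i] by simp
  have "\<bar>(LBINT t. ?\<Delta> t)\<bar> \<le> (LBINT t. indicator {0..T} t * Q)"
    by (rule integral_abs_le[OF Qi]) (use le in simp)
  also have "\<dots> = T * Q" using T(1) by simp
  finally have 1: "\<bar>(LBINT t. indicator {0..} t * c t) - (LBINT t. indicator {0..} t * d t)\<bar> \<le> T * Q"
    using c0(1) di by simp
  \<comment> \<open>The weak form contains \<open>f0\<close>, the claim the density at time
    0.\<close>
  have init: "(LBINT z. f 0 z * \<Psi> (0, z)) = (LBINT z. f0 z * \<Psi> (0, z))"
  proof (rule pairing_initial)
    show "Ck k (\<lambda>z. \<Psi> (0, z))" for k
      using Ck_compose_affine[OF bounded_linear_Pair[OF bounded_linear_zero bounded_linear_ident], of k \<Psi> 0] \<Psi> by simp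
  qed
  have "\<bar>(LBINT z. f 0 z * \<phi> (0, gyro_center \<epsilon> z)) - (LBINT x. \<phi> (0, x) * \<rho> 0 x)\<bar> \<le> B * \<epsilon> * (M + kinetic_bound)"
  proof (rule gyro_center_shift)
    show "continuous_on UNIV (\<lambda>x. \<phi> (0, x))"
      by (rule continuous_on_compose2[OF test_function_continuous[OF \<phi>]]) (auto intro!: continuous_intros)
    show "\<bar>\<phi> (0, x) - \<phi> (0, y)\<bar> \<le> B * norm (x - y)" for x y
      using B(3)[of "(0, x)" "(0, y)"] by (simp add: norm_Pair)
  qed (use B(1) in auto)
  then have 2: "\<bar>(LBINT z. f0 z * \<Psi> (0, z)) - (LBINT x. \<rho> 0 x * \<phi> (0, x))\<bar> \<le> B * \<epsilon> * (M + kinetic_bound)"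
    using init by (simp add: \<Psi>_def G_def mult.commute)
  have "0 \<le> (LBINT z. (norm (electric_field (f 0) (fst z)))\<^sup>2 * f 0 z)"
    by (rule integral_nonneg_AE) (use f_nonneg[OF order_refl] in \<open>eventually_elim, simp\<close>)
  then have "0 \<le> K" using K[of 0] by simp
  then have "B * \<epsilon> * (M + kinetic_bound) \<le> Q"
    unfolding Q_def using B(1) eps bounds_nonneg by (intro mult_left_mono) auto
  with 1 2 c0(2) have "\<bar>(LBINT t. indicator {0..} t * d t) + (LBINT x. \<rho> 0 x * \<phi> (0, x))\<bar> \<le> T * Q + Q" by linarith
  also have "T * Q + Q = \<epsilon> * (B * ((T + 1) * (M + 2 * kinetic_bound + K)))" by (simp add: Q_def algebra_simps)
  finally show ?thesis unfolding d_def .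
qed

text \<open>As a function on phase space the weight is constant in v and only locally square
  integrable, which is what \<open>pairing_continuous\<close> asks for.\<close>

lemma density_pairing_continuous:
  assumes \<phi>: "l2 \<phi>"
  shows "continuous_on {0..} (\<lambda>t. pairing \<phi> (\<rho> t))"
proof -
  note [measurable] = l2_borel[OF \<phi>]
  have w: "l2 (\<lambda>z :: R2 \<times> R2. cutoff R z * \<phi> (fst z))" for R
  proof -
    have p: "integrable lborel2 (\<lambda>p :: R2 \<times> R2. (\<phi> (fst p))\<^sup>2 * cutoff R (snd p))"
    proof (rule lborel_pair.Fubini_integrable)
      have "integrable lborel (\<lambda>x. (\<phi> x)\<^sup>2 * measure lborel (cball (0::R2) R))" using l2_integrable[OF \<phi>] by simp
      then show "integrable lborel (\<lambda>x. LBINT y. norm ((\<phi> (fst (x, y)))\<^sup>2 * cutoff R (snd (x, y) :: R2)))"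
        by (simp add: abs_mult)
      show "AE x in lborel. integrable lborel (\<lambda>y. (\<phi> (fst (x, y)))\<^sup>2 * cutoff R (snd (x, y) :: R2))"
        using emeasure_cball_less_top by (intro AE_I2) simp
    qed measurable
    have m: "borel_fun (\<lambda>z :: R2 \<times> R2. cutoff R z * \<phi> (fst z))"
    proof -
      have "(\<lambda>z :: R2 \<times> R2. \<phi> (fst z)) \<in> borel_measurable borel2" by measurable
      then show ?thesis by (simp add: borel_prod)
    qed
    have "norm ((cutoff R z * \<phi> (fst z))\<^sup>2) \<le> norm ((\<phi> (fst z))\<^sup>2 * cutoff R (snd z))" for z :: "R2 \<times> R2"
      using norm_snd_le[of "snd z" "fst z"] by (auto simp: indicator_def)
    then have "integrable lborel (\<lambda>z :: R2 \<times> R2. (cutoff R z * \<phi> (fst z))\<^sup>2)"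
      using m by (intro dominated_integrable[OF p[unfolded lborel_prod]] borel_measurable_power AE_I2) simp_all
    then show ?thesis using m by (simp add: l2_def)
  qed
  have eq: "pairing \<phi> (\<rho> t) = (LBINT z. \<phi> (fst z) * f t z)" if t: "0 \<le> t" for t
  proof (rule integral_macro_density(1))
    obtain R where R: "ess_bounded L R (f t)" using f_bounded_at[OF t] by blast
    have m: "borel_fun (\<lambda>z :: R2 \<times> R2. \<phi> (fst z) * f t z)"
    proof -
      have "(\<lambda>z :: R2 \<times> R2. \<phi> (fst z)) \<in> borel_measurable borel2" by measurable
      then show ?thesis using ess_bounded_borel[OF R] by (simp add: borel_prod)
    qed
    have "AE z in lborel. R < norm z \<longrightarrow> f t z = 0" using R unfolding ess_bounded_def by auto
    then have "AE z in lborel. cutoff R z * \<phi> (fst z) * f t z = \<phi> (fst z) * f t z"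
      by eventually_elim (auto simp: indicator_def)
    from integrable_cong_AE_imp[OF l2_mult_integrable[OF w ess_bounded_l2[OF R]] _ this] m
    show "integrable lborel (\<lambda>z. \<phi> (fst z) * f t z)" by simp
  qed
  show ?thesis using pairing_continuous[OF w] by (rule continuous_on_cong[THEN iffD2, rotated -1]) (auto simp: eq)
qed

end

lemma positive_times_density: "macro_density (positive_times f t) = (if 0 \<le> t then macro_density (f t) else (\<lambda>_. 0))"
  by (auto simp: positive_times_def macro_density_def fun_eq_iff)

section \<open>The limit\<close>

lemma L2_restrict_space:
  fixes g :: "R2 \<Rightarrow> 'b::euclidean_space"
  assumes K: "compact K" and g: "borel_fun g"
  shows "Lp_norm (restrict_space lborel K) 2 g = sqrt (LBINT x. indicator K x * (norm (g x))\<^sup>2)"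
    "Lp_mem (restrict_space lborel K) 2 g \<longleftrightarrow> integrable lborel (\<lambda>x. indicator K x * (norm (g x))\<^sup>2)"
proof -
  have Ks: "K \<inter> space lborel \<in> sets lborel" using borel_compact[OF K] by simp
  have "0 \<le> (LBINT x. indicator K x * (norm (g x))\<^sup>2)" by simp
  then show "Lp_norm (restrict_space lborel K) 2 g = sqrt (LBINT x. indicator K x * (norm (g x))\<^sup>2)"
    unfolding Lp_norm_def by (simp add: integral_restrict_space[OF Ks] powr_half_sqrt)
  have "g \<in> borel_measurable (restrict_space lborel K)" using g by (intro measurable_restrict_space1) simp
  then show "Lp_mem (restrict_space lborel K) 2 g \<longleftrightarrow> integrable lborel (\<lambda>x. indicator K x * (norm (g x))\<^sup>2)"
    unfolding Lp_mem_def by (simp add: integrable_restrict_space[OF Ks])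
qed

lemma coulomb_field_borel: "L12_bounded M S u \<Longrightarrow> borel_fun (field u)"
  by (rule kernel_convolution_borel[OF coulomb_kernel_borel L12_boundedD(2)])

lemma coulomb_field_gap:
  fixes R :: real
  assumes u: "L12_bounded M S u" and w: "L12_bounded M S w"
  shows "integrable lborel (\<lambda>x. cutoff R x * (norm (field u x - field w x))\<^sup>2)"
    "(LBINT x. cutoff R x * (norm (field u x - field w x))\<^sup>2)
      = (LBINT x. cutoff R x * (norm (field (\<lambda>x. u x - w x) x))\<^sup>2)"
proof -
  note d = L12_bounded_diff[OF u w]
  note [measurable] = coulomb_field_borel[OF u] coulomb_field_borel[OF w] coulomb_field_borel[OF d]
  have ae: "AE x in lborel. cutoff R x * (norm (field (\<lambda>x. u x - w x) x))\<^sup>2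
      = cutoff R x * (norm (field u x - field w x))\<^sup>2" using coulomb_field_diff[OF u w] by eventually_elim simp
  have "integrable lborel (\<lambda>x. cutoff R x * (norm (field (\<lambda>x. u x - w x) x))\<^sup>2)"
    by (rule coulomb_field_L2_loc[OF L12_boundedD(5,6)[OF d], of R]) (use d in blast)
  from integrable_cong_AE_imp[OF this _ ae]
  show "integrable lborel (\<lambda>x. cutoff R x * (norm (field u x - field w x))\<^sup>2)" by simp
  show "(LBINT x. cutoff R x * (norm (field u x - field w x))\<^sup>2)
      = (LBINT x. cutoff R x * (norm (field (\<lambda>x. u x - w x) x))\<^sup>2)"
    by (rule integral_cong_AE[symmetric]) (use ae in simp_all)
qed

lemma coulomb_field_gap_tendsto:
  assumes u: "\<And>j. L12_bounded M S (u j)" and w: "\<And>j. L12_bounded M S (w j)"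
    and weak: "\<And>\<phi>. l2 \<phi> \<Longrightarrow> (\<lambda>j. (pairing \<phi> (u j)) - pairing \<phi> (w j)) \<longlonglongrightarrow> 0"
  shows "(\<lambda>j. LBINT x. cutoff R x * (norm (field (u j) x - field (w j) x))\<^sup>2) \<longlonglongrightarrow> 0"
  unfolding coulomb_field_gap(2)[OF u w]
proof (rule coulomb_field_compact[OF L12_bounded_diff[OF u w]])
  fix \<phi> :: "R2 \<Rightarrow> real" assume \<phi>: "l2 \<phi>"
  have "(LBINT x. \<phi> x * (u j x - w j x)) = pairing \<phi> (u j) - pairing \<phi> (w j)" for j
    using l2_mult_integrable[OF \<phi> L12_boundedD(3)[OF u]] l2_mult_integrable[OF \<phi> L12_boundedD(3)[OF w]] by (simp add: right_diff_distrib)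
  then show "(\<lambda>j. LBINT x. \<phi> x * (u j x - w j x)) \<longlonglongrightarrow> 0" using weak[OF \<phi>] by simp
qed

lemma coulomb_field_L2_norm_tendsto:
  assumes u: "\<And>j. L12_bounded M S (u j)" and w: "\<And>j. L12_bounded M S (w j)"
    and weak: "\<And>\<phi>. l2 \<phi> \<Longrightarrow> (\<lambda>j. (pairing \<phi> (u j)) - pairing \<phi> (w j)) \<longlonglongrightarrow> 0"
    and K: "compact K"
  shows "(\<lambda>j. Lp_norm (restrict_space lborel K) 2
      (\<lambda>x. field (u j) x - field (w j) x)) \<longlonglongrightarrow> 0"
proof -
  obtain R where R: "K \<subseteq> cball 0 R" using bounded_subset_ballD[OF compact_imp_bounded[OF K], of 0] ball_subset_cball by blast
  note [measurable] = coulomb_field_borel[OF u] coulomb_field_borel[OF w] borel_compact[OF K]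
  let ?d = "\<lambda>j x. field (u j) x - field (w j) x"
  have eq: "Lp_norm (restrict_space lborel K) 2 (?d j) = sqrt (LBINT x. indicator K x * (norm (?d j x))\<^sup>2)" for j
    by (rule L2_restrict_space(1)[OF K]) measurable
  have le: "(LBINT x. indicator K x * (norm (?d j x))\<^sup>2) \<le> (LBINT x. cutoff R x * (norm (?d j x))\<^sup>2)" for j
  proof (rule integral_mono_AE'[OF coulomb_field_gap(1)[OF u w]])
    show "AE x in lborel. indicator K x * (norm (?d j x))\<^sup>2 \<le> cutoff R x * (norm (?d j x))\<^sup>2"
      using R by (intro AE_I2 mult_right_mono indicator_leI) auto
  qed simp
  have "(\<lambda>j. sqrt (LBINT x. cutoff R x * (norm (?d j x))\<^sup>2)) \<longlonglongrightarrow> sqrt 0"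
    by (intro tendsto_real_sqrt coulomb_field_gap_tendsto[OF u w weak])
  then have "(\<lambda>j. sqrt (LBINT x. cutoff R x * (norm (?d j x))\<^sup>2)) \<longlonglongrightarrow> 0" by simp
  then have "(\<lambda>j. sqrt (LBINT x. indicator K x * (norm (?d j x))\<^sup>2)) \<longlonglongrightarrow> 0"
    by (rule Lim_null_comparison[rotated]) (use le in \<open>simp add: always_eventually\<close>)
  then show ?thesis unfolding eq .
qed

text \<open>Weak convergence is tested with a truncation of (1 + |x|^2) sgn w, which is bounded with
  compact support; against \<open>w\<close> it produces the absolute value. Monotone convergence
  removes the truncation.\<close>

lemma weak_limit_moment:
  assumes u: "\<And>j. L12_bounded M S (u j)" and mi: "\<And>j. integrable lborel (\<lambda>x. (norm x)\<^sup>2 * \<bar>u j x\<bar>)"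
    and mom: "\<And>j. (LBINT x. (norm x)\<^sup>2 * \<bar>u j x\<bar>) \<le> m" and w: "l2 w"
    and weak: "\<And>\<phi>. l2 \<phi> \<Longrightarrow> (\<lambda>j. pairing \<phi> (u j)) \<longlonglongrightarrow> pairing \<phi> w"
  shows "integrable lborel (\<lambda>x. (1 + (norm x)\<^sup>2) * \<bar>w x\<bar>)" "(LBINT x. (1 + (norm x)\<^sup>2) * \<bar>w x\<bar>) \<le> M + m"
proof -
  note [measurable] = l2_borel[OF w]
  define h where "h n x = indicator (cball 0 (real n)) x * ((1 + (norm x)\<^sup>2) * sgn (w x))" for n and x :: R2
  have h: "l2 (h n)" for n
  proof (rule l2_bounded_support)
    show "borel_fun (h n)" unfolding h_def[abs_def] by measurable
    show "\<bar>h n x\<bar> \<le> 1 + (real n)\<^sup>2" for x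
      using power_mono[of "norm x" "real n" 2] by (auto simp: h_def indicator_def abs_mult abs_sgn_eq)
    show "h n x = 0" if "norm x \<ge> real n + 1" for x using that by (simp add: h_def indicator_def)
  qed
  have hw: "h n x * w x = indicator (cball 0 (real n)) x * ((1 + (norm x)\<^sup>2) * \<bar>w x\<bar>)" for n x
    by (simp add: h_def abs_sgn mult.assoc mult.commute)
  have "pairing (h n) (u j) \<le> M + m" for n j
  proof -
    note D = L12_boundedD[OF u[of j]]
    have "pairing (h n) (u j) \<le> (LBINT x. \<bar>u j x\<bar> + (norm x)\<^sup>2 * \<bar>u j x\<bar>)"
    proof (rule integral_mono)
      show "integrable lborel (\<lambda>x. h n x * u j x)" by (rule l2_mult_integrable[OF h D(3)])
      show "integrable lborel (\<lambda>x. \<bar>u j x\<bar> + (norm x)\<^sup>2 * \<bar>u j x\<bar>)" using D(1) mi by simp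
      fix x :: R2
      have "\<bar>h n x\<bar> \<le> 1 + (norm x)\<^sup>2" by (auto simp: h_def indicator_def abs_mult abs_sgn_eq)
      then have "\<bar>h n x\<bar> * \<bar>u j x\<bar> \<le> (1 + (norm x)\<^sup>2) * \<bar>u j x\<bar>" by (intro mult_right_mono) auto
      then show "h n x * u j x \<le> \<bar>u j x\<bar> + (norm x)\<^sup>2 * \<bar>u j x\<bar>"
        using abs_ge_self[of "h n x * u j x"] by (simp add: abs_mult distrib_right)
    qed
    also have "\<dots> = (LBINT x. \<bar>u j x\<bar>) + (LBINT x. (norm x)\<^sup>2 * \<bar>u j x\<bar>)" using D(1) mi by simp
    also have "\<dots> \<le> M + m" using D(9) mom[of j] by linarith
    finally show ?thesis .
  qed
  then have bnd: "pairing (h n) w \<le> M + m" for n by (intro LIMSEQ_le_const2[OF weak[OF h]]) auto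
  have int: "integrable lborel (\<lambda>x. h n x * w x)" for n by (rule l2_mult_integrable[OF h w])
  have mono: "mono (\<lambda>n. h n x * w x)" for x unfolding hw by (auto simp: mono_def indicator_def)
  have inc: "incseq (\<lambda>n. pairing (h n) w)"
  proof (rule monoI)
    fix i j :: nat assume "i \<le> j"
    show "pairing (h i) w \<le> pairing (h j) w"
    proof (rule integral_mono)
      show "h i x * w x \<le> h j x * w x" for x by (rule monoD[OF mono \<open>i \<le> j\<close>])
    qed (rule int)+
  qed
  obtain l where l: "(\<lambda>n. pairing (h n) w) \<longlonglongrightarrow> l" "l \<le> M + m"
  proof -
    obtain l where l: "(\<lambda>n. pairing (h n) w) \<longlonglongrightarrow> l"
      using incseq_convergent[OF inc] bnd by blast
    have "l \<le> M + m" by (rule LIMSEQ_le_const2[OF l]) (use bnd in blast)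
    with l show thesis by (rule that)
  qed
  have lim: "(\<lambda>n. h n x * w x) \<longlonglongrightarrow> (1 + (norm x)\<^sup>2) * \<bar>w x\<bar>" for x
  proof (rule tendsto_eventually)
    obtain N where "norm x \<le> real N" using real_arch_simple by blast
    then have "\<forall>n\<ge>N. h n x * w x = (1 + (norm x)\<^sup>2) * \<bar>w x\<bar>"
      unfolding hw by (auto simp: indicator_def)
    then show "\<forall>\<^sub>F n in sequentially. h n x * w x = (1 + (norm x)\<^sup>2) * \<bar>w x\<bar>"
      unfolding eventually_sequentially by blast
  qed
  have m: "(\<lambda>x. (1 + (norm x)\<^sup>2) * \<bar>w x\<bar>) \<in> borel_measurable lborel" by measurable
  note I = integral_monotone_convergence[OF int AE_I2[OF mono] AE_I2[OF lim] l(1) m]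
    integrable_monotone_convergence[OF int AE_I2[OF mono] AE_I2[OF lim] l(1) m]
  show "integrable lborel (\<lambda>x. (1 + (norm x)\<^sup>2) * \<bar>w x\<bar>)" by (rule I(2))
  show "(LBINT x. (1 + (norm x)\<^sup>2) * \<bar>w x\<bar>) \<le> M + m" using I(1) l(2) by simp
qed

text \<open>Both |w| and |x| |w| lie below (1 + |x|^2) |w|; the first moment is what the logarithmic
  convolution consumes.\<close>

lemma weak_limit_L12_bounded:
  assumes wi: "integrable lborel (\<lambda>x. (1 + (norm x)\<^sup>2) * \<bar>w x\<bar>)" "(LBINT x. (1 + (norm x)\<^sup>2) * \<bar>w x\<bar>) \<le> C"
    and w: "l2 w" "sq_int w \<le> S"
  shows "L12_bounded C S w" "integrable lborel (\<lambda>x. norm x * \<bar>w x\<bar>)"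
proof -
  note [measurable] = l2_borel[OF w(1)]
  have le: "1 * \<bar>w x\<bar> \<le> (1 + (norm x)\<^sup>2) * \<bar>w x\<bar>" "norm x * \<bar>w x\<bar> \<le> (1 + (norm x)\<^sup>2) * \<bar>w x\<bar>" for x
    by (rule mult_right_mono; simp add: le_one_plus_square)+
  have i: "integrable lborel w"
    by (rule dominated_integrable[OF wi(1)]) (use le(1) in \<open>auto simp: abs_mult\<close>)
  have "(LBINT x. \<bar>w x\<bar>) \<le> C" by (rule order_trans[OF integral_mono wi(2)]) (use i wi(1) le(1) in auto)
  with i w show "L12_bounded C S w" by (simp add: L12_bounded_def)
  show "integrable lborel (\<lambda>x. norm x * \<bar>w x\<bar>)"
    by (rule dominated_integrable[OF wi(1)]) (use le(2) in \<open>auto simp: abs_mult\<close>)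
qed

section \<open>The nonlinear transport term\<close>

lemma integrable_time_slices:
  fixes G :: "real \<times> R2 \<Rightarrow> 'b::euclidean_space"
  assumes Gm: "G \<in> borel_measurable borel2" and T: "0 \<le> T"
    and int: "\<And>t. t \<in> {0..T} \<Longrightarrow> integrable lborel (\<lambda>x. G (t, x)) \<and> (LBINT x. norm (G (t, x))) \<le> C"
    and zero: "\<And>t x. t \<notin> {0..T} \<Longrightarrow> G (t, x) = 0"
  shows "integrable lborel G" "(LBINT p. G p) = (LBINT t. LBINT x. G (t, x))"
proof -
  have Gm': "G \<in> borel_measurable lborel2" using Gm by simp
  have "(\<lambda>(t, x). norm (G (t, x))) \<in> borel_measurable (borel \<Otimes>\<^sub>M lborel)" using Gm by simp
  from sigma_finite_measure.borel_measurable_lebesgue_integral[OF sigma_finite_lborel this]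
  have nm: "borel_fun (\<lambda>t. LBINT x. norm (G (t, x)))" by simp
  have "integrable lborel2 G"
  proof (rule lborel_pair.Fubini_integrable[OF Gm'])
    have Ci: "integrable lborel (\<lambda>t. indicator {0..T} t * C)"
      by (intro integrable_mult_left integrable_real_indicator) (simp_all add: T)
    have "norm (LBINT x. norm (G (t, x))) \<le> norm (indicator {0..T} t * C)" for t
    proof (cases "t \<in> {0..T}")
      case True
      have "0 \<le> (LBINT x. norm (G (t, x)))" by simp
      moreover have "(LBINT x. norm (G (t, x))) \<le> \<bar>C\<bar>" using int[OF True] by linarith
      ultimately show ?thesis using True by simp
    qed (simp add: zero)
    then show "integrable lborel (\<lambda>t. LBINT x. norm (G (t, x)))"
      using nm by (intro dominated_integrable[OF Ci] AE_I2) auto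
    have "integrable lborel (\<lambda>x. G (t, x))" for t using int[of t] zero[of t] by (cases "t \<in> {0..T}") auto
    then show "AE t in lborel. integrable lborel (\<lambda>x. G (t, x))" by simp
  qed
  note i = this
  show "integrable lborel G" using i by (simp add: lborel_prod)
  show "(LBINT p. G p) = (LBINT t. LBINT x. G (t, x))"
    using lborel_pair.integral_fst'[OF i] by (simp add: lborel_prod)
qed

abbreviation (input) transport :: "(real \<times> R2 \<Rightarrow> real) \<Rightarrow> real \<Rightarrow> (R2 \<Rightarrow> R2) \<Rightarrow> R2 \<Rightarrow> real" where
  "transport \<phi> t e x \<equiv> FD \<phi> (t, x) (1, perp (e x))"

text \<open>Compactness of the field map turns weak continuity of the densities in time into strong
  continuity of the fields on compact sets, tested along sequences of times.\<close>

lemma C_L2_loc_coulomb_field: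
  assumes u: "\<And>t. 0 \<le> t \<Longrightarrow> L12_bounded M S (u t)"
    and cont: "\<And>\<phi>. l2 \<phi> \<Longrightarrow> continuous_on {0..} (\<lambda>t. pairing \<phi> (u t))"
  shows "C_L2_loc (\<lambda>t. field (u t))" unfolding C_L2_loc_def
proof (intro allI impI conjI)
  fix K :: "R2 set" and t :: real assume K: "compact K" and t: "0 \<le> t"
  obtain R where R: "K \<subseteq> cball 0 R" using bounded_subset_ballD[OF compact_imp_bounded[OF K], of 0] ball_subset_cball by blast
  note [measurable] = coulomb_field_borel[OF u[OF t]] borel_compact[OF K]
  have "integrable lborel (\<lambda>x. cutoff R x * (norm (field (u t) x))\<^sup>2)"
    by (rule coulomb_field_L2_loc[OF L12_boundedD(5,6)[OF u[OF t]], of R]) (use u[OF t] in blast)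
  then have "integrable lborel (\<lambda>x. indicator K x * (norm (field (u t) x))\<^sup>2)"
  proof (rule dominated_integrable)
    have "indicator K x * (norm (field (u t) x))\<^sup>2 \<le> cutoff R x * (norm (field (u t) x))\<^sup>2" for x
      using R by (intro mult_right_mono indicator_leI) auto
    then show "AE x in lborel. norm (indicator K x * (norm (field (u t) x))\<^sup>2) \<le> norm (cutoff R x * (norm (field (u t) x))\<^sup>2)"
      by (simp add: abs_mult)
  qed measurable
  then show "Lp_mem (restrict_space lborel K) 2 (field (u t))"
    using L2_restrict_space(2)[OF K coulomb_field_borel[OF u[OF t]]] by simp
  show "((\<lambda>s. Lp_norm (restrict_space lborel K) 2 (\<lambda>x. field (u s) x - field (u t) x)) \<longlongrightarrow> 0) (at t within {0..})"
    unfolding tendsto_at_iff_sequentially comp_def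
  proof (intro allI impI)
    fix X :: "nat \<Rightarrow> real" assume X: "\<forall>i. X i \<in> {0..} - {t}" "X \<longlonglongrightarrow> t"
    show "(\<lambda>j. Lp_norm (restrict_space lborel K) 2 (\<lambda>x. field (u (X j)) x - field (u t) x)) \<longlonglongrightarrow> 0"
    proof (rule coulomb_field_L2_norm_tendsto[OF _ _ _ K])
      show "L12_bounded M S (u (X j))" "L12_bounded M S (u t)" for j using X(1) t by (auto intro: u)
      fix \<phi> :: "R2 \<Rightarrow> real" assume \<phi>: "l2 \<phi>"
      have "(\<lambda>j. pairing \<phi> (u (X j))) \<longlonglongrightarrow> pairing \<phi> (u t)"
        by (rule continuous_on_tendsto_compose[OF cont[OF \<phi>] X(2)]) (use X(1) t in auto)
      then show "(\<lambda>j. (pairing \<phi> (u (X j))) - pairing \<phi> (u t)) \<longlonglongrightarrow> 0"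
        using LIM_zero by blast
    qed
  qed
qed

text \<open>The direction enters linearly and the time components cancel, so the second bound sees
  only the difference of the fields.\<close>

lemma transport_bound:
  assumes \<phi>: "test_function \<phi>" and A: "0 \<le> A" "\<And>p h. \<bar>FD \<phi> p h\<bar> \<le> A * norm h"
    and R: "\<And>p h. R \<le> norm p \<Longrightarrow> FD \<phi> p h = 0"
  shows "\<bar>transport \<phi> t e x\<bar> \<le> cutoff R x * (A * (1 + norm (e x)))"
    "\<bar>transport \<phi> t e x - transport \<phi> t e' x\<bar> \<le> cutoff R x * (A * norm (e x - e' x))"
proof -
  have out: "FD \<phi> (t, x) h = 0" if "x \<notin> cball 0 R" for h
    using that R[of "(t, x)" h] norm_snd_le[of x t] by simp
  have "norm (1::real, perp (e x)) \<le> 1 + norm (e x)" using norm_Pair_le[of "1::real" "perp (e x)"] by simp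
  from order_trans[OF A(2) mult_left_mono[OF this A(1)]]
  show "\<bar>transport \<phi> t e x\<bar> \<le> cutoff R x * (A * (1 + norm (e x)))"
    using out by (cases "x \<in> cball 0 R") simp_all
  have "transport \<phi> t e x - transport \<phi> t e' x = FD \<phi> (t, x) ((1, perp (e x)) - (1, perp (e' x)))"
    by (rule linear_diff[OF linear_frechet_derivative_Ck[OF test_function_Ck[OF \<phi>]], symmetric])
  also have "(1::real, perp (e x)) - (1, perp (e' x)) = (0, perp (e x - e' x))"
    using linear_diff[OF bounded_linear.linear[OF bounded_linear_perp], of "e x" "e' x"] by simp
  finally have eq: "transport \<phi> t e x - transport \<phi> t e' x = FD \<phi> (t, x) (0, perp (e x - e' x))" .
  have "norm (0::real, perp (e x - e' x)) = norm (e x - e' x)" by (simp add: norm_Pair)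
  with A(2)[of "(t, x)" "(0, perp (e x - e' x))"]
  show "\<bar>transport \<phi> t e x - transport \<phi> t e' x\<bar> \<le> cutoff R x * (A * norm (e x - e' x))"
    unfolding eq using out by (cases "x \<in> cball 0 R") simp_all
qed

lemma transport_borel:
  assumes \<phi>: "test_function \<phi>" and e: "borel_fun e"
  shows "borel_fun (\<lambda>x. transport \<phi> t e x)"
proof (rule frechet_derivative_borel[OF test_function_Ck[OF \<phi>]])
  show "(\<lambda>x. (t, x)) \<in> borel_measurable (borel :: R2 measure)" by (rule borel_measurable_Pair) simp_all
  show "borel_fun (\<lambda>x. (1::real, perp (e x)))"
    by (rule borel_measurable_Pair) (simp_all add: measurable_compose[OF e perp_borel])
qed

lemma field_cutoff_l2:
  assumes u: "L12_bounded M S u"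
  shows "l2 (\<lambda>x. cutoff R x * norm (field u x))" unfolding l2_def
proof
  note [measurable] = coulomb_field_borel[OF u]
  show "borel_fun (\<lambda>x. cutoff R x * norm (field u x))" by measurable
  have "integrable lborel (\<lambda>x. cutoff R x * (norm (field u x))\<^sup>2)"
    by (rule coulomb_field_L2_loc[OF L12_boundedD(5,6)[OF u], of R]) (use u in blast)
  moreover have "(cutoff R x * norm (field u x))\<^sup>2 = cutoff R x * (norm (field u x))\<^sup>2" for x
    by (simp add: indicator_def)
  ultimately show "integrable lborel (\<lambda>x. (cutoff R x * norm (field u x))\<^sup>2)" by simp
qed

lemma field_cutoff_weight_bound:
  assumes "0 \<le> M" "0 \<le> S"
  obtains C where "\<And>u. L12_bounded M S u \<Longrightarrow>
      l2 (\<lambda>x. cutoff R x * (A * (1 + norm (field u x)))) \<and>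
      (LBINT x. (cutoff R x * (A * (1 + norm (field u x))))\<^sup>2) \<le> C"
proof -
  obtain C where C: "\<And>u. L12_bounded M S u \<Longrightarrow>
      integrable lborel (\<lambda>x. cutoff R x * (norm (field u x))\<^sup>2) \<and>
      (LBINT x. cutoff R x * (norm (field u x))\<^sup>2) \<le> C"
    by (rule coulomb_field_L2_loc[OF assms, of R]) (rule that, assumption)
  let ?I = "\<lambda>x :: R2. cutoff R x :: real"
  show thesis
  proof (rule that[of "2 * A\<^sup>2 * ((LBINT x. ?I x) + C)"])
    fix u assume u: "L12_bounded M S u"
    have I2: "l2 ?I" by (rule l2_indicator) auto
    have Ii: "integrable lborel ?I" by (rule integrable_real_indicator) auto
    have "l2 (\<lambda>x. A * ?I x + A * (?I x * norm (field u x)))"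
      by (rule l2_add[OF l2_cmult[OF I2] l2_cmult[OF field_cutoff_l2[OF u]]])
    moreover have "(\<lambda>x. A * ?I x + A * (?I x * norm (field u x))) = (\<lambda>x. ?I x * (A * (1 + norm (field u x))))"
      by (simp add: algebra_simps)
    ultimately have l: "l2 (\<lambda>x. ?I x * (A * (1 + norm (field u x))))" by simp
    have "(LBINT x. (?I x * (A * (1 + norm (field u x))))\<^sup>2) \<le> (LBINT x. 2 * A\<^sup>2 * (?I x + ?I x * (norm (field u x))\<^sup>2))"
    proof (rule integral_mono[OF l2_integrable[OF l]])
      show "integrable lborel (\<lambda>x. 2 * A\<^sup>2 * (?I x + ?I x * (norm (field u x))\<^sup>2))" using Ii C[OF u] by simp
      show "(?I x * (A * (1 + norm (field u x))))\<^sup>2 \<le> 2 * A\<^sup>2 * (?I x + ?I x * (norm (field u x))\<^sup>2)" for x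
      proof (cases "x \<in> cball 0 R")
        case True
        have e: "2 * A\<^sup>2 * (1 + (norm (field u x))\<^sup>2) = A\<^sup>2 * (2 * 1\<^sup>2 + 2 * (norm (field u x))\<^sup>2)" by (simp add: algebra_simps)
        show ?thesis unfolding indicator_simps(1)[OF True] mult_1_left power_mult_distrib e
          by (rule mult_left_mono[OF square_add_le]) simp
      qed simp
    qed
    also have "\<dots> = 2 * A\<^sup>2 * ((LBINT x. ?I x) + (LBINT x. ?I x * (norm (field u x))\<^sup>2))" using Ii C[OF u] by simp
    also have "\<dots> \<le> 2 * A\<^sup>2 * ((LBINT x. ?I x) + C)" using C[OF u] by (intro mult_left_mono) auto
    finally show "l2 (\<lambda>x. ?I x * (A * (1 + norm (field u x)))) \<and>
      (LBINT x. (?I x * (A * (1 + norm (field u x))))\<^sup>2) \<le> 2 * A\<^sup>2 * ((LBINT x. ?I x) + C)" using l by blast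
  qed
qed

lemma l2_mult_abs_le:
  assumes "l2 u" "l2 w"
  shows "(LBINT x. \<bar>u x * w x\<bar>) \<le> sq_int u + sq_int w"
proof -
  have "(LBINT x. \<bar>u x * w x\<bar>) \<le> (LBINT x. (u x)\<^sup>2 + (w x)\<^sup>2)"
  proof (rule integral_mono)
    show "integrable lborel (\<lambda>x. \<bar>u x * w x\<bar>)" by (rule integrable_abs[OF l2_mult_integrable[OF assms]])
    show "integrable lborel (\<lambda>x. (u x)\<^sup>2 + (w x)\<^sup>2)" using assms by (simp add: l2_integrable)
    show "\<bar>u x * w x\<bar> \<le> (u x)\<^sup>2 + (w x)\<^sup>2" for x
      using sum_squares_bound[of "\<bar>u x\<bar>" "\<bar>w x\<bar>"] mult_nonneg_nonneg[OF abs_ge_zero abs_ge_zero, of "u x" "w x"]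
      unfolding abs_mult power2_abs by linarith
  qed
  then show ?thesis using assms by (simp add: l2_integrable)
qed

text \<open>On a ball the weight 1 + |E| is bounded in L2, and pairing it with \<open>u\<close>
  costs the two squared norms. The constant does not depend on t, so it can dominate the time
  integral.\<close>

lemma transport_pairing_bound:
  assumes \<phi>: "test_function \<phi>" and MS: "0 \<le> M" "0 \<le> S"
  obtains C where "\<And>t u. L12_bounded M S u \<Longrightarrow> l2 (\<lambda>x. transport \<phi> t (field u) x) \<and>
      (LBINT x. \<bar>u x * transport \<phi> t (field u) x\<bar>) \<le> C"
proof -
  obtain A where A: "A \<ge> 0" "\<And>p h. \<bar>FD \<phi> p h\<bar> \<le> A * norm h"
    using test_function_derivative_bounded[OF \<phi>] by metis
  obtain R where R: "\<And>p h. R \<le> norm p \<Longrightarrow> FD \<phi> p h = 0" using test_function_support[OF \<phi>] by metis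
  obtain C where C: "\<And>u. L12_bounded M S u \<Longrightarrow>
      l2 (\<lambda>x. cutoff R x * (A * (1 + norm (field u x)))) \<and>
      (LBINT x. (cutoff R x * (A * (1 + norm (field u x))))\<^sup>2) \<le> C"
    by (rule field_cutoff_weight_bound[OF MS, of R A]) (rule that, assumption)
  show thesis
  proof (rule that[of "S + C"])
    fix t u assume u: "L12_bounded M S u"
    let ?b = "\<lambda>x. cutoff R x * (A * (1 + norm (field u x)))"
    note D = L12_boundedD[OF u] and b = transport_bound(1)[OF \<phi> A R]
    have b': "\<bar>transport \<phi> t (field u) x\<bar> \<le> \<bar>?b x\<bar>" for x
      using b[where t = t and e = "field u" and x = x] by (rule order_trans[OF _ abs_ge_self])
    have l: "l2 (\<lambda>x. transport \<phi> t (field u) x)"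
      by (rule l2_bound[OF conjunct1[OF C[OF u]] transport_borel[OF \<phi> coulomb_field_borel[OF u]] AE_I2[OF b']])
    have "(LBINT x. \<bar>u x * transport \<phi> t (field u) x\<bar>) \<le> (LBINT x. \<bar>u x * ?b x\<bar>)"
    proof (rule integral_mono)
      show "integrable lborel (\<lambda>x. \<bar>u x * transport \<phi> t (field u) x\<bar>)" by (rule integrable_abs[OF l2_mult_integrable[OF D(3) l]])
      show "integrable lborel (\<lambda>x. \<bar>u x * ?b x\<bar>)" by (rule integrable_abs[OF l2_mult_integrable[OF D(3) conjunct1[OF C[OF u]]]])
      show "\<bar>u x * transport \<phi> t (field u) x\<bar> \<le> \<bar>u x * ?b x\<bar>" for x
        unfolding abs_mult[of "u x"] by (rule mult_left_mono[OF b']) simp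
    qed
    also have "\<dots> \<le> S + C" using l2_mult_abs_le[OF D(3) conjunct1[OF C[OF u]]] D(4) C[OF u] by linarith
    finally show "l2 (\<lambda>x. transport \<phi> t (field u) x) \<and> (LBINT x. \<bar>u x * transport \<phi> t (field u) x\<bar>) \<le> S + C" using l by blast
  qed
qed

text \<open>Weak convergence of the densities is enough for the nonlinear term because the fields converge strongly on balls.\<close>

lemma transport_pairing_tendsto:
  assumes \<phi>: "test_function \<phi>" and u: "\<And>j. L12_bounded M S (u j)" and w: "L12_bounded M S w"
    and weak: "\<And>\<phi>. l2 \<phi> \<Longrightarrow> (\<lambda>j. pairing \<phi> (u j)) \<longlonglongrightarrow> pairing \<phi> w"
  shows "(\<lambda>j. LBINT x. u j x * transport \<phi> t (field (u j)) x) \<longlonglongrightarrow> pairing w (transport \<phi> t (field w))"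
proof -
  obtain A where A: "A \<ge> 0" "\<And>p h. \<bar>FD \<phi> p h\<bar> \<le> A * norm h"
    using test_function_derivative_bounded[OF \<phi>] by metis
  obtain R where R: "\<And>p h. R \<le> norm p \<Longrightarrow> FD \<phi> p h = 0" using test_function_support[OF \<phi>] by metis
  note D = L12_boundedD[OF u] and Dw = L12_boundedD[OF w]
  have l: "l2 (\<lambda>x. transport \<phi> t (field v) x)" if "L12_bounded M S v" for v
    by (rule transport_pairing_bound[OF \<phi> Dw(5,6)]) (use that in blast)
  let ?d = "\<lambda>j x. transport \<phi> t (field (u j)) x - transport \<phi> t (field w) x"
  let ?gap = "\<lambda>j. LBINT x. cutoff R x * (norm (field (u j) x - field w x))\<^sup>2"
  have ld: "l2 (?d j)" for j by (rule l2_diff[OF l[OF u] l[OF w]])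
  have gap: "sq_int (?d j) \<le> A\<^sup>2 * ?gap j" for j
  proof -
    have "sq_int (?d j) \<le> (LBINT x. A\<^sup>2 * (cutoff R x * (norm (field (u j) x - field w x))\<^sup>2))"
    proof (rule integral_mono[OF l2_integrable[OF ld]])
      show "integrable lborel (\<lambda>x. A\<^sup>2 * (cutoff R x * (norm (field (u j) x - field w x))\<^sup>2))"
        using coulomb_field_gap(1)[OF u w] by simp
      fix x :: R2
      have "\<bar>?d j x\<bar> \<le> cutoff R x * (A * norm (field (u j) x - field w x))" by (rule transport_bound(2)[OF \<phi> A R])
      from power_mono[OF this abs_ge_zero, where n = 2]
      have "(?d j x)\<^sup>2 \<le> (cutoff R x * (A * norm (field (u j) x - field w x)))\<^sup>2" unfolding power2_abs .
      also have "\<dots> = A\<^sup>2 * (cutoff R x * (norm (field (u j) x - field w x))\<^sup>2)"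
        by (cases "x \<in> cball 0 R") (simp_all add: power_mult_distrib)
      finally show "(?d j x)\<^sup>2 \<le> A\<^sup>2 * (cutoff R x * (norm (field (u j) x - field w x))\<^sup>2)" .
    qed
    then show ?thesis by simp
  qed
  have "?gap \<longlonglongrightarrow> 0"
  proof (rule coulomb_field_gap_tendsto[OF u w])
    show "(\<lambda>j. (pairing \<phi> (u j)) - pairing \<phi> w) \<longlonglongrightarrow> 0" if "l2 \<phi>" for \<phi>
      using weak[OF that] LIM_zero by blast
  qed
  then have "(\<lambda>j. sqrt S * sqrt (A\<^sup>2 * ?gap j)) \<longlonglongrightarrow> sqrt S * sqrt (A\<^sup>2 * 0)" by (intro tendsto_intros)
  then have g0: "(\<lambda>j. sqrt S * sqrt (A\<^sup>2 * ?gap j)) \<longlonglongrightarrow> 0" by simp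
  \<comment> \<open>The product is split into \<open>u j\<close> against the difference of the
    transport terms, which tends to 0 in L2, and \<open>u j\<close> against a fixed L2
    function.\<close>
  have "(\<lambda>j. pairing (u j) (?d j)) \<longlonglongrightarrow> 0"
  proof (rule Lim_null_comparison[OF _ g0], intro always_eventually allI)
    fix j
    have "norm (pairing (u j) (?d j)) \<le> sqrt (sq_int (u j)) * sqrt (sq_int (?d j))"
      using l2_Cauchy_Schwarz_abs[OF D(3) ld] by simp
    also have "\<dots> \<le> sqrt S * sqrt (A\<^sup>2 * ?gap j)"
      using D(4,6) gap by (intro mult_mono real_sqrt_le_mono) auto
    finally show "norm (pairing (u j) (?d j)) \<le> sqrt S * sqrt (A\<^sup>2 * ?gap j)" .
  qed
  from tendsto_add[OF this weak[OF l[OF w]]]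
  have "(\<lambda>j. (pairing (u j) (?d j)) + pairing (transport \<phi> t (field w)) (u j))
      \<longlonglongrightarrow> pairing (transport \<phi> t (field w)) w" by simp
  moreover have "pairing (u j) (?d j) + pairing (transport \<phi> t (field w)) (u j)
      = (LBINT x. u j x * transport \<phi> t (field (u j)) x)" for j
    using l2_mult_integrable[OF D(3) l[OF u], of j j] l2_mult_integrable[OF D(3) l[OF w], of j]
    by (simp add: right_diff_distrib mult.commute)
  ultimately show ?thesis by (simp add: mult.commute)
qed

text \<open>From here on only densities and their fields enter. In the application the first bound
  is mass plus second moment, since \<open>weak_limit_moment\<close> bounds these two together for
  the limit.\<close>

locale density_limit =
  fixes r :: "nat \<Rightarrow> real \<Rightarrow> R2 \<Rightarrow> real" and \<rho> :: "real \<Rightarrow> R2 \<Rightarrow> real" and M S :: real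
  assumes r_bound: "\<And>n t. 0 \<le> t \<Longrightarrow> L12_bounded M S (r n t)"
    and \<rho>_bound: "\<And>t. 0 \<le> t \<Longrightarrow> L12_bounded M S (\<rho> t)"
    and r_continuous: "\<And>n \<phi>. l2 \<phi> \<Longrightarrow> continuous_on {0..} (\<lambda>t. pairing \<phi> (r n t))"
    and uniform: "\<And>\<phi> T. l2 \<phi> \<Longrightarrow>
      uniform_limit {0..T} (\<lambda>n t. LBINT x. \<phi> x * r n t x) (\<lambda>t. pairing \<phi> (\<rho> t)) sequentially"
    and r_measurable: "\<And>n. case_prod (positive_times (r n)) \<in> borel_measurable borel2"
    and \<rho>_measurable: "case_prod \<rho> \<in> borel_measurable borel2"
begin

lemma nonneg: "0 \<le> M" "0 \<le> S" using L12_boundedD(5,6)[OF \<rho>_bound[OF order_refl]] by auto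

lemma pairing_tendsto: "l2 \<phi> \<Longrightarrow> 0 \<le> t \<Longrightarrow> (\<lambda>n. pairing \<phi> (r n t)) \<longlonglongrightarrow> pairing \<phi> (\<rho> t)"
  using tendsto_uniform_limitI[OF uniform, of \<phi> t t] by simp

lemma \<rho>_continuous:
  assumes "l2 \<phi>"
  shows "continuous_on {0..} (\<lambda>t. pairing \<phi> (\<rho> t))"
proof (rule continuous_on_halfline)
  fix T
  have "continuous_on {0..T} (\<lambda>t. pairing \<phi> (r n t))" for n
    by (rule continuous_on_subset[OF r_continuous[OF assms]]) auto
  then show "continuous_on {0..T} (\<lambda>t. pairing \<phi> (\<rho> t))"
    by (intro uniform_limit_theorem[OF _ uniform[OF assms]] always_eventually) auto
qed

lemma converges_weakly: "converges_C_L2_weak r \<rho>" unfolding converges_C_L2_weak_def C_L2_weak_def Lp_mem_2_iff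
  using L12_boundedD(3)[OF r_bound] L12_boundedD(3)[OF \<rho>_bound] r_continuous \<rho>_continuous uniform by blast

lemma Linf_time_L2: "Linf_time_Lp 2 \<rho>" unfolding Linf_time_Lp_def time_measurable_def
proof (intro conjI exI[of _ "sqrt S"] AE_I2 impI)
  show "case_prod \<rho> \<in> borel_measurable (restrict_space borel ({0..} \<times> UNIV))"
    using \<rho>_measurable by (intro measurable_restrict_space1) (simp add: borel_prod)
  fix t :: real assume t: "0 \<le> t"
  note D = L12_boundedD[OF \<rho>_bound[OF t]]
  show "Lp_mem lborel 2 (\<rho> t)" using D(3) by (simp add: Lp_mem_2_iff)
  have "Lp_norm lborel 2 (\<rho> t) = sqrt (sq_int (\<rho> t))" by (simp add: Lp_norm_def powr_half_sqrt)
  then show "Lp_norm lborel 2 (\<rho> t) \<le> sqrt S" using D(4) by simp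
qed

lemma fields_converge: "converges_C_L2_loc (\<lambda>n t. field (r n t)) (\<lambda>t. field (\<rho> t))"
  unfolding converges_C_L2_loc_def
proof (intro conjI allI impI)
  show "C_L2_loc (\<lambda>t. field (r n t))" for n by (rule C_L2_loc_coulomb_field[OF r_bound r_continuous])
  show "C_L2_loc (\<lambda>t. field (\<rho> t))" by (rule C_L2_loc_coulomb_field[OF \<rho>_bound \<rho>_continuous])
  fix K :: "R2 set" and T :: real assume K: "compact K" and T: "0 < T"
  let ?N = "\<lambda>n t. Lp_norm (restrict_space lborel K) 2 (\<lambda>x. field (r n t) x - field (\<rho> t) x)"
  show "uniform_limit {0..T} ?N (\<lambda>_. 0) sequentially" unfolding uniform_limit_iff
  proof (intro allI impI)
    fix e :: real assume e: "0 < e"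
    \<comment> \<open>Uniformity in t is reduced to sequences: \<open>s n\<close> is a time at which
      the norm reaches \<open>e\<close> whenever there is one, and compactness is applied along
      \<open>s\<close>, using that weak convergence is uniform in t.\<close>
    have "\<exists>t. t \<in> {0..T} \<and> ((\<exists>t\<in>{0..T}. e \<le> dist (?N n t) 0) \<longrightarrow> e \<le> dist (?N n t) 0)" for n
    proof (cases "\<exists>t\<in>{0..T}. e \<le> dist (?N n t) 0")
      case False
      then show ?thesis using T by (intro exI[of _ 0]) simp
    qed blast
    then have "\<exists>s. \<forall>n. s n \<in> {0..T} \<and> ((\<exists>t\<in>{0..T}. e \<le> dist (?N n t) 0) \<longrightarrow> e \<le> dist (?N n (s n)) 0)"
      by (intro choice allI)
    then obtain s where s0: "\<forall>n. s n \<in> {0..T} \<and> ((\<exists>t\<in>{0..T}. e \<le> dist (?N n t) 0) \<longrightarrow> e \<le> dist (?N n (s n)) 0)"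
      by (rule exE)
    have s: "s n \<in> {0..T}" for n using s0 by blast
    have s2: "e \<le> dist (?N n (s n)) 0" if "t \<in> {0..T}" "e \<le> dist (?N n t) 0" for n t
    proof (rule mp[OF conjunct2[OF spec[OF s0]]])
      show "\<exists>t\<in>{0..T}. e \<le> dist (?N n t) 0"
      proof (rule bexI[where x = t])
        show "e \<le> dist (?N n t) 0" by (rule that(2))
      qed (rule that(1))
    qed
    have "(\<lambda>n. ?N n (s n)) \<longlonglongrightarrow> 0"
    proof (rule coulomb_field_L2_norm_tendsto[OF _ _ _ K])
      show "L12_bounded M S (r n (s n))" "L12_bounded M S (\<rho> (s n))" for n using s[of n] by (auto intro: r_bound \<rho>_bound)
      fix \<phi> :: "R2 \<Rightarrow> real" assume \<phi>: "l2 \<phi>"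
      show "(\<lambda>n. (pairing \<phi> (r n (s n))) - pairing \<phi> (\<rho> (s n))) \<longlonglongrightarrow> 0"
        unfolding tendsto_iff
      proof (intro allI impI)
        fix d :: real assume d: "0 < d"
        show "\<forall>\<^sub>F n in sequentially. dist ((LBINT x. \<phi> x * r n (s n) x) - pairing \<phi> (\<rho> (s n))) 0 < d"
          using uniform_limitD[OF uniform[OF \<phi>] d, of T] by eventually_elim (use s in \<open>auto simp: dist_real_def\<close>)
      qed
    qed
    from tendstoD[OF this e] show "\<forall>\<^sub>F n in sequentially. \<forall>t\<in>{0..T}. dist (?N n t) 0 < e"
    proof eventually_elim
      case (elim n)
      show ?case
      proof
        show "dist (?N n t) 0 < e" if "t \<in> {0..T}" for t
        proof (rule ccontr)
          assume "\<not> dist (?N n t) 0 < e"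
          then have "e \<le> dist (?N n t) 0" by (simp only: not_less)
          from less_le_trans[OF elim s2[OF that this]] show False by (rule less_irrefl[THEN notE])
        qed
      qed
    qed
  qed
qed

lemma field_measurable: "(\<lambda>p. field (\<rho> (fst p)) (snd p)) \<in> borel_measurable borel2"
  by (rule kernel_convolution_measurable[OF coulomb_kernel_borel \<rho>_measurable])

lemma euler_integrable:
  assumes T: "0 < T" and K: "compact K"
  shows "set_integrable lborel ({0..T} \<times> K) (\<lambda>(t, x). \<rho> t x)"
    "set_integrable lborel ({0..T} \<times> K) (\<lambda>(t, x). \<rho> t x *\<^sub>R perp (field (\<rho> t) x))"
proof -
  note [measurable] = borel_compact[OF K] \<rho>_measurable field_measurable
  have ind: "indicator ({0..T} \<times> K) (t, x) = indicator {0..T} t * (indicator K x :: real)" for t x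
    by (simp add: indicator_def)
  have Em: "(\<lambda>p. perp (field (\<rho> (fst p)) (snd p))) \<in> borel_measurable borel2"
    by (rule measurable_compose[OF field_measurable perp_borel])
  have 1: "(\<lambda>p :: real \<times> R2. indicator ({0..T} \<times> K) p *\<^sub>R \<rho> (fst p) (snd p)) \<in> borel_measurable borel2" by measurable
  have 2: "(\<lambda>p :: real \<times> R2. indicator ({0..T} \<times> K) p *\<^sub>R (\<rho> (fst p) (snd p) *\<^sub>R perp (field (\<rho> (fst p)) (snd p)))) \<in> borel_measurable borel2"
    using Em by measurable
  have "integrable lborel (\<lambda>p :: real \<times> R2. indicator ({0..T} \<times> K) p *\<^sub>R \<rho> (fst p) (snd p))"
  proof (rule integrable_time_slices(1)[OF 1, of T M])
    fix t assume t: "t \<in> {0..T}"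
    then have D: "L12_bounded M S (\<rho> t)" by (auto intro: \<rho>_bound)
    note D = L12_boundedD[OF D]
    have i: "integrable lborel (\<lambda>x. indicator K x *\<^sub>R \<rho> t x)" by (rule integrable_mult_indicator) (use D(1) in simp_all)
    have "(LBINT x. norm (indicator K x *\<^sub>R \<rho> t x)) \<le> (LBINT x. \<bar>\<rho> t x\<bar>)"
      by (rule integral_mono[OF integrable_norm[OF i] integrable_abs[OF D(1)]]) (simp add: indicator_def)
    then show "integrable lborel (\<lambda>x. indicator ({0..T} \<times> K) (t, x) *\<^sub>R \<rho> (fst (t, x)) (snd (t, x))) \<and>
        (LBINT x. norm (indicator ({0..T} \<times> K) (t, x) *\<^sub>R \<rho> (fst (t, x)) (snd (t, x)))) \<le> M"
      using i t D(9) by (simp add: ind)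
  qed (use T in \<open>auto simp: ind\<close>)
  then show "set_integrable lborel ({0..T} \<times> K) (\<lambda>(t, x). \<rho> t x)"
    by (simp add: set_integrable_def case_prod_beta')
  obtain R where R: "K \<subseteq> cball 0 R" using bounded_subset_ballD[OF compact_imp_bounded[OF K], of 0] ball_subset_cball by blast
  obtain C where C: "\<And>u. L12_bounded M S u \<Longrightarrow>
      l2 (\<lambda>x. cutoff R x * (1 * (1 + norm (field u x)))) \<and>
      (LBINT x. (cutoff R x * (1 * (1 + norm (field u x))))\<^sup>2) \<le> C"
    by (rule field_cutoff_weight_bound[OF nonneg, of R 1]) (rule that, assumption)
  have "integrable lborel (\<lambda>p :: real \<times> R2. indicator ({0..T} \<times> K) p *\<^sub>R (\<rho> (fst p) (snd p) *\<^sub>R perp (field (\<rho> (fst p)) (snd p))))"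
  proof (rule integrable_time_slices(1)[OF 2, of T "S + C"])
    fix t assume t: "t \<in> {0..T}"
    then have L: "L12_bounded M S (\<rho> t)" by (auto intro: \<rho>_bound)
    note D = L12_boundedD[OF L]
    note [measurable] = D(2) coulomb_field_borel[OF L]
    let ?b = "\<lambda>x. cutoff R x * (1 * (1 + norm (field (\<rho> t) x)))"
    have bi: "integrable lborel (\<lambda>x. \<bar>\<rho> t x * ?b x\<bar>)" by (rule integrable_abs[OF l2_mult_integrable[OF D(3) conjunct1[OF C[OF L]]]])
    have le: "norm (indicator K x *\<^sub>R (\<rho> t x *\<^sub>R perp (field (\<rho> t) x))) \<le> \<bar>\<rho> t x * ?b x\<bar>" for x
    proof (cases "x \<in> K")
      case True
      then have "x \<in> cball 0 R" using R by blast
      then show ?thesis using True by (simp add: abs_mult mult_left_mono)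
    qed simp
    have "borel_fun (\<lambda>x. perp (field (\<rho> t) x))" by measurable
    then have m: "borel_fun (\<lambda>x. indicator K x *\<^sub>R (\<rho> t x *\<^sub>R perp (field (\<rho> t) x)))" by measurable
    have i: "integrable lborel (\<lambda>x. indicator K x *\<^sub>R (\<rho> t x *\<^sub>R perp (field (\<rho> t) x)))"
      by (rule dominated_integrable[OF bi]) (use m le in simp_all)
    have "(LBINT x. norm (indicator K x *\<^sub>R (\<rho> t x *\<^sub>R perp (field (\<rho> t) x)))) \<le> (LBINT x. \<bar>\<rho> t x * ?b x\<bar>)"
      by (rule integral_mono[OF integrable_norm[OF i] bi le])
    also have "\<dots> \<le> S + C" using l2_mult_abs_le[OF D(3) conjunct1[OF C[OF L]]] D(4) C[OF L] by linarith
    finally show "integrable lborel (\<lambda>x. indicator ({0..T} \<times> K) (t, x) *\<^sub>R (\<rho> (fst (t, x)) (snd (t, x)) *\<^sub>R perp (field (\<rho> (fst (t, x))) (snd (t, x))))) \<and>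
        (LBINT x. norm (indicator ({0..T} \<times> K) (t, x) *\<^sub>R (\<rho> (fst (t, x)) (snd (t, x)) *\<^sub>R perp (field (\<rho> (fst (t, x))) (snd (t, x)))))) \<le> S + C"
      using i t by (simp add: ind)
  qed (use T in \<open>auto simp: ind\<close>)
  then show "set_integrable lborel ({0..T} \<times> K) (\<lambda>(t, x). \<rho> t x *\<^sub>R perp (field (\<rho> t) x))"
    by (simp add: set_integrable_def case_prod_beta')
qed

text \<open>Dominated convergence in time: the transport pairing converges at each t, is bounded by
  a constant on [0,T], and vanishes for t > T, where \<phi> is zero.\<close>

lemma euler_weak_form:
  fixes \<phi> :: "real \<times> R2 \<Rightarrow> real"
  assumes \<phi>: "test_function \<phi>"
    and residual: "(\<lambda>n. (LBINT t. indicator {0..} t * (LBINT x. r n t x * transport \<phi> t (field (r n t)) x))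
        + (LBINT x. r n 0 x * \<phi> (0, x))) \<longlonglongrightarrow> 0"
  shows "set_lebesgue_integral lborel ({0..} \<times> UNIV) (\<lambda>(t, x). \<rho> t x * FD \<phi> (t, x) (1, perp (field (\<rho> t) x)))
      + (LBINT x. \<rho> 0 x * \<phi> (0, x)) = 0"
proof -
  obtain T where T: "0 < T" "\<And>p. T \<le> norm p \<Longrightarrow> \<phi> p = 0" "\<And>p h. T \<le> norm p \<Longrightarrow> FD \<phi> p h = 0"
    using test_function_support[OF \<phi>] by metis
  have zero: "transport \<phi> t e x = 0" if "T < t" for t e x
    using T(3)[of "(t, x)"] norm_fst_le[of t x] that by simp
  obtain C where C: "\<And>t u. L12_bounded M S u \<Longrightarrow> l2 (\<lambda>x. transport \<phi> t (field u) x) \<and>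
      (LBINT x. \<bar>u x * transport \<phi> t (field u) x\<bar>) \<le> C"
    by (rule transport_pairing_bound[OF \<phi> nonneg]) (rule that, assumption)
  define F where "F u t = pairing u (transport \<phi> t (field u))" for u t
  have Fle: "\<bar>indicator {0..} t * F (v t) t\<bar> \<le> indicator {0..T} t * C" if v: "\<And>t. 0 \<le> t \<Longrightarrow> L12_bounded M S (v t)" for v t
  proof (cases "t \<in> {0..T}")
    case True
    have "\<bar>F (v t) t\<bar> \<le> (LBINT x. \<bar>v t x * transport \<phi> t (field (v t)) x\<bar>)" unfolding F_def by (rule integral_abs_bound)
    also have "\<dots> \<le> C" using C[OF v] True by simp
    finally show ?thesis using True by simp
  next
    case False
    then have "t < 0 \<or> T < t" by auto
    then have "indicator {0..} t * F (v t) t = 0"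
    proof
      assume "T < t"
      then have "F (v t) t = 0" unfolding F_def zero[OF \<open>T < t\<close>] by simp
      then show ?thesis by simp
    qed simp
    then show ?thesis using False by simp
  qed
  have FL: "borel_fun (\<lambda>t. indicator {0..} t * F (r n t) t)" for n
  proof -
    have "borel_fun (\<lambda>t. F (positive_times (r n) t) t)" unfolding F_def
      by (rule transport_term_measurable(2)[OF \<phi> r_measurable kernel_convolution_measurable[OF coulomb_kernel_borel r_measurable]])
    moreover have eq: "indicator {0..} t * F (r n t) t = indicator {0..} t * F (positive_times (r n) t) t" for t
    proof (cases "0 \<le> t")
      case True
      then have "positive_times (r n) t = r n t" by (simp add: positive_times_def fun_eq_iff)
      then show ?thesis by simp
    qed simp
    ultimately show ?thesis unfolding eq by simp
  qed
  have F\<rho>: "borel_fun (\<lambda>t. indicator {0..} t * F (\<rho> t) t)"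
    using transport_term_measurable(2)[OF \<phi> \<rho>_measurable field_measurable] unfolding F_def by simp
  have lim: "(\<lambda>n. LBINT t. indicator {0..} t * F (r n t) t) \<longlonglongrightarrow> (LBINT t. indicator {0..} t * F (\<rho> t) t)"
  proof (rule integral_dominated_convergence[where w = "\<lambda>t. indicator {0..T} t * C"])
    show "integrable lborel (\<lambda>t. indicator {0..T} t * C)"
      by (intro integrable_mult_left integrable_real_indicator) (simp_all add: T(1) less_imp_le)
    have "(\<lambda>n. indicator {0..} t * F (r n t) t) \<longlonglongrightarrow> indicator {0..} t * F (\<rho> t) t" for t
    proof (cases "0 \<le> t")
      case True
      have "(\<lambda>n. F (r n t) t) \<longlonglongrightarrow> F (\<rho> t) t" unfolding F_def
        by (rule transport_pairing_tendsto[OF \<phi> r_bound[OF True] \<rho>_bound[OF True] pairing_tendsto[OF _ True]])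
      then show ?thesis by (rule tendsto_mult_left)
    qed simp
    then show "AE t in lborel. (\<lambda>n. indicator {0..} t * F (r n t) t) \<longlonglongrightarrow> indicator {0..} t * F (\<rho> t) t" by simp
    show "AE t in lborel. norm (indicator {0..} t * F (r n t) t) \<le> indicator {0..T} t * C" for n
      using Fle[of "r n"] r_bound by simp
  qed (use FL F\<rho> in simp_all)
  have "l2 (\<lambda>x. \<phi> (0, x))"
  proof -
    have "continuous_on UNIV (\<lambda>x. \<phi> (0, x))"
      by (rule continuous_on_compose2[OF test_function_continuous[OF \<phi>]]) (auto intro!: continuous_intros)
    then have m: "borel_fun (\<lambda>x. \<phi> (0, x))" by (rule borel_measurable_continuous_onI)
    obtain B where B: "\<And>p. \<bar>\<phi> p\<bar> \<le> B" using test_function_bounded[OF \<phi>] by metis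
    have "\<phi> (0, x) = 0" if "norm x \<ge> T" for x :: R2 using T(2)[of "(0, x)"] that by (simp add: norm_Pair)
    from l2_bounded_support[OF m B this] show ?thesis .
  qed
  from pairing_tendsto[OF this order_refl]
  have "(\<lambda>n. LBINT x. r n 0 x * \<phi> (0, x)) \<longlonglongrightarrow> (LBINT x. \<rho> 0 x * \<phi> (0, x))" by (simp add: mult.commute)
  from tendsto_add[OF lim this] residual
  have key: "(LBINT t. indicator {0..} t * F (\<rho> t) t) + (LBINT x. \<rho> 0 x * \<phi> (0, x)) = 0"
    unfolding F_def by (rule LIMSEQ_unique)
  \<comment> \<open>The weak form integrates over (t, x), whereas the limit was taken in time
    slices; Fubini reconciles the two.\<close>
  define G where "G p = indicator {0..} (fst p) * (\<rho> (fst p) (snd p) * FD \<phi> (fst p, snd p) (1, perp (field (\<rho> (fst p)) (snd p))))"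
    for p :: "real \<times> R2"
  have Gm: "G \<in> borel_measurable borel2" unfolding G_def[abs_def]
    by (rule borel_measurable_times[OF _ transport_term_measurable(1)[OF \<phi> \<rho>_measurable field_measurable]]) measurable
  have "(LBINT p. G p) = (LBINT t. LBINT x. G (t, x))"
  proof (rule integrable_time_slices(2)[OF Gm, of T C])
    fix t assume t: "t \<in> {0..T}"
    then have L: "L12_bounded M S (\<rho> t)" by (auto intro: \<rho>_bound)
    show "integrable lborel (\<lambda>x. G (t, x)) \<and> (LBINT x. norm (G (t, x))) \<le> C"
      using l2_mult_integrable[OF L12_boundedD(3)[OF L] conjunct1[OF C[OF L]]] C[OF L, of t] t by (simp add: G_def)
  qed (use zero T(1) in \<open>auto simp: G_def indicator_def\<close>)
  also have "\<dots> = (LBINT t. indicator {0..} t * F (\<rho> t) t)" by (simp add: G_def F_def)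
  finally have "(LBINT p. G p) = (LBINT t. indicator {0..} t * F (\<rho> t) t)" .
  moreover have "set_lebesgue_integral lborel ({0..} \<times> UNIV) (\<lambda>(t, x). \<rho> t x * FD \<phi> (t, x) (1, perp (field (\<rho> t) x)))
      = (LBINT p. G p)" unfolding set_lebesgue_integral_def
    by (rule Bochner_Integration.integral_cong[OF refl]) (auto simp: G_def indicator_def)
  ultimately show ?thesis using key by simp
qed

end

lemma L12_bounded_mono: "L12_bounded M S u \<Longrightarrow> M \<le> M' \<Longrightarrow> L12_bounded M' S u"
  by (auto simp: L12_bounded_def)

lemma (in vp_solution) initial_mass_moment_le:
  assumes "Lp_norm lborel 1 f0 + (LBINT x. (norm x)\<^sup>2 * macro_density f0 x) \<le> C"
  shows "(LBINT z. f0 z) \<le> C" "(LBINT z. (norm (fst z))\<^sup>2 * f0 z) \<le> C"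
proof -
  obtain R where R: "ess_bounded L R f0" using f0_bounded by blast
  have i: "integrable lborel (\<lambda>z. (norm (fst z))\<^sup>2 * f0 z)"
    using ess_bounded_integrable_continuous[OF R, of "\<lambda>z. (norm (fst z))\<^sup>2"] by (simp add: mult.commute continuous_intros)
  have fi: "integrable lborel f0" by (rule ess_bounded_integrable_self[OF R])
  have "(LBINT z. \<bar>f0 z\<bar>) = (LBINT z. f0 z)"
    by (rule integral_cong_AE) (use fi f0_nonneg in \<open>auto elim: eventually_mono\<close>)
  moreover have m: "0 \<le> (LBINT z. f0 z)" by (rule integral_nonneg_AE[OF f0_nonneg])
  ultimately have 1: "Lp_norm lborel 1 f0 = (LBINT z. f0 z)" by (simp add: Lp_norm_def)
  have 2: "(LBINT x. (norm x)\<^sup>2 * macro_density f0 x) = (LBINT z. (norm (fst z))\<^sup>2 * f0 z)"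
    by (rule integral_macro_density(1)[OF i])
  have "0 \<le> (LBINT z. (norm (fst z))\<^sup>2 * f0 z)"
    by (rule integral_nonneg_AE) (use f0_nonneg in \<open>eventually_elim, simp\<close>)
  with m assms 1 2 show "(LBINT z. f0 z) \<le> C" "(LBINT z. (norm (fst z))\<^sup>2 * f0 z) \<le> C" by linarith+
qed

theorem theorem1p2:
  fixes f0 :: "real \<Rightarrow> R2 \<times> R2 \<Rightarrow> real"
    and f :: "real \<Rightarrow> real \<Rightarrow> R2 \<times> R2 \<Rightarrow> real"
  assumes "\<And>\<epsilon>. \<epsilon> > 0 \<Longrightarrow> Lp_mem lborel 1 (f0 \<epsilon>)"
    and "\<And>\<epsilon>. \<epsilon> > 0 \<Longrightarrow> Linf_mem lborel (f0 \<epsilon>)"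
    and "\<And>\<epsilon>. \<epsilon> > 0 \<Longrightarrow> (AE z in lborel. 0 \<le> f0 \<epsilon> z)"
    and "\<And>\<epsilon>. \<epsilon> > 0 \<Longrightarrow> \<exists>K. compact K \<and> ess_supported_in K (f0 \<epsilon>)"
    and "bdd_above ((\<lambda>\<epsilon>. Lp_norm lborel 1 (f0 \<epsilon>)
           + (LINT x|lborel. (norm x)\<^sup>2 * macro_density (f0 \<epsilon>) x)) ` {0<..})"
    and "bdd_above ((\<lambda>\<epsilon>. energy (f0 \<epsilon>)) ` {0<..})"
    and "(SUP \<epsilon>\<in>{0<..}. Linf_norm lborel (f0 \<epsilon>)) < \<infinity>"
    and "\<And>\<epsilon>. \<epsilon> > 0 \<Longrightarrow> vp_global_weak_solution \<epsilon> (f0 \<epsilon>) (f \<epsilon>)"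
  shows "\<exists>(\<epsilon>s :: nat \<Rightarrow> real) \<rho>. (\<forall>n. \<epsilon>s n > 0) \<and> \<epsilon>s \<longlonglongrightarrow> 0 \<and>
           converges_C_L2_weak (\<lambda>n t. macro_density (f (\<epsilon>s n) t)) \<rho> \<and>
           Linf_time_Lp 2 \<rho> \<and>
           (\<exists>E. converges_C_L2_loc (\<lambda>n t. electric_field (f (\<epsilon>s n) t)) E \<and>
                (\<forall>t\<ge>0. is_convolution coulomb_kernel (\<rho> t) (E t)) \<and>
                euler_global_weak_solution \<rho> E)"
proof -
  define X where "X = (SUP \<epsilon>\<in>{0<..}. Linf_norm lborel (f0 \<epsilon>))"
  \<comment> \<open>The maximum with 1 makes the bound positive, as the density estimate
    requires.\<close>
  define L where "L = max 1 (real_of_ereal X)"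
  have XL: "X \<le> ereal L" using assms(7) by (cases X) (auto simp: L_def X_def[symmetric])
  have L: "0 < L" "Linf_norm lborel (f0 \<epsilon>) \<le> ereal L" if "0 < \<epsilon>" for \<epsilon>
    using SUP_upper[of \<epsilon> "{0<..}" "\<lambda>\<epsilon>. Linf_norm lborel (f0 \<epsilon>)"] that XL by (auto simp: L_def X_def)
  obtain M where M: "\<And>\<epsilon>. 0 < \<epsilon> \<Longrightarrow> Lp_norm lborel 1 (f0 \<epsilon>) + (LBINT x. (norm x)\<^sup>2 * macro_density (f0 \<epsilon>) x) \<le> M" "0 \<le> M"
  proof -
    from assms(5) obtain C where "\<And>\<epsilon>. 0 < \<epsilon> \<Longrightarrow> Lp_norm lborel 1 (f0 \<epsilon>) + (LBINT x. (norm x)\<^sup>2 * macro_density (f0 \<epsilon>) x) \<le> C"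
      unfolding bdd_above_def by auto
    then show thesis by (intro that[of "max C 0"]) (auto simp: le_max_iff_disj)
  qed
  obtain H where H: "\<And>\<epsilon>. 0 < \<epsilon> \<Longrightarrow> energy (f0 \<epsilon>) \<le> H" "0 \<le> H"
  proof -
    from assms(6) obtain C where "\<And>\<epsilon>. 0 < \<epsilon> \<Longrightarrow> energy (f0 \<epsilon>) \<le> C" unfolding bdd_above_def by auto
    then show thesis by (intro that[of "max C 0"]) (auto simp: le_max_iff_disj)
  qed
  \<comment> \<open>The value at which \<epsilon> (1 + 2 M) equals 1/2; up to it the moment bounds
    are uniform.\<close>
  define \<epsilon>0 where "\<epsilon>0 = 1 / (2 * (1 + 2 * M))"
  have \<epsilon>0: "0 < \<epsilon>0" "\<epsilon>0 \<le> 1" "\<epsilon>0 * (1 + 2 * M) = 1 / 2" using M(2) by (auto simp: \<epsilon>0_def)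
  have vb: "vp_solution_bounds \<epsilon> (f0 \<epsilon>) (f \<epsilon>) L M H" if \<epsilon>: "0 < \<epsilon>" "\<epsilon> \<le> \<epsilon>0" for \<epsilon>
  proof -
    interpret vp_solution \<epsilon> "f0 \<epsilon>" "f \<epsilon>" L
      by unfold_locales (rule \<epsilon>(1), rule assms(8)[OF \<epsilon>(1)], rule assms(2)[OF \<epsilon>(1)], rule L(2)[OF \<epsilon>(1)], rule assms(4)[OF \<epsilon>(1)], rule assms(3)[OF \<epsilon>(1)])
    have "\<epsilon> * (1 + 2 * M) \<le> \<epsilon>0 * (1 + 2 * M)" using \<epsilon>(2) M(2) by (intro mult_right_mono) auto
    then show ?thesis
      using initial_mass_moment_le[OF M(1)[OF \<epsilon>(1)]] L(1)[OF \<epsilon>(1)] M(2) H(1)[OF \<epsilon>(1)] H(2) \<epsilon> \<epsilon>0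
      by unfold_locales auto
  qed
  \<comment> \<open>The constants of the locale depend on \<open>L\<close>, \<open>M\<close> and
    \<open>H\<close> alone, so they are common to all members of the sequence.\<close>
  define m where "m = vp_solution_bounds.moment_bound M H"
  define k where "k = vp_solution_bounds.kinetic_bound M H"
  define S where "S = vp_solution_bounds.L2_bound L M H"
  note vb0 = vb[OF \<epsilon>0(1) order_refl]
  have m: "0 \<le> m" "0 \<le> k" unfolding m_def k_def by (rule vp_solution_bounds.bounds_nonneg[OF vb0])+
  have S: "0 \<le> S" unfolding S_def by (rule vp_solution_bounds.L2_bound_nonneg[OF vb0])
  \<comment> \<open>Starting at \<epsilon>0 keeps every index, and not merely a tail, within the
    uniform bounds.\<close>
  define e where "e n = \<epsilon>0 / (real n + 1)" for n
  have e: "0 < e n" "e n \<le> \<epsilon>0" for n using \<epsilon>0(1) by (auto simp: e_def field_simps)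
  have e0: "e \<longlonglongrightarrow> 0"
    using tendsto_mult_left[OF LIMSEQ_inverse_real_of_nat, of \<epsilon>0] by (simp add: e_def[abs_def] divide_inverse add.commute)
  note vbe = vb[OF e]
  have density: "L12_bounded M S (macro_density (f (e n) t))" "integrable lborel (\<lambda>x. (norm x)\<^sup>2 * \<bar>macro_density (f (e n) t) x\<bar>)"
    "(LBINT x. (norm x)\<^sup>2 * \<bar>macro_density (f (e n) t) x\<bar>) \<le> m" if "0 \<le> t" for n t
    using vp_solution_bounds.density_bounds[OF vbe that] unfolding S_def m_def by blast+
  obtain K where K: "0 \<le> K" "\<And>g L R. ess_bounded L R g \<Longrightarrow> AE z in lborel. 0 \<le> g z \<Longrightarrow> L12_bounded M S (macro_density g) \<Longrightarrow>
      integrable lborel (\<lambda>z. (norm (electric_field g (fst z)))\<^sup>2 * g z) \<and>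
      (LBINT z. (norm (electric_field g (fst z)))\<^sup>2 * g z) \<le> K"
    by (rule weighted_field_bound[OF M(2) S]) (rule that, assumption+)
  have fieldK: "integrable lborel (\<lambda>z. (norm (electric_field (f (e n) t) (fst z)))\<^sup>2 * f (e n) t z) \<and>
      (LBINT z. (norm (electric_field (f (e n) t) (fst z)))\<^sup>2 * f (e n) t z) \<le> K" if t: "0 \<le> t" for n t
  proof -
    interpret vp_solution_bounds "e n" "f0 (e n)" "f (e n)" L M H by (rule vbe)
    obtain R where "ess_bounded L R (f (e n) t)" using f_bounded_at[OF t] by blast
    from K(2)[OF this f_nonneg[OF t] density(1)[OF t]] show ?thesis .
  qed
  obtain \<sigma> where \<sigma>: "strict_mono (\<sigma> :: nat \<Rightarrow> nat)"
    "\<And>\<phi> T. l2 \<phi> \<Longrightarrow> uniformly_Cauchy_on {0..T} (\<lambda>n t. LBINT x. \<phi> x * macro_density (f (e (\<sigma> n)) t) x)"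
  proof (rule L2_time_subsequence[of "\<lambda>n t. macro_density (f (e n) t)" S e])
    show "l2 (macro_density (f (e n) t))" "(LBINT x. (macro_density (f (e n) t) x)\<^sup>2) \<le> S" if "0 \<le> t" for n t
      using L12_boundedD(3,4)[OF density(1)[OF that]] by blast+
    show "e \<longlonglongrightarrow> 0" "0 \<le> e n" for n using e0 e(1)[of n] by auto
    fix \<phi> :: "R2 \<Rightarrow> real" assume \<phi>: "test_function \<phi>"
    obtain B1 where B1: "B1 \<ge> 0" "\<And>x h. \<bar>FD \<phi> x h\<bar> \<le> B1 * norm h" using test_function_derivative_bounded[OF \<phi>] by metis
    obtain B2 where B2: "B2 \<ge> 0" "\<And>x y. \<bar>\<phi> x - \<phi> y\<bar> \<le> B2 * norm (x - y)" using test_function_Lipschitz[OF \<phi>] by metis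
    define B where "B = max B1 B2"
    have B: "0 \<le> B" "\<And>x h. \<bar>FD \<phi> x h\<bar> \<le> B * norm h" "\<And>x y. \<bar>\<phi> x - \<phi> y\<bar> \<le> B * norm (x - y)"
      using B1(1) order_trans[OF B1(2) mult_right_mono[of B1 B]] order_trans[OF B2(2) mult_right_mono[of B2 B]] by (auto simp: B_def)
    let ?C = "B * (M + K) + 2 * (B * (M + k))"
    have nn: "0 \<le> B * (M + K)" "0 \<le> 2 * (B * (M + k))" using B(1) M(2) K(1) m by auto
    have "\<bar>(LBINT x. \<phi> x * macro_density (f (e n) t) x) - (LBINT x. \<phi> x * macro_density (f (e n) s) x)\<bar> \<le> ?C * (\<bar>t - s\<bar> + e n)"
      if st: "0 \<le> s" "0 \<le> t" for n s t
    proof -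
      have "\<bar>(LBINT x. \<phi> x * macro_density (f (e n) t) x) - (LBINT x. \<phi> x * macro_density (f (e n) s) x)\<bar>
          \<le> B * (M + K) * \<bar>t - s\<bar> + 2 * (B * e n * (M + k))"
        unfolding k_def by (rule vp_solution_bounds.density_equicontinuous[OF vbe \<phi> B fieldK st])
      also have "\<dots> = B * (M + K) * \<bar>t - s\<bar> + 2 * (B * (M + k)) * e n" by (simp add: mult_ac)
      also have "\<dots> \<le> ?C * \<bar>t - s\<bar> + ?C * e n"
        by (intro add_mono mult_right_mono) (use nn e(1)[of n] in auto)
      finally show ?thesis by (simp only: distrib_left)
    qed
    moreover have "0 \<le> ?C" using nn by simp
    ultimately show "\<exists>B\<ge>0. \<forall>n. \<forall>s\<ge>0. \<forall>t\<ge>0.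
        \<bar>(LBINT x. \<phi> x * macro_density (f (e n) t) x) - (LBINT x. \<phi> x * macro_density (f (e n) s) x)\<bar> \<le> B * (\<bar>t - s\<bar> + e n)"
      by blast
  qed (rule that, assumption+)
  define \<epsilon>s where "\<epsilon>s n = e (\<sigma> n)" for n
  define r where "r n t = macro_density (f (\<epsilon>s n) t)" for n t
  have \<epsilon>s: "\<epsilon>s \<longlonglongrightarrow> 0" using LIMSEQ_subseq_LIMSEQ[OF e0 \<sigma>(1)] by (simp add: \<epsilon>s_def[abs_def] comp_def)
  \<comment> \<open>At this stage the limit is a number for each \<phi> and t; it remains to
    represent these numbers by a density.\<close>
  have pairing_limit: "uniform_limit {0..T} (\<lambda>n t. LBINT x. \<phi> x * r n t x) (\<lambda>t. lim (\<lambda>n. pairing \<phi> (r n t))) sequentially"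
    if "l2 \<phi>" for \<phi> T
    using Cauchy_uniformly_convergent[OF \<sigma>(2)[OF that]] unfolding uniformly_convergent_uniform_limit_iff r_def \<epsilon>s_def .
  have r_meas: "case_prod (positive_times (r n)) \<in> borel_measurable borel2" for n
  proof -
    interpret vp_solution_bounds "\<epsilon>s n" "f0 (\<epsilon>s n)" "f (\<epsilon>s n)" L M H unfolding \<epsilon>s_def by (rule vbe)
    have "positive_times (r n) = (\<lambda>t. macro_density (positive_times (f (\<epsilon>s n)) t))"
      by (auto simp: fun_eq_iff positive_times_density r_def positive_times_def)
    then show ?thesis using macro_density_param_borel[OF positive_times_borel[OF f_time_measurable]] by simp
  qed
  have r: "L12_bounded M S (r n t)" "integrable lborel (\<lambda>x. (norm x)\<^sup>2 * \<bar>r n t x\<bar>)" "(LBINT x. (norm x)\<^sup>2 * \<bar>r n t x\<bar>) \<le> m"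
    if "0 \<le> t" for n t using density[OF that] by (simp_all add: r_def \<epsilon>s_def)
  have pt: "positive_times (r n) t = (if 0 \<le> t then r n t else (\<lambda>_. 0))" for n t
    by (auto simp: positive_times_def)
  have l0: "l2 (\<lambda>_ :: R2. 0)" by (simp add: l2_def)
  \<comment> \<open>The densities are extended by 0 to negative times because the limit theorem
    ranges over all real parameters.\<close>
  obtain \<rho> where \<rho>: "borel_fun (case_prod \<rho>)" "\<And>t. l2 (\<rho> t)" "\<And>t. sq_int (\<rho> t) \<le> S"
    "\<And>\<phi> t. l2 \<phi> \<Longrightarrow> (\<lambda>n. pairing \<phi> (positive_times (r n) t)) \<longlonglongrightarrow> pairing \<phi> (\<rho> t)"
  proof (rule L2_weak_limit_measurable[of "\<lambda>n. positive_times (r n)" S])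
    show "case_prod (positive_times (r n)) \<in> borel_measurable borel" for n using r_meas by (simp add: borel_prod)
    show "l2 (positive_times (r n) t)" "(LBINT x. (positive_times (r n) t x)\<^sup>2) \<le> S" for n t
      using L12_boundedD(3,4)[OF r(1)] l0 S by (auto simp: pt)
    show "convergent (\<lambda>n. pairing \<phi> (positive_times (r n) t))" if \<phi>: "l2 \<phi>" for \<phi> t
    proof (cases "0 \<le> t")
      case True
      then show ?thesis using tendsto_uniform_limitI[OF pairing_limit[OF \<phi>, of t], of t] by (auto simp: pt convergent_def)
    qed (simp add: pt convergent_const)
  qed (rule that, assumption+)
  have weak: "(\<lambda>n. pairing \<phi> (r n t)) \<longlonglongrightarrow> pairing \<phi> (\<rho> t)" if "l2 \<phi>" "0 \<le> t" for \<phi> t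
    using \<rho>(4)[OF that(1), of t] that(2) by (simp add: pt)
  have \<rho>_moment: "L12_bounded (M + m) S (\<rho> t)" "integrable lborel (\<lambda>x. norm x * \<bar>\<rho> t x\<bar>)" if t: "0 \<le> t" for t
    using weak_limit_L12_bounded[OF weak_limit_moment[OF r[OF t] \<rho>(2) weak[OF _ t]] \<rho>(2,3)] by blast+
  interpret lim: density_limit r \<rho> "M + m" S
  proof
    show "L12_bounded (M + m) S (r n t)" if "0 \<le> t" for n t by (rule L12_bounded_mono[OF r(1)[OF that]]) (use m in simp)
    show "L12_bounded (M + m) S (\<rho> t)" if "0 \<le> t" for t by (rule \<rho>_moment(1)[OF that])
    show "continuous_on {0..} (\<lambda>t. pairing \<phi> (r n t))" if "l2 \<phi>" for n \<phi>
    proof -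
      interpret vp_solution_bounds "\<epsilon>s n" "f0 (\<epsilon>s n)" "f (\<epsilon>s n)" L M H unfolding \<epsilon>s_def by (rule vbe)
      show ?thesis unfolding r_def by (rule density_pairing_continuous[OF that])
    qed
    show "uniform_limit {0..T} (\<lambda>n t. LBINT x. \<phi> x * r n t x) (\<lambda>t. pairing \<phi> (\<rho> t)) sequentially" if "l2 \<phi>" for \<phi> T
      using pairing_limit[OF that, of T]
    proof (rule uniform_limit_cong[THEN iffD1, rotated -1])
      show "lim (\<lambda>n. pairing \<phi> (r n t)) = pairing \<phi> (\<rho> t)" if t: "t \<in> {0..T}" for t
        by (rule limI[OF weak[OF \<open>l2 \<phi>\<close>]]) (use t in simp)
    qed simp
    show "case_prod (positive_times (r n)) \<in> borel_measurable borel2" for n by (rule r_meas)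
    show "case_prod \<rho> \<in> borel_measurable borel2" using \<rho>(1) by (simp add: borel_prod)
  qed
  have field_eq: "electric_field (f (\<epsilon>s n) t) = field (r n t)" for n t by (simp add: electric_field_def r_def)
  have residual: "(\<lambda>n. (LBINT t. indicator {0..} t * (LBINT x. r n t x * transport \<phi> t (field (r n t)) x))
      + (LBINT x. r n 0 x * \<phi> (0, x))) \<longlonglongrightarrow> 0" if \<phi>: "test_function \<phi>" for \<phi>
  proof -
    obtain B1 where B1: "B1 \<ge> 0" "\<And>x y h. \<bar>FD \<phi> x h - FD \<phi> y h\<bar> \<le> B1 * norm (x - y) * norm h"
      using test_function_derivative_Lipschitz[OF \<phi>] by metis
    obtain B2 where B2: "B2 \<ge> 0" "\<And>x y. \<bar>\<phi> x - \<phi> y\<bar> \<le> B2 * norm (x - y)" using test_function_Lipschitz[OF \<phi>] by metis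
    obtain T where T: "0 < T" "\<And>p. T \<le> norm p \<Longrightarrow> \<phi> p = 0" "\<And>p h. T \<le> norm p \<Longrightarrow> FD \<phi> p h = 0"
      using test_function_support[OF \<phi>] by metis
    define B where "B = max B1 B2"
    have B0: "0 \<le> B" "B1 \<le> B" "B2 \<le> B" using B1(1) by (auto simp: B_def)
    have Ba: "\<bar>FD \<phi> x h - FD \<phi> y h\<bar> \<le> B * norm (x - y) * norm h" for x y h
      by (rule order_trans[OF B1(2) mult_right_mono[OF mult_right_mono[OF B0(2)]]]) simp_all
    have Bb: "\<bar>\<phi> x - \<phi> y\<bar> \<le> B * norm (x - y)" for x y
      by (rule order_trans[OF B2(2) mult_right_mono[OF B0(3)]]) simp
    have "\<bar>(LBINT t. indicator {0..} t * (LBINT x. r n t x * transport \<phi> t (field (r n t)) x))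
      + (LBINT x. r n 0 x * \<phi> (0, x))\<bar> \<le> \<epsilon>s n * (B * ((T + 1) * (M + 2 * k + K)))" for n
      using vp_solution_bounds.euler_residual[OF vbe \<phi> B0(1) Ba Bb T fieldK, of "\<sigma> n"]
      unfolding \<epsilon>s_def[symmetric] r_def[symmetric] field_eq k_def .
    then show ?thesis
      by (intro Lim_null_comparison[OF _ tendsto_mult_left_zero[OF \<epsilon>s]] always_eventually allI) simp
  qed
  have "euler_global_weak_solution \<rho> (\<lambda>t. field (\<rho> t))" unfolding euler_global_weak_solution_def
  proof (intro conjI allI impI)
    \<comment> \<open>Here the first moment of the limit enters: it makes the convolution with the
      logarithm converge.\<close>
    show "\<exists>\<psi>. is_convolution laplace_kernel (\<rho> t) \<psi> \<and> has_weak_perp_gradient \<psi> (\<lambda>x. perp (field (\<rho> t) x) /\<^sub>R (2 * pi))"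
      if "0 \<le> t" for t using laplace_convolution_weak_gradient[OF \<rho>_moment[OF that]] by blast
  qed (use lim.euler_integrable lim.euler_weak_form residual in blast)+
  then show ?thesis
    using lim.converges_weakly lim.Linf_time_L2 lim.fields_converge \<epsilon>s e(1) is_convolution_coulomb[OF \<rho>_moment(1)]
    unfolding field_eq[symmetric] unfolding r_def
    by (intro exI[of _ \<epsilon>s] exI[of _ \<rho>] conjI exI[of _ "\<lambda>t. field (\<rho> t)"]) (auto simp: \<epsilon>s_def)
qed

end
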